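(* Suppose $|\Delta|=1$. Let $K$ be a (small) differential subfield of $\mathcal{U}$ and let $V\subset\mathbb{P}^n=\mathbb{P}^n(\mathcal{U})$ be a complete differential variety defined and irreducible over $K$. If the Kolchin polynomial of $V$ equals $d$, then there exists a unique (up to a nonzero factor in $K$) irreducible $R\in K\{\bar y\}=K\{y_0,\dots,y_n\}$ of order $d$ such that an element of $\mathbb{A}^{n+1}$ is linearly dependent over $V$ if and only if it is in the general solution of the differential equation $R(\bar y)=0$.
   Context: $(\mathcal{U},\Delta)$ with $\Delta=\{\delta\}$ is a universal domain for ordinary differential algebraic geometry: a sufficiently large saturated differentially closed field of characteristic $0$. A $\Delta$-polynomial $f\in K\{y_0,\dots,y_n\}$ is $\Delta$-homogeneous of degree $e$ if $f(ty_0,\dots,ty_n)=t^e f(y_0,\dots,y_n)$ for $t$ another $\Delta$-indeterminate. $\Delta$-closed subsets of $\mathbb{P}^n$ defined over $K$ are the zero sets of collections of $\Delta$-homogeneous $\Delta$-polynomials over $K$ (projective differential varieties). $\Delta$-closed subsets of products of projective spaces are defined by $\Delta$-polynomials $\Delta$-homogeneous separately in each group of variables. A $\Delta$-closed set defined over $K$ is irreducible over $K$ if it is nonempty and not the union of two proper $\Delta$-closed subsets defined over $K$. A quasiprojective differential variety is a $\Delta$-open subset of a projective differential variety. Complete: a $\Delta$-closed $V\subseteq\mathbb{P}^n$ is complete if $\pi_2\colon V\times Y\to Y$ is a $\Delta$-closed map for every quasiprojective differential variety $Y$. Linear dependence: $\bar a=(a_0,\dots,a_n)\in\mathbb{A}^{n+1}$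 is linearly dependent over $V$ if there is $v=[v_0:\cdots:v_n]\in V$ with $\sum_{i=0}^n v_ia_i=0$. The inclusion $V\subset\mathbb{P}^n$ is proper, so $n\ge1$. Kolchin polynomial: for a tuple $b$ from $\mathcal{U}$, $\omega_{b/K}(t)$ is the numerical polynomial which for all large $t\in\mathbb{N}$ equals the transcendence degree over $K$ of the field generated over $K$ by all $\delta^r b_i$, $r\le t$. For $\alpha=[a_0:\cdots:a_n]$ with $a_i\neq0$, $\omega_{\alpha/K}:=\omega_{(a_0/a_i,\dots,a_n/a_i)/K}$, and $\omega_V:=\omega_{\alpha/K}$ for $\alpha$ a generic point of $V$ over $K$ (a point of $V$ lying in no proper $\Delta$-closed subset of $V$ defined over $K$). Order and general solution: the order of $R\in K\{\bar y\}\setminus K$ is the largest $r$ such that some $\delta^r y_i$ occurs in $R$; irreducible means irreducible as a polynomial over $K$. For irreducible $R$ with separant $S$ (the partial derivative of $R$ with respect to its leader, for a ranking of the derivatives), the general component of $R$ is the prime differential ideal $\{f\in K\{\bar y\}: Sf\in\sqrt{[R]}\}$, where $[R]$ is the differential ideal generated by $R$ (it does not depend on the ranking). The general solution of $R=0$ is the zero set in $\mathbb{A}^{n+1}$ of the general component. *)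

theory Defs
  imports
    Complex_Main
    "HOL-Library.Poly_Mapping"
    "HOL-Library.Equipollence"
    "HOL-Computational_Algebra.Polynomial"
begin

section \<open>Polynomials and differential polynomials\<close>

type_synonym ('v, 'a) mpol = "('v \<Rightarrow>\<^sub>0 nat) \<Rightarrow>\<^sub>0 'a"

text \<open>
  Differential polynomials over a ring in the differential indeterminates \<open>y\<^sub>0, y\<^sub>1, \<dots>\<close>:
  the algebraic indeterminate \<open>(i, r)\<close> is the derivative \<open>\<delta>\<^sup>r y\<^sub>i\<close>.
\<close>

type_synonym 'a dpol = "(nat \<times> nat, 'a) mpol"

definition mconst :: "'a \<Rightarrow> ('v, 'a::comm_ring_1) mpol" where
  "mconst c = Poly_Mapping.single 0 c"

definition mvar :: "'v \<Rightarrow> ('v, 'a::comm_ring_1) mpol" where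
  "mvar v = Poly_Mapping.single (Poly_Mapping.single v 1) 1"

definition mvars :: "('v, 'a::comm_ring_1) mpol \<Rightarrow> 'v set" where
  "mvars f = (\<Union>m \<in> Poly_Mapping.keys f. Poly_Mapping.keys m)"

definition mcoeffs_in :: "'a set \<Rightarrow> ('v, 'a::comm_ring_1) mpol \<Rightarrow> bool" where
  "mcoeffs_in K f \<longleftrightarrow> (\<forall>m \<in> Poly_Mapping.keys f. Poly_Mapping.lookup f m \<in> K)"

text \<open>Evaluation at \<open>\<xi>\<close>, with the coefficients transported along \<open>\<iota>\<close>.\<close>

definition meval ::
  "('a \<Rightarrow> 'b) \<Rightarrow> ('v \<Rightarrow> 'b) \<Rightarrow> ('v, 'a::comm_ring_1) mpol \<Rightarrow> 'b::comm_ring_1" where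
  "meval \<iota> \<xi> f = (\<Sum>m \<in> Poly_Mapping.keys f. \<iota> (Poly_Mapping.lookup f m) *
     (\<Prod>v \<in> Poly_Mapping.keys m. \<xi> v ^ Poly_Mapping.lookup m v))"

definition mpartial :: "'v \<Rightarrow> ('v, 'a::comm_ring_1) mpol \<Rightarrow> ('v, 'a) mpol" where
  "mpartial v f = (\<Sum>m \<in> Poly_Mapping.keys f.
     Poly_Mapping.single (m - Poly_Mapping.single v 1)
       (of_nat (Poly_Mapping.lookup m v) * Poly_Mapping.lookup f m))"

text \<open>The derivation of the ring of differential polynomials extending \<open>\<delta>\<close>.\<close>

definition dpol_deriv :: "('a \<Rightarrow> 'a) \<Rightarrow> 'a::comm_ring_1 dpol \<Rightarrow> 'a dpol" where
  "dpol_deriv \<delta> f = Poly_Mapping.map \<delta> f +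
     (\<Sum>(i, r) \<in> mvars f. mpartial (i, r) f * mvar (i, Suc r))"

text \<open>
  \<open>dpol_eval \<iota> D f a\<close> substitutes \<open>a i\<close> for \<open>y\<^sub>i\<close> in a differential ring with derivation \<open>D\<close>.
\<close>

definition dpol_eval ::
  "('a \<Rightarrow> 'b) \<Rightarrow> ('b \<Rightarrow> 'b) \<Rightarrow> 'a::comm_ring_1 dpol \<Rightarrow> (nat \<Rightarrow> 'b::comm_ring_1) \<Rightarrow> 'b" where
  "dpol_eval \<iota> D f a = meval \<iota> (\<lambda>(i, r). (D ^^ r) (a i)) f"

abbreviation dval :: "('a \<Rightarrow> 'a) \<Rightarrow> 'a::comm_ring_1 dpol \<Rightarrow> (nat \<Rightarrow> 'a) \<Rightarrow> 'a" where
  "dval \<equiv> dpol_eval id"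

definition dpols :: "'a set \<Rightarrow> nat \<Rightarrow> 'a::comm_ring_1 dpol set" where
  "dpols K n = {f. mcoeffs_in K f \<and> mvars f \<subseteq> {..n} \<times> UNIV}"


section \<open>Differential fields and universal domains\<close>

definition derivation :: "('u::comm_ring_1 \<Rightarrow> 'u) \<Rightarrow> bool" where
  "derivation \<delta> \<longleftrightarrow> (\<forall>x y. \<delta> (x + y) = \<delta> x + \<delta> y) \<and> (\<forall>x y. \<delta> (x * y) = \<delta> x * y + x * \<delta> y)"

definition subfield_set :: "'u::field set \<Rightarrow> bool" where
  "subfield_set K \<longleftrightarrow> 0 \<in> K \<and> 1 \<in> K \<and>
     (\<forall>x \<in> K. \<forall>y \<in> K. x + y \<in> K \<and> x - y \<in> K \<and> x * y \<in> K) \<and> (\<forall>x \<in> K. inverse x \<in> K)"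

definition diff_subfield :: "('u::field \<Rightarrow> 'u) \<Rightarrow> 'u set \<Rightarrow> bool" where
  "diff_subfield \<delta> K \<longleftrightarrow> subfield_set K \<and> (\<forall>x \<in> K. \<delta> x \<in> K)"

definition dpol_order :: "'a::comm_ring_1 dpol \<Rightarrow> nat" where
  "dpol_order f = Max (snd ` mvars f)"

text \<open>
  Blum's axioms. Constants count as having order less than \<open>0\<close>, so that for \<open>f\<close> of order \<open>0\<close>
  the condition on \<open>g\<close> is that \<open>g\<close> be a nonzero constant.
\<close>

definition differentially_closed :: "('u::field \<Rightarrow> 'u) \<Rightarrow> bool" where
  "differentially_closed \<delta> \<longleftrightarrow>
     (\<forall>f \<in> dpols UNIV 0. \<forall>g \<in> dpols UNIV 0.
        mvars f \<noteq> {} \<and> g \<noteq> 0 \<and> (\<forall>v \<in> mvars g. snd v < dpol_order f) \<longrightarrow>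
        (\<exists>a. dval \<delta> f (\<lambda>_. a) = 0 \<and> dval \<delta> g (\<lambda>_. a) \<noteq> 0))"

datatype 'u dterm =
    Var nat
  | Param 'u
  | Zero
  | One
  | Add "'u dterm" "'u dterm"
  | Neg "'u dterm"
  | Mult "'u dterm" "'u dterm"
  | Der "'u dterm"

datatype (params: 'u) dform =
    Eq "'u dterm" "'u dterm"
  | Not "'u dform"
  | And "'u dform" "'u dform"
  | Exists nat "'u dform"

primrec tvars :: "'u dterm \<Rightarrow> nat set" where
  "tvars (Var i) = {i}"
| "tvars (Param c) = {}"
| "tvars Zero = {}"
| "tvars One = {}"
| "tvars (Add s t) = tvars s \<union> tvars t"
| "tvars (Neg t) = tvars t"
| "tvars (Mult s t) = tvars s \<union> tvars t"
| "tvars (Der t) = tvars t"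

primrec free_vars :: "'u dform \<Rightarrow> nat set" where
  "free_vars (Eq s t) = tvars s \<union> tvars t"
| "free_vars (Not \<phi>) = free_vars \<phi>"
| "free_vars (And \<phi> \<psi>) = free_vars \<phi> \<union> free_vars \<psi>"
| "free_vars (Exists i \<phi>) = free_vars \<phi> - {i}"

primrec tval :: "('u::comm_ring_1 \<Rightarrow> 'u) \<Rightarrow> (nat \<Rightarrow> 'u) \<Rightarrow> 'u dterm \<Rightarrow> 'u" where
  "tval \<delta> e (Var i) = e i"
| "tval \<delta> e (Param c) = c"
| "tval \<delta> e Zero = 0"
| "tval \<delta> e One = 1"
| "tval \<delta> e (Add s t) = tval \<delta> e s + tval \<delta> e t"
| "tval \<delta> e (Neg t) = - tval \<delta> e t"
| "tval \<delta> e (Mult s t) = tval \<delta> e s * tval \<delta> e t"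
| "tval \<delta> e (Der t) = \<delta> (tval \<delta> e t)"

primrec holds :: "('u::comm_ring_1 \<Rightarrow> 'u) \<Rightarrow> (nat \<Rightarrow> 'u) \<Rightarrow> 'u dform \<Rightarrow> bool" where
  "holds \<delta> e (Eq s t) \<longleftrightarrow> tval \<delta> e s = tval \<delta> e t"
| "holds \<delta> e (Not \<phi>) \<longleftrightarrow> \<not> holds \<delta> e \<phi>"
| "holds \<delta> e (And \<phi> \<psi>) \<longleftrightarrow> holds \<delta> e \<phi> \<and> holds \<delta> e \<psi>"
| "holds \<delta> e (Exists i \<phi>) \<longleftrightarrow> (\<exists>u. holds \<delta> (e(i := u)) \<phi>)"

text \<open>
  Every 1-type (a finitely satisfiable set of formulas in the variable 0) over a parameter set
  of cardinality less than that of the model is realised.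
\<close>

definition saturated :: "('u::comm_ring_1 \<Rightarrow> 'u) \<Rightarrow> bool" where
  "saturated \<delta> \<longleftrightarrow>
     (\<forall>A \<Phi>. A \<prec> (UNIV :: 'u set) \<and> (\<forall>\<phi> \<in> \<Phi>. params \<phi> \<subseteq> A \<and> free_vars \<phi> \<subseteq> {0}) \<and>
        (\<forall>\<Phi>\<^sub>0. finite \<Phi>\<^sub>0 \<and> \<Phi>\<^sub>0 \<subseteq> \<Phi> \<longrightarrow> (\<exists>u. \<forall>\<phi> \<in> \<Phi>\<^sub>0. holds \<delta> (\<lambda>_. u) \<phi>)) \<longrightarrow>
        (\<exists>u. \<forall>\<phi> \<in> \<Phi>. holds \<delta> (\<lambda>_. u) \<phi>))"

definition universal_domain :: "('u::field_char_0 \<Rightarrow> 'u) \<Rightarrow> bool" where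
  "universal_domain \<delta> \<longleftrightarrow> derivation \<delta> \<and> differentially_closed \<delta> \<and> saturated \<delta>"

definition small :: "'u set \<Rightarrow> bool" where
  "small K \<longleftrightarrow> K \<prec> (UNIV :: 'u set)"


section \<open>Projective differential varieties\<close>

definition affine_space :: "nat \<Rightarrow> (nat \<Rightarrow> 'u::field) set" where
  "affine_space N = {a. \<forall>i \<ge> N. a i = 0}"

text \<open>A point of projective space is the set of all its tuples of homogeneous coordinates.\<close>

definition proj_point :: "(nat \<Rightarrow> 'u::field) \<Rightarrow> (nat \<Rightarrow> 'u) set" where
  "proj_point a = {(\<lambda>i. c * a i) | c. c \<noteq> 0}"

definition proj_space :: "nat \<Rightarrow> (nat \<Rightarrow> 'u::field) set set" where
  "proj_space n = proj_point ` (affine_space (Suc n) - {\<lambda>_. 0})"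

text \<open>
  \<open>f (t y) = t\<^sup>e f y\<close> as an identity of differential polynomials, where \<open>t = y\<^sub>j\<close>
  multiplies the indeterminates with index in \<open>I\<close>; \<open>j\<close> has to be an index not used in \<open>f\<close>.
\<close>

definition d_homogeneous ::
  "('u::comm_ring_1 \<Rightarrow> 'u) \<Rightarrow> nat \<Rightarrow> nat set \<Rightarrow> nat \<Rightarrow> 'u dpol \<Rightarrow> bool" where
  "d_homogeneous \<delta> j I e f \<longleftrightarrow>
     dpol_eval mconst (dpol_deriv \<delta>) f
       (\<lambda>i. if i \<in> I then mvar (j, 0) * mvar (i, 0) else mvar (i, 0)) = mvar (j, 0) ^ e * f"

definition proj_zeros :: "('u::field \<Rightarrow> 'u) \<Rightarrow> nat \<Rightarrow> 'u dpol set \<Rightarrow> (nat \<Rightarrow> 'u) set set" where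
  "proj_zeros \<delta> n F = {p \<in> proj_space n. \<forall>f \<in> F. \<forall>a \<in> p. dval \<delta> f a = 0}"

definition d_closed ::
  "('u::field \<Rightarrow> 'u) \<Rightarrow> 'u set \<Rightarrow> nat \<Rightarrow> (nat \<Rightarrow> 'u) set set \<Rightarrow> bool" where
  "d_closed \<delta> K n V \<longleftrightarrow>
     (\<exists>F \<subseteq> {f \<in> dpols K n. \<exists>e. d_homogeneous \<delta> (Suc n) {..n} e f}. V = proj_zeros \<delta> n F)"

definition d_irreducible ::
  "('u::field \<Rightarrow> 'u) \<Rightarrow> 'u set \<Rightarrow> nat \<Rightarrow> (nat \<Rightarrow> 'u) set set \<Rightarrow> bool" where
  "d_irreducible \<delta> K n V \<longleftrightarrow> V \<noteq> {} \<and>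
     \<not> (\<exists>A B. d_closed \<delta> K n A \<and> d_closed \<delta> K n B \<and> A \<subset> V \<and> B \<subset> V \<and> V = A \<union> B)"

definition quasiprojective ::
  "('u::field \<Rightarrow> 'u) \<Rightarrow> nat \<Rightarrow> (nat \<Rightarrow> 'u) set set \<Rightarrow> bool" where
  "quasiprojective \<delta> m Y \<longleftrightarrow>
     (\<exists>W Z. d_closed \<delta> UNIV m W \<and> d_closed \<delta> UNIV m Z \<and> Y = W - Z)"

text \<open>
  In the product of projective spaces of dimensions \<open>n\<close> and \<open>m\<close> the indeterminates with index
  in \<open>{..n}\<close> are the coordinates of the first factor, those with index in \<open>{Suc n..Suc n + m}\<close>
  the coordinates of the second, and \<open>Suc (Suc n + m)\<close> is the index of the extra
  indeterminate used to express homogeneity.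
\<close>

definition join :: "nat \<Rightarrow> (nat \<Rightarrow> 'u) \<Rightarrow> (nat \<Rightarrow> 'u) \<Rightarrow> nat \<Rightarrow> 'u" where
  "join n a b = (\<lambda>i. if i \<le> n then a i else b (i - Suc n))"

definition d_closed_prod ::
  "('u::field \<Rightarrow> 'u) \<Rightarrow> nat \<Rightarrow> nat \<Rightarrow> ((nat \<Rightarrow> 'u) set \<times> (nat \<Rightarrow> 'u) set) set \<Rightarrow> bool" where
  "d_closed_prod \<delta> n m Z \<longleftrightarrow>
     (\<exists>F \<subseteq> {f \<in> dpols UNIV (Suc n + m).
           (\<exists>e. d_homogeneous \<delta> (Suc (Suc n + m)) {..n} e f) \<and>
           (\<exists>e. d_homogeneous \<delta> (Suc (Suc n + m)) {Suc n..Suc n + m} e f)}.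
        Z = {(p, q) \<in> proj_space n \<times> proj_space m.
               \<forall>f \<in> F. \<forall>a \<in> p. \<forall>b \<in> q. dval \<delta> f (join n a b) = 0})"

text \<open>The second projection is closed with respect to the induced topologies on \<open>V \<times> Y\<close> and \<open>Y\<close>.\<close>

definition d_complete ::
  "('u::field \<Rightarrow> 'u) \<Rightarrow> nat \<Rightarrow> (nat \<Rightarrow> 'u) set set \<Rightarrow> bool" where
  "d_complete \<delta> n V \<longleftrightarrow> d_closed \<delta> UNIV n V \<and>
     (\<forall>m Y Z. quasiprojective \<delta> m Y \<and> d_closed_prod \<delta> n m Z \<longrightarrow>
        (\<exists>C. d_closed \<delta> UNIV m C \<and> snd ` (Z \<inter> V \<times> Y) = C \<inter> Y))"

definition generic_point ::
  "('u::field \<Rightarrow> 'u) \<Rightarrow> 'u set \<Rightarrow> nat \<Rightarrow> (nat \<Rightarrow> 'u) set set \<Rightarrow> (nat \<Rightarrow> 'u) set \<Rightarrow> bool" where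
  "generic_point \<delta> K n V \<alpha> \<longleftrightarrow> \<alpha> \<in> V \<and> (\<forall>W. d_closed \<delta> K n W \<and> W \<subset> V \<longrightarrow> \<alpha> \<notin> W)"

definition lin_dependent_over :: "nat \<Rightarrow> (nat \<Rightarrow> 'u::field) set set \<Rightarrow> (nat \<Rightarrow> 'u) \<Rightarrow> bool" where
  "lin_dependent_over n V a \<longleftrightarrow> (\<exists>p \<in> V. \<exists>v \<in> p. (\<Sum>i\<le>n. v i * a i) = 0)"


section \<open>Kolchin polynomials\<close>

definition field_gen :: "'u::field set \<Rightarrow> 'u set \<Rightarrow> 'u set" where
  "field_gen K S = \<Inter> {L. subfield_set L \<and> K \<union> S \<subseteq> L}"

text \<open>The algebraic indeterminates are indexed by the elements of \<open>B\<close> themselves.\<close>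

definition alg_independent :: "'u::field set \<Rightarrow> 'u set \<Rightarrow> bool" where
  "alg_independent K B \<longleftrightarrow>
     (\<forall>p :: ('u, 'u) mpol. mcoeffs_in K p \<and> mvars p \<subseteq> B \<and> meval id (\<lambda>v. v) p = 0 \<longrightarrow> p = 0)"

definition transcendence_basis :: "'u::field set \<Rightarrow> 'u set \<Rightarrow> 'u set \<Rightarrow> bool" where
  "transcendence_basis K L B \<longleftrightarrow> B \<subseteq> L \<and> alg_independent K B \<and>
     (\<forall>B'. B \<subset> B' \<and> B' \<subseteq> L \<longrightarrow> \<not> alg_independent K B')"

definition trdeg :: "'u::field set \<Rightarrow> 'u set \<Rightarrow> nat" where
  "trdeg K L = card (SOME B. transcendence_basis K L B)"

definition kolchin_poly ::
  "('u::field \<Rightarrow> 'u) \<Rightarrow> 'u set \<Rightarrow> nat \<Rightarrow> (nat \<Rightarrow> 'u) \<Rightarrow> rat poly" where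
  "kolchin_poly \<delta> K n b = (THE \<omega>. \<forall>\<^sub>F t in sequentially.
     poly \<omega> (of_nat t) = of_nat (trdeg K (field_gen K {(\<delta> ^^ r) (b i) | i r. i \<le> n \<and> r \<le> t})))"

text \<open>
  The result does not depend on the choices of homogeneous coordinates and affine chart here,
  or on that of the generic point in the definition after this one.
\<close>

definition kolchin_poly_point ::
  "('u::field \<Rightarrow> 'u) \<Rightarrow> 'u set \<Rightarrow> nat \<Rightarrow> (nat \<Rightarrow> 'u) set \<Rightarrow> rat poly" where
  "kolchin_poly_point \<delta> K n \<alpha> =
     (let a = (SOME a. a \<in> \<alpha>); i = (SOME i. i \<le> n \<and> a i \<noteq> 0)
      in kolchin_poly \<delta> K n (\<lambda>j. a j / a i))"

definition kolchin_poly_variety ::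
  "('u::field \<Rightarrow> 'u) \<Rightarrow> 'u set \<Rightarrow> nat \<Rightarrow> (nat \<Rightarrow> 'u) set set \<Rightarrow> rat poly" where
  "kolchin_poly_variety \<delta> K n V = kolchin_poly_point \<delta> K n (SOME \<alpha>. generic_point \<delta> K n V \<alpha>)"


section \<open>General solutions\<close>

definition dpol_unit :: "'u::field set \<Rightarrow> nat \<Rightarrow> 'u dpol \<Rightarrow> bool" where
  "dpol_unit K n f \<longleftrightarrow> f \<in> dpols K n \<and> (\<exists>g \<in> dpols K n. f * g = 1)"

definition dpol_irreducible :: "'u::field set \<Rightarrow> nat \<Rightarrow> 'u dpol \<Rightarrow> bool" where
  "dpol_irreducible K n R \<longleftrightarrow> R \<in> dpols K n \<and> R \<noteq> 0 \<and> \<not> dpol_unit K n R \<and>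
     (\<forall>f \<in> dpols K n. \<forall>g \<in> dpols K n. R = f * g \<longrightarrow> dpol_unit K n f \<or> dpol_unit K n g)"

text \<open>
  Rankings, as reflexive order relations on the derivatives of \<open>y\<^sub>0, \<dots>, y\<^sub>n\<close>; such an order is
  automatically a well-order.
\<close>

definition ranking :: "nat \<Rightarrow> ((nat \<times> nat) \<times> (nat \<times> nat)) set \<Rightarrow> bool" where
  "ranking n \<rho> \<longleftrightarrow> linear_order_on ({..n} \<times> UNIV) \<rho> \<and>
     (\<forall>i \<le> n. \<forall>r. ((i, r), (i, Suc r)) \<in> \<rho>) \<and>
     (\<forall>i \<le> n. \<forall>j \<le> n. \<forall>r s. ((i, r), (j, s)) \<in> \<rho> \<longrightarrow> ((i, Suc r), (j, Suc s)) \<in> \<rho>)"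

definition leader :: "((nat \<times> nat) \<times> (nat \<times> nat)) set \<Rightarrow> 'u::field dpol \<Rightarrow> nat \<times> nat" where
  "leader \<rho> R = (THE u. u \<in> mvars R \<and> (\<forall>v \<in> mvars R. (v, u) \<in> \<rho>))"

definition separant :: "((nat \<times> nat) \<times> (nat \<times> nat)) set \<Rightarrow> 'u::field dpol \<Rightarrow> 'u dpol" where
  "separant \<rho> R = mpartial (leader \<rho> R) R"

definition differential_ideal ::
  "('u::field \<Rightarrow> 'u) \<Rightarrow> 'u set \<Rightarrow> nat \<Rightarrow> 'u dpol set \<Rightarrow> bool" where
  "differential_ideal \<delta> K n I \<longleftrightarrow> I \<subseteq> dpols K n \<and> 0 \<in> I \<and>
     (\<forall>f \<in> I. \<forall>g \<in> I. f + g \<in> I) \<and> (\<forall>h \<in> dpols K n. \<forall>f \<in> I. h * f \<in> I) \<and>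
     (\<forall>f \<in> I. dpol_deriv \<delta> f \<in> I)"

definition differential_ideal_gen ::
  "('u::field \<Rightarrow> 'u) \<Rightarrow> 'u set \<Rightarrow> nat \<Rightarrow> 'u dpol set \<Rightarrow> 'u dpol set" where
  "differential_ideal_gen \<delta> K n F = \<Inter> {I. differential_ideal \<delta> K n I \<and> F \<subseteq> I}"

definition radical :: "'u::field set \<Rightarrow> nat \<Rightarrow> 'u dpol set \<Rightarrow> 'u dpol set" where
  "radical K n I = {f \<in> dpols K n. \<exists>k. f ^ k \<in> I}"

definition general_component ::
  "('u::field \<Rightarrow> 'u) \<Rightarrow> 'u set \<Rightarrow> nat \<Rightarrow> ((nat \<times> nat) \<times> (nat \<times> nat)) set \<Rightarrow>
     'u dpol \<Rightarrow> 'u dpol set" where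
  "general_component \<delta> K n \<rho> R =
     {f \<in> dpols K n. separant \<rho> R * f \<in> radical K n (differential_ideal_gen \<delta> K n {R})}"

definition general_solution ::
  "('u::field \<Rightarrow> 'u) \<Rightarrow> 'u set \<Rightarrow> nat \<Rightarrow> ((nat \<times> nat) \<times> (nat \<times> nat)) set \<Rightarrow>
     'u dpol \<Rightarrow> (nat \<Rightarrow> 'u) set" where
  "general_solution \<delta> K n \<rho> R =
     {a \<in> affine_space (Suc n). \<forall>f \<in> general_component \<delta> K n \<rho> R. dval \<delta> f a = 0}"

definition is_dependence_equation ::
  "('u::field \<Rightarrow> 'u) \<Rightarrow> 'u set \<Rightarrow> nat \<Rightarrow> ((nat \<times> nat) \<times> (nat \<times> nat)) set \<Rightarrow>
     (nat \<Rightarrow> 'u) set set \<Rightarrow> nat \<Rightarrow> 'u dpol \<Rightarrow> bool" where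
  "is_dependence_equation \<delta> K n \<rho> V d R \<longleftrightarrow>
     dpol_irreducible K n R \<and> dpol_order R = d \<and>
     (\<forall>a \<in> affine_space (Suc n). lin_dependent_over n V a \<longleftrightarrow> a \<in> general_solution \<delta> K n \<rho> R)"

end

theory Submission
  imports Defs "HOL-Library.Product_Lexorder" "HOL-Library.More_List"
begin

text \<open>
  Let \<open>v\<close> be a generic point of \<open>V\<close> over \<open>K\<close>, normalised to have a coordinate \<open>v\<^sub>i = 1\<close>, and let \<open>c\<close> be a
  generic vector orthogonal to \<open>v\<close>. Completeness of \<open>V\<close> makes the set of linearly dependent vectors closed;
  by saturation it is defined over \<open>K\<close>, and it is the zero set of the prime differential ideal of \<open>c\<close> over
  \<open>K\<close>. The coordinates of \<open>c\<close> other than \<open>c\<^sub>i\<close> are differentially independent over the field generated by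
  \<open>v\<close>. If \<open>P\<close> is a relation of lowest order \<open>s\<close> of \<open>c\<^sub>i\<close> over them, then differentiating \<open>P\<close> along the
  hyperplane orthogonal to \<open>v\<close> recovers \<open>v\<close> rationally from \<open>c\<close>, so that \<open>s\<close> equals the transcendence
  degree \<open>d\<close> of \<open>v\<close> and its derivatives. The irreducible relation \<open>R\<close> among the derivatives of \<open>c\<close> up to
  order \<open>d\<close> is unique up to a factor in \<open>K\<close>. A transcendence degree count shows that the derivatives not
  involving the leader of \<open>R\<close> are independent, whatever the ranking, and reduction modulo \<open>R\<close> then
  identifies the general component of \<open>R\<close> with the ideal of \<open>c\<close>.
\<close>

section \<open>Homomorphisms and derivations on polynomial rings\<close>

text \<open>Completeness gives closedness over the whole universal domain only, whereas
  \<open>c\<close> is generic over \<open>K\<close>. Saturation stands in for automorphisms over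
  \<open>K\<close>: if two tuples satisfy the same differential equations over \<open>K\<close>,
  every element adjoined to one has a counterpart for the other, and an element outside
  \<open>K\<close> has a second realisation of its type. Hence a polynomial of minimal support
  vanishing on the dependent vectors, with a coefficient normalised to 1, has coefficients in
  \<open>K\<close>, since otherwise subtracting a conjugate would shrink the support.

  The equality of \<open>s\<close> and \<open>d\<close> comes from two exchange arguments over the
  derivatives of the coordinates other than \<open>c i\<close>. All derivatives of
  \<open>c i\<close> are algebraic over these and a transcendence basis of \<open>d\<close> elements
  for \<open>v\<close>, so \<open>s\<close> is at most \<open>d\<close>. As \<open>v\<close> is
  rational over \<open>c\<close>, that basis is in turn algebraic over these and \<open>s\<close>
  derivatives of \<open>c i\<close>, so \<open>d\<close> is at most \<open>s\<close>.

  The ranking is arbitrary, so the leader of \<open>R\<close> can belong to another coordinate and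
  have order below \<open>d\<close>. Independence of the derivatives free of the leader is therefore
  not built into \<open>c\<close> and needs its own count.\<close>

abbreviation coef :: "('k \<Rightarrow>\<^sub>0 'a::zero) \<Rightarrow> 'k \<Rightarrow> 'a" where
  "coef \<equiv> Poly_Mapping.lookup"

abbreviation supp :: "('k \<Rightarrow>\<^sub>0 'a::zero) \<Rightarrow> 'k set" where
  "supp \<equiv> Poly_Mapping.keys"

definition ring_homo :: "('a::comm_ring_1 \<Rightarrow> 'b::comm_ring_1) \<Rightarrow> bool" where
  "ring_homo h \<longleftrightarrow> h 1 = 1 \<and> (\<forall>x y. h (x + y) = h x + h y) \<and> (\<forall>x y. h (x * y) = h x * h y)"

lemma ring_homoD:
  assumes "ring_homo h"
  shows ring_homo_1: "h 1 = 1" and ring_homo_add: "h (x + y) = h x + h y"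
    and ring_homo_mult: "h (x * y) = h x * h y" and ring_homo_0: "h 0 = 0"
    and ring_homo_uminus: "h (- x) = - h x" and ring_homo_diff: "h (x - y) = h x - h y"
    and ring_homo_power: "h (x ^ k) = h x ^ k"
proof -
  show a: "h 1 = 1" "\<And>x y. h (x + y) = h x + h y" "\<And>x y. h (x * y) = h x * h y"
    using assms unfolding ring_homo_def by auto
  show z: "h 0 = 0" using a(2)[of 0 0] by simp
  show m: "h (- x) = - h x" for x using a(2)[of x "- x"] z by (simp add: eq_neg_iff_add_eq_0 add.commute)
  show "h (x - y) = h x - h y" using a(2)[of x "- y"] m by simp
  show "h (x ^ k) = h x ^ k" by (induction k) (auto simp: a)
qed

lemma ring_homo_sum: "ring_homo h \<Longrightarrow> h (sum f A) = (\<Sum>x\<in>A. h (f x))"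
  by (induction A rule: infinite_finite_induct) (auto simp: ring_homoD)

lemma ring_homo_prod: "ring_homo h \<Longrightarrow> h (prod f A) = (\<Prod>x\<in>A. h (f x))"
  by (induction A rule: infinite_finite_induct) (auto simp: ring_homoD)

lemma ring_homo_of_nat: "ring_homo h \<Longrightarrow> h (of_nat k) = of_nat k"
  by (induction k) (auto simp: ring_homoD)

lemma ring_homo_id [simp]: "ring_homo id" "ring_homo (\<lambda>x. x)"
  by (auto simp: ring_homo_def)

lemma ring_homo_comp: "ring_homo g \<Longrightarrow> ring_homo h \<Longrightarrow> ring_homo (\<lambda>x. g (h x))"
  by (auto simp: ring_homo_def)

subsection \<open>Evaluation\<close>

definition mono_eval :: "('v \<Rightarrow> 'b) \<Rightarrow> ('v \<Rightarrow>\<^sub>0 nat) \<Rightarrow> 'b::comm_ring_1" where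
  "mono_eval \<xi> m = (\<Prod>v\<in>supp m. \<xi> v ^ coef m v)"

lemma mono_eval_superset: "finite W \<Longrightarrow> supp m \<subseteq> W \<Longrightarrow> mono_eval \<xi> m = (\<Prod>v\<in>W. \<xi> v ^ coef m v)"
  unfolding mono_eval_def by (rule prod.mono_neutral_left) (auto simp: in_keys_iff)

lemma mono_eval_0 [simp]: "mono_eval \<xi> 0 = 1"
  by (simp add: mono_eval_def)

lemma mono_eval_add: "mono_eval \<xi> (m + n) = mono_eval \<xi> m * mono_eval \<xi> n"
proof -
  let ?W = "supp m \<union> supp n"
  have "supp (m + n) \<subseteq> ?W" by (rule keys_add)
  then have "mono_eval \<xi> (m + n) = (\<Prod>v\<in>?W. \<xi> v ^ coef (m + n) v)"
    by (intro mono_eval_superset) auto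
  also have "\<dots> = mono_eval \<xi> m * mono_eval \<xi> n"
    by (simp add: mono_eval_superset[of ?W] lookup_add power_add prod.distrib)
  finally show ?thesis .
qed

lemma mono_eval_single [simp]: "mono_eval \<xi> (Poly_Mapping.single v k) = \<xi> v ^ k"
  by (cases "k = 0") (auto simp: mono_eval_def)

lemma meval_eq: "meval \<iota> \<xi> f = (\<Sum>m\<in>supp f. \<iota> (coef f m) * mono_eval \<xi> m)"
  by (simp add: meval_def mono_eval_def)

lemma meval_superset:
  "\<iota> 0 = 0 \<Longrightarrow> finite M \<Longrightarrow> supp f \<subseteq> M \<Longrightarrow> meval \<iota> \<xi> f = (\<Sum>m\<in>M. \<iota> (coef f m) * mono_eval \<xi> m)"
  unfolding meval_eq by (rule sum.mono_neutral_left) (auto simp: in_keys_iff)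

lemma poly_mapping_sum_single: "f = (\<Sum>m\<in>supp f. Poly_Mapping.single m (coef f m))"
proof (rule poly_mapping_eqI)
  fix k
  have "(\<Sum>m\<in>supp f. coef (Poly_Mapping.single m (coef f m)) k) = (\<Sum>m\<in>supp f. if m = k then coef f m else 0)"
    by (intro sum.cong) (auto simp: lookup_single)
  then show "coef f k = coef (\<Sum>m\<in>supp f. Poly_Mapping.single m (coef f m)) k"
    by (auto simp: lookup_sum in_keys_iff)
qed

text \<open>Multiplicativity and the Leibniz rule are bilinear, so that with this rule they need
  checking on single terms only.\<close>

lemma poly_mapping_add_induct [case_names zero single add]:
  fixes f :: "'k \<Rightarrow>\<^sub>0 'a::comm_monoid_add"
  assumes "P 0" "\<And>m c. P (Poly_Mapping.single m c)" "\<And>f g. P f \<Longrightarrow> P g \<Longrightarrow> P (f + g)"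
  shows "P f"
proof -
  have "P (\<Sum>m\<in>M. Poly_Mapping.single m (coef f m))" for M
    by (induction M rule: infinite_finite_induct) (auto intro: assms)
  then show ?thesis using poly_mapping_sum_single[of f] by metis
qed

lemma meval_0 [simp]: "meval \<iota> \<xi> 0 = 0"
  by (simp add: meval_def)

lemma meval_single: "\<iota> 0 = 0 \<Longrightarrow> meval \<iota> \<xi> (Poly_Mapping.single m c) = \<iota> c * mono_eval \<xi> m"
  by (subst meval_superset[where M = "{m}"]) auto

lemma meval_add:
  assumes "ring_homo \<iota>"
  shows "meval \<iota> \<xi> (f + g) = meval \<iota> \<xi> f + meval \<iota> \<xi> g"
proof -
  let ?M = "supp f \<union> supp g"
  have M: "finite ?M" "supp f \<subseteq> ?M" "supp g \<subseteq> ?M" "supp (f + g) \<subseteq> ?M" by (auto dest: subsetD[OF keys_add])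
  show ?thesis
    unfolding meval_superset[of \<iota>, OF ring_homo_0[OF assms] M(1,2)] meval_superset[of \<iota>, OF ring_homo_0[OF assms] M(1,3)]
      meval_superset[of \<iota>, OF ring_homo_0[OF assms] M(1,4)]
    by (simp add: lookup_add ring_homoD[OF assms] algebra_simps sum.distrib)
qed

lemma meval_mult:
  assumes "ring_homo \<iota>"
  shows "meval \<iota> \<xi> (f * g) = meval \<iota> \<xi> f * meval \<iota> \<xi> g"
proof (induction f rule: poly_mapping_add_induct)
  case (single m c)
  show ?case
    by (induction g rule: poly_mapping_add_induct)
      (auto simp: mult_single meval_single ring_homoD[OF assms] mono_eval_add meval_add[OF assms] algebra_simps)
qed (auto simp: meval_add[OF assms] algebra_simps)

lemma meval_mconst [simp]: "ring_homo \<iota> \<Longrightarrow> meval \<iota> \<xi> (mconst c) = \<iota> c"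
  by (simp add: mconst_def meval_single ring_homoD)

lemma meval_mvar [simp]: "ring_homo \<iota> \<Longrightarrow> meval \<iota> \<xi> (mvar v) = \<xi> v"
  by (simp add: mvar_def meval_single ring_homoD)

lemma mconst_1 [simp]: "mconst 1 = 1" and mconst_0 [simp]: "mconst 0 = 0"
  by (simp_all add: mconst_def)

lemma ring_homo_mconst [simp]: "ring_homo mconst"
  by (auto simp: ring_homo_def mconst_def single_add mult_single)

lemma ring_homo_meval: "ring_homo \<iota> \<Longrightarrow> ring_homo (meval \<iota> \<xi>)"
  using meval_mconst[of \<iota> \<xi> 1] by (simp add: ring_homo_def meval_add meval_mult del: meval_mconst)

lemma mvar_power: "mvar v ^ k = Poly_Mapping.single (Poly_Mapping.single v k) 1"
proof (induction k)
  case (Suc k)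
  have "Poly_Mapping.single v (Suc k) = Poly_Mapping.single v 1 + Poly_Mapping.single v k"
    by (simp flip: single_add)
  then show ?case using Suc by (simp add: mvar_def mult_single)
qed simp

lemma mono_eval_mvar: "mono_eval mvar m = Poly_Mapping.single m (1::'a::comm_ring_1)"
proof (induction m rule: poly_mapping_add_induct)
  case (add f g)
  then show ?case by (simp add: mono_eval_add mult_single)
qed (auto simp: mvar_power)

lemma single_eq_mconst_mono: "Poly_Mapping.single m c = mconst c * mono_eval mvar m"
  by (simp add: mono_eval_mvar mconst_def mult_single)

subsection \<open>Polynomials with restricted coefficients and indeterminates\<close>

text \<open>Besides \<open>dpols\<close>, this covers polynomials in an arbitrary set of
  indeterminates, as needed for inductions on that set, and \<open>K\<close> may itself be a set of
  polynomials, as in \<open>coef_split_poly_in\<close>.\<close>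

definition MP :: "'a set \<Rightarrow> 'v set \<Rightarrow> ('v, 'a::comm_ring_1) mpol set" where
  "MP K W = {f. mcoeffs_in K f \<and> mvars f \<subseteq> W}"

lemma dpols_eq_MP: "dpols K n = MP K ({..n} \<times> UNIV)"
  by (simp add: dpols_def MP_def)

definition subring_set :: "'a::comm_ring_1 set \<Rightarrow> bool" where
  "subring_set K \<longleftrightarrow> 0 \<in> K \<and> 1 \<in> K \<and> (\<forall>x\<in>K. \<forall>y\<in>K. x + y \<in> K \<and> x - y \<in> K \<and> x * y \<in> K)"

lemma subring_setD:
  assumes "subring_set K"
  shows "0 \<in> K" "1 \<in> K" "x \<in> K \<Longrightarrow> y \<in> K \<Longrightarrow> x + y \<in> K" "x \<in> K \<Longrightarrow> y \<in> K \<Longrightarrow> x - y \<in> K"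
    "x \<in> K \<Longrightarrow> y \<in> K \<Longrightarrow> x * y \<in> K" "x \<in> K \<Longrightarrow> - x \<in> K" "x \<in> K \<Longrightarrow> x ^ k \<in> K" "of_nat k \<in> K"
proof -
  show a: "0 \<in> K" "1 \<in> K" "\<And>x y. x \<in> K \<Longrightarrow> y \<in> K \<Longrightarrow> x + y \<in> K" "\<And>x y. x \<in> K \<Longrightarrow> y \<in> K \<Longrightarrow> x - y \<in> K"
    "\<And>x y. x \<in> K \<Longrightarrow> y \<in> K \<Longrightarrow> x * y \<in> K"
    using assms unfolding subring_set_def by auto
  show "x \<in> K \<Longrightarrow> - x \<in> K" using a(4)[of 0 x] a(1) by simp
  show "x \<in> K \<Longrightarrow> x ^ k \<in> K" by (induction k) (auto intro: a)
  show "of_nat k \<in> K" by (induction k) (auto intro: a)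
qed

lemma subring_set_sum: "subring_set K \<Longrightarrow> (\<And>x. x \<in> A \<Longrightarrow> f x \<in> K) \<Longrightarrow> sum f A \<in> K"
  by (induction A rule: infinite_finite_induct) (auto intro: subring_setD)

lemma subring_set_prod: "subring_set K \<Longrightarrow> (\<And>x. x \<in> A \<Longrightarrow> f x \<in> K) \<Longrightarrow> prod f A \<in> K"
  by (induction A rule: infinite_finite_induct) (auto intro: subring_setD)

lemma subring_set_UNIV [simp]: "subring_set UNIV"
  by (simp add: subring_set_def)

lemma subfield_subring: "subfield_set K \<Longrightarrow> subring_set K"
  by (auto simp: subfield_set_def subring_set_def)

lemma diff_subfield_subring: "diff_subfield \<delta> K \<Longrightarrow> subring_set K"
  by (auto simp: diff_subfield_def subfield_subring)

lemma mcoeffs_in_iff: "0 \<in> K \<Longrightarrow> mcoeffs_in K f \<longleftrightarrow> (\<forall>m. coef f m \<in> K)"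
  by (metis in_keys_iff mcoeffs_in_def)

lemma mvars_iff: "v \<in> mvars f \<longleftrightarrow> (\<exists>m. coef f m \<noteq> 0 \<and> coef m v \<noteq> 0)"
  by (auto simp: mvars_def in_keys_iff)

lemma finite_mvars [simp]: "finite (mvars f)"
  by (simp add: mvars_def)

lemma mvars_add: "mvars (f + g) \<subseteq> mvars f \<union> mvars g"
  using keys_add[of f g] by (auto simp: mvars_def)

lemma mvars_mult: "mvars (f * g) \<subseteq> mvars f \<union> mvars g"
proof
  fix v assume "v \<in> mvars (f * g)"
  then obtain m where m: "m \<in> supp (f * g)" "v \<in> supp m" by (auto simp: mvars_def)
  then obtain a b where ab: "a \<in> supp f" "b \<in> supp g" "m = a + b" using keys_mult[of f g] by auto
  then have "v \<in> supp a \<union> supp b" using m(2) keys_add[of a b] by auto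
  then show "v \<in> mvars f \<union> mvars g" using ab by (auto simp: mvars_def)
qed

lemma mvars_uminus [simp]: "mvars (- f) = mvars f"
  by (auto simp: mvars_iff)

lemma mvars_mconst [simp]: "mvars (mconst c) = {}"
  by (auto simp: mvars_iff mconst_def lookup_single when_def split: if_splits)

lemma mvars_mvar [simp]: "mvars (mvar v :: ('v, 'a::comm_ring_1) mpol) = {v}"
  by (auto simp: mvars_def mvar_def)

lemma mvars_empty_iff: "mvars f = {} \<longleftrightarrow> (\<exists>c. f = mconst c)"
proof
  assume "mvars f = {}"
  then have *: "m = 0" if "m \<in> supp f" for m
    using that by (auto simp: mvars_def)
  have "f = mconst (coef f 0)"
  proof (rule poly_mapping_eqI)
    fix k show "coef f k = coef (mconst (coef f 0)) k"
      using *[of k] by (cases "k = 0") (auto simp: mconst_def lookup_single in_keys_iff)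
  qed
  then show "\<exists>c. f = mconst c" ..
qed auto

lemma coef_mult_in:
  assumes K: "subring_set K" and "\<forall>m. coef f m \<in> K" "\<forall>m. coef g m \<in> K"
  shows "coef (f * g :: ('v, 'a::comm_ring_1) mpol) m \<in> K"
proof -
  have "f * g = (\<Sum>a\<in>supp f. Poly_Mapping.single a (coef f a)) * (\<Sum>b\<in>supp g. Poly_Mapping.single b (coef g b))"
    using poly_mapping_sum_single[of f] poly_mapping_sum_single[of g] by simp
  also have "\<dots> = (\<Sum>a\<in>supp f. \<Sum>b\<in>supp g. Poly_Mapping.single (a + b) (coef f a * coef g b))"
    by (simp add: sum_product mult_single)
  finally have "coef (f * g) m = (\<Sum>a\<in>supp f. \<Sum>b\<in>supp g. coef (Poly_Mapping.single (a + b) (coef f a * coef g b)) m)"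
    by (simp add: lookup_sum)
  also have "\<dots> \<in> K"
    by (intro subring_set_sum[OF K]) (auto simp: lookup_single when_def assms intro: subring_setD[OF K])
  finally show ?thesis .
qed

lemma MP_iff: "subring_set K \<Longrightarrow> f \<in> MP K W \<longleftrightarrow> (\<forall>m. coef f m \<in> K) \<and> mvars f \<subseteq> W"
  by (simp add: MP_def mcoeffs_in_iff subring_setD)

lemma MP_mconst [intro]: "subring_set K \<Longrightarrow> c \<in> K \<Longrightarrow> mconst c \<in> MP K W"
  by (auto simp: MP_iff mconst_def[of c] lookup_single when_def subring_setD)
     (auto simp flip: mconst_def)

lemma MP_mvar [intro]: "subring_set K \<Longrightarrow> v \<in> W \<Longrightarrow> mvar v \<in> MP K W"
  by (auto simp: MP_iff mvar_def[of v] lookup_single when_def subring_setD)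
     (auto simp flip: mvar_def simp: mvars_def mvar_def)

lemma subring_MP: "subring_set K \<Longrightarrow> subring_set (MP K W)"
proof -
  assume K: "subring_set K"
  have c: "0 \<in> MP K W" "1 \<in> MP K W"
    using MP_mconst[OF K subring_setD(1)[OF K], of W] MP_mconst[OF K subring_setD(2)[OF K], of W] by auto
  have n: "- g \<in> MP K W" if "g \<in> MP K W" for g
    using that by (auto simp: MP_iff[OF K] intro: subring_setD[OF K])
  have a: "f + g \<in> MP K W" if "f \<in> MP K W" "g \<in> MP K W" for f g
    using that mvars_add[of f g] by (auto simp: MP_iff[OF K] lookup_add intro: subring_setD[OF K])
  have m: "f * g \<in> MP K W" if "f \<in> MP K W" "g \<in> MP K W" for f g
    using that mvars_mult[of f g] by (auto simp: MP_iff[OF K] intro: coef_mult_in[OF K])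
  show ?thesis unfolding subring_set_def using c a m n a[OF _ n] by auto
qed

lemma MP_mono: "K \<subseteq> L \<Longrightarrow> W \<subseteq> W' \<Longrightarrow> MP K W \<subseteq> MP L W'"
  by (auto simp: MP_def mcoeffs_in_def)

lemma MP_UNIV [simp]: "f \<in> MP UNIV UNIV"
  by (auto simp: MP_def mcoeffs_in_def)

text \<open>A polynomial is a finite sum of products of a constant and indeterminates. In the cases
  \<open>add\<close> and \<open>mult\<close> both operands are known to lie in
  \<open>MP K W\<close>, which invariants about derivatives use.\<close>

lemma MP_induct [consumes 2, case_names const var add mult]:
  assumes K: "subring_set K" and f: "f \<in> MP K W"
    and "\<And>c. c \<in> K \<Longrightarrow> P (mconst c)" "\<And>v. v \<in> W \<Longrightarrow> P (mvar v)"
    and "\<And>f g. f \<in> MP K W \<Longrightarrow> g \<in> MP K W \<Longrightarrow> P f \<Longrightarrow> P g \<Longrightarrow> P (f + g)"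
    and "\<And>f g. f \<in> MP K W \<Longrightarrow> g \<in> MP K W \<Longrightarrow> P f \<Longrightarrow> P g \<Longrightarrow> P (f * g)"
  shows "P f"
proof -
  define Q where "Q f \<longleftrightarrow> f \<in> MP K W \<and> P f" for f
  note M = subring_setD[OF subring_MP[OF K]]
  have c: "Q (mconst c)" if "c \<in> K" for c using that assms unfolding Q_def by auto
  have v: "Q (mvar v)" if "v \<in> W" for v using that assms unfolding Q_def by auto
  have a: "Q (f + g)" if "Q f" "Q g" for f g using that assms M unfolding Q_def by auto
  have m: "Q (f * g)" if "Q f" "Q g" for f g using that assms M unfolding Q_def by auto
  have 0: "Q 0" "Q 1" using c[of 0] c[of 1] subring_setD[OF K] by auto
  have pow: "Q (f ^ k)" if "Q f" for f k by (induction k) (auto intro: m that 0)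
  have pr: "Q (prod h A)" if "\<And>x. x \<in> A \<Longrightarrow> Q (h x)" for h and A :: "'b set" 
    using that by (induction A rule: infinite_finite_induct) (auto intro: m 0)
  have sm: "Q (sum h A)" if "\<And>x. x \<in> A \<Longrightarrow> Q (h x)" for h and A :: "('b \<Rightarrow>\<^sub>0 nat) set" 
    using that by (induction A rule: infinite_finite_induct) (auto intro: a 0)
  have "Q (\<Sum>m\<in>supp f. Poly_Mapping.single m (coef f m))"
  proof (rule sm)
    fix x assume x: "x \<in> supp f"
    have "supp x \<subseteq> W" "coef f x \<in> K" using f x by (auto simp: MP_def mvars_def mcoeffs_in_def)
    then show "Q (Poly_Mapping.single x (coef f x))" unfolding single_eq_mconst_mono mono_eval_def
      by (intro m c pr pow v) auto
  qed
  then show ?thesis using poly_mapping_sum_single[of f] unfolding Q_def by metis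
qed

text \<open>Identities between evaluations, substitutions and partial evaluations are reduced to
  constants and indeterminates by this lemma.\<close>

lemma ring_homo_eqI:
  assumes "subring_set K" "f \<in> MP K W" "ring_homo g" "ring_homo h"
    and "\<And>c. c \<in> K \<Longrightarrow> g (mconst c) = h (mconst c)" "\<And>v. v \<in> W \<Longrightarrow> g (mvar v) = h (mvar v)"
  shows "g f = h f"
  using assms(1,2) by (induction rule: MP_induct) (auto simp: ring_homoD assms)

lemma meval_cong:
  assumes "\<And>v. v \<in> mvars f \<Longrightarrow> \<xi> v = \<zeta> v"
  shows "meval \<iota> \<xi> f = meval \<iota> \<zeta> f"
proof -
  have "(\<Prod>v\<in>supp m. \<xi> v ^ coef m v) = (\<Prod>v\<in>supp m. \<zeta> v ^ coef m v)" if "m \<in> supp f" for m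
  proof (intro prod.cong refl)
    fix v assume "v \<in> supp m"
    then have "v \<in> mvars f" using that unfolding mvars_def by blast
    then show "\<xi> v ^ coef m v = \<zeta> v ^ coef m v" by (simp add: assms)
  qed
  then show ?thesis unfolding meval_def by (intro sum.cong refl) simp
qed

lemma meval_in:
  assumes K: "subring_set K" and f: "f \<in> MP K W" and \<iota>: "ring_homo \<iota>" and L: "subring_set L"
    and "\<And>c. c \<in> K \<Longrightarrow> \<iota> c \<in> L" "\<And>v. v \<in> W \<Longrightarrow> \<xi> v \<in> L"
  shows "meval \<iota> \<xi> f \<in> L"
  using K f by (induction rule: MP_induct)
    (auto simp: assms ring_homoD[OF ring_homo_meval[OF \<iota>]] intro: subring_setD[OF L])

subsection \<open>Derivations\<close>

lemma derivation_add: "derivation D \<Longrightarrow> D (x + y) = D x + D y"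
  by (simp add: derivation_def)

lemma derivation_mult: "derivation D \<Longrightarrow> D (x * y) = D x * y + x * D y"
  by (simp add: derivation_def)

lemma derivation_0: "derivation D \<Longrightarrow> D 0 = 0"
  using derivation_add[of D 0 0] by simp

lemma derivation_1: "derivation D \<Longrightarrow> D 1 = 0"
  using derivation_mult[of D 1 1] by simp

lemma derivation_uminus: "derivation D \<Longrightarrow> D (- x) = - D x"
  using derivation_add[of D x "- x"] by (simp add: derivation_0 eq_neg_iff_add_eq_0 add.commute)

lemma derivation_diff: "derivation D \<Longrightarrow> D (x - y) = D x - D y"
  using derivation_add[of D x "- y"] by (simp add: derivation_uminus)

lemma derivation_sum: "derivation D \<Longrightarrow> D (sum f A) = (\<Sum>x\<in>A. D (f x))"
  by (induction A rule: infinite_finite_induct) (auto simp: derivation_0 derivation_add)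

lemma derivation_of_nat: "derivation D \<Longrightarrow> D (of_nat k) = 0"
  by (induction k) (auto simp: derivation_0 derivation_add derivation_1)

lemmas derivation_simps = derivation_add derivation_mult derivation_0 derivation_1 derivation_uminus
  derivation_diff derivation_sum derivation_of_nat

lemma derivation_polyI:
  fixes L :: "('v, 'a::comm_ring_1) mpol \<Rightarrow> ('v, 'a) mpol"
  assumes add: "\<And>f g. L (f + g) = L f + L g"
    and single: "\<And>m n c e. L (Poly_Mapping.single m c * Poly_Mapping.single n e) =
      L (Poly_Mapping.single m c) * Poly_Mapping.single n e + Poly_Mapping.single m c * L (Poly_Mapping.single n e)"
  shows "derivation L"
proof -
  have 0: "L 0 = 0" using add[of 0 0] by simp
  have "L (f * g) = L f * g + f * L g" for f g
  proof (induction f rule: poly_mapping_add_induct)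
    case (single m c)
    show ?case
      by (induction g rule: poly_mapping_add_induct) (auto simp: 0 assms algebra_simps)
  qed (auto simp: 0 add algebra_simps)
  then show ?thesis using add by (auto simp: derivation_def)
qed

lemma mpartial_superset:
  "finite M \<Longrightarrow> supp f \<subseteq> M \<Longrightarrow> mpartial v f = (\<Sum>m\<in>M. Poly_Mapping.single (m - Poly_Mapping.single v 1) (of_nat (coef m v) * coef f m))"
  unfolding mpartial_def by (rule sum.mono_neutral_left) (auto simp: in_keys_iff)

lemma mpartial_add: "mpartial v (f + g) = mpartial v f + mpartial v g"
proof -
  let ?M = "supp f \<union> supp g"
  have M: "finite ?M" "supp f \<subseteq> ?M" "supp g \<subseteq> ?M" "supp (f + g) \<subseteq> ?M" by (auto dest: subsetD[OF keys_add])
  show ?thesis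
    unfolding mpartial_superset[OF M(1,2)] mpartial_superset[OF M(1,3)] mpartial_superset[OF M(1,4)]
    by (simp add: lookup_add algebra_simps sum.distrib single_add)
qed

lemma mpartial_single:
  "mpartial v (Poly_Mapping.single m c) = Poly_Mapping.single (m - Poly_Mapping.single v 1) (of_nat (coef m v) * c)"
  by (subst mpartial_superset[where M = "{m}"]) auto

lemma minus_single_add:
  fixes m n :: "'v \<Rightarrow>\<^sub>0 nat"
  assumes "coef m v > 0"
  shows "m - Poly_Mapping.single v 1 + n = m + n - Poly_Mapping.single v 1"
  using assms by (intro poly_mapping_eqI) (auto simp: lookup_add lookup_minus lookup_single when_def)

lemma derivation_mpartial: "derivation (mpartial v :: ('v, 'a::comm_ring_1) mpol \<Rightarrow> _)"
proof (rule derivation_polyI)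
  fix m n :: "'v \<Rightarrow>\<^sub>0 nat" and c e :: 'a
  let ?s = "Poly_Mapping.single"
  let ?x = "?s v 1"
  \<comment> \<open>With exponent 0 at \<open>v\<close> the subtraction of exponents is truncated
    and the two monomials may differ, but then the coefficient is 0.\<close>
  have 1: "?s (m - ?x + n) (of_nat (coef m v) * (c * e)) = ?s (m + n - ?x) (of_nat (coef m v) * (c * e))"
    using minus_single_add[of m v n] by (cases "coef m v = 0") auto
  have 2: "?s (m + (n - ?x)) (of_nat (coef n v) * (c * e)) = ?s (m + n - ?x) (of_nat (coef n v) * (c * e))"
    using minus_single_add[of n v m] by (cases "coef n v = 0") (auto simp: add.commute)
  show "mpartial v (?s m c * ?s n e) = mpartial v (?s m c) * ?s n e + ?s m c * mpartial v (?s n e)"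
    using 1 2 by (simp add: mult_single mpartial_single lookup_add algebra_simps single_add flip: single_add)
qed (rule mpartial_add)

lemma mpartial_mconst [simp]: "mpartial v (mconst c) = 0"
  by (simp add: mconst_def mpartial_single)

lemma mpartial_mvar: "mpartial v (mvar w) = (if v = w then 1 else 0)"
  by (auto simp: mvar_def mpartial_single lookup_single when_def)

lemma mpartial_not_mvars: "v \<notin> mvars f \<Longrightarrow> mpartial v f = 0"
  unfolding mpartial_def by (intro sum.neutral) (auto simp: mvars_def in_keys_iff)

lemma derivation_map_coeffs:
  assumes "derivation (\<delta> :: 'a::comm_ring_1 \<Rightarrow> 'a)"
  shows "derivation (Poly_Mapping.map \<delta> :: ('v, 'a) mpol \<Rightarrow> _)"
proof (rule derivation_polyI)
  have z: "\<delta> 0 = 0" using assms by (rule derivation_0)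
  have l: "coef (Poly_Mapping.map \<delta> f) m = \<delta> (coef f m)" for f :: "('v, 'a) mpol" and m
    by (auto simp: Poly_Mapping.map.rep_eq when_def z)
  show "Poly_Mapping.map \<delta> (f + g) = Poly_Mapping.map \<delta> f + Poly_Mapping.map \<delta> g" for f g :: "('v, 'a) mpol"
    by (rule poly_mapping_eqI) (simp add: l lookup_add derivation_simps[OF assms])
  have s: "Poly_Mapping.map \<delta> (Poly_Mapping.single m c) = Poly_Mapping.single m (\<delta> c)" for m :: "'v \<Rightarrow>\<^sub>0 nat" and c
    by (rule poly_mapping_eqI) (auto simp: l lookup_single when_def z)
  show "Poly_Mapping.map \<delta> (Poly_Mapping.single m c * Poly_Mapping.single n e) =
     Poly_Mapping.map \<delta> (Poly_Mapping.single m c) * Poly_Mapping.single n e +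
     Poly_Mapping.single m c * Poly_Mapping.map \<delta> (Poly_Mapping.single n e)" for m n :: "'v \<Rightarrow>\<^sub>0 nat" and c e
    by (simp add: mult_single s derivation_simps[OF assms] flip: single_add)
qed

text \<open>Summing over a common finite superset makes the derivatives of \<open>f\<close>,
  \<open>g\<close>, \<open>f + g\<close> and \<open>f * g\<close> comparable term by term.\<close>

lemma dpol_deriv_superset:
  "finite W \<Longrightarrow> mvars f \<subseteq> W \<Longrightarrow>
    dpol_deriv \<delta> f = Poly_Mapping.map \<delta> f + (\<Sum>(i, r)\<in>W. mpartial (i, r) f * mvar (i, Suc r))"
  unfolding dpol_deriv_def
  by (intro arg_cong2[where f = "(+)"] refl sum.mono_neutral_left) (auto simp: mpartial_not_mvars)

lemma derivation_dpol_deriv: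
  fixes \<delta> :: "'a::comm_ring_1 \<Rightarrow> 'a"
  assumes "derivation \<delta>"
  shows "derivation (dpol_deriv \<delta>)"
proof -
  note p = derivation_simps[OF derivation_mpartial] derivation_simps[OF derivation_map_coeffs[OF assms]]
  have "dpol_deriv \<delta> (f + g) = dpol_deriv \<delta> f + dpol_deriv \<delta> g \<and>
        dpol_deriv \<delta> (f * g) = dpol_deriv \<delta> f * g + f * dpol_deriv \<delta> g" for f g :: "'a dpol"
  proof -
    let ?W = "mvars f \<union> mvars g"
    have W: "finite ?W" "mvars f \<subseteq> ?W" "mvars g \<subseteq> ?W" "mvars (f + g) \<subseteq> ?W" "mvars (f * g) \<subseteq> ?W"
      using mvars_add[of f g] mvars_mult[of f g] by auto
    show ?thesis
      unfolding dpol_deriv_superset[OF W(1,2)] dpol_deriv_superset[OF W(1,3)] dpol_deriv_superset[OF W(1,4)]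
        dpol_deriv_superset[OF W(1,5)]
      by (auto simp: p case_prod_beta algebra_simps sum.distrib sum_distrib_left)
  qed
  then show ?thesis by (auto simp: derivation_def)
qed

lemma dpol_deriv_mconst [simp]:
  assumes "derivation \<delta>"
  shows "dpol_deriv \<delta> (mconst c) = mconst (\<delta> c)"
proof -
  have "Poly_Mapping.map \<delta> (mconst c) = mconst (\<delta> c)"
    by (intro poly_mapping_eqI)
       (auto simp: mconst_def Poly_Mapping.map.rep_eq lookup_single when_def derivation_0[OF assms])
  then show ?thesis by (simp add: dpol_deriv_def)
qed

lemma dpol_deriv_mvar [simp]:
  assumes "derivation \<delta>"
  shows "dpol_deriv \<delta> (mvar (i, r)) = mvar (i, Suc r)"
proof -
  have "Poly_Mapping.map \<delta> (mvar (i, r)) = 0"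
    by (intro poly_mapping_eqI) (auto simp: mvar_def Poly_Mapping.map.rep_eq lookup_single when_def derivation_simps[OF assms])
  then show ?thesis by (simp add: dpol_deriv_def mpartial_mvar)
qed

lemma dpol_deriv_funpow_mvar: "derivation \<delta> \<Longrightarrow> (dpol_deriv \<delta> ^^ k) (mvar (i, r)) = mvar (i, r + k)"
  by (induction k) auto

lemma dpol_deriv_funpow_mconst: "derivation \<delta> \<Longrightarrow> (dpol_deriv \<delta> ^^ k) (mconst c) = mconst ((\<delta> ^^ k) c)"
  by (induction k) auto

lemma dpol_deriv_MP:
  assumes d: "derivation \<delta>" and K: "subring_set K" and "\<And>c. c \<in> K \<Longrightarrow> \<delta> c \<in> K"
    and W: "\<And>i r. (i, r) \<in> W \<Longrightarrow> (i, r) \<in> W' \<and> (i, Suc r) \<in> W'"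
    and f: "f \<in> MP K W"
  shows "dpol_deriv \<delta> f \<in> MP K W'"
proof -
  note M = subring_setD[OF subring_MP[OF K]]
  have W': "W \<subseteq> W'" using W by auto
  show ?thesis
    using K f
  proof (induction rule: MP_induct)
    case (mult f g)
    then show ?case using MP_mono[of K K W W'] W'
      by (auto simp: derivation_simps[OF derivation_dpol_deriv[OF d]] intro!: M(3,5))
  next
    case (var v)
    then show ?case using W by (cases v) (auto simp: d K)
  qed (auto simp: d K assms derivation_simps[OF derivation_dpol_deriv[OF d]] intro: M)
qed

subsection \<open>Differential evaluation and substitution\<close>

lemma ring_homo_dpol_eval: "ring_homo \<iota> \<Longrightarrow> ring_homo (\<lambda>f. dpol_eval \<iota> D f a)"
  unfolding dpol_eval_def by (rule ring_homo_meval)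

lemma dpol_eval_mvar [simp]: "ring_homo \<iota> \<Longrightarrow> dpol_eval \<iota> D (mvar (i, r)) a = (D ^^ r) (a i)"
  by (simp add: dpol_eval_def)

lemma dpol_eval_mconst [simp]: "ring_homo \<iota> \<Longrightarrow> dpol_eval \<iota> D (mconst c) a = \<iota> c"
  by (simp add: dpol_eval_def)

lemmas dpol_eval_hom = ring_homoD[OF ring_homo_dpol_eval]
lemmas dval_hom = ring_homoD[OF ring_homo_dpol_eval[OF ring_homo_id(1)]]

lemma dpol_eval_deriv:
  assumes \<iota>: "ring_homo \<iota>" and \<delta>: "derivation \<delta>" and D: "derivation D" and c: "\<And>c. \<iota> (\<delta> c) = D (\<iota> c)"
  shows "dpol_eval \<iota> D (dpol_deriv \<delta> f) a = D (dpol_eval \<iota> D f a)"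
  using subring_set_UNIV MP_UNIV[of f]
proof (induction f rule: MP_induct)
  case (var v)
  then show ?case by (cases v) (simp add: \<iota> \<delta>)
qed (auto simp: \<iota> \<delta> c dpol_eval_hom[OF \<iota>] derivation_simps[OF derivation_dpol_deriv[OF \<delta>]] derivation_simps[OF D])

lemma dval_deriv: "derivation \<delta> \<Longrightarrow> dval \<delta> (dpol_deriv \<delta> f) a = \<delta> (dval \<delta> f a)"
  by (rule dpol_eval_deriv) auto

lemma dval_cong: "(\<And>i r. (i, r) \<in> mvars f \<Longrightarrow> a i = b i) \<Longrightarrow> dval \<delta> f a = dval \<delta> f b"
  unfolding dpol_eval_def by (rule meval_cong) auto

text \<open>The target carries the derivation \<open>dpol_deriv \<delta>\<close>, so
  \<open>\<theta> i\<close> replaces the indeterminate with index \<open>i\<close> together with all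
  its derivatives. The left side of the condition in \<open>d_homogeneous\<close> is an
  instance.\<close>

definition dsubst :: "('a \<Rightarrow> 'a) \<Rightarrow> (nat \<Rightarrow> 'a dpol) \<Rightarrow> 'a::comm_ring_1 dpol \<Rightarrow> 'a dpol" where
  "dsubst \<delta> \<theta> f = dpol_eval mconst (dpol_deriv \<delta>) f \<theta>"

lemma ring_homo_dsubst: "ring_homo (dsubst \<delta> \<theta>)"
  unfolding dsubst_def by (rule ring_homo_dpol_eval) simp

lemmas dsubst_hom = ring_homoD[OF ring_homo_dsubst]

lemma dsubst_mconst [simp]: "dsubst \<delta> \<theta> (mconst c) = mconst c"
  by (simp add: dsubst_def)

lemma dsubst_mvar: "dsubst \<delta> \<theta> (mvar (i, r)) = (dpol_deriv \<delta> ^^ r) (\<theta> i)"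
  by (simp add: dsubst_def)

lemma dsubst_deriv: "derivation \<delta> \<Longrightarrow> dsubst \<delta> \<theta> (dpol_deriv \<delta> f) = dpol_deriv \<delta> (dsubst \<delta> \<theta> f)"
  unfolding dsubst_def by (rule dpol_eval_deriv) (auto intro: derivation_dpol_deriv)

lemma dval_funpow_deriv: "derivation \<delta> \<Longrightarrow> dval \<delta> ((dpol_deriv \<delta> ^^ r) f) a = (\<delta> ^^ r) (dval \<delta> f a)"
  by (induction r) (auto simp: dval_deriv)

lemma dval_dsubst:
  assumes "derivation \<delta>"
  shows "dval \<delta> (dsubst \<delta> \<theta> f) a = dval \<delta> f (\<lambda>i. dval \<delta> (\<theta> i) a)"
proof (rule ring_homo_eqI[of UNIV f UNIV "\<lambda>f. dval \<delta> (dsubst \<delta> \<theta> f) a"])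
  fix v :: "nat \<times> nat"
  show "dval \<delta> (dsubst \<delta> \<theta> (mvar v)) a = dval \<delta> (mvar v) (\<lambda>i. dval \<delta> (\<theta> i) a)"
    by (cases v) (simp add: dsubst_mvar dval_funpow_deriv[OF assms])
qed (auto intro!: ring_homo_comp[OF ring_homo_dpol_eval ring_homo_dsubst] ring_homo_dpol_eval)

lemma dpol_deriv_funpow_MP:
  assumes "derivation \<delta>" "subring_set K" "\<And>c. c \<in> K \<Longrightarrow> \<delta> c \<in> K" "f \<in> MP K (I \<times> UNIV)"
  shows "(dpol_deriv \<delta> ^^ r) f \<in> MP K (I \<times> UNIV)"
  by (induction r) (auto intro!: assms dpol_deriv_MP[of \<delta> K "I \<times> UNIV"])

lemma dsubst_MP:
  assumes \<delta>: "derivation \<delta>" and K: "subring_set K" "\<And>c. c \<in> K \<Longrightarrow> \<delta> c \<in> K" and f: "f \<in> MP K (I \<times> UNIV)"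
    and \<theta>: "\<And>i. i \<in> I \<Longrightarrow> \<theta> i \<in> MP K (J \<times> UNIV)"
  shows "dsubst \<delta> \<theta> f \<in> MP K (J \<times> UNIV)"
  unfolding dsubst_def dpol_eval_def
  using f by (intro meval_in[OF K(1) _ ring_homo_mconst subring_MP[OF K(1)]])
    (auto intro!: K dpol_deriv_funpow_MP \<delta> \<theta>)

section \<open>Factorization of polynomials\<close>

subsection \<open>Polynomials in one distinguished indeterminate\<close>

lemma mvars_0 [simp]: "mvars 0 = {}" and mvars_1 [simp]: "mvars 1 = {}"
  using mvars_mconst[of 0] mvars_mconst[of 1] by (auto simp: mvars_def)

definition polys_over :: "'r::comm_ring_1 set \<Rightarrow> 'r poly set" where
  "polys_over A = {p. \<forall>k. coeff p k \<in> A}"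

lemma subring_polys_over:
  assumes A: "subring_set A"
  shows "subring_set (polys_over A)"
proof -
  note D = subring_setD[OF A]
  have "1 \<in> polys_over A" using D(1,2) by (auto simp: polys_over_def coeff_pCons one_pCons split: nat.splits)
  then show ?thesis unfolding subring_set_def
    by (auto simp: polys_over_def coeff_mult intro!: D(3-5) subring_set_sum[OF A] D(1))
qed

lemma polys_over_pCons: "a \<in> A \<Longrightarrow> p \<in> polys_over A \<Longrightarrow> pCons a p \<in> polys_over A"
  by (auto simp: polys_over_def coeff_pCons split: nat.splits)

lemma polys_over_0: "0 \<in> A \<Longrightarrow> 0 \<in> polys_over A"
  by (auto simp: polys_over_def)

lemma polys_over_monom: "0 \<in> A \<Longrightarrow> a \<in> A \<Longrightarrow> monom a k \<in> polys_over A"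
  by (auto simp: polys_over_def)

lemma polys_over_smult: "subring_set A \<Longrightarrow> a \<in> A \<Longrightarrow> p \<in> polys_over A \<Longrightarrow> smult a p \<in> polys_over A"
  by (auto simp: polys_over_def intro: subring_setD)

lemma poly_in: "subring_set A \<Longrightarrow> p \<in> polys_over A \<Longrightarrow> x \<in> A \<Longrightarrow> poly p x \<in> A"
  by (auto simp: polys_over_def poly_altdef intro!: subring_set_sum subring_setD)

lemma ring_homo_const_poly: "ring_homo h \<Longrightarrow> ring_homo (\<lambda>c. [:h c:])"
  by (auto simp: ring_homo_def one_pCons)

lemma ring_homo_poly: "ring_homo (\<lambda>p. poly p x)"
  by (auto simp: ring_homo_def)

text \<open>The polynomial is regarded as univariate in \<open>z\<close>. Its coefficients stay in
  the same type, without occurrence of \<open>z\<close>, so that substituting \<open>mvar z\<close>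
  gives back \<open>f\<close> (\<open>poly_up\<close>).\<close>

definition up :: "'v \<Rightarrow> ('v, 'a::comm_ring_1) mpol \<Rightarrow> ('v, 'a) mpol poly" where
  "up z = meval (\<lambda>c. [:mconst c:]) (\<lambda>v. if v = z then [:0, 1:] else [:mvar v:])"

lemma ring_homo_up: "ring_homo (up z)"
  unfolding up_def by (intro ring_homo_meval ring_homo_const_poly) simp

lemmas up_hom = ring_homoD[OF ring_homo_up]

lemma up_mconst [simp]: "up z (mconst c) = [:mconst c:]"
  unfolding up_def by (intro meval_mconst ring_homo_const_poly) simp

lemma up_mvar: "up z (mvar v) = (if v = z then [:0, 1:] else [:mvar v:])"
  unfolding up_def by (intro meval_mvar ring_homo_const_poly) simp

lemma poly_up: "poly (up z f) (mvar z) = f"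
  by (rule ring_homo_eqI[of UNIV f UNIV "\<lambda>f. poly (up z f) (mvar z)" "\<lambda>x. x"])
    (auto intro: ring_homo_comp[OF ring_homo_poly ring_homo_up] simp: up_mvar)

lemma up_not_mvars:
  assumes "z \<notin> mvars f"
  shows "up z f = [:f:]"
  by (rule ring_homo_eqI[of UNIV f "- {z}" "up z"])
    (use assms in \<open>auto intro: ring_homo_up ring_homo_const_poly[OF ring_homo_id(2)] simp: up_mvar MP_def mcoeffs_in_def\<close>)

lemma up_polys_over:
  assumes K: "subring_set K" and f: "f \<in> MP K W"
  shows "up z f \<in> polys_over (MP K (W - {z}))"
proof -
  note M = subring_MP[OF K, of "W - {z}"]
  show ?thesis unfolding up_def
    by (rule meval_in[OF K f ring_homo_const_poly[OF ring_homo_mconst] subring_polys_over[OF M]])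
      (auto intro!: polys_over_pCons polys_over_0 subring_setD[OF M] MP_mconst MP_mvar K)
qed

lemma coeff_up_in: "subring_set K \<Longrightarrow> f \<in> MP K W \<Longrightarrow> coeff (up z f) k \<in> MP K (W - {z})"
  using up_polys_over[of K f W z] by (auto simp: polys_over_def)

lemma mvars_coeff_up: "mvars (coeff (up z f) k) \<subseteq> mvars f - {z}"
  using coeff_up_in[of UNIV f "mvars f" z k] by (auto simp: MP_def mcoeffs_in_def)

lemma poly_mvar_in:
  assumes K: "subring_set K" and p: "p \<in> polys_over (MP K W)"
  shows "poly p (mvar z) \<in> MP K (insert z W)"
proof (rule poly_in[OF subring_MP[OF K]])
  show "p \<in> polys_over (MP K (insert z W))" using p MP_mono[of K K W "insert z W"] by (auto simp: polys_over_def)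
qed (auto simp: K)

lemma up_poly:
  assumes "p \<in> polys_over (MP UNIV (- {z}))"
  shows "up z (poly p (mvar z)) = p"
proof -
  have "up z (poly p (mvar z)) = (\<Sum>i\<le>degree p. [:coeff p i:] * [:0, 1:] ^ i)"
    unfolding poly_altdef ring_homo_sum[OF ring_homo_up] up_hom up_mvar
    using assms by (intro sum.cong refl) (auto simp: up_not_mvars polys_over_def MP_def)
  also have "\<dots> = (\<Sum>i\<le>degree p. monom (coeff p i) i)"
    by (intro sum.cong refl) (simp add: monom_altdef)
  finally show ?thesis by (simp add: poly_as_sum_of_monoms)
qed

lemma up_eq_0_iff [simp]: "up z f = 0 \<longleftrightarrow> f = 0"
  using poly_up[of z f] up_hom(4)[of z] by (metis poly_0)

definition mdeg :: "'v \<Rightarrow> ('v, 'a::comm_ring_1) mpol \<Rightarrow> nat" where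
  "mdeg z f = degree (up z f)"

lemma mdeg_pos_iff: "mdeg z f > 0 \<longleftrightarrow> z \<in> mvars f"
proof
  assume "mdeg z f > 0"
  then show "z \<in> mvars f" using up_not_mvars[of z f] by (cases "z \<in> mvars f") (auto simp: mdeg_def)
next
  assume z: "z \<in> mvars f"
  show "mdeg z f > 0"
  proof (rule ccontr)
    assume "\<not> mdeg z f > 0"
    then obtain c where c: "up z f = [:c:]" by (auto simp: mdeg_def elim: degree_eq_zeroE)
    then have "f = c" using poly_up[of z f] by simp
    then have "coeff (up z f) 0 = f" using c by simp
    then show False using mvars_coeff_up[of z f 0] z by auto
  qed
qed

lemma up_mpartial: "up z (mpartial z f) = pderiv (up z f)"
  using subring_set_UNIV MP_UNIV[of f]
proof (induction f rule: MP_induct)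
  case (mult f g)
  then show ?case
    by (simp add: derivation_simps[OF derivation_mpartial] up_hom pderiv_mult algebra_simps)
qed (auto simp: derivation_simps[OF derivation_mpartial] up_hom pderiv_add up_mvar mpartial_mvar pderiv_pCons)

lemma meval_up:
  assumes "ring_homo \<iota>"
  shows "meval \<iota> \<xi> f = (\<Sum>k\<le>mdeg z f. meval \<iota> \<xi> (coeff (up z f) k) * \<xi> z ^ k)"
proof -
  have "meval \<iota> \<xi> f = meval \<iota> \<xi> (\<Sum>k\<le>degree (up z f). coeff (up z f) k * mvar z ^ k)"
    using poly_up[of z f] by (simp add: poly_altdef)
  then show ?thesis
    by (simp add: mdeg_def ring_homo_sum[OF ring_homo_meval] ring_homoD[OF ring_homo_meval] assms)
qed

text \<open>In characteristic 0 the leading coefficient in \<open>z\<close> is multiplied by the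
  nonzero degree. The linear order on the indeterminates is there for the integral domain structure
  on polynomials.\<close>

lemma mpartial_nonzero:
  fixes f :: "('v::linorder, 'a::{idom,ring_char_0}) mpol"
  assumes "z \<in> mvars f"
  shows "mpartial z f \<noteq> 0" "mdeg z (mpartial z f) < mdeg z f"
proof -
  let ?n = "mdeg z f"
  have n: "?n > 0" using assms by (simp add: mdeg_pos_iff)
  have "coeff (up z f) ?n \<noteq> 0" using n by (auto simp: mdeg_def up_hom)
  then obtain m where m: "coef (coeff (up z f) ?n) m \<noteq> 0" by (metis lookup_zero poly_mapping_eqI)
  have "coeff (pderiv (up z f)) (?n - 1) = of_nat ?n * coeff (up z f) ?n"
    using n by (simp add: coeff_pderiv)
  also have "coef \<dots> m = of_nat ?n * coef (coeff (up z f) ?n) m"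
  proof -
    have "coef (of_nat k * g) m = of_nat k * coef g m" for k and g :: "('v, 'a) mpol"
      by (induction k) (auto simp: algebra_simps lookup_add)
    then show ?thesis by blast
  qed
  also have "\<dots> \<noteq> 0" using m n by simp
  finally have "pderiv (up z f) \<noteq> 0" by auto
  then show "mpartial z f \<noteq> 0" using up_mpartial[of z f] by (auto simp: up_hom)
  have "degree (pderiv (up z f)) \<le> ?n - 1"
    unfolding mdeg_def by (rule degree_le) (auto simp: coeff_pderiv coeff_eq_0)
  then show "mdeg z (mpartial z f) < mdeg z f" using n by (simp add: mdeg_def up_mpartial)
qed

lemma mpartial_MP:
  assumes K: "subring_set K" and f: "f \<in> MP K W"
  shows "mpartial z f \<in> MP K W"
proof -
  note M = subring_setD[OF subring_MP[OF K]]
  show ?thesis using K f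
    by (induction rule: MP_induct) (auto simp: derivation_simps[OF derivation_mpartial] mpartial_mvar K intro!: M)
qed

lemma mvars_mpartial: "mvars (mpartial z f) \<subseteq> mvars f"
  using mpartial_MP[of UNIV f "mvars f" z] by (auto simp: MP_def mcoeffs_in_def)

lemma mdeg_mult:
  fixes f g :: "('v::linorder, 'a::idom) mpol"
  shows "f \<noteq> 0 \<Longrightarrow> g \<noteq> 0 \<Longrightarrow> mdeg z (f * g) = mdeg z f + mdeg z g"
  by (simp add: mdeg_def up_hom degree_mult_eq)

lemma mvars_mult_eq:
  fixes f g :: "('v::linorder, 'a::idom) mpol"
  shows "f \<noteq> 0 \<Longrightarrow> g \<noteq> 0 \<Longrightarrow> mvars (f * g) = mvars f \<union> mvars g"
  by (auto simp: mdeg_mult simp flip: mdeg_pos_iff)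

subsection \<open>Pseudo-division and greatest common divisors up to a factor\<close>

text \<open>Multiplying by the leading coefficient of \<open>q\<close> instead of dividing by it
  keeps all coefficients in the subring \<open>A\<close>.\<close>

lemma pseudo_division:
  assumes A: "subring_set A" and q: "q \<in> polys_over A" "q \<noteq> 0"
  shows "p \<in> polys_over A \<Longrightarrow> \<exists>k. \<exists>s\<in>polys_over A. \<exists>r\<in>polys_over A.
    smult (lead_coeff q ^ k) p = s * q + r \<and> (r = 0 \<or> degree r < degree q)"
\<comment> \<open>The measure puts the zero polynomial below the nonzero constants, since a step may
  turn a constant into 0.\<close>
proof (induction "if p = 0 then 0 else Suc (degree p)" arbitrary: p rule: less_induct)
  case less
  note P = subring_setD[OF subring_polys_over[OF A]]
  show ?case
  proof (cases "p = 0 \<or> degree p < degree q")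
    case True
    then show ?thesis using less(2) P(1) by (intro exI[of _ 0] bexI[of _ 0] bexI[of _ p]) auto
  next
    case False
    let ?c = "lead_coeff q" and ?m = "monom (lead_coeff p) (degree p - degree q)"
    define p' where "p' = smult ?c p - ?m * q"
    have cA: "?c \<in> A" "lead_coeff p \<in> A" using q(1) less(2) by (auto simp: polys_over_def)
    have m: "?m \<in> polys_over A" using cA subring_setD(1)[OF A] by (intro polys_over_monom)
    have p': "p' \<in> polys_over A" unfolding p'_def using cA m q less(2) A by (intro P polys_over_smult)
    have dm: "degree (?m * q) \<le> degree p"
      using degree_mult_le[of ?m q] degree_monom_le[of "lead_coeff p" "degree p - degree q"] False by linarith
    have top: "coeff p' (degree p) = 0"
      using False coeff_monom_mult[of "lead_coeff p" "degree p - degree q" q "degree p"]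
      by (auto simp: p'_def)
    have "degree p' \<le> degree p" unfolding p'_def using dm by (intro degree_diff_le degree_smult_le)
    then have lt: "p' = 0 \<or> degree p' < degree p" using top
      by (metis leading_coeff_0_iff le_neq_implies_less)
    then have "(if p' = 0 then 0 else Suc (degree p')) < (if p = 0 then 0 else Suc (degree p))"
      using False by auto
    from less(1)[OF this p'] obtain k s r where s: "s \<in> polys_over A" "r \<in> polys_over A"
      "smult (?c ^ k) p' = s * q + r" "r = 0 \<or> degree r < degree q" by blast
    have "smult (?c ^ Suc k) p = (s + smult (?c ^ k) ?m) * q + r"
      using s(3) by (simp add: p'_def algebra_simps smult_diff_right)
    moreover have "s + smult (?c ^ k) ?m \<in> polys_over A"
      using s(1) m by (intro P polys_over_smult A subring_setD(7)[OF A] cA)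
    ultimately show ?thesis using s by blast
  qed
qed

text \<open>\<open>m\<close> is a nonzero element of least degree in the ideal generated by
  \<open>p\<close> and \<open>q\<close>: pseudo-remainders by \<open>m\<close> lie in the ideal and
  have smaller degree, so they vanish. This is a greatest common divisor over the fraction field of
  \<open>A\<close>, with denominators cleared by powers of the leading coefficient.\<close>

lemma poly_bezout:
  fixes p q :: "'r::idom poly"
  assumes A: "subring_set A" and p: "p \<in> polys_over A" and q: "q \<in> polys_over A" "q \<noteq> 0"
  obtains m u w s t k l where "m \<noteq> 0" "m = u * p + w * q" "m \<in> polys_over A" "u \<in> polys_over A" "w \<in> polys_over A"
    "s \<in> polys_over A" "t \<in> polys_over A" "smult (lead_coeff m ^ k) p = s * m" "smult (lead_coeff m ^ l) q = t * m"
proof -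
  note P = subring_setD[OF subring_polys_over[OF A]]
  define J where "J = {u * p + w * q | u w. u \<in> polys_over A \<and> w \<in> polys_over A}"
  have "p = 1 * p + 0 * q" "q = 0 * p + 1 * q" by simp_all
  then have pJ: "p \<in> J" and qJ: "q \<in> J" unfolding J_def using P(1,2) by blast+
  have JA: "J \<subseteq> polys_over A" unfolding J_def using p q by (auto intro!: P)
  have J1: "f - s * g \<in> J" if fg: "f \<in> J" "g \<in> J" and s: "s \<in> polys_over A" for f g s
  proof -
    obtain u w u' w' where "f = u * p + w * q" "g = u' * p + w' * q"
      and m: "u \<in> polys_over A" "w \<in> polys_over A" "u' \<in> polys_over A" "w' \<in> polys_over A"
      using fg unfolding J_def by blast
    then have "f - s * g = (u - s * u') * p + (w - s * w') * q" by (simp add: algebra_simps)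
    moreover have "u - s * u' \<in> polys_over A" "w - s * w' \<in> polys_over A" by (intro P m s)+
    ultimately show ?thesis unfolding J_def by blast
  qed
  have J2: "smult a f \<in> J" if f: "f \<in> J" and a: "a \<in> A" for a f
  proof -
    obtain u w where "f = u * p + w * q" and m: "u \<in> polys_over A" "w \<in> polys_over A"
      using f unfolding J_def by blast
    then have "smult a f = smult a u * p + smult a w * q" by (simp add: smult_add_right)
    moreover have "smult a u \<in> polys_over A" "smult a w \<in> polys_over A" by (intro polys_over_smult A a m)+
    ultimately show ?thesis unfolding J_def by blast
  qed
  obtain m where m: "m \<in> J" "m \<noteq> 0" "\<And>g. g \<in> J \<Longrightarrow> g \<noteq> 0 \<Longrightarrow> degree m \<le> degree g"
    using exists_least_lemma[of "\<lambda>n. \<exists>g\<in>J. g \<noteq> 0 \<and> degree g = n"]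
      ex_has_least_nat[of "\<lambda>g. g \<in> J \<and> g \<noteq> 0" q degree] qJ q(2) by blast
  have mA: "m \<in> polys_over A" using m(1) JA by blast
  have lcA: "lead_coeff m \<in> A" using mA by (simp add: polys_over_def)
  have div: "\<exists>k. \<exists>s\<in>polys_over A. smult (lead_coeff m ^ k) f = s * m" if f: "f \<in> J" for f
  proof -
    obtain k s r where s: "s \<in> polys_over A" "smult (lead_coeff m ^ k) f = s * m + r" "r = 0 \<or> degree r < degree m"
      using pseudo_division[OF A mA m(2), of f] f JA by blast
    have "r = smult (lead_coeff m ^ k) f - s * m" using s(2) by simp
    also have "\<dots> \<in> J" by (intro J1 J2 f m s subring_setD(7)[OF A] lcA)
    finally have "r = 0" using s(3) m(3) by fastforce
    then show ?thesis using s by auto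
  qed
  obtain u w where "m = u * p + w * q" "u \<in> polys_over A" "w \<in> polys_over A" using m(1) unfolding J_def by blast
  then show ?thesis using that div[OF pJ] div[OF qJ] m(2) mA by blast
qed

subsection \<open>Irreducible polynomials are prime\<close>

text \<open>Over a field the units are the nonzero constants, so a trivial factor is one without
  indeterminates. \<open>dpol_irreducible_iff\<close> relates this to
  \<open>dpol_irreducible\<close>.\<close>

definition mirr :: "'u::field set \<Rightarrow> ('v, 'u) mpol \<Rightarrow> bool" where
  "mirr K f \<longleftrightarrow> f \<in> MP K UNIV \<and> mvars f \<noteq> {} \<and>
     (\<forall>g\<in>MP K UNIV. \<forall>h\<in>MP K UNIV. f = g * h \<longrightarrow> mvars g = {} \<or> mvars h = {})"

definition mdvd :: "'u::field set \<Rightarrow> ('v, 'u) mpol \<Rightarrow> ('v, 'u) mpol \<Rightarrow> bool" where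
  "mdvd K g f \<longleftrightarrow> (\<exists>q\<in>MP K UNIV. f = q * g)"

text \<open>The sum of the partial degrees, not the total degree. It is additive on products of
  nonzero polynomials and positive on nonconstant ones, hence a measure for factoring.\<close>

definition tdeg :: "('v, 'u::field) mpol \<Rightarrow> nat" where
  "tdeg f = (\<Sum>v\<in>mvars f. mdeg v f)"

context
  fixes K :: "'u::field set"
  assumes K: "subfield_set K"
begin

lemma KR: "subring_set K"
  by (rule subfield_subring[OF K])

lemma MPR: "subring_set (MP K W)"
  by (rule subring_MP[OF KR])

lemmas MPD = subring_setD[OF MPR]

lemma MP_to_UNIV: "f \<in> MP K W \<Longrightarrow> f \<in> MP K UNIV"
  using MP_mono[of K K W UNIV] by auto

lemma mdvd_quotient_MP:
  fixes f g :: "('v::linorder, 'u) mpol"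
  assumes "mdvd K g f" "f \<in> MP K W" "g \<noteq> 0"
  shows "\<exists>q\<in>MP K W. f = q * g"
proof (cases "f = 0")
  case True
  then show ?thesis using MPD(1)[of W] by (intro bexI[of _ 0]) auto
next
  case False
  obtain q where q: "q \<in> MP K UNIV" "f = q * g" using assms(1) unfolding mdvd_def by blast
  then have "mvars q \<subseteq> mvars f" using False assms(3) by (simp add: mvars_mult_eq)
  then show ?thesis using q assms(2) by (auto simp: MP_def)
qed

lemma tdeg_superset: "finite T \<Longrightarrow> mvars f \<subseteq> T \<Longrightarrow> tdeg f = (\<Sum>v\<in>T. mdeg v f)"
  unfolding tdeg_def by (rule sum.mono_neutral_left) (auto simp flip: mdeg_pos_iff)

lemma tdeg_mult:
  fixes f g :: "('v::linorder, 'u) mpol"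
  assumes "f \<noteq> 0" "g \<noteq> 0"
  shows "tdeg (f * g) = tdeg f + tdeg g"
proof -
  let ?T = "mvars f \<union> mvars g"
  have "finite ?T" "mvars f \<subseteq> ?T" "mvars g \<subseteq> ?T" "mvars (f * g) \<subseteq> ?T" using mvars_mult[of f g] by auto
  then show ?thesis by (simp add: tdeg_superset[of ?T] mdeg_mult[OF assms] sum.distrib)
qed

lemma tdeg_pos: "mvars f \<noteq> {} \<Longrightarrow> tdeg f > 0"
  unfolding tdeg_def by (rule ccontr) (use mdeg_pos_iff in fastforce)

lemma exists_irreducible_factor:
  fixes f :: "('v::linorder, 'u) mpol"
  shows "f \<in> MP K W \<Longrightarrow> mvars f \<noteq> {} \<Longrightarrow> f \<noteq> 0 \<Longrightarrow> \<exists>p\<in>MP K W. \<exists>q\<in>MP K W. mirr K p \<and> f = p * q"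
proof (induction "tdeg f" arbitrary: f rule: less_induct)
  case less
  show ?case
  proof (cases "mirr K f")
    case True
    then show ?thesis using less(2) MPD(2)[of W] by (intro bexI[of _ f] bexI[of _ 1]) auto
  next
    case False
    then obtain g h where gh: "g \<in> MP K UNIV" "h \<in> MP K UNIV" "f = g * h" "mvars g \<noteq> {}" "mvars h \<noteq> {}"
      using less(2,3) MP_to_UNIV unfolding mirr_def by blast
    then have n: "g \<noteq> 0" "h \<noteq> 0" using less(4) by auto
    have W: "g \<in> MP K W" "h \<in> MP K W"
      using gh(1,2) less(2) mvars_mult_eq[OF n] gh(3) by (auto simp: MP_def)
    have "tdeg g < tdeg f" using tdeg_mult[OF n] gh(3) tdeg_pos[OF gh(5)] by simp
    then obtain p q where "p \<in> MP K W" "q \<in> MP K W" "mirr K p" "g = p * q"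
      using less(1)[of g] W(1) gh(4) n by blast
    then show ?thesis using gh(3) W(2) by (intro bexI[of _ p] bexI[of _ "q * h"]) (auto intro!: MPD)
  qed
qed

lemma const_inverse:
  fixes a :: "('v, 'u) mpol"
  assumes "a \<in> MP K W" "mvars a = {}" "a \<noteq> 0"
  obtains b where "b \<in> MP K {}" "b * a = 1" "mvars b = {}"
proof -
  obtain c where c: "a = mconst c" using assms(2) mvars_empty_iff by blast
  have "coef (mconst c :: ('v, 'u) mpol) 0 = c" by (simp add: mconst_def)
  then have "c \<in> K" using assms(1) c by (auto simp: MP_iff[OF KR]) metis
  moreover have "c \<noteq> 0" using assms(3) c by auto
  ultimately show ?thesis
    using that[of "mconst (inverse c)"] K c ring_homoD(3)[OF ring_homo_mconst, of "inverse c" c]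
    by (auto simp: subfield_set_def intro!: MP_mconst KR)
qed

text \<open>Only factors in the indeterminates in \<open>S\<close> are tested, which permits
  induction on \<open>S\<close>.\<close>

definition mprime_in :: "'v set \<Rightarrow> ('v, 'u) mpol \<Rightarrow> bool" where
  "mprime_in S p \<longleftrightarrow> (\<forall>f\<in>MP K S. \<forall>g\<in>MP K S. mdvd K p (f * g) \<longrightarrow> mdvd K p f \<or> mdvd K p g)"

lemma mdvd_add: "mdvd K p f \<Longrightarrow> mdvd K p g \<Longrightarrow> mdvd K p (f + g)"
  unfolding mdvd_def by (metis MPD(3) distrib_right)

lemma mdvd_diff: "mdvd K p f \<Longrightarrow> mdvd K p g \<Longrightarrow> mdvd K p (f - g)"
  unfolding mdvd_def by (metis MPD(4) left_diff_distrib)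

lemma mdvd_0: "mdvd K p 0"
  unfolding mdvd_def using MPD(1) by (intro bexI[of _ 0]) auto

lemma mdvd_sum: "(\<And>x. x \<in> A \<Longrightarrow> mdvd K p (f x)) \<Longrightarrow> mdvd K p (sum f A)"
  by (induction A rule: infinite_finite_induct) (auto intro: mdvd_add mdvd_0)

lemma mdvd_mult: "mdvd K p f \<Longrightarrow> g \<in> MP K UNIV \<Longrightarrow> mdvd K p (g * f)"
  unfolding mdvd_def by (metis MPD(5) mult.assoc)

lemma mdvd_coeffs:
  assumes p: "p \<in> MP K UNIV" "z \<notin> mvars p"
  shows "mdvd K p f \<longleftrightarrow> (\<forall>k. mdvd K p (coeff (up z f) k))"
proof
  assume "mdvd K p f"
  then obtain q where q: "q \<in> MP K UNIV" "f = q * p" unfolding mdvd_def by blast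
  have "coeff (up z f) k = coeff (up z q) k * p" for k
    using q(2) p by (simp add: up_hom up_not_mvars mult.commute)
  then show "\<forall>k. mdvd K p (coeff (up z f) k)"
    unfolding mdvd_def using coeff_up_in[OF KR q(1)] MP_to_UNIV by blast
next
  assume *: "\<forall>k. mdvd K p (coeff (up z f) k)"
  have "f = (\<Sum>k\<le>degree (up z f). mvar z ^ k * coeff (up z f) k)"
    using poly_up[of z f] by (simp add: poly_altdef mult.commute)
  also have "mdvd K p \<dots>"
    using * by (intro mdvd_sum mdvd_mult) (auto intro!: MPD MP_mvar KR)
  finally show "mdvd K p f" .
qed

text \<open>If \<open>p\<close> divides neither \<open>f\<close> nor \<open>g\<close>, take the lowest coefficients of \<open>f\<close> and \<open>g\<close> not divisible by \<open>p\<close>.\<close>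

lemma mprime_in_insert:
  assumes p: "p \<in> MP K S" and z: "z \<notin> S" and prime: "mprime_in S p"
  shows "mprime_in (insert z S) p"
  unfolding mprime_in_def
proof (intro ballI impI, rule ccontr)
  fix f g assume fg: "f \<in> MP K (insert z S)" "g \<in> MP K (insert z S)" "mdvd K p (f * g)"
    and n: "\<not> (mdvd K p f \<or> mdvd K p g)"
  have p': "p \<in> MP K UNIV" "z \<notin> mvars p" using p z MP_to_UNIV by (auto simp: MP_def)
  let ?f = "coeff (up z f)" and ?g = "coeff (up z g)"
  have in_S: "?f k \<in> MP K S" "?g k \<in> MP K S" for k
    using coeff_up_in[OF KR fg(1), of z k] coeff_up_in[OF KR fg(2), of z k] z by auto
  obtain i where i: "\<not> mdvd K p (?f i)" "\<forall>k<i. mdvd K p (?f k)"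
    using n mdvd_coeffs[OF p'] exists_least_iff[of "\<lambda>k. \<not> mdvd K p (?f k)"] by blast
  obtain j where j: "\<not> mdvd K p (?g j)" "\<forall>k<j. mdvd K p (?g k)"
    using n mdvd_coeffs[OF p'] exists_least_iff[of "\<lambda>k. \<not> mdvd K p (?g k)"] by blast
  have "mdvd K p (coeff (up z (f * g)) (i + j))" using fg(3) mdvd_coeffs[OF p'] by blast
  then have "mdvd K p (\<Sum>k\<le>i + j. ?f k * ?g (i + j - k))" by (simp add: up_hom coeff_mult)
  also have "(\<Sum>k\<le>i + j. ?f k * ?g (i + j - k)) = ?f i * ?g j + (\<Sum>k\<in>{..i + j} - {i}. ?f k * ?g (i + j - k))"
    by (subst sum.remove[of _ i]) auto
  finally have 1: "mdvd K p (?f i * ?g j + (\<Sum>k\<in>{..i + j} - {i}. ?f k * ?g (i + j - k)))" .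
  have "mdvd K p (\<Sum>k\<in>{..i + j} - {i}. ?f k * ?g (i + j - k))"
  proof (rule mdvd_sum)
    fix k assume k: "k \<in> {..i + j} - {i}"
    show "mdvd K p (?f k * ?g (i + j - k))"
    proof (cases "k < i")
      case True
      then show ?thesis using i(2) mdvd_mult[OF _ MP_to_UNIV[OF in_S(2)], of p "?f k" "i + j - k"] by (simp add: mult.commute)
    next
      case False
      then have "i + j - k < j" using k by auto
      then show ?thesis using j(2) mdvd_mult[OF _ MP_to_UNIV[OF in_S(1)], of p "?g (i + j - k)" k] by simp
    qed
  qed
  from mdvd_diff[OF 1 this] have "mdvd K p (?f i * ?g j)" by simp
  then show False using prime in_S i(1) j(1) unfolding mprime_in_def by blast
qed

text \<open>Gauss's lemma in divisor form: each irreducible factor of \<open>a\<close> is prime,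
  hence divides \<open>s\<close> or \<open>m\<close> and can be cancelled there. \<open>a1\<close>
  and \<open>a2\<close> collect the factors taken from \<open>s\<close> and from
  \<open>m\<close>.\<close>

lemma cancel_primes:
  fixes a P s m :: "('v::linorder, 'u) mpol"
  assumes prime: "\<And>p. p \<in> MP K S \<Longrightarrow> mirr K p \<Longrightarrow> mprime_in T p" and ST: "S \<subseteq> T"
  shows "a \<in> MP K S \<Longrightarrow> a \<noteq> 0 \<Longrightarrow> s \<in> MP K T \<Longrightarrow> m \<in> MP K T \<Longrightarrow> P \<in> MP K T \<Longrightarrow> a * P = s * m \<Longrightarrow>
    \<exists>a1\<in>MP K S. \<exists>a2\<in>MP K S. \<exists>s0\<in>MP K T. \<exists>m0\<in>MP K T. s = a1 * s0 \<and> m = a2 * m0 \<and> P = s0 * m0"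
proof (induction "tdeg a" arbitrary: a s m rule: less_induct)
  case less
  have n: "a \<noteq> 0" by fact
  show ?case
  proof (cases "mvars a = {}")
    case True
    obtain b where b: "b \<in> MP K {}" "b * a = 1" using const_inverse[OF less(2) True n] by blast
    have bT: "b \<in> MP K T" using MP_mono[of K K "{}" T] b by auto
    have "P = (b * a) * P" using b(2) by simp
    also have "\<dots> = b * (a * P)" by (rule mult.assoc)
    also have "\<dots> = s * (b * m)" unfolding less(7) by (rule mult.left_commute)
    finally have "P = s * (b * m)" .
    moreover have "(b * a) * m = a * (b * m)" by (simp only: ac_simps)
    then have "m = a * (b * m)" using b(2) by simp
    moreover have "s = 1 * s" by simp
    ultimately show ?thesis using MPD(5)[OF bT less(5)] less(2,4) MPD(2)[of S] by blast
  next
    case False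
    obtain p q where pq: "p \<in> MP K S" "q \<in> MP K S" "mirr K p" "a = p * q"
      using exists_irreducible_factor[OF less(2) False n] by blast
    have nz: "p \<noteq> 0" "q \<noteq> 0" using n pq(4) by auto
    have "mvars p \<noteq> {}" using pq(3) by (simp add: mirr_def)
    then have lt: "tdeg q < tdeg a" using tdeg_mult[OF nz] pq(4) tdeg_pos[of p] by simp
    have "s * m = (q * P) * p" using less(7) pq(4) by (simp add: algebra_simps)
    moreover have "q * P \<in> MP K UNIV" using pq(2) less(6) MP_to_UNIV by (intro MPD) auto
    ultimately have "mdvd K p (s * m)" unfolding mdvd_def by blast
    then consider "mdvd K p s" | "mdvd K p m"
      using prime[OF pq(1,3)] less(4,5) unfolding mprime_in_def by blast
    then show ?thesis
    proof cases
      case 1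
      then obtain s' where s': "s' \<in> MP K T" "s = s' * p" using mdvd_quotient_MP less(4) nz(1) by blast
      have "p * (q * P) = p * (s' * m)" using less(7) pq(4) s'(2) by (simp add: algebra_simps)
      then have "q * P = s' * m" using nz(1) by simp
      from less(1)[OF lt pq(2) nz(2) s'(1) less(5,6) this] obtain a1 a2 s0 m0 where
        h: "a1 \<in> MP K S" "a2 \<in> MP K S" "s0 \<in> MP K T" "m0 \<in> MP K T" "s' = a1 * s0" "m = a2 * m0" "P = s0 * m0" by blast
      have "s = (p * a1) * s0" using s'(2) h(5) by (simp add: algebra_simps)
      then show ?thesis using h MPD(5)[OF pq(1) h(1)] by blast
    next
      case 2
      then obtain m' where m': "m' \<in> MP K T" "m = m' * p" using mdvd_quotient_MP less(5) nz(1) by blast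
      have "p * (q * P) = p * (s * m')" using less(7) pq(4) m'(2) by (simp add: algebra_simps)
      then have "q * P = s * m'" using nz(1) by simp
      from less(1)[OF lt pq(2) nz(2) less(4) m'(1) less(6) this] obtain a1 a2 s0 m0 where
        h: "a1 \<in> MP K S" "a2 \<in> MP K S" "s0 \<in> MP K T" "m0 \<in> MP K T" "s = a1 * s0" "m' = a2 * m0" "P = s0 * m0" by blast
      have "m = (p * a2) * m0" using m'(2) h(6) by (simp add: algebra_simps)
      then show ?thesis using h MPD(5)[OF pq(1) h(2)] by blast
    qed
  qed
qed

text \<open>Apply \<open>poly_bezout\<close> to \<open>f\<close> and \<open>R\<close> in
  \<open>z\<close>. A result \<open>m\<close> free of \<open>z\<close> is the second alternative.
  Otherwise \<open>R\<close> divides \<open>m\<close>, and a power of the leading coefficient of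
  \<open>m\<close> times \<open>f\<close> is a multiple of \<open>R\<close>; factors free of
  \<open>z\<close> can be cancelled because \<open>R\<close> is irreducible and contains
  \<open>z\<close>.\<close>

lemma irreducible_divides_or_bezout_step:
  fixes R f :: "('v::linorder, 'u) mpol"
  assumes prime: "\<And>p. p \<in> MP K S \<Longrightarrow> mirr K p \<Longrightarrow> mprime_in (insert z S) p" and z: "z \<notin> S"
    and R: "R \<in> MP K (insert z S)" "mirr K R" "z \<in> mvars R" and f: "f \<in> MP K (insert z S)"
  shows "mdvd K R f \<or> (\<exists>u\<in>MP K (insert z S). \<exists>w\<in>MP K (insert z S). \<exists>m\<in>MP K S. m \<noteq> 0 \<and> u * f + w * R = m)"
proof -
  let ?T = "insert z S"
  have Rn: "R \<noteq> 0" using R(3) mvars_mconst[of 0] by auto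
  have dS: "insert z S - {z} = S" using z by auto
  have uS: "up z g \<in> polys_over (MP K S)" if "g \<in> MP K ?T" for g
    using up_polys_over[OF KR that, of z] dS by simp
  obtain m u w s t k l where b: "m \<noteq> 0" "m = u * up z f + w * up z R" "m \<in> polys_over (MP K S)"
    "u \<in> polys_over (MP K S)" "w \<in> polys_over (MP K S)"
    "s \<in> polys_over (MP K S)" "t \<in> polys_over (MP K S)" "smult (lead_coeff m ^ k) (up z f) = s * m"
    "smult (lead_coeff m ^ l) (up z R) = t * m"
    by (rule poly_bezout[OF MPR uS[OF f] uS[OF R(1)]]) (use Rn in auto)
  define e where "e p = poly p (mvar z)" for p :: "('v, 'u) mpol poly"
  have eT: "e p \<in> MP K ?T" if "p \<in> polys_over (MP K S)" for p
    unfolding e_def by (rule poly_mvar_in[OF KR that])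
  have up_e: "up z (e p) = p" if "p \<in> polys_over (MP K S)" for p
    unfolding e_def
    by (rule up_poly) (use that z in \<open>auto simp: polys_over_def MP_def mcoeffs_in_def\<close>)
  define a where "a = lead_coeff m"
  have a: "a \<in> MP K S" "a \<noteq> 0" using b(1,3) by (auto simp: a_def polys_over_def)
  have em: "e m = e u * f + e w * R" using b(2) by (simp add: e_def poly_up)
  have ef: "a ^ k * f = e s * e m" using arg_cong[OF b(8), of e] by (simp add: e_def poly_up a_def)
  have eR: "a ^ l * R = e t * e m" using arg_cong[OF b(9), of e] by (simp add: e_def poly_up a_def)
  have ak: "a ^ k \<in> MP K S" "a ^ k \<noteq> 0" "a ^ l \<in> MP K S" "a ^ l \<noteq> 0" for k l using a by (auto intro: MPD)
  have cz: "z \<notin> mvars g" if "g \<in> MP K S" for g using that z by (auto simp: MP_def)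
  have unit: "c \<in> MP K S \<Longrightarrow> h \<in> MP K ?T \<Longrightarrow> R = c * h \<Longrightarrow> \<exists>b\<in>MP K UNIV. h = b * R" for c h
  proof -
    assume c: "c \<in> MP K S" "h \<in> MP K ?T" "R = c * h"
    have "z \<in> mvars h" using c(3) R(3) mvars_mult[of c h] cz[OF c(1)] by auto
    then have "mvars c = {}" using R(2) c MP_to_UNIV unfolding mirr_def by blast
    moreover have "c \<noteq> 0" using c(3) Rn by auto
    ultimately obtain b where "b \<in> MP K {}" "b * c = 1" using const_inverse c(1) by metis
    then show ?thesis using c(3) MP_to_UNIV[of b] by (metis mult.assoc mult_1)
  qed
  show ?thesis
  proof (cases "degree m = 0")
    case True
    then obtain c where c: "m = [:c:]" by (auto elim: degree_eq_zeroE)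
    have "c \<in> MP K S" "c \<noteq> 0" using b(1,3) c by (auto simp: polys_over_def dest: spec[of _ 0])
    moreover have "e u * f + e w * R = c" using em c by (simp add: e_def)
    ultimately show ?thesis using eT[OF b(4)] eT[OF b(5)] by blast
  next
    case False
    from cancel_primes[OF prime _ ak(3,4) eT[OF b(7)] eT[OF b(3)] R(1) eR]
    obtain a1 a2 t0 m0 where h: "a1 \<in> MP K S" "a2 \<in> MP K S" "t0 \<in> MP K ?T" "m0 \<in> MP K ?T"
      "e m = a2 * m0" "R = t0 * m0" by blast
    \<comment> \<open>\<open>z\<close> occurs in \<open>m0\<close>, so the cofactor
      \<open>t0\<close> of \<open>m0\<close> in the irreducible \<open>R\<close> is a constant and
      \<open>R\<close> divides \<open>e m\<close>.\<close>
    have "z \<in> mvars (e m)" using False up_e[OF b(3)] mdeg_pos_iff[of z "e m"] by (simp add: mdeg_def)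
    then have "z \<in> mvars m0" using h(5) mvars_mult[of a2 m0] cz[OF h(2)] by auto
    then have t0: "mvars t0 = {}" using R(2) h MP_to_UNIV unfolding mirr_def by blast
    have "t0 \<noteq> 0" using h(6) Rn by auto
    then obtain b0 where b0: "b0 \<in> MP K {}" "b0 * t0 = 1" using const_inverse[OF h(3) t0] by blast
    have m0: "m0 = b0 * R" using b0(2) h(6) by (metis mult.assoc mult_1)
    have "a ^ k * f = (e s * a2 * b0) * R" using ef h(5) m0 by (simp add: algebra_simps)
    moreover have "e s * a2 * b0 \<in> MP K ?T"
      using eT[OF b(6)] h(2) b0(1) MP_mono[of K K S ?T] MP_mono[of K K "{}" ?T] by (intro MPD) auto
    ultimately obtain c1 c2 f0 R0 where g: "c1 \<in> MP K S" "c2 \<in> MP K S" "f0 \<in> MP K ?T" "R0 \<in> MP K ?T"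
      "R = c2 * R0" "f = f0 * R0"
      using cancel_primes[OF prime _ ak(1,2) _ R(1) f] by blast
    obtain b1 where "b1 \<in> MP K UNIV" "R0 = b1 * R" using unit[OF g(2,4,5)] by blast
    then have "f = (f0 * b1) * R" "f0 * b1 \<in> MP K UNIV"
      using g(3,6) MP_to_UNIV by (auto simp: algebra_simps intro!: MPD)
    then show ?thesis unfolding mdvd_def by blast
  qed
qed

text \<open>Induction on the indeterminates. If \<open>p\<close> involves the new \<open>z\<close>
  and does not divide \<open>f\<close>, then \<open>u * f + w * p = m\<close> with \<open>m\<close>
  free of \<open>z\<close>; multiplying by \<open>g\<close> shows that \<open>p\<close> divides
  \<open>m * g\<close>, and \<open>m\<close> is cancelled by \<open>cancel_primes\<close>.\<close>

theorem irreducible_imp_prime: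
  fixes p :: "('v::linorder, 'u) mpol"
  assumes "finite S"
  shows "p \<in> MP K S \<Longrightarrow> mirr K p \<Longrightarrow> mprime_in S p"
  using assms
proof (induction S arbitrary: p rule: finite_induct)
  case empty
  then show ?case by (auto simp: mirr_def MP_def)
next
  case (insert z S)
  have lift: "mprime_in (insert z S) q" if "q \<in> MP K S" "mirr K q" for q
    by (rule mprime_in_insert[OF that(1) insert.hyps(2) insert.IH[OF that]])
  show ?case
  proof (cases "z \<in> mvars p")
    case False
    then have "p \<in> MP K S" using insert(4) by (auto simp: MP_def)
    then show ?thesis using lift insert(5) by blast
  next
    case True
    show ?thesis unfolding mprime_in_def
    proof (intro ballI impI)
      fix f g assume f: "f \<in> MP K (insert z S)" and g: "g \<in> MP K (insert z S)" and d: "mdvd K p (f * g)"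
      have pn: "p \<noteq> 0" using True mvars_mconst[of 0] by auto
      show "mdvd K p f \<or> mdvd K p g"
      proof (cases "mdvd K p f")
        case nf: False
        then obtain u w m where h: "u \<in> MP K (insert z S)" "w \<in> MP K (insert z S)" "m \<in> MP K S" "m \<noteq> 0" "u * f + w * p = m"
          using irreducible_divides_or_bezout_step[OF lift insert(2) insert(4,5) True f] by blast
        obtain q where q: "q \<in> MP K (insert z S)" "f * g = q * p"
          using mdvd_quotient_MP[OF d _ pn] f g MPD(5) by blast
        have "m * g = (u * q + w * g) * p" using q(2) h(5) by (auto simp: algebra_simps)
        moreover have "u * q + w * g \<in> MP K (insert z S)" by (intro MPD h q g)
        ultimately obtain a1 a2 g0 p0 where k: "a1 \<in> MP K S" "a2 \<in> MP K S" "g0 \<in> MP K (insert z S)" "p0 \<in> MP K (insert z S)"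
          "p = a2 * p0" "g = g0 * p0"
          using cancel_primes[OF lift _ h(3,4) _ insert(4) g] by blast
        have "z \<notin> mvars a2" using k(2) insert(2) by (auto simp: MP_def)
        then have "z \<in> mvars p0" using k(5) True mvars_mult[of a2 p0] by auto
        then have a2: "mvars a2 = {}" using insert(5) k MP_to_UNIV unfolding mirr_def by blast
        have "a2 \<noteq> 0" using k(5) pn by auto
        then obtain b where b: "b \<in> MP K {}" "b * a2 = 1" using const_inverse[OF k(2) a2] by blast
        have "p0 = b * p" using b(2) k(5) by (metis mult.assoc mult_1)
        then have "g = (g0 * b) * p" "g0 * b \<in> MP K UNIV"
          using k(3,6) b(1) MP_to_UNIV by (auto simp: algebra_simps intro!: MPD)
        then show ?thesis unfolding mdvd_def by blast
      qed auto
    qed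
  qed
qed

theorem irreducible_divides_or_bezout:
  fixes R f :: "('v::linorder, 'u) mpol"
  assumes R: "R \<in> MP K W" "mirr K R" "z \<in> mvars R" and f: "f \<in> MP K W"
  shows "(\<exists>q\<in>MP K W. f = q * R) \<or> (\<exists>u\<in>MP K W. \<exists>w\<in>MP K W. \<exists>m\<in>MP K (W - {z}). m \<noteq> 0 \<and> u * f + w * R = m)"
proof -
  define S where "S = mvars R \<union> mvars f - {z}"
  have S: "finite S" "z \<notin> S" "insert z S = mvars R \<union> mvars f" using R(3) by (auto simp: S_def)
  have SW: "MP K (insert z S) \<subseteq> MP K W" "MP K S \<subseteq> MP K (W - {z})"
    using R f by (auto intro!: MP_mono simp: S S_def MP_def)
  have "R \<in> MP K (insert z S)" "f \<in> MP K (insert z S)" using R f S by (auto simp: MP_def)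
  moreover have "mprime_in (insert z S) p" if "p \<in> MP K S" "mirr K p" for p
    using mprime_in_insert[OF that(1) S(2) irreducible_imp_prime[OF S(1) that]] .
  moreover have "R \<noteq> 0" using R(3) mvars_mconst[of 0] by auto
  ultimately show ?thesis
    using irreducible_divides_or_bezout_step[of S z R f] S(2) R SW mdvd_quotient_MP[of R f W] f by blast
qed

text \<open>If \<open>R\<close> did not divide \<open>f\<close>, some nonzero \<open>m\<close> free
  of \<open>z\<close> would lie in the ideal of \<open>R\<close> and \<open>f\<close> and vanish at
  \<open>\<xi>\<close> with them.\<close>

corollary irreducible_divides_if_vanishes:
  fixes R f :: "('v::linorder, 'u) mpol"
  assumes R: "R \<in> MP K W" "mirr K R" "z \<in> mvars R" and f: "f \<in> MP K W"
    and zero: "meval id \<xi> R = 0" "meval id \<xi> f = 0"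
    and indep: "\<And>m. m \<in> MP K (W - {z}) \<Longrightarrow> meval id \<xi> m = 0 \<Longrightarrow> m = 0"
  shows "\<exists>q\<in>MP K W. f = q * R"
proof -
  have "m = 0" if "m \<in> MP K (W - {z})" "u * f + w * R = m" for u w m
    using indep[OF that(1)] zero arg_cong[OF that(2), of "meval id \<xi>"] by (simp add: meval_add meval_mult)
  then show ?thesis using irreducible_divides_or_bezout[OF R f] by blast
qed

lemma dpol_unit_iff:
  assumes "f \<in> dpols K n"
  shows "dpol_unit K n f \<longleftrightarrow> f \<noteq> 0 \<and> mvars f = {}"
proof
  assume "dpol_unit K n f"
  then obtain g where g: "f * g = 1" unfolding dpol_unit_def by blast
  then have "f \<noteq> 0" "g \<noteq> 0" by auto
  then have "mvars f \<subseteq> mvars (f * g)" by (simp add: mvars_mult_eq)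
  then show "f \<noteq> 0 \<and> mvars f = {}" using g mvars_mconst[of "1::'u"] \<open>f \<noteq> 0\<close> by auto
next
  assume *: "f \<noteq> 0 \<and> mvars f = {}"
  obtain b where "b \<in> MP K {}" "b * f = 1" using const_inverse[of f] assms * by (metis dpols_eq_MP)
  then show "dpol_unit K n f"
    using assms MP_mono[of K K "{}" "{..n} \<times> UNIV"] by (auto simp: dpol_unit_def dpols_eq_MP mult.commute)
qed

lemma dpol_irreducible_iff: "dpol_irreducible K n R \<longleftrightarrow> R \<in> dpols K n \<and> mirr K R"
proof (cases "R \<in> dpols K n \<and> R \<noteq> 0")
  case True
  have sub: "g \<in> dpols K n" "h \<in> dpols K n" "dpol_unit K n g \<longleftrightarrow> mvars g = {}" "dpol_unit K n h \<longleftrightarrow> mvars h = {}"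
    if "g \<in> MP K UNIV" "h \<in> MP K UNIV" "R = g * h" for g h
  proof -
    have n: "g \<noteq> 0" "h \<noteq> 0" using that(3) True by auto
    show g: "g \<in> dpols K n" and h: "h \<in> dpols K n"
      using that True mvars_mult_eq[OF n] by (auto simp: dpols_eq_MP MP_def)
    show "dpol_unit K n g \<longleftrightarrow> mvars g = {}" "dpol_unit K n h \<longleftrightarrow> mvars h = {}"
      using dpol_unit_iff[OF g] dpol_unit_iff[OF h] n by auto
  qed
  have dU: "f \<in> MP K UNIV" if "f \<in> dpols K n" for f using that MP_to_UNIV by (auto simp: dpols_eq_MP)
  have "(\<forall>f\<in>dpols K n. \<forall>g\<in>dpols K n. R = f * g \<longrightarrow> dpol_unit K n f \<or> dpol_unit K n g) \<longleftrightarrow>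
    (\<forall>f\<in>MP K UNIV. \<forall>g\<in>MP K UNIV. R = f * g \<longrightarrow> mvars f = {} \<or> mvars g = {})"
  proof (intro iffI ballI impI)
    fix f g assume *: "\<forall>f\<in>dpols K n. \<forall>g\<in>dpols K n. R = f * g \<longrightarrow> dpol_unit K n f \<or> dpol_unit K n g"
      and fg: "f \<in> MP K UNIV" "g \<in> MP K UNIV" "R = f * g"
    show "mvars f = {} \<or> mvars g = {}" using sub[OF fg] * fg(3) by auto
  next
    fix f g assume *: "\<forall>f\<in>MP K UNIV. \<forall>g\<in>MP K UNIV. R = f * g \<longrightarrow> mvars f = {} \<or> mvars g = {}"
      and fg: "f \<in> dpols K n" "g \<in> dpols K n" "R = f * g"
    show "dpol_unit K n f \<or> dpol_unit K n g" using sub(3,4)[OF dU dU fg(3)] fg dU * by auto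
  qed
  then show ?thesis
    unfolding dpol_irreducible_def mirr_def using True dpol_unit_iff[of R n] dU by auto
next
  case False
  then show ?thesis by (auto simp: dpol_irreducible_def mirr_def)
qed

end

section \<open>Algebraic dependence\<close>

subsection \<open>Algebraic elements over a subfield\<close>

lemma subfieldD:
  assumes "subfield_set F"
  shows "0 \<in> F" "1 \<in> F" "x \<in> F \<Longrightarrow> y \<in> F \<Longrightarrow> x + y \<in> F" "x \<in> F \<Longrightarrow> y \<in> F \<Longrightarrow> x - y \<in> F"
    "x \<in> F \<Longrightarrow> y \<in> F \<Longrightarrow> x * y \<in> F" "x \<in> F \<Longrightarrow> inverse x \<in> F" "x \<in> F \<Longrightarrow> - x \<in> F" "x \<in> F \<Longrightarrow> y \<in> F \<Longrightarrow> x / y \<in> F"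
    "x \<in> F \<Longrightarrow> x ^ k \<in> F"
  using assms subring_setD[OF subfield_subring[OF assms]] by (auto simp: subfield_set_def divide_inverse)

lemma subfield_field_gen: "subfield_set (field_gen K S)"
  unfolding field_gen_def subfield_set_def by auto

lemma field_gen_superset: "K \<union> S \<subseteq> field_gen K S"
  unfolding field_gen_def by auto

lemma field_gen_least: "subfield_set L \<Longrightarrow> K \<subseteq> L \<Longrightarrow> S \<subseteq> L \<Longrightarrow> field_gen K S \<subseteq> L"
  unfolding field_gen_def by auto

lemma field_gen_mono: "S \<subseteq> T \<Longrightarrow> field_gen K S \<subseteq> field_gen K T"
  by (rule field_gen_least[OF subfield_field_gen]) (use field_gen_superset[of K T] in auto)

text \<open>Gaussian elimination for a homogeneous system with more unknowns \<open>c i\<close> than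
  equations \<open>j\<close>.\<close>

lemma linear_dependence:
  fixes A :: "'i \<Rightarrow> 'j \<Rightarrow> 'u::field"
  assumes F: "subfield_set F"
  shows "finite J \<Longrightarrow> finite I \<Longrightarrow> card J < card I \<Longrightarrow> (\<And>i j. i \<in> I \<Longrightarrow> j \<in> J \<Longrightarrow> A i j \<in> F) \<Longrightarrow>
    \<exists>c. (\<forall>i\<in>I. c i \<in> F) \<and> (\<exists>i\<in>I. c i \<noteq> 0) \<and> (\<forall>j\<in>J. (\<Sum>i\<in>I. c i * A i j) = 0)"
proof (induction J arbitrary: I A rule: finite_induct)
  case empty
  then have "I \<noteq> {}" by auto
  then show ?case using subfieldD(2)[OF F] by (intro exI[of _ "\<lambda>_. 1"]) auto
next
  case (insert j0 J)
  note D = subfieldD[OF F] and S = subfield_subring[OF F]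
  show ?case
  proof (cases "\<forall>i\<in>I. A i j0 = 0")
    case True
    have "card J < card I" using insert by simp
    then obtain c where "\<forall>i\<in>I. c i \<in> F" "\<exists>i\<in>I. c i \<noteq> 0" "\<forall>j\<in>J. (\<Sum>i\<in>I. c i * A i j) = 0"
      using insert.IH[of I A] insert.prems by auto
    then show ?thesis using True by (intro exI[of _ c]) auto
  next
    case False
    then obtain p where p: "p \<in> I" "A p j0 \<noteq> 0" by blast
    define I' where "I' = I - {p}"
    define B where "B i j = A i j - A i j0 / A p j0 * A p j" for i j
    have I': "finite I'" "card J < card I'" "I = insert p I'" "p \<notin> I'" using insert p by (auto simp: I'_def)
    have "B i j \<in> F" if "i \<in> I'" "j \<in> J" for i j
      unfolding B_def using that insert.prems(3) p I'(3) by (intro D) auto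
    then obtain c where c: "\<forall>i\<in>I'. c i \<in> F" "\<exists>i\<in>I'. c i \<noteq> 0" "\<forall>j\<in>J. (\<Sum>i\<in>I'. c i * B i j) = 0"
      using insert.IH[OF I'(1,2), of B] by blast
    \<comment> \<open>The value at the pivot \<open>p\<close> is chosen to satisfy equation
      \<open>j0\<close>; by the definition of \<open>B\<close> the other equations then reduce to
      those solved by \<open>c\<close>.\<close>
    define e where "e = c(p := - (\<Sum>i\<in>I'. c i * (A i j0 / A p j0)))"
    have eq: "(\<Sum>i\<in>I. e i * A i j) = (\<Sum>i\<in>I'. c i * B i j)" for j
    proof -
      have "(\<Sum>i\<in>I'. e i * A i j) = (\<Sum>i\<in>I'. c i * A i j)" using I'(4) by (intro sum.cong) (auto simp: e_def)
      then show ?thesis using I' by (simp add: e_def B_def algebra_simps sum_subtractf sum_distrib_left)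
    qed
    have "e i \<in> F" if "i \<in> I" for i
      using that c(1) insert.prems(3) p I'(3) unfolding e_def
      by (auto intro!: D subring_set_sum[OF S])
    moreover have "\<exists>i\<in>I. e i \<noteq> 0" using c(2) I'(3,4) by (auto simp: e_def)
    moreover have "(\<Sum>i\<in>I. e i * A i j) = 0" if "j \<in> insert j0 J" for j
      using that c(3) p(2) unfolding eq by (auto simp: B_def)
    ultimately show ?thesis by blast
  qed
qed

text \<open>For infinite \<open>B\<close> the sums are 0 by convention, so the statements that place
  \<open>B\<close> inside its span assume it finite.\<close>

definition fspan :: "'u::field set \<Rightarrow> 'u set \<Rightarrow> 'u set" where
  "fspan F B = {\<Sum>b\<in>B. a b * b | a. \<forall>b\<in>B. a b \<in> F}"

lemma fspan_closed:
  assumes F: "subfield_set F"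
  shows "0 \<in> fspan F B" "x \<in> fspan F B \<Longrightarrow> y \<in> fspan F B \<Longrightarrow> x + y \<in> fspan F B"
    "x \<in> fspan F B \<Longrightarrow> c \<in> F \<Longrightarrow> c * x \<in> fspan F B" "finite B \<Longrightarrow> b \<in> B \<Longrightarrow> b \<in> fspan F B"
proof -
  note D = subfieldD[OF F]
  show "0 \<in> fspan F B" unfolding fspan_def using D(1) by (auto intro!: exI[of _ "\<lambda>_. 0"])
  show "x \<in> fspan F B \<Longrightarrow> y \<in> fspan F B \<Longrightarrow> x + y \<in> fspan F B"
  proof -
    assume "x \<in> fspan F B" "y \<in> fspan F B"
    then obtain a a' where "x = (\<Sum>b\<in>B. a b * b)" "y = (\<Sum>b\<in>B. a' b * b)" "\<forall>b\<in>B. a b \<in> F" "\<forall>b\<in>B. a' b \<in> F"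
      unfolding fspan_def by blast
    then show ?thesis unfolding fspan_def using D(3)
      by (auto intro!: exI[of _ "\<lambda>b. a b + a' b"] simp: algebra_simps sum.distrib)
  qed
  show "x \<in> fspan F B \<Longrightarrow> c \<in> F \<Longrightarrow> c * x \<in> fspan F B"
  proof -
    assume "x \<in> fspan F B" and c: "c \<in> F"
    then obtain a where "x = (\<Sum>b\<in>B. a b * b)" "\<forall>b\<in>B. a b \<in> F"
      unfolding fspan_def by blast
    then show ?thesis unfolding fspan_def using D(5) c
      by (auto intro!: exI[of _ "\<lambda>b. c * a b"] simp: sum_distrib_left mult.assoc)
  qed
  show "b \<in> fspan F B" if "finite B" "b \<in> B"
  proof -
    have "(\<Sum>b'\<in>B. (if b' = b then 1 else 0) * b') = (\<Sum>b'\<in>B. if b' = b then b' else 0)"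
      by (intro sum.cong) auto
    also have "\<dots> = b" using that by simp
    finally show ?thesis unfolding fspan_def using D(1,2) by (auto intro!: exI[of _ "\<lambda>b'. if b' = b then 1 else 0"])
  qed
qed

lemma fspan_sum: "subfield_set F \<Longrightarrow> (\<And>x. x \<in> A \<Longrightarrow> f x \<in> fspan F B) \<Longrightarrow> sum f A \<in> fspan F B"
  by (induction A rule: infinite_finite_induct) (auto intro: fspan_closed)

definition alg_over :: "'u::field set \<Rightarrow> 'u \<Rightarrow> bool" where
  "alg_over F x \<longleftrightarrow> (\<exists>p\<in>polys_over F. p \<noteq> 0 \<and> poly p x = 0)"

lemma alg_over_mono: "F \<subseteq> G \<Longrightarrow> alg_over F x \<Longrightarrow> alg_over G x"
  by (auto simp: alg_over_def polys_over_def)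

lemma alg_over_self: "subfield_set F \<Longrightarrow> x \<in> F \<Longrightarrow> alg_over F x"
  unfolding alg_over_def
  by (rule bexI[of _ "[:- x, 1:]"]) (auto intro!: polys_over_pCons polys_over_0 subfieldD)

lemma alg_over_monic:
  assumes F: "subfield_set F" and "alg_over F x"
  obtains p where "p \<in> polys_over F" "lead_coeff p = 1" "poly p x = 0"
proof -
  obtain q where q: "q \<in> polys_over F" "q \<noteq> 0" "poly q x = 0" using assms(2) unfolding alg_over_def by blast
  have "lead_coeff q \<in> F" using q(1) by (simp add: polys_over_def)
  then have "smult (inverse (lead_coeff q)) q \<in> polys_over F"
    by (intro polys_over_smult subfield_subring[OF F] q subfieldD(6)[OF F])
  then show ?thesis using that q(2,3) by force
qed

lemma alg_over_if_powers_in_fspan: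
  assumes F: "subfield_set F" and B: "finite B" and pow: "\<And>k. x ^ k \<in> fspan F B"
  shows "alg_over F x"
proof -
  have "\<exists>a. x ^ k = (\<Sum>b\<in>B. a b * b) \<and> (\<forall>b\<in>B. a b \<in> F)" for k
    using pow[of k] unfolding fspan_def by blast
  then obtain A where A: "\<And>k. x ^ k = (\<Sum>b\<in>B. A k b * b)" "\<And>k b. b \<in> B \<Longrightarrow> A k b \<in> F" by metis
  \<comment> \<open>One more power of \<open>x\<close> than there are elements of \<open>B\<close>,
    so the powers are linearly dependent over \<open>F\<close>.\<close>
  let ?I = "{..card B}"
  obtain c where c: "\<forall>i\<in>?I. c i \<in> F" "\<exists>i\<in>?I. c i \<noteq> 0" "\<forall>b\<in>B. (\<Sum>i\<in>?I. c i * A i b) = 0"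
    using linear_dependence[OF F B, of ?I A] A(2) by auto
  define p where "p = (\<Sum>i\<in>?I. monom (c i) i)"
  have "coeff p k = (if k \<in> ?I then c k else 0)" for k
    by (auto simp: p_def coeff_sum)
  then have p: "p \<in> polys_over F" "p \<noteq> 0"
    using c(1,2) subfieldD(1)[OF F] by (auto simp: polys_over_def poly_eq_iff)
  have "poly p x = (\<Sum>i\<in>?I. \<Sum>b\<in>B. c i * A i b * b)"
    by (simp add: p_def poly_sum poly_monom A(1) sum_distrib_left mult.assoc)
  also have "\<dots> = (\<Sum>b\<in>B. (\<Sum>i\<in>?I. c i * A i b) * b)"
    by (subst sum.swap) (simp add: sum_distrib_right)
  also have "\<dots> = 0" using c(3) by simp
  finally show ?thesis using p unfolding alg_over_def by blast
qed

text \<open>Since \<open>p\<close> is monic, pseudo-division by it is division, so the ring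
  generated by \<open>M\<close> and \<open>x\<close> is spanned by the products of \<open>B\<close>
  with the powers of \<open>x\<close> below the degree of \<open>p\<close>.\<close>

lemma integral_adjoin:
  assumes F: "subfield_set F" and M: "subring_set M" "F \<subseteq> M" "M \<subseteq> fspan F B" "finite B"
    and p: "p \<in> polys_over M" "lead_coeff p = 1" "poly p x = 0"
  obtains M' B' where "subring_set M'" "M \<subseteq> M'" "x \<in> M'" "M' \<subseteq> fspan F B'" "finite B'"
proof
  let ?M = "{poly q x | q. q \<in> polys_over M}" and ?B = "(\<lambda>(b, i). b * x ^ i) ` (B \<times> {..<degree p})"
  note P = subring_setD[OF subring_polys_over[OF M(1)]] and MD = subring_setD[OF M(1)]
  show "finite ?B" using M(4) by auto
  have I: "poly q x \<in> ?M" if "q \<in> polys_over M" for q using that by blast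
  show "subring_set ?M" unfolding subring_set_def
  proof (intro conjI ballI)
    show "0 \<in> ?M" "1 \<in> ?M" using I[OF P(1)] I[OF P(2)] by simp_all
    fix y z assume "y \<in> ?M" "z \<in> ?M"
    then obtain q r where q: "y = poly q x" "z = poly r x" "q \<in> polys_over M" "r \<in> polys_over M" by blast
    show "y + z \<in> ?M" "y - z \<in> ?M" "y * z \<in> ?M"
      using I[OF P(3)[OF q(3,4)]] I[OF P(4)[OF q(3,4)]] I[OF P(5)[OF q(3,4)]] q(1,2) by simp_all
  qed
  show "M \<subseteq> ?M"
  proof
    fix m assume "m \<in> M"
    then have "[:m:] \<in> polys_over M" by (intro polys_over_pCons polys_over_0 MD)
    then show "m \<in> ?M" by (auto intro!: exI[of _ "[:m:]"])
  qed
  have "[:0, 1:] \<in> polys_over M" by (intro polys_over_pCons polys_over_0 MD)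
  then show "x \<in> ?M" by (auto intro!: exI[of _ "[:0, 1:]"])
  have b: "m * x ^ i \<in> fspan F ?B" if m: "m \<in> M" and i: "i < degree p" for m i
  proof -
    obtain a where a: "m = (\<Sum>b\<in>B. a b * b)" "\<forall>b\<in>B. a b \<in> F" using m M(3) unfolding fspan_def by blast
    have "m * x ^ i = (\<Sum>b\<in>B. a b * (b * x ^ i))" by (simp add: a(1) sum_distrib_right mult.assoc)
    also have "\<dots> \<in> fspan F ?B"
      using a(2) i M(4) by (intro fspan_sum[OF F] fspan_closed(3,4)[OF F]) auto
    finally show ?thesis .
  qed
  show "?M \<subseteq> fspan F ?B"
  proof safe
    fix q assume q: "q \<in> polys_over M"
    have "p \<noteq> 0" using p(2) by auto
    then obtain k s r where r: "s \<in> polys_over M" "r \<in> polys_over M" "smult (lead_coeff p ^ k) q = s * p + r"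
      "r = 0 \<or> degree r < degree p"
      using pseudo_division[OF M(1) p(1) _ q] by blast
    have "poly q x = poly r x" using arg_cong[OF r(3), of "\<lambda>q. poly q x"] p(2,3) by simp
    also have "\<dots> = (\<Sum>i\<le>degree r. coeff r i * x ^ i)" by (rule poly_altdef)
    also have "\<dots> \<in> fspan F ?B"
    proof (cases "r = 0")
      case False
      then show ?thesis using r(2,4) by (intro fspan_sum[OF F] b) (auto simp: polys_over_def)
    qed (simp add: fspan_closed[OF F])
    finally show "poly q x \<in> fspan F ?B" .
  qed
qed

lemma algebraic_in_finite_ring:
  assumes F: "subfield_set F" and Y: "finite Y"
  shows "(\<And>y. y \<in> Y \<Longrightarrow> alg_over F y) \<Longrightarrow> \<exists>M B. subring_set M \<and> F \<subseteq> M \<and> Y \<subseteq> M \<and> M \<subseteq> fspan F B \<and> finite B"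
  using Y
proof (induction Y rule: finite_induct)
  case empty
  have "F \<subseteq> fspan F {1}"
    unfolding fspan_def by (auto intro!: exI[of _ "\<lambda>_. _"])
  then show ?case using subfield_subring[OF F] by (intro exI[of _ F] exI[of _ "{1}"]) auto
next
  case (insert y Y)
  then obtain M B where M: "subring_set M" "F \<subseteq> M" "Y \<subseteq> M" "M \<subseteq> fspan F B" "finite B" by auto
  obtain p where p: "p \<in> polys_over F" "lead_coeff p = 1" "poly p y = 0"
    by (rule alg_over_monic[OF F, of y]) (use insert.prems in auto)
  have pM: "p \<in> polys_over M" using p(1) M(2) by (auto simp: polys_over_def)
  obtain M' B' where "subring_set M'" "M \<subseteq> M'" "y \<in> M'" "M' \<subseteq> fspan F B'" "finite B'"
    by (rule integral_adjoin[OF F M(1,2,4,5) pM p(2,3)])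
  then show ?case using M(2,3) by blast
qed

lemma alg_over_in_finite_ring:
  assumes "subfield_set F" "subring_set M" "M \<subseteq> fspan F B" "finite B" "x \<in> M"
  shows "alg_over F x"
  using alg_over_if_powers_in_fspan[OF assms(1,4)] subring_setD(7)[OF assms(2,5)] assms(3) by blast

lemma subfield_algebraic:
  assumes F: "subfield_set F"
  shows "subfield_set {x. alg_over F x}"
proof -
  have "alg_over F (x + y) \<and> alg_over F (x - y) \<and> alg_over F (x * y)" if xy: "alg_over F x" "alg_over F y" for x y
  proof -
    have "\<exists>M B. subring_set M \<and> F \<subseteq> M \<and> {x, y} \<subseteq> M \<and> M \<subseteq> fspan F B \<and> finite B"
      using xy by (intro algebraic_in_finite_ring[OF F]) auto
    then obtain M B where M: "subring_set M" "{x, y} \<subseteq> M" "M \<subseteq> fspan F B" "finite B" by blast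
    then have "x + y \<in> M" "x - y \<in> M" "x * y \<in> M" using subring_setD[OF M(1)] by auto
    then show ?thesis using alg_over_in_finite_ring[OF F M(1,3,4)] by blast
  qed
  moreover have "alg_over F (inverse x)" if x: "alg_over F x" for x
  proof (cases "x = 0")
    case False
    obtain p where p: "p \<in> polys_over F" "p \<noteq> 0" "poly p x = 0" using x unfolding alg_over_def by blast
    \<comment> \<open>If \<open>x\<close> is a root of \<open>p\<close>, its inverse is a root of
      the polynomial with reversed coefficients.\<close>
    have "reflect_poly p \<in> polys_over F"
      using p(1) subfieldD(1)[OF F] by (auto simp: polys_over_def coeff_reflect_poly)
    moreover have "poly (reflect_poly p) (inverse x) = 0"
      using False p(3) poly_reflect_poly_nz[of "inverse x" p] by simp
    ultimately show ?thesis using p(2) unfolding alg_over_def by (intro bexI[of _ "reflect_poly p"]) auto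
  qed (use x in simp)
  ultimately show ?thesis
    using alg_over_self[OF F] subfieldD(1,2)[OF F] unfolding subfield_set_def by auto
qed

text \<open>The finitely many coefficients of a monic equation for \<open>x\<close> lie in a ring of
  finite dimension over \<open>F\<close>, and adjoining \<open>x\<close> keeps the dimension
  finite.\<close>

lemma alg_over_trans:
  assumes F: "subfield_set F" and "alg_over {y. alg_over F y} x"
  shows "alg_over F x"
proof -
  obtain p where p: "p \<in> polys_over {y. alg_over F y}" "lead_coeff p = 1" "poly p x = 0"
    using alg_over_monic[OF subfield_algebraic[OF F] assms(2)] .
  have "\<exists>M B. subring_set M \<and> F \<subseteq> M \<and> coeff p ` {..degree p} \<subseteq> M \<and> M \<subseteq> fspan F B \<and> finite B"
    using p(1) by (intro algebraic_in_finite_ring[OF F]) (auto simp: polys_over_def)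
  then obtain M B where M: "subring_set M" "F \<subseteq> M" "coeff p ` {..degree p} \<subseteq> M" "M \<subseteq> fspan F B" "finite B"
    by blast
  have "coeff p k \<in> M" for k
  proof (cases "k \<le> degree p")
    case False
    then show ?thesis using subring_setD(1)[OF M(1)] by (simp add: coeff_eq_0)
  qed (use M(3) in auto)
  then have pM: "p \<in> polys_over M" by (simp add: polys_over_def)
  obtain M' B' where M': "subring_set M'" "M \<subseteq> M'" "x \<in> M'" "M' \<subseteq> fspan F B'" "finite B'"
    by (rule integral_adjoin[OF F M(1,2,4,5) pM p(2,3)])
  then show ?thesis using alg_over_in_finite_ring[OF F M'(1,4,5,3)] by blast
qed

text \<open>No derivatives are adjoined: those needed are put into \<open>S\<close>
  explicitly.\<close>

definition acl :: "'u::field set \<Rightarrow> 'u set \<Rightarrow> 'u set" where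
  "acl K S = {x. alg_over (field_gen K S) x}"

lemma subfield_acl: "subfield_set (acl K S)"
  unfolding acl_def by (rule subfield_algebraic[OF subfield_field_gen])

lemma field_gen_subset_acl: "field_gen K S \<subseteq> acl K S"
  unfolding acl_def using alg_over_self[OF subfield_field_gen] by blast

lemma acl_superset: "K \<subseteq> acl K S" "S \<subseteq> acl K S"
  using field_gen_superset[of K S] field_gen_subset_acl[of K S] by auto

lemma acl_mono: "S \<subseteq> T \<Longrightarrow> acl K S \<subseteq> acl K T"
  unfolding acl_def using alg_over_mono[OF field_gen_mono] by auto

lemma acl_idem: "acl K (acl K S) \<subseteq> acl K S"
proof
  fix x assume "x \<in> acl K (acl K S)"
  then have "alg_over (field_gen K (acl K S)) x" by (simp add: acl_def)
  then have "alg_over (acl K S) x"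
    by (rule alg_over_mono[OF field_gen_least[OF subfield_acl acl_superset(1) subset_refl]])
  then show "x \<in> acl K S" using alg_over_trans[OF subfield_field_gen] unfolding acl_def by blast
qed

subsection \<open>Algebraic dependence and polynomial relations\<close>

text \<open>The assumption on a coefficient guarantees that substituting \<open>\<xi>\<close> for
  the indeterminates other than \<open>w\<close> leaves a nonzero polynomial; for \<open>f\<close>
  alone to be nonzero would not be enough.\<close>

lemma acl_if_relation:
  assumes K: "subfield_set K" and f: "f \<in> MP K (insert w W)" "meval id \<xi> f = 0"
    and k: "meval id \<xi> (coeff (up w f) k) \<noteq> 0"
  shows "\<xi> w \<in> acl K (\<xi> ` W)"
proof -
  note KR = subfield_subring[OF K]
  let ?L = "field_gen K (\<xi> ` W)"
  have L: "subfield_set ?L" "K \<subseteq> ?L" "\<xi> ` W \<subseteq> ?L"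
    using subfield_field_gen field_gen_superset[of K "\<xi> ` W"] by auto
  define p where "p = (\<Sum>k\<le>mdeg w f. monom (meval id \<xi> (coeff (up w f) k)) k)"
  have c: "coeff p k = meval id \<xi> (coeff (up w f) k)" for k
  proof (cases "k \<le> mdeg w f")
    case False
    then show ?thesis by (auto simp: p_def coeff_sum mdeg_def coeff_eq_0)
  qed (simp add: p_def coeff_sum)
  have "coeff p k \<in> ?L" for k
    unfolding c using coeff_up_in[OF KR f(1), of w k]
    by (rule meval_in[OF KR _ ring_homo_id(1) subfield_subring[OF L(1)]]) (use L in auto)
  then have "p \<in> polys_over ?L" by (simp add: polys_over_def)
  moreover have "p \<noteq> 0" using k c[of k] by auto
  moreover have "poly p (\<xi> w) = meval id \<xi> f"
    by (simp add: p_def poly_sum poly_monom meval_up[OF ring_homo_id(1), of \<xi> f w])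
  ultimately show ?thesis using f(2) unfolding acl_def alg_over_def by auto
qed

lemma polys_over_pConsD:
  assumes "pCons a p \<in> polys_over A"
  shows "a \<in> A" "p \<in> polys_over A"
proof -
  have c: "coeff (pCons a p) k \<in> A" for k using assms by (simp add: polys_over_def)
  show "a \<in> A" using c[of 0] by simp
  show "p \<in> polys_over A" using c[of "Suc _"] by (simp add: polys_over_def)
qed

lemma field_gen_fractions:
  assumes K: "subfield_set K" and x: "x \<in> field_gen K (\<xi> ` W)"
  shows "\<exists>f\<in>MP K W. \<exists>g\<in>MP K W. meval id \<xi> g \<noteq> 0 \<and> x = meval id \<xi> f / meval id \<xi> g"
proof -
  note KR = subfield_subring[OF K]
  note M = subring_setD[OF subring_MP[OF KR, of W]]
  define Q where "Q = {meval id \<xi> f / meval id \<xi> g | f g. f \<in> MP K W \<and> g \<in> MP K W \<and> meval id \<xi> g \<noteq> 0}"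
  have QI: "meval id \<xi> f / meval id \<xi> g \<in> Q" if "f \<in> MP K W" "g \<in> MP K W" "meval id \<xi> g \<noteq> 0" for f g
    using that unfolding Q_def by blast
  note h = ring_homoD[OF ring_homo_meval[OF ring_homo_id(1)]]
  have 1: "meval id \<xi> f \<in> Q" if "f \<in> MP K W" for f using QI[OF that M(2)] by (simp add: h)
  have "subfield_set Q" unfolding subfield_set_def
  proof (intro conjI ballI)
    show "0 \<in> Q" "1 \<in> Q" using 1[OF M(1)] 1[OF M(2)] by (auto simp: h)
  next
    fix x y assume "x \<in> Q" "y \<in> Q"
    then obtain f g f' g' where q: "f \<in> MP K W" "g \<in> MP K W" "meval id \<xi> g \<noteq> 0" "x = meval id \<xi> f / meval id \<xi> g"
      "f' \<in> MP K W" "g' \<in> MP K W" "meval id \<xi> g' \<noteq> 0" "y = meval id \<xi> f' / meval id \<xi> g'" unfolding Q_def by blast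
    have n: "meval id \<xi> (g * g') \<noteq> 0" using q by (simp add: h)
    have g: "g * g' \<in> MP K W" using q by (auto intro: M)
    have "x + y = meval id \<xi> (f * g' + f' * g) / meval id \<xi> (g * g')" using q by (simp add: h add_frac_eq)
    moreover have "f * g' + f' * g \<in> MP K W" by (intro M q)
    ultimately show "x + y \<in> Q" using QI[OF _ g n] by metis
    have "x - y = meval id \<xi> (f * g' - f' * g) / meval id \<xi> (g * g')" using q by (simp add: h diff_frac_eq)
    moreover have "f * g' - f' * g \<in> MP K W" by (intro M q)
    ultimately show "x - y \<in> Q" using QI[OF _ g n] by metis
    have "x * y = meval id \<xi> (f * f') / meval id \<xi> (g * g')" using q by (simp add: h)
    moreover have "f * f' \<in> MP K W" by (intro M q)
    ultimately show "x * y \<in> Q" using QI[OF _ g n] by metis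
  next
    fix x assume "x \<in> Q"
    then obtain f g where q: "f \<in> MP K W" "g \<in> MP K W" "meval id \<xi> g \<noteq> 0" "x = meval id \<xi> f / meval id \<xi> g" unfolding Q_def by blast
    show "inverse x \<in> Q"
    proof (cases "meval id \<xi> f = 0")
      case True
      then show ?thesis using q 1[OF M(1)] by (simp add: h)
    next
      case False
      then show ?thesis using q QI[of g f] by simp
    qed
  qed
  moreover have "K \<subseteq> Q" using 1[OF MP_mconst[OF KR]] by auto
  moreover have "\<xi> ` W \<subseteq> Q" using 1[OF MP_mvar[OF KR]] by auto
  ultimately have "x \<in> Q" using field_gen_least x by blast
  then show ?thesis unfolding Q_def by blast
qed

text \<open>Clearing denominators turns an equation with coefficients in the generated field into a
  polynomial relation; \<open>b\<close> evaluates to a common denominator of its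
  coefficients.\<close>

lemma relation_if_acl:
  assumes K: "subfield_set K" and w: "w \<notin> W" and x: "\<xi> w \<in> acl K (\<xi> ` W)"
  shows "\<exists>f\<in>MP K (insert w W). meval id \<xi> f = 0 \<and> (\<exists>k. meval id \<xi> (coeff (up w f) k) \<noteq> 0)"
proof -
  note KR = subfield_subring[OF K]
  note M = subring_setD[OF subring_MP[OF KR, of W]]
  note h = ring_homoD[OF ring_homo_meval[OF ring_homo_id(1)]]
  obtain p where p: "p \<in> polys_over (field_gen K (\<xi> ` W))" "p \<noteq> 0" "poly p (\<xi> w) = 0"
    using x unfolding acl_def alg_over_def by blast
  have "p \<in> polys_over (field_gen K (\<xi> ` W)) \<Longrightarrow> \<exists>b\<in>MP K W. meval id \<xi> b \<noteq> 0 \<and>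
     (\<forall>k. \<exists>c\<in>MP K W. meval id \<xi> c = meval id \<xi> b * coeff p k)"
  proof (induction p)
    case 0
    have "meval id \<xi> 1 \<noteq> 0" "meval id \<xi> 0 = meval id \<xi> 1 * coeff 0 k" for k by (simp_all add: h)
    then show ?case using M(1,2) by blast
  next
    case (pCons a p)
    have "p \<in> polys_over (field_gen K (\<xi> ` W))" and a: "a \<in> field_gen K (\<xi> ` W)"
      using polys_over_pConsD[OF pCons.prems] by auto
    then obtain b where b: "b \<in> MP K W" "meval id \<xi> b \<noteq> 0" "\<forall>k. \<exists>c\<in>MP K W. meval id \<xi> c = meval id \<xi> b * coeff p k"
      using pCons.IH by blast
    obtain f g where fg: "f \<in> MP K W" "g \<in> MP K W" "meval id \<xi> g \<noteq> 0" "a = meval id \<xi> f / meval id \<xi> g"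
      using field_gen_fractions[OF K a] by blast
    have "\<exists>c\<in>MP K W. meval id \<xi> c = meval id \<xi> (b * g) * coeff (pCons a p) k" for k
    proof (cases k)
      case 0
      then show ?thesis using fg b(1) by (intro bexI[of _ "b * f"]) (auto simp: h intro: M)
    next
      case (Suc j)
      obtain c where "c \<in> MP K W" "meval id \<xi> c = meval id \<xi> b * coeff p j" using b(3) by blast
      then show ?thesis using fg Suc by (intro bexI[of _ "g * c"]) (auto simp: h intro: M)
    qed
    moreover have "meval id \<xi> (b * g) \<noteq> 0" "b * g \<in> MP K W" using b(1,2) fg(2,3) by (auto simp: h intro: M)
    ultimately show ?case by blast
  qed
  then obtain b where b: "b \<in> MP K W" "meval id \<xi> b \<noteq> 0" "\<forall>k. \<exists>c\<in>MP K W. meval id \<xi> c = meval id \<xi> b * coeff p k"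
    using p(1) by blast
  obtain c where c: "\<And>k. c k \<in> MP K W" "\<And>k. meval id \<xi> (c k) = meval id \<xi> b * coeff p k" using b(3) by metis
  define q where "q = (\<Sum>k\<le>degree p. monom (c k) k)"
  have q: "coeff q k = (if k \<le> degree p then c k else 0)" for k by (auto simp: q_def coeff_sum)
  have qM: "q \<in> polys_over (MP K W)" using q c(1) M(1) by (auto simp: polys_over_def)
  define f where "f = poly q (mvar w)"
  have f: "f \<in> MP K (insert w W)" unfolding f_def by (rule poly_mvar_in[OF KR qM])
  have "q \<in> polys_over (MP UNIV (- {w}))"
    using qM MP_mono[of K UNIV W "- {w}"] w by (auto simp: polys_over_def)
  then have u: "up w f = q" unfolding f_def by (rule up_poly)
  have "meval id \<xi> f = (\<Sum>k\<le>degree p. meval id \<xi> (c k) * \<xi> w ^ k)"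
    by (simp add: f_def q_def poly_sum poly_monom ring_homo_sum[OF ring_homo_meval] h)
  also have "\<dots> = meval id \<xi> b * poly p (\<xi> w)"
    by (simp add: c(2) poly_altdef sum_distrib_left mult.assoc)
  finally have "meval id \<xi> f = 0" using p(3) by simp
  moreover have "meval id \<xi> (coeff (up w f) (degree p)) \<noteq> 0" using b(2) p(2) by (simp add: u q c(2))
  ultimately show ?thesis using f by blast
qed

lemma coeff_up_commute:
  assumes "x \<noteq> y"
  shows "coeff (up y (coeff (up x f) k)) i = coeff (up x (coeff (up y f) i)) k"
proof -
  let ?P = "\<lambda>i. coeff (up y f) i"
  have xy: "z \<notin> mvars (coeff (up x g) k)" if "z \<notin> mvars g" for g k z
    using mvars_coeff_up[of x g k] that by auto
  have yP: "y \<notin> mvars (?P i)" for i using mvars_coeff_up[of y f i] by auto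
  have "f = (\<Sum>i\<le>degree (up y f). ?P i * mvar y ^ i)" using poly_up[of y f] by (simp add: poly_altdef)
  then have "up x f = up x (\<Sum>i\<le>degree (up y f). ?P i * mvar y ^ i)" by (rule arg_cong)
  also have "\<dots> = (\<Sum>i\<le>degree (up y f). up x (?P i) * [:mvar y:] ^ i)"
    using assms by (simp add: ring_homo_sum[OF ring_homo_up] up_hom up_mvar)
  also have "\<dots> = (\<Sum>i\<le>degree (up y f). smult (mvar y ^ i) (up x (?P i)))"
    by (intro sum.cong refl) (simp add: poly_const_pow)
  finally have "coeff (up x f) k = (\<Sum>i\<le>degree (up y f). coeff (up x (?P i)) k * mvar y ^ i)"
    by (simp add: coeff_sum mult.commute)
  then have "up y (coeff (up x f) k) = up y (\<Sum>i\<le>degree (up y f). coeff (up x (?P i)) k * mvar y ^ i)"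
    by (rule arg_cong)
  also have "\<dots> = (\<Sum>i\<le>degree (up y f). up y (coeff (up x (?P i)) k) * [:0, 1:] ^ i)"
    by (simp add: ring_homo_sum[OF ring_homo_up] up_hom up_mvar)
  also have "\<dots> = (\<Sum>i\<le>degree (up y f). monom (coeff (up x (?P i)) k) i)"
    by (intro sum.cong refl) (simp add: up_not_mvars[OF xy[OF yP]] monom_altdef)
  finally show ?thesis by (cases "i \<le> degree (up y f)") (auto simp: coeff_sum coeff_eq_0 up_hom)
qed

text \<open>A relation for \<open>y\<close> over \<open>x\<close> and \<open>S\<close> is also one
  for \<open>x\<close> over \<open>y\<close> and \<open>S\<close>, unless all its coefficients in
  \<open>x\<close> vanish. In that case one of them, read as a polynomial in \<open>y\<close>, would
  be a relation for \<open>y\<close> over \<open>S\<close>, since extracting coefficients in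
  \<open>x\<close> and in \<open>y\<close> commutes.\<close>

lemma acl_exchange:
  assumes K: "subfield_set K" and y: "y \<in> acl K (insert x S)" "y \<notin> acl K S"
  shows "x \<in> acl K (insert y S)"
proof (cases "y \<in> insert x S \<or> x \<in> S")
  case True
  then show ?thesis using y acl_superset(2)[of S K] acl_superset(2)[of "insert y S" K] by (auto simp: insert_absorb)
next
  case False
  note KR = subfield_subring[OF K]
  obtain f i where f: "f \<in> MP K (insert y (insert x S))" "meval id (\<lambda>v. v) f = 0" "meval id (\<lambda>v. v) (coeff (up y f) i) \<noteq> 0"
    using relation_if_acl[OF K, of y "insert x S" "\<lambda>v. v"] False y(1) by auto
  show ?thesis
  proof (rule ccontr)
    assume x: "x \<notin> acl K (insert y S)"
    have z: "meval id (\<lambda>v. v) (coeff (up x f) k) = 0" for k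
      using acl_if_relation[OF K, of f x "insert y S" "\<lambda>v. v" k] f x by (auto simp: insert_commute)
    have "\<exists>k. meval id (\<lambda>v. v) (coeff (up x (coeff (up y f) i)) k) \<noteq> 0"
      using f(3) meval_up[OF ring_homo_id(1), of "\<lambda>v. v" "coeff (up y f) i" x]
      by (metis (no_types, lifting) mult_zero_left sum.neutral)
    then obtain k where k: "meval id (\<lambda>v. v) (coeff (up y (coeff (up x f) k)) i) \<noteq> 0"
      using coeff_up_commute[of x y f] False by auto
    have "coeff (up x f) k \<in> MP K (insert y S)"
      using coeff_up_in[OF KR f(1), of x k] MP_mono[of K K "insert y (insert x S) - {x}" "insert y S"] by auto
    then have "y \<in> acl K S" using acl_if_relation[OF K _ z k] by auto
    then show False using y(2) by blast
  qed
qed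

subsection \<open>Closure operators with the exchange property\<close>

text \<open>A pregeometry. Finite character is proved for \<open>acl\<close> separately, in
  \<open>acl_finitary\<close>.\<close>

locale matroid_closure =
  fixes cl :: "'u set \<Rightarrow> 'u set"
  assumes ext: "S \<subseteq> cl S" and mono: "S \<subseteq> T \<Longrightarrow> cl S \<subseteq> cl T" and idem: "cl (cl S) \<subseteq> cl S"
    and exchange: "y \<in> cl (insert x S) \<Longrightarrow> y \<notin> cl S \<Longrightarrow> x \<in> cl (insert y S)"
begin

definition indep :: "'u set \<Rightarrow> bool" where
  "indep X \<longleftrightarrow> (\<forall>x\<in>X. x \<notin> cl (X - {x}))"

lemma cl_least: "S \<subseteq> cl T \<Longrightarrow> cl S \<subseteq> cl T"
  using mono[of S "cl T"] idem[of T] by blast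

lemma indep_subset: "indep X \<Longrightarrow> Y \<subseteq> X \<Longrightarrow> indep Y"
  unfolding indep_def by (meson Diff_mono mono subset_iff order_refl)

lemma indep_insert_iff: "x \<notin> X \<Longrightarrow> indep (insert x X) \<longleftrightarrow> indep X \<and> x \<notin> cl X"
proof
  assume "x \<notin> X" "indep (insert x X)"
  then show "indep X \<and> x \<notin> cl X" using indep_subset[of "insert x X" X] by (auto simp: indep_def)
next
  assume x: "x \<notin> X" and *: "indep X \<and> x \<notin> cl X"
  show "indep (insert x X)" unfolding indep_def
  proof
    fix y assume y: "y \<in> insert x X"
    show "y \<notin> cl (insert x X - {y})"
    proof (cases "y = x")
      case False
      then have eq: "insert x X - {y} = insert x (X - {y})" and yX: "y \<in> X" using y by auto
      have "x \<in> cl X" if "y \<in> cl (insert x (X - {y}))"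
        using exchange[OF that] * yX unfolding indep_def by (metis insert_Diff)
      then show ?thesis using * eq by auto
    qed (use x * in auto)
  qed
qed

text \<open>Steinitz exchange: an element of \<open>B\<close> outside \<open>C\<close> is replaced
  by one of \<open>C\<close> that keeps \<open>B\<close> independent, which lowers the measure and
  leaves the cardinality alone.\<close>

lemma finite_steinitz:
  "finite B \<Longrightarrow> finite C \<Longrightarrow> indep B \<Longrightarrow> B \<subseteq> cl C \<Longrightarrow> card B \<le> card C"
proof (induction "card (B - C)" arbitrary: B rule: less_induct)
  case less
  show ?case
  proof (cases "B \<subseteq> C")
    case True
    then show ?thesis using less.prems by (intro card_mono)
  next
    case False
    then obtain b where b: "b \<in> B" "b \<notin> C" by blast
    have nb: "b \<notin> cl (B - {b})" using less.prems(3) b(1) by (simp add: indep_def)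
    have "\<not> C \<subseteq> cl (B - {b})"
    proof
      assume "C \<subseteq> cl (B - {b})"
      then have "cl C \<subseteq> cl (B - {b})" by (rule cl_least)
      then show False using less.prems(4) b(1) nb by auto
    qed
    then obtain c where c: "c \<in> C" "c \<notin> cl (B - {b})" by auto
    have cB: "c \<notin> B - {b}" using c(2) ext[of "B - {b}"] by auto
    define B' where "B' = insert c (B - {b})"
    have "indep B'" unfolding B'_def
      using indep_insert_iff[OF cB] indep_subset[OF less.prems(3)] c(2) by auto
    moreover have "B' \<subseteq> cl C" using less.prems(4) c(1) ext[of C] by (auto simp: B'_def)
    moreover have "finite B'" using less.prems(1) by (simp add: B'_def)
    moreover have "B' - C \<subset> B - C" using b c(1) by (auto simp: B'_def)
    then have "card (B' - C) < card (B - C)" using less.prems(1) by (intro psubset_card_mono) auto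
    moreover have "card B' = card B" using cB b(1) less.prems(1) card_Suc_Diff1[of B b] by (simp add: B'_def)
    ultimately show ?thesis using less.hyps[of B'] less.prems(2) by simp
  qed
qed

lemma steinitz:
  assumes "finite C" "indep B" "B \<subseteq> cl C"
  shows "finite B" "card B \<le> card C"
proof -
  show f: "finite B"
  proof (rule ccontr)
    assume "infinite B"
    then obtain B' where B': "B' \<subseteq> B" "finite B'" "card B' = Suc (card C)"
      using infinite_arbitrarily_large by blast
    then have "card B' \<le> card C" using finite_steinitz[of B' C] indep_subset[of B B'] assms by auto
    then show False using B'(3) by simp
  qed
  then show "card B \<le> card C" using finite_steinitz assms by blast
qed

lemma basis_exists:
  assumes "finite S"
  obtains B where "B \<subseteq> S" "indep B" "S \<subseteq> cl B"
proof -
  have "\<exists>B\<subseteq>S. indep B \<and> S \<subseteq> cl B"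
    using assms
  proof (induction S rule: finite_induct)
    case empty
    then show ?case by (auto simp: indep_def)
  next
    case (insert x S)
    then obtain B where B: "B \<subseteq> S" "indep B" "S \<subseteq> cl B" by blast
    show ?case
    proof (cases "x \<in> cl B")
      case True
      then show ?thesis using B by blast
    next
      case False
      have "x \<notin> B" using B(1) insert(2) by blast
      then have "indep (insert x B)" using indep_insert_iff B(2) False by blast
      moreover have "insert x S \<subseteq> cl (insert x B)" using B(3) mono[of B "insert x B"] ext[of "insert x B"] by blast
      ultimately show ?thesis using B(1) by (meson insert_mono)
    qed
  qed
  then show ?thesis using that by blast
qed

lemma indep_sequence:
  fixes x :: "nat \<Rightarrow> 'u"
  assumes "\<And>r. r < k \<Longrightarrow> x r \<notin> cl (x ` {..<r})"
  shows "indep (x ` {..<k})" "inj_on x {..<k}"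
proof -
  have "indep (x ` {..<k}) \<and> inj_on x {..<k}"
    using assms
  proof (induction k)
    case (Suc k)
    then have "x k \<notin> cl (x ` {..<k})" "indep (x ` {..<k})" "inj_on x {..<k}" by auto
    moreover then have "x k \<notin> x ` {..<k}" using ext[of "x ` {..<k}"] by auto
    ultimately show ?case by (simp add: lessThan_Suc indep_insert_iff)
  qed (simp add: indep_def)
  then show "indep (x ` {..<k})" "inj_on x {..<k}" by auto
qed

text \<open>Contraction of \<open>A\<close>: for \<open>acl K\<close>, bases with respect to it
  measure transcendence degree over the field generated by \<open>K\<close> and
  \<open>A\<close>.\<close>

lemma matroid_contract: "matroid_closure (\<lambda>S. cl (A \<union> S))"
proof
  fix S T x y
  show "S \<subseteq> cl (A \<union> S)" using ext[of "A \<union> S"] by auto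
  show "cl (A \<union> S) \<subseteq> cl (A \<union> T)" if "S \<subseteq> T" using that by (intro mono) auto
  show "cl (A \<union> cl (A \<union> S)) \<subseteq> cl (A \<union> S)" using ext[of "A \<union> S"] by (intro cl_least) auto
  show "x \<in> cl (A \<union> insert y S)" if "y \<in> cl (A \<union> insert x S)" "y \<notin> cl (A \<union> S)"
    using that exchange[of y x "A \<union> S"] by simp
qed

end

lemma matroid_acl:
  assumes K: "subfield_set K"
  shows "matroid_closure (acl K)"
proof
  show "S \<subseteq> acl K S" for S by (rule acl_superset(2))
  show "acl K S \<subseteq> acl K T" if "S \<subseteq> T" for S T by (rule acl_mono[OF that])
  show "acl K (acl K S) \<subseteq> acl K S" for S by (rule acl_idem)
  show "x \<in> acl K (insert y S)" if "y \<in> acl K (insert x S)" "y \<notin> acl K S" for x y S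
    by (rule acl_exchange[OF K that])
qed

abbreviation aindep :: "'u::field set \<Rightarrow> 'u set \<Rightarrow> bool" where
  "aindep K \<equiv> matroid_closure.indep (acl K)"

text \<open>Families rather than sets, so that the index of an element serves as its indeterminate;
  \<open>fam_indep_iff\<close> splits this into injectivity and independence of the image.\<close>

definition fam_indep :: "'u::field set \<Rightarrow> 'v set \<Rightarrow> ('v \<Rightarrow> 'u) \<Rightarrow> bool" where
  "fam_indep K W \<xi> \<longleftrightarrow> (\<forall>p\<in>MP K W. meval id \<xi> p = 0 \<longrightarrow> p = 0)"

lemma fam_indep_subset: "fam_indep K W \<xi> \<Longrightarrow> V \<subseteq> W \<Longrightarrow> fam_indep K V \<xi>"
  unfolding fam_indep_def using MP_mono[of K K V W] by auto

lemma fam_indep_insert: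
  assumes K: "subfield_set K" and w: "w \<notin> W"
  shows "fam_indep K (insert w W) \<xi> \<longleftrightarrow> fam_indep K W \<xi> \<and> \<xi> w \<notin> acl K (\<xi> ` W)"
proof (intro iffI conjI notI)
  assume i: "fam_indep K (insert w W) \<xi>"
  then show "fam_indep K W \<xi>" by (rule fam_indep_subset) auto
  assume "\<xi> w \<in> acl K (\<xi> ` W)"
  then obtain f k where f: "f \<in> MP K (insert w W)" "meval id \<xi> f = 0" "meval id \<xi> (coeff (up w f) k) \<noteq> 0"
    using relation_if_acl[OF K w] by blast
  then have "f = 0" using i unfolding fam_indep_def by blast
  then show False using f(3) by (simp add: up_hom)
next
  assume *: "fam_indep K W \<xi> \<and> \<xi> w \<notin> acl K (\<xi> ` W)"
  show "fam_indep K (insert w W) \<xi>" unfolding fam_indep_def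
  proof (intro ballI impI)
    fix f assume f: "f \<in> MP K (insert w W)" "meval id \<xi> f = 0"
    have "coeff (up w f) k = 0" for k
    proof -
      have "coeff (up w f) k \<in> MP K W"
        using coeff_up_in[OF subfield_subring[OF K] f(1), of w k] w by auto
      moreover have "meval id \<xi> (coeff (up w f) k) = 0"
        using acl_if_relation[OF K f] * by blast
      ultimately show ?thesis using * unfolding fam_indep_def by blast
    qed
    then have "up w f = 0" by (simp add: poly_eq_iff)
    then show "f = 0" by simp
  qed
qed

lemma fam_indep_iff:
  assumes K: "subfield_set K"
  shows "fam_indep K W \<xi> \<longleftrightarrow> inj_on \<xi> W \<and> aindep K (\<xi> ` W)"
proof -
  interpret matroid_closure "acl K" by (rule matroid_acl[OF K])
  have fin: "fam_indep K W \<xi> \<longleftrightarrow> inj_on \<xi> W \<and> indep (\<xi> ` W)" if "finite W" for W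
    using that
  proof (induction W rule: finite_induct)
    case empty
    have "fam_indep K {} \<xi>" unfolding fam_indep_def
    proof (intro ballI impI)
      fix p assume "p \<in> MP K {}" and z: "meval id \<xi> p = 0"
      then obtain c where "p = mconst c" using mvars_empty_iff[of p] by (auto simp: MP_def)
      then show "p = 0" using z by simp
    qed
    then show ?case by (auto simp: indep_def)
  next
    case (insert w W)
    show ?case
    proof (cases "\<xi> w \<in> \<xi> ` W")
      case True
      then show ?thesis using fam_indep_insert[OF K insert(2), of \<xi>] acl_superset(2)[of "\<xi> ` W" K] insert(2) by auto
    next
      case False
      then show ?thesis using fam_indep_insert[OF K insert(2), of \<xi>] insert indep_insert_iff[OF False] by auto
    qed
  qed
  show ?thesis
  proof
    assume i: "fam_indep K W \<xi>"
    have inj: "inj_on \<xi> W"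
    proof (rule inj_onI)
      fix v w assume "v \<in> W" "w \<in> W" "\<xi> v = \<xi> w"
      then show "v = w" using fin[of "{v, w}"] fam_indep_subset[OF i, of "{v, w}"] by (auto dest: inj_onD)
    qed
    have "\<xi> w \<notin> acl K (\<xi> ` W - {\<xi> w})" if "w \<in> W" for w
    proof -
      have "\<xi> ` W - {\<xi> w} = \<xi> ` (W - {w})" using inj that by (auto dest: inj_onD)
      moreover have "insert w (W - {w}) = W" using that by blast
      ultimately show ?thesis using fam_indep_insert[OF K, of w "W - {w}" \<xi>] i by auto
    qed
    then show "inj_on \<xi> W \<and> indep (\<xi> ` W)" using inj by (auto simp: indep_def)
  next
    assume *: "inj_on \<xi> W \<and> indep (\<xi> ` W)"
    show "fam_indep K W \<xi>" unfolding fam_indep_def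
    proof (intro ballI impI)
      fix p assume p: "p \<in> MP K W" "meval id \<xi> p = 0"
      \<comment> \<open>A polynomial involves finitely many indeterminates, which reduces to the
        finite case.\<close>
      have W: "mvars p \<subseteq> W" "p \<in> MP K (mvars p)" using p(1) by (auto simp: MP_def)
      have "inj_on \<xi> (mvars p) \<and> indep (\<xi> ` mvars p)"
        using * W(1) indep_subset[of "\<xi> ` W" "\<xi> ` mvars p"] inj_on_subset[of \<xi> W "mvars p"] by auto
      then show "p = 0" using fin[of "mvars p"] W(2) p(2) unfolding fam_indep_def by auto
    qed
  qed
qed

lemma alg_independent_iff: "subfield_set K \<Longrightarrow> alg_independent K B \<longleftrightarrow> aindep K B"
  using fam_indep_iff[of K B "\<lambda>v. v"] by (auto simp: alg_independent_def fam_indep_def MP_def)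

text \<open>\<open>trdeg\<close> refers to a basis chosen by \<open>SOME\<close> among the maximal
  independent subsets of the whole field, so all of these must be shown to have the cardinality of
  \<open>B\<close>.\<close>

lemma trdeg_field_gen:
  assumes K: "subfield_set K" and S: "finite S" and B: "B \<subseteq> S" "aindep K B" "S \<subseteq> acl K B"
  shows "trdeg K (field_gen K S) = card B"
proof -
  interpret matroid_closure "acl K" by (rule matroid_acl[OF K])
  let ?L = "field_gen K S"
  have SL: "S \<subseteq> ?L" using field_gen_superset by auto
  have L: "?L \<subseteq> acl K B" using field_gen_subset_acl[of K S] cl_least[OF B(3)] by blast
  have "transcendence_basis K ?L B" unfolding transcendence_basis_def alg_independent_iff[OF K]
  proof (intro conjI allI impI B notI)
    show "B \<subseteq> ?L" using B(1) SL by blast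
    fix B' assume B': "B \<subset> B' \<and> B' \<subseteq> ?L" "indep B'"
    then obtain b where b: "b \<in> B'" "b \<notin> B" by blast
    have "B \<subseteq> B' - {b}" using B' b by blast
    then have "b \<in> acl K (B' - {b})" using B' b L mono[of B "B' - {b}"] by blast
    then show False using B'(2) b(1) by (simp add: indep_def)
  qed
  then have "transcendence_basis K ?L (SOME B. transcendence_basis K ?L B)" by (rule someI)
  moreover have "card B' = card B" if "transcendence_basis K ?L B'" for B'
  proof -
    have B': "B' \<subseteq> ?L" "indep B'" "\<And>C. B' \<subset> C \<Longrightarrow> C \<subseteq> ?L \<Longrightarrow> \<not> indep C"
      using that unfolding transcendence_basis_def alg_independent_iff[OF K] by auto
    have fB: "finite B" using B(1) S finite_subset by blast
    have 1: "finite B'" "card B' \<le> card B" using steinitz[OF fB B'(2)] B'(1) L by auto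
    have "S \<subseteq> acl K B'"
    proof
      fix s assume s: "s \<in> S"
      show "s \<in> acl K B'"
      proof (rule ccontr)
        assume n: "s \<notin> acl K B'"
        then have sB: "s \<notin> B'" using acl_superset by blast
        have "indep (insert s B')" using indep_insert_iff[OF sB] B'(2) n by blast
        moreover have "B' \<subset> insert s B'" "insert s B' \<subseteq> ?L" using sB s SL B'(1) by auto
        ultimately show False using B'(3) by blast
      qed
    qed
    then have "card B \<le> card B'" using steinitz(2)[OF 1(1) B(2)] B(1) by blast
    then show ?thesis using 1 by simp
  qed
  ultimately show ?thesis unfolding trdeg_def by blast
qed

subsection \<open>Derivations and algebraic closure\<close>

lemma derivation_poly:
  assumes d: "derivation \<delta>" and L: "subring_set L" "x \<in> L" and F: "\<And>c. c \<in> F \<Longrightarrow> \<delta> c \<in> L"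
  shows "p \<in> polys_over F \<Longrightarrow> \<exists>c\<in>L. \<delta> (poly p x) = c + poly (pderiv p) x * \<delta> x"
proof (induction p)
  case 0
  then show ?case using subring_setD[OF L(1)] derivation_0[OF d] by (intro bexI[of _ 0]) auto
next
  case (pCons a p)
  have "p \<in> polys_over F" "a \<in> F"
    using polys_over_pConsD[OF pCons.prems] by auto
  then obtain c where c: "c \<in> L" "\<delta> (poly p x) = c + poly (pderiv p) x * \<delta> x" using pCons.IH by blast
  have "\<delta> (poly (pCons a p) x) = (\<delta> a + x * c) + poly (pderiv (pCons a p)) x * \<delta> x"
    using c(2) by (simp add: pderiv_pCons derivation_simps[OF d] algebra_simps)
  moreover have "\<delta> a + x * c \<in> L" using c(1) L F[OF \<open>a \<in> F\<close>] by (intro subring_setD)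
  ultimately show ?case by blast
qed

lemma derivation_inverse:
  fixes \<delta> :: "'u::field \<Rightarrow> 'u"
  assumes d: "derivation \<delta>"
  shows "\<delta> (inverse x) = - (\<delta> x * inverse x * inverse x)"
proof (cases "x = 0")
  case False
  have "\<delta> (x * inverse x) = 0" using False derivation_1[OF d] by simp
  then have "x * \<delta> (inverse x) = - (\<delta> x * inverse x)"
    by (simp add: derivation_mult[OF d] eq_neg_iff_add_eq_0 add.commute)
  then have "inverse x * (x * \<delta> (inverse x)) = - (\<delta> x * inverse x * inverse x)" by simp
  then show ?thesis using False by (simp flip: mult.assoc)
qed (simp add: derivation_0[OF d])

lemma subfield_deriv_preimage:
  assumes d: "derivation \<delta>" and L: "subfield_set L"
  shows "subfield_set {y \<in> L. \<delta> y \<in> L}"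
  unfolding subfield_set_def using subfieldD[OF L]
  by (auto simp: derivation_simps[OF d] derivation_inverse[OF d])

text \<open>Differentiate an equation of least degree for \<open>x\<close>: in characteristic 0 the
  derivative of the polynomial does not vanish at \<open>x\<close>, so the result can be solved for
  \<open>\<delta> x\<close>.\<close>

lemma derivation_algebraic:
  fixes \<delta> :: "'u::field_char_0 \<Rightarrow> 'u"
  assumes d: "derivation \<delta>" and L: "subfield_set L" "F \<subseteq> L" "\<And>c. c \<in> F \<Longrightarrow> \<delta> c \<in> L" "x \<in> L" and x: "alg_over F x"
  shows "\<delta> x \<in> L"
proof -
  \<comment> \<open>\<open>F\<close> may be any set, but the minimality argument needs the formal
    derivative to have coefficients in the same set again.\<close>
  define G where "G = field_gen F {}"
  have G: "subfield_set G" "F \<subseteq> G" "\<And>c. c \<in> G \<Longrightarrow> \<delta> c \<in> L" "G \<subseteq> L"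
  proof -
    have "F \<subseteq> {y \<in> L. \<delta> y \<in> L}" using L(2,3) by auto
    from field_gen_least[OF subfield_deriv_preimage[OF d L(1)] this empty_subsetI]
    show "\<And>c. c \<in> G \<Longrightarrow> \<delta> c \<in> L" "G \<subseteq> L" unfolding G_def by auto
    show "subfield_set G" "F \<subseteq> G" using subfield_field_gen field_gen_superset[of F "{}"] unfolding G_def by auto
  qed
  obtain p where p: "p \<in> polys_over G" "p \<noteq> 0" "poly p x = 0"
    and min: "\<And>q. q \<in> polys_over G \<Longrightarrow> q \<noteq> 0 \<Longrightarrow> poly q x = 0 \<Longrightarrow> degree p \<le> degree q"
    using alg_over_mono[OF G(2) x] ex_has_least_nat[of "\<lambda>p. p \<in> polys_over G \<and> p \<noteq> 0 \<and> poly p x = 0" _ degree]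
    unfolding alg_over_def by blast
  have deg: "degree p > 0"
  proof (rule ccontr)
    assume "\<not> degree p > 0"
    then obtain c where "p = [:c:]" by (auto elim: degree_eq_zeroE)
    then show False using p by auto
  qed
  have pd: "pderiv p \<in> polys_over G"
    using p(1) subfield_subring[OF G(1)] by (auto simp: polys_over_def coeff_pderiv intro!: subfieldD[OF G(1)])
      (metis of_nat_Suc subring_setD(8))
  have ne: "poly (pderiv p) x \<noteq> 0"
    using min[OF pd] deg by (auto simp: pderiv_eq_0_iff degree_pderiv)
  obtain c where c: "c \<in> L" "\<delta> (poly p x) = c + poly (pderiv p) x * \<delta> x"
    using derivation_poly[OF d subfield_subring[OF L(1)] L(4) G(3) p(1)] by blast
  have "\<delta> x = - c / poly (pderiv p) x"
    using c(2) ne p(3) derivation_0[OF d] by (simp add: field_simps eq_neg_iff_add_eq_0)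
  moreover have "poly (pderiv p) x \<in> L"
    using pd G(4) by (intro poly_in[OF subfield_subring[OF L(1)] _ L(4)]) (auto simp: polys_over_def)
  ultimately show ?thesis using c(1) subfieldD[OF L(1)] by auto
qed

lemma acl_deriv:
  fixes \<delta> :: "'u::field_char_0 \<Rightarrow> 'u"
  assumes d: "derivation \<delta>" and K: "diff_subfield \<delta> K" and x: "x \<in> acl K T"
  shows "\<delta> x \<in> acl K (T \<union> \<delta> ` T)"
proof (rule derivation_algebraic[OF d subfield_acl])
  let ?L = "acl K (T \<union> \<delta> ` T)"
  have KL: "K \<subseteq> ?L" "\<And>c. c \<in> K \<Longrightarrow> \<delta> c \<in> ?L" "T \<subseteq> ?L" "\<delta> ` T \<subseteq> ?L"
    using acl_superset[of K "T \<union> \<delta> ` T"] acl_superset(2)[of "T \<union> \<delta> ` T" K] K by (auto simp: diff_subfield_def)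
  have "field_gen K T \<subseteq> {y \<in> ?L. \<delta> y \<in> ?L}"
    using KL by (intro field_gen_least[OF subfield_deriv_preimage[OF d subfield_acl]]) auto
  then show "field_gen K T \<subseteq> ?L" "\<And>c. c \<in> field_gen K T \<Longrightarrow> \<delta> c \<in> ?L" by auto
  show "x \<in> ?L" using x acl_mono[of T "T \<union> \<delta> ` T" K] by auto
  show "alg_over (field_gen K T) x" using x by (simp add: acl_def)
qed

lemma field_gen_deriv_closed:
  assumes d: "derivation \<delta>" and K: "diff_subfield \<delta> K" and S: "\<delta> ` S \<subseteq> S" and x: "x \<in> field_gen K S"
  shows "\<delta> x \<in> field_gen K S"
proof -
  have "field_gen K S \<subseteq> {y \<in> field_gen K S. \<delta> y \<in> field_gen K S}"
    using field_gen_superset[of K S] S K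
    by (intro field_gen_least[OF subfield_deriv_preimage[OF d subfield_field_gen]]) (auto simp: diff_subfield_def)
  then show ?thesis using x by blast
qed

section \<open>Realising types\<close>

lemma tval_cong: "(\<And>i. i \<in> tvars t \<Longrightarrow> e i = e' i) \<Longrightarrow> tval \<delta> e t = tval \<delta> e' t"
  by (induction t) auto

lemma holds_cong: "(\<And>i. i \<in> free_vars \<phi> \<Longrightarrow> e i = e' i) \<Longrightarrow> holds \<delta> e \<phi> \<longleftrightarrow> holds \<delta> e' \<phi>"
proof (induction \<phi> arbitrary: e e')
  case (Eq s t)
  then show ?case using tval_cong[of s e e' \<delta>] tval_cong[of t e e' \<delta>] by auto
next
  case (Exists i \<phi>)
  have "holds \<delta> (e(i := u)) \<phi> = holds \<delta> (e'(i := u)) \<phi>" for u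
    by (rule Exists.IH) (use Exists.prems in auto)
  then show ?case by simp
next
  case (And \<phi> \<psi>)
  have "holds \<delta> e \<phi> = holds \<delta> e' \<phi>" by (rule And.IH(1)) (use And.prems in auto)
  moreover have "holds \<delta> e \<psi> = holds \<delta> e' \<psi>" by (rule And.IH(2)) (use And.prems in auto)
  ultimately show ?case by simp
next
  case (Not \<phi>)
  have "holds \<delta> e \<phi> = holds \<delta> e' \<phi>" by (rule Not.IH) (use Not.prems in auto)
  then show ?case by simp
qed

definition conj_list :: "'u dform list \<Rightarrow> 'u dform" where
  "conj_list l = foldr And l (Eq Zero Zero)"

lemma conj_list_simps:
  "holds \<delta> e (conj_list l) \<longleftrightarrow> (\<forall>\<phi>\<in>set l. holds \<delta> e \<phi>)"
  "free_vars (conj_list l) = (\<Union>\<phi>\<in>set l. free_vars \<phi>)"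
  "params (conj_list l) = (\<Union>\<phi>\<in>set l. params \<phi>)"
  by (induction l) (auto simp: conj_list_def)

definition ex_list :: "nat list \<Rightarrow> 'u dform \<Rightarrow> 'u dform" where
  "ex_list is \<phi> = foldr Exists is \<phi>"

lemma ex_list_simps:
  "free_vars (ex_list is \<phi>) = free_vars \<phi> - set is"
  "params (ex_list is \<phi>) = params \<phi>"
  by (induction "is") (auto simp: ex_list_def)

lemma holds_ex_list: "holds \<delta> e (ex_list is \<phi>) \<longleftrightarrow> (\<exists>e'. (\<forall>i. i \<notin> set is \<longrightarrow> e' i = e i) \<and> holds \<delta> e' \<phi>)"
proof (induction "is" arbitrary: e)
  case Nil
  have "e' = e" if "\<forall>i. e' i = e i" for e' using that by auto
  then show ?case by (auto simp: ex_list_def)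
next
  case (Cons i "is")
  have "holds \<delta> e (ex_list (i # is) \<phi>) \<longleftrightarrow> (\<exists>u. holds \<delta> (e(i := u)) (ex_list is \<phi>))"
    by (simp add: ex_list_def)
  also have "\<dots> \<longleftrightarrow> (\<exists>u e'. (\<forall>j. j \<notin> set is \<longrightarrow> e' j = (e(i := u)) j) \<and> holds \<delta> e' \<phi>)"
    by (simp only: Cons.IH)
  also have "\<dots> \<longleftrightarrow> (\<exists>e'. (\<forall>j. j \<notin> set (i # is) \<longrightarrow> e' j = e j) \<and> holds \<delta> e' \<phi>)"
  proof
    assume "\<exists>u e'. (\<forall>j. j \<notin> set is \<longrightarrow> e' j = (e(i := u)) j) \<and> holds \<delta> e' \<phi>"
    then obtain u e' where e': "\<forall>j. j \<notin> set is \<longrightarrow> e' j = (e(i := u)) j" "holds \<delta> e' \<phi>" by blast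
    then show "\<exists>e'. (\<forall>j. j \<notin> set (i # is) \<longrightarrow> e' j = e j) \<and> holds \<delta> e' \<phi>" by (intro exI[of _ e']) auto
  next
    assume "\<exists>e'. (\<forall>j. j \<notin> set (i # is) \<longrightarrow> e' j = e j) \<and> holds \<delta> e' \<phi>"
    then obtain e' where e': "\<forall>j. j \<notin> set (i # is) \<longrightarrow> e' j = e j" "holds \<delta> e' \<phi>" by blast
    then show "\<exists>u e'. (\<forall>j. j \<notin> set is \<longrightarrow> e' j = (e(i := u)) j) \<and> holds \<delta> e' \<phi>"
      by (intro exI[of _ "e' i"] exI[of _ e']) auto
  qed
  finally show ?case .
qed

lemma lesspoll_insert:
  assumes "A \<prec> B" "infinite B"
  shows "insert a A \<prec> B"
proof (cases "finite A")
  case True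
  then show ?thesis using assms(2) by (intro finite_lesspoll_infinite) auto
next
  case False
  then show ?thesis using eq_lesspoll_trans[OF infinite_insert_eqpoll assms(1)] by blast
qed

lemma lesspoll_Un_finite: "finite F \<Longrightarrow> A \<prec> B \<Longrightarrow> infinite B \<Longrightarrow> A \<union> F \<prec> B"
proof (induction F rule: finite_induct)
  case (insert x F)
  then show ?case using lesspoll_insert[of "A \<union> F" B x] by simp
qed simp

text \<open>\<open>saturated\<close> speaks of formulas in the variable 0 only, so the variable
  \<open>i\<close> is moved there.\<close>

definition at_var0 :: "nat \<Rightarrow> 'u dform \<Rightarrow> 'u dform" where
  "at_var0 i \<psi> = (if i = 0 then \<psi> else Exists i (And (Eq (Var i) (Var 0)) \<psi>))"

lemma at_var0:
  assumes "free_vars \<psi> \<subseteq> {i}"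
  shows "free_vars (at_var0 i \<psi>) \<subseteq> {0}" "params (at_var0 i \<psi>) = params \<psi>"
    "holds \<delta> (\<lambda>_. u) (at_var0 i \<psi>) \<longleftrightarrow> holds \<delta> (\<lambda>_. u) \<psi>"
proof -
  show "free_vars (at_var0 i \<psi>) \<subseteq> {0}" using assms by (auto simp: at_var0_def)
  show "params (at_var0 i \<psi>) = params \<psi>" by (auto simp: at_var0_def)
  have "(\<lambda>_. u)(i := u) = (\<lambda>_. u)" by auto
  then show "holds \<delta> (\<lambda>_. u) (at_var0 i \<psi>) \<longleftrightarrow> holds \<delta> (\<lambda>_. u) \<psi>" by (auto simp: at_var0_def)
qed

text \<open>
  Types in several variables are realised one variable at a time: the remaining variables are first
  quantified existentially, and the value found then becomes a parameter.
\<close>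

theorem saturated_multi:
  fixes \<delta> :: "'u::comm_ring_1 \<Rightarrow> 'u"
  assumes sat: "saturated \<delta>" and inf: "infinite (UNIV :: 'u set)" and S: "finite S"
  shows "A \<prec> (UNIV :: 'u set) \<Longrightarrow> (\<And>\<phi>. \<phi> \<in> \<Phi> \<Longrightarrow> params \<phi> \<subseteq> A \<and> free_vars \<phi> \<subseteq> S) \<Longrightarrow>
    (\<And>\<Phi>\<^sub>0. finite \<Phi>\<^sub>0 \<Longrightarrow> \<Phi>\<^sub>0 \<subseteq> \<Phi> \<Longrightarrow> \<exists>e. \<forall>\<phi>\<in>\<Phi>\<^sub>0. holds \<delta> e \<phi>) \<Longrightarrow> \<exists>e. \<forall>\<phi>\<in>\<Phi>. holds \<delta> e \<phi>"
  using S
proof (induction S arbitrary: A \<Phi> rule: finite_induct)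
  case empty
  have "holds \<delta> (\<lambda>_. 0) \<phi>" if p: "\<phi> \<in> \<Phi>" for \<phi>
  proof -
    obtain e where "holds \<delta> e \<phi>" using empty(3)[of "{\<phi>}"] p by auto
    then show ?thesis using holds_cong[of \<phi> e "\<lambda>_. 0" \<delta>] empty(2)[OF p] by auto
  qed
  then show ?case by blast
next
  case (insert i S)
  obtain "is" where ivs: "set is = S" using finite_list[OF insert.hyps(1)] by blast
  define g where "g l = ex_list is (conj_list l)" for l :: "'u dform list"
  have g_fv: "free_vars (g l) \<subseteq> {i}" "params (g l) \<subseteq> A" if "set l \<subseteq> \<Phi>" for l
    using that insert.prems(2) ivs by (force simp: g_def ex_list_simps conj_list_simps)+
  define \<Psi> where "\<Psi> = (\<lambda>l. at_var0 i (g l)) ` {l. set l \<subseteq> \<Phi>}"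
  have "\<exists>u. \<forall>\<psi>\<in>\<Psi>. holds \<delta> (\<lambda>_. u) \<psi>"
  proof (rule sat[unfolded saturated_def, rule_format], intro conjI ballI allI impI)
    show "A \<prec> (UNIV :: 'u set)" by (rule insert.prems(1))
    show "params \<psi> \<subseteq> A" "free_vars \<psi> \<subseteq> {0}" if p: "\<psi> \<in> \<Psi>" for \<psi>
    proof -
      obtain l where l: "set l \<subseteq> \<Phi>" "\<psi> = at_var0 i (g l)" using p by (auto simp: \<Psi>_def)
      show "params \<psi> \<subseteq> A" "free_vars \<psi> \<subseteq> {0}"
        using at_var0(1,2)[OF g_fv(1)[OF l(1)]] g_fv(2)[OF l(1)] l(2) by auto
    qed
    fix \<Psi>0 assume "finite \<Psi>0 \<and> \<Psi>0 \<subseteq> \<Psi>"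
    then obtain L where L: "L \<subseteq> {l. set l \<subseteq> \<Phi>}" "finite L" "\<Psi>0 = (\<lambda>l. at_var0 i (g l)) ` L"
      unfolding \<Psi>_def by (meson finite_subset_image)
    obtain e where e: "\<forall>\<phi>\<in>(\<Union>l\<in>L. set l). holds \<delta> e \<phi>"
      using insert.prems(3)[of "\<Union>l\<in>L. set l"] L(1,2) by auto
    have "holds \<delta> (\<lambda>_. e i) (at_var0 i (g l))" if l: "l \<in> L" for l
    proof -
      have lP: "set l \<subseteq> \<Phi>" using l L(1) by auto
      let ?e = "\<lambda>j. if j \<in> S then e j else e i"
      have "holds \<delta> ?e \<phi>" if "\<phi> \<in> set l" for \<phi>
      proof -
        have h: "holds \<delta> e \<phi>" using e that l by blast
        have "free_vars \<phi> \<subseteq> insert i S" using that lP insert.prems(2) by blast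
        then have "holds \<delta> e \<phi> \<longleftrightarrow> holds \<delta> ?e \<phi>" by (intro holds_cong) auto
        then show ?thesis using h by blast
      qed
      then have "holds \<delta> (\<lambda>_. e i) (g l)"
        unfolding g_def holds_ex_list using ivs by (intro exI[of _ ?e]) (auto simp: conj_list_simps)
      then show ?thesis using at_var0(3)[OF g_fv(1)[OF lP]] by blast
    qed
    then show "\<exists>u. \<forall>\<phi>\<in>\<Psi>0. holds \<delta> (\<lambda>_. u) \<phi>" using L(3) by auto
  qed
  then obtain u where u: "\<And>l. set l \<subseteq> \<Phi> \<Longrightarrow> holds \<delta> (\<lambda>_. u) (at_var0 i (g l))" unfolding \<Psi>_def by auto
  \<comment> \<open>Binding \<open>i\<close> to the parameter \<open>u\<close> removes it from the
    free variables, which brings the formulas into the scope of the induction hypothesis.\<close>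
  define h where "h \<phi> = Exists i (And (Eq (Var i) (Param u)) \<phi>)" for \<phi>
  have "\<exists>e. \<forall>\<phi>\<in>h ` \<Phi>. holds \<delta> e \<phi>"
  proof (rule insert.IH)
    show "insert u A \<prec> (UNIV :: 'u set)" by (rule lesspoll_insert[OF insert.prems(1) inf])
    show "params \<phi> \<subseteq> insert u A \<and> free_vars \<phi> \<subseteq> S" if "\<phi> \<in> h ` \<Phi>" for \<phi>
      using that insert.prems(2) by (fastforce simp: h_def)
    fix \<Phi>0 assume "finite \<Phi>0" "\<Phi>0 \<subseteq> h ` \<Phi>"
    then obtain F where F: "F \<subseteq> \<Phi>" "finite F" "\<Phi>0 = h ` F" by (meson finite_subset_image)
    obtain l where l: "set l = F" using finite_list[OF F(2)] by blast
    have "holds \<delta> (\<lambda>_. u) (g l)" using u[of l] at_var0(3)[OF g_fv(1), of l \<delta> u] F(1) l by auto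
    then obtain e where e: "\<forall>j. j \<notin> S \<longrightarrow> e j = u" "\<forall>\<phi>\<in>F. holds \<delta> e \<phi>"
      unfolding g_def holds_ex_list using ivs l by (auto simp: conj_list_simps)
    have "e(i := u) = e" using e(1) insert.hyps(2) by auto
    then have "\<forall>\<phi>\<in>F. holds \<delta> e (h \<phi>)" using e(2) unfolding h_def by (auto intro!: exI[of _ u])
    then show "\<exists>e. \<forall>\<phi>\<in>\<Phi>0. holds \<delta> e \<phi>" using F(3) by auto
  qed
  then obtain e where "\<forall>\<phi>\<in>\<Phi>. holds \<delta> (e(i := u)) \<phi>" unfolding h_def by auto
  then show ?case by blast
qed

section \<open>Solvability of systems of differential equations and inequations\<close>

lemma dpol_term:
  fixes \<delta> :: "'u::comm_ring_1 \<Rightarrow> 'u"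
  assumes K: "subring_set K" and f: "f \<in> MP K (I \<times> UNIV)"
  shows "\<exists>t. set_dterm t \<subseteq> K \<and> tvars t \<subseteq> I \<and> (\<forall>e. tval \<delta> e t = dval \<delta> f e)"
  using K f
proof (induction rule: MP_induct)
  case (const c)
  then show ?case by (intro exI[of _ "Param c"]) auto
next
  case (var v)
  have "set_dterm ((Der ^^ r) (Var i) :: 'u dterm) = {} \<and> tvars ((Der ^^ r) (Var i) :: 'u dterm) = {i} \<and> tval \<delta> e ((Der ^^ r) (Var i)) = (\<delta> ^^ r) (e i)" for r i e
    by (induction r) auto
  then show ?case using var by (cases v) (auto intro!: exI[of _ "(Der ^^ snd v) (Var (fst v))"])
next
  case (add f g)
  then obtain s t where "set_dterm s \<subseteq> K \<and> tvars s \<subseteq> I \<and> (\<forall>e. tval \<delta> e s = dval \<delta> f e)"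
    "set_dterm t \<subseteq> K \<and> tvars t \<subseteq> I \<and> (\<forall>e. tval \<delta> e t = dval \<delta> g e)" by blast
  then have "set_dterm (Add s t) \<subseteq> K" "tvars (Add s t) \<subseteq> I" "tval \<delta> e (Add s t) = dval \<delta> (f + g) e" for e
    by (simp_all add: dval_hom)
  then show ?case by blast
next
  case (mult f g)
  then obtain s t where "set_dterm s \<subseteq> K \<and> tvars s \<subseteq> I \<and> (\<forall>e. tval \<delta> e s = dval \<delta> f e)"
    "set_dterm t \<subseteq> K \<and> tvars t \<subseteq> I \<and> (\<forall>e. tval \<delta> e t = dval \<delta> g e)" by blast
  then have "set_dterm (Mult s t) \<subseteq> K" "tvars (Mult s t) \<subseteq> I" "tval \<delta> e (Mult s t) = dval \<delta> (f * g) e" for e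
    by (simp_all add: dval_hom)
  then show ?case by blast
qed

abbreviation tup :: "'u::zero list \<Rightarrow> nat \<Rightarrow> 'u" where
  "tup \<equiv> nth_default 0"

text \<open>Saturation for \<open>m\<close> unknowns \<open>ys\<close> and known parameters
  \<open>xs\<close>. The parameters enter through additional formulas that fix the variables from
  \<open>m\<close> on, so all polynomials have coefficients in the small ring
  \<open>K\<close>.\<close>

theorem realise_polynomials:
  fixes \<delta> :: "'u::comm_ring_1 \<Rightarrow> 'u"
  assumes sat: "saturated \<delta>" and inf: "infinite (UNIV :: 'u set)" and K: "subring_set K" "small K"
    and P: "Ps \<subseteq> MP K ({..<m + length xs} \<times> UNIV)" and N: "Nz \<subseteq> MP K ({..<m + length xs} \<times> UNIV)"
    and fin: "\<And>P0 N0. finite P0 \<Longrightarrow> P0 \<subseteq> Ps \<Longrightarrow> finite N0 \<Longrightarrow> N0 \<subseteq> Nz \<Longrightarrow>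
      \<exists>ys. length ys = m \<and> (\<forall>f\<in>P0. dval \<delta> f (tup (ys @ xs)) = 0) \<and> (\<forall>f\<in>N0. dval \<delta> f (tup (ys @ xs)) \<noteq> 0)"
  shows "\<exists>ys. length ys = m \<and> (\<forall>f\<in>Ps. dval \<delta> f (tup (ys @ xs)) = 0) \<and> (\<forall>f\<in>Nz. dval \<delta> f (tup (ys @ xs)) \<noteq> 0)"
proof -
  let ?I = "{..<m + length xs}"
  have "\<forall>f. \<exists>t. f \<in> MP K (?I \<times> UNIV) \<longrightarrow> set_dterm t \<subseteq> K \<and> tvars t \<subseteq> ?I \<and> (\<forall>e. tval \<delta> e t = dval \<delta> f e)"
    using dpol_term[OF K(1)] by blast
  then obtain T where T: "\<And>f. f \<in> MP K (?I \<times> UNIV) \<Longrightarrow> set_dterm (T f) \<subseteq> K \<and> tvars (T f) \<subseteq> ?I \<and> (\<forall>e. tval \<delta> e (T f) = dval \<delta> f e)"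
    by metis
  define gp where "gp f = Eq (T f) Zero" for f
  define gn where "gn f = Not (Eq (T f) Zero)" for f
  define gx where "gx j = Eq (Var (m + j)) (Param (xs ! j))" for j
  have gp: "holds \<delta> e (gp f) \<longleftrightarrow> dval \<delta> f e = 0" if "f \<in> Ps" for f e using T P that by (auto simp: gp_def)
  have gn: "holds \<delta> e (gn f) \<longleftrightarrow> dval \<delta> f e \<noteq> 0" if "f \<in> Nz" for f e using T N that by (auto simp: gn_def)
  have gx: "holds \<delta> e (gx j) \<longleftrightarrow> e (m + j) = xs ! j" for e j by (simp add: gx_def)
  have "\<exists>e. \<forall>\<phi>\<in>gp ` Ps \<union> gn ` Nz \<union> gx ` {..<length xs}. holds \<delta> e \<phi>"
  proof (rule saturated_multi[OF sat inf, of ?I])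
    show "K \<union> set xs \<prec> (UNIV :: 'u set)" using K(2) inf by (intro lesspoll_Un_finite) (auto simp: small_def)
    show "params \<phi> \<subseteq> K \<union> set xs \<and> free_vars \<phi> \<subseteq> ?I" if "\<phi> \<in> gp ` Ps \<union> gn ` Nz \<union> gx ` {..<length xs}" for \<phi>
      using that
    proof (elim UnE imageE)
      fix f assume "\<phi> = gp f" "f \<in> Ps"
      then show ?thesis using T[of f] P by (auto simp: gp_def)
    next
      fix f assume "\<phi> = gn f" "f \<in> Nz"
      then show ?thesis using T[of f] N by (auto simp: gn_def)
    qed (auto simp: gx_def)
    fix \<Phi>0 assume f: "finite \<Phi>0" "\<Phi>0 \<subseteq> gp ` Ps \<union> gn ` Nz \<union> gx ` {..<length xs}"
    obtain P0 where P0: "P0 \<subseteq> Ps" "finite P0" "\<Phi>0 \<inter> gp ` Ps = gp ` P0"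
      using finite_subset_image[of "\<Phi>0 \<inter> gp ` Ps" gp Ps] f(1) by auto
    obtain N0 where N0: "N0 \<subseteq> Nz" "finite N0" "\<Phi>0 \<inter> gn ` Nz = gn ` N0"
      using finite_subset_image[of "\<Phi>0 \<inter> gn ` Nz" gn Nz] f(1) by auto
    obtain ys where ys: "length ys = m" "\<forall>f\<in>P0. dval \<delta> f (tup (ys @ xs)) = 0" "\<forall>f\<in>N0. dval \<delta> f (tup (ys @ xs)) \<noteq> 0"
      using fin[OF P0(2,1) N0(2,1)] by blast
    have "holds \<delta> (tup (ys @ xs)) \<phi>" if "\<phi> \<in> \<Phi>0" for \<phi>
    proof -
      have "\<phi> \<in> \<Phi>0 \<inter> gp ` Ps \<or> \<phi> \<in> \<Phi>0 \<inter> gn ` Nz \<or> \<phi> \<in> gx ` {..<length xs}"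
        using subsetD[OF f(2) that] that by (elim UnE) simp_all
      then consider "\<phi> \<in> gp ` P0" | "\<phi> \<in> gn ` N0" | "\<phi> \<in> gx ` {..<length xs}"
        unfolding P0(3) N0(3) by (elim disjE)
      then show ?thesis
      proof cases
        case 1
        then show ?thesis using gp P0(1) ys(2) by auto
      next
        case 2
        then show ?thesis using gn N0(1) ys(3) by auto
      next
        case 3
        then show ?thesis using ys(1) by (auto simp: gx nth_default_append nth_default_def)
      qed
    qed
    then show "\<exists>e. \<forall>\<phi>\<in>\<Phi>0. holds \<delta> e \<phi>" by blast
  qed simp
  then obtain e where e: "\<forall>\<phi>\<in>gp ` Ps \<union> gn ` Nz \<union> gx ` {..<length xs}. holds \<delta> e \<phi>" by blast
  define ys where "ys = map e [0..<m]"
  have tup_e: "tup (ys @ xs) i = e i" if "i < m + length xs" for i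
  proof (cases "i < m")
    case False
    then have "e (m + (i - m)) = xs ! (i - m)" using e gx[of e "i - m"] that by auto
    then show ?thesis using False that by (simp add: ys_def nth_append nth_default_def)
  qed (simp add: ys_def nth_append nth_default_def)
  have eq: "dval \<delta> f (tup (ys @ xs)) = dval \<delta> f e" if "f \<in> MP K (?I \<times> UNIV)" for f
    by (rule dval_cong) (use that tup_e in \<open>auto simp: MP_def\<close>)
  have "dval \<delta> f (tup (ys @ xs)) = 0" if "f \<in> Ps" for f
    using eq[OF subsetD[OF P that]] gp[OF that, of e] e that by simp
  moreover have "dval \<delta> f (tup (ys @ xs)) \<noteq> 0" if "f \<in> Nz" for f
    using eq[OF subsetD[OF N that]] gn[OF that, of e] e that by simp
  moreover have "length ys = m" by (simp add: ys_def)
  ultimately show ?thesis by blast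
qed

section \<open>Differential polynomials over a universal domain\<close>

subsection \<open>Partial evaluation\<close>

lemma coef_map: "h 0 = 0 \<Longrightarrow> coef (Poly_Mapping.map h f) m = h (coef f m)"
  by (auto simp: Poly_Mapping.map.rep_eq when_def)

lemma ring_homo_map_coeffs:
  assumes h: "ring_homo h"
  shows "ring_homo (Poly_Mapping.map h :: ('v, 'a::comm_ring_1) mpol \<Rightarrow> ('v, 'b::comm_ring_1) mpol)"
proof -
  note hD = ring_homoD[OF h]
  have s: "Poly_Mapping.map h (Poly_Mapping.single m c) = Poly_Mapping.single m (h c)" for m :: "'v \<Rightarrow>\<^sub>0 nat" and c
    by (rule poly_mapping_eqI) (auto simp: coef_map hD lookup_single when_def)
  have add: "Poly_Mapping.map h (f + g) = Poly_Mapping.map h f + Poly_Mapping.map h g" for f g :: "('v, 'a) mpol"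
    by (rule poly_mapping_eqI) (simp add: coef_map hD lookup_add)
  have z: "Poly_Mapping.map h (0 :: ('v, 'a) mpol) = 0"
    by (rule poly_mapping_eqI) (simp add: coef_map hD)
  have "Poly_Mapping.map h (f * g) = Poly_Mapping.map h f * Poly_Mapping.map h g" for f g :: "('v, 'a) mpol"
  proof (induction f rule: poly_mapping_add_induct)
    case (single m c)
    show ?case
      by (induction g rule: poly_mapping_add_induct) (simp_all add: z s add mult_single hD algebra_simps)
  qed (simp_all add: z add algebra_simps)
  moreover have "Poly_Mapping.map h (1 :: ('v, 'a) mpol) = 1"
    using s[of 0 1] by (simp add: hD)
  ultimately show ?thesis using add by (simp add: ring_homo_def)
qed

text \<open>\<open>split_poly X f\<close> is \<open>f\<close> as a polynomial in the indeterminates in \<open>X\<close> whose coefficients are polynomials in the others.\<close>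

definition split_poly :: "'v set \<Rightarrow> ('v, 'a::comm_ring_1) mpol \<Rightarrow> ('v, ('v, 'a) mpol) mpol" where
  "split_poly X = meval (\<lambda>c. mconst (mconst c)) (\<lambda>v. if v \<in> X then mvar v else mconst (mvar v))"

definition peval :: "'v set \<Rightarrow> ('v \<Rightarrow> 'a) \<Rightarrow> ('v, 'a::comm_ring_1) mpol \<Rightarrow> ('v, 'a) mpol" where
  "peval X \<xi> = meval mconst (\<lambda>v. if v \<in> X then mvar v else mconst (\<xi> v))"

lemma ring_homo_mconst2: "ring_homo (\<lambda>c. mconst (mconst c))"
  by (rule ring_homo_comp[OF ring_homo_mconst ring_homo_mconst])

lemma ring_homo_split_poly: "ring_homo (split_poly X)"
  unfolding split_poly_def by (rule ring_homo_meval[OF ring_homo_mconst2])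

lemma ring_homo_peval: "ring_homo (peval X \<xi>)"
  unfolding peval_def by (rule ring_homo_meval[OF ring_homo_mconst])

lemma split_poly_mconst: "split_poly X (mconst c) = mconst (mconst c)"
  unfolding split_poly_def by (rule meval_mconst[OF ring_homo_mconst2])

lemma split_poly_mvar: "split_poly X (mvar v) = (if v \<in> X then mvar v else mconst (mvar v))"
  unfolding split_poly_def by (rule meval_mvar[OF ring_homo_mconst2])

lemma map_mconst: "h 0 = 0 \<Longrightarrow> Poly_Mapping.map h (mconst c) = mconst (h c)"
  by (rule poly_mapping_eqI) (auto simp: coef_map mconst_def lookup_single when_def)

lemma map_mvar: "ring_homo h \<Longrightarrow> Poly_Mapping.map h (mvar v) = mvar v"
  by (rule poly_mapping_eqI) (auto simp: coef_map mvar_def lookup_single when_def ring_homoD)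

lemma peval_eq: "peval X \<xi> f = Poly_Mapping.map (meval id \<xi>) (split_poly X f)"
proof -
  have h: "ring_homo (meval id \<xi>)" by (rule ring_homo_meval[OF ring_homo_id(1)])
  have z: "meval id \<xi> 0 = 0" by simp
  show ?thesis
  proof (rule ring_homo_eqI[of UNIV f UNIV "peval X \<xi>" "\<lambda>f. Poly_Mapping.map (meval id \<xi>) (split_poly X f)"])
    show "ring_homo (\<lambda>f. Poly_Mapping.map (meval id \<xi>) (split_poly X f))"
      by (rule ring_homo_comp[OF ring_homo_map_coeffs[OF h] ring_homo_split_poly])
    show "peval X \<xi> (mconst c) = Poly_Mapping.map (meval id \<xi>) (split_poly X (mconst c))" for c
      by (simp add: split_poly_mconst map_mconst[where h = "meval id \<xi>", OF z] peval_def)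
    show "peval X \<xi> (mvar v) = Poly_Mapping.map (meval id \<xi>) (split_poly X (mvar v))" for v
      by (simp add: split_poly_mvar map_mconst[where h = "meval id \<xi>", OF z] map_mvar[OF h] peval_def)
  qed (simp_all add: ring_homo_peval)
qed

lemma coef_peval: "coef (peval X \<xi> f) m = meval id \<xi> (coef (split_poly X f) m)"
  unfolding peval_eq by (rule coef_map) simp

lemma coef_split_poly_in:
  assumes K: "subring_set K" and f: "f \<in> MP K W"
  shows "coef (split_poly X f) m \<in> MP K (W - X)"
proof -
  note R = subring_MP[OF K, of "W - X"]
  have "split_poly X f \<in> MP (MP K (W - X)) UNIV"
    unfolding split_poly_def
    by (rule meval_in[OF K f ring_homo_mconst2 subring_MP[OF R]]) (auto intro!: MP_mconst MP_mvar R K)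
  then show ?thesis by (simp add: MP_iff[OF R])
qed

lemma meval_split_poly: "meval id mvar (split_poly X f) = f"
proof (rule ring_homo_eqI[of UNIV f UNIV "\<lambda>f. meval id mvar (split_poly X f)" "\<lambda>x. x"])
  show "ring_homo (\<lambda>f. meval id mvar (split_poly X f))"
    by (rule ring_homo_comp[OF ring_homo_meval[OF ring_homo_id(1)] ring_homo_split_poly])
qed (simp_all add: split_poly_mconst split_poly_mvar)

lemma meval_peval: "meval id \<zeta> (peval X \<xi> f) = meval id (\<lambda>v. if v \<in> X then \<zeta> v else \<xi> v) f"
proof (rule ring_homo_eqI[of UNIV f UNIV "\<lambda>f. meval id \<zeta> (peval X \<xi> f)"])
  show "ring_homo (\<lambda>f. meval id \<zeta> (peval X \<xi> f))"
    by (rule ring_homo_comp[OF ring_homo_meval[OF ring_homo_id(1)] ring_homo_peval])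
  show "ring_homo (meval id (\<lambda>v. if v \<in> X then \<zeta> v else \<xi> v))" by (rule ring_homo_meval[OF ring_homo_id(1)])
qed (simp_all add: peval_def)

lemma peval_MP:
  assumes "f \<in> MP UNIV W"
  shows "peval X \<xi> f \<in> MP UNIV (W \<inter> X)"
  unfolding peval_def
  by (rule meval_in[OF subring_set_UNIV assms ring_homo_mconst subring_MP[OF subring_set_UNIV]])
    (auto intro!: MP_mconst MP_mvar)

lemma dsubst_eq_peval:
  assumes d: "derivation \<delta>"
  shows "dsubst \<delta> (\<lambda>i. if i \<in> I then mvar (i, 0) else mconst (a i)) f = peval (I \<times> UNIV) (\<lambda>(i, r). (\<delta> ^^ r) (a i)) f"
proof (rule ring_homo_eqI[of UNIV f UNIV])
  show "dsubst \<delta> (\<lambda>i. if i \<in> I then mvar (i, 0) else mconst (a i)) (mvar v) = peval (I \<times> UNIV) (\<lambda>(i, r). (\<delta> ^^ r) (a i)) (mvar v)" for v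
    by (cases v) (simp add: dsubst_mvar dpol_deriv_funpow_mvar[OF d] dpol_deriv_funpow_mconst[OF d] peval_def)
  show "dsubst \<delta> (\<lambda>i. if i \<in> I then mvar (i, 0) else mconst (a i)) (mconst c) = peval (I \<times> UNIV) (\<lambda>(i, r). (\<delta> ^^ r) (a i)) (mconst c)" for c
    by (simp add: peval_def)
qed (simp_all add: ring_homo_dsubst ring_homo_peval)

subsection \<open>Elimination of proper derivatives of the leader\<close>

text \<open>What reduction requires of a ring of differential polynomials. It is applied to
  \<open>dpols K n\<close> and, through \<open>pv\<close>, to differential polynomials in one
  unknown over the differential ring generated by \<open>K\<close> and a tuple.\<close>

definition dclosed :: "('a \<Rightarrow> 'a) \<Rightarrow> nat \<Rightarrow> 'a::comm_ring_1 dpol set \<Rightarrow> bool" where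
  "dclosed \<delta> i A \<longleftrightarrow> subring_set A \<and> (\<forall>f\<in>A. dpol_deriv \<delta> f \<in> A) \<and>
     (\<forall>f\<in>A. \<forall>s. up (i, s) f \<in> polys_over A) \<and> (\<forall>s. mvar (i, s) \<in> A)"

definition dideal :: "('a \<Rightarrow> 'a) \<Rightarrow> 'a::comm_ring_1 dpol set \<Rightarrow> 'a dpol set \<Rightarrow> bool" where
  "dideal \<delta> A J \<longleftrightarrow> 0 \<in> J \<and> (\<forall>f\<in>J. \<forall>g\<in>J. f + g \<in> J) \<and> (\<forall>a\<in>A. \<forall>f\<in>J. a * f \<in> J) \<and> (\<forall>f\<in>J. dpol_deriv \<delta> f \<in> J)"

definition order_le :: "nat \<Rightarrow> nat \<Rightarrow> 'a::comm_ring_1 dpol \<Rightarrow> bool" where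
  "order_le i N f \<longleftrightarrow> (\<forall>s. (i, s) \<in> mvars f \<longrightarrow> s \<le> N)"

lemma order_le_iff: "order_le i N f \<longleftrightarrow> f \<in> MP UNIV {(j, s). j \<noteq> i \<or> s \<le> N}"
  by (auto simp: order_le_def MP_def mcoeffs_in_def)

lemma order_le_closed:
  "order_le i N f \<Longrightarrow> order_le i N g \<Longrightarrow> order_le i N (f + g)"
  "order_le i N f \<Longrightarrow> order_le i N g \<Longrightarrow> order_le i N (f - g)"
  "order_le i N f \<Longrightarrow> order_le i N g \<Longrightarrow> order_le i N (f * g)"
  "order_le i N f \<Longrightarrow> order_le i N (f ^ k)"
  "order_le i N f \<Longrightarrow> order_le i N (- f)"
  "(\<And>x. x \<in> B \<Longrightarrow> order_le i N (F x)) \<Longrightarrow> order_le i N (sum F B)"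
proof -
  note R = subring_MP[OF subring_set_UNIV, of "{(j, s). j \<noteq> i \<or> s \<le> N}"]
  show "order_le i N f \<Longrightarrow> order_le i N g \<Longrightarrow> order_le i N (f + g)"
    "order_le i N f \<Longrightarrow> order_le i N g \<Longrightarrow> order_le i N (f - g)"
    "order_le i N f \<Longrightarrow> order_le i N g \<Longrightarrow> order_le i N (f * g)"
    "order_le i N f \<Longrightarrow> order_le i N (f ^ k)"
    "order_le i N f \<Longrightarrow> order_le i N (- f)"
    unfolding order_le_iff by (rule subring_setD[OF R]; assumption)+
  show "(\<And>x. x \<in> B \<Longrightarrow> order_le i N (F x)) \<Longrightarrow> order_le i N (sum F B)"
    unfolding order_le_iff by (rule subring_set_sum[OF R])
qed

lemma order_le_mono: "order_le i N f \<Longrightarrow> N \<le> M \<Longrightarrow> order_le i M f"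
  by (auto simp: order_le_def)

lemma order_le_mvars: "mvars g \<subseteq> mvars f \<Longrightarrow> order_le i N f \<Longrightarrow> order_le i N g"
  by (auto simp: order_le_def)

lemma order_le_deriv:
  assumes "derivation \<delta>" "order_le i N f"
  shows "order_le i (Suc N) (dpol_deriv \<delta> f)"
  unfolding order_le_iff
  by (rule dpol_deriv_MP[OF assms(1) subring_set_UNIV _ _ assms(2)[unfolded order_le_iff]]) auto

lemma mpartial_in_dclosed:
  fixes f :: "'a::idom dpol"
  assumes "dclosed \<delta> i A" "f \<in> A"
  shows "mpartial (i, s) f \<in> A"
proof -
  have A: "subring_set A" "up (i, s) f \<in> polys_over A" "mvar (i, s) \<in> A" using assms by (auto simp: dclosed_def)
  have "pderiv (up (i, s) f) \<in> polys_over A"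
    unfolding polys_over_def
  proof (intro CollectI allI)
    fix k
    have "coeff (up (i, s) f) (Suc k) \<in> A" using A(2) by (simp add: polys_over_def)
    then have "of_nat (Suc k) * coeff (up (i, s) f) (Suc k) \<in> A" by (intro subring_setD[OF A(1)])
    then show "coeff (pderiv (up (i, s) f)) k \<in> A" unfolding coeff_pderiv .
  qed
  then have "poly (pderiv (up (i, s) f)) (mvar (i, s)) \<in> A" by (rule poly_in[OF A(1) _ A(3)])
  then show ?thesis using poly_up[of "(i, s)" "mpartial (i, s) f"] by (simp add: up_mpartial)
qed

text \<open>The top derivative enters linearly at the first differentiation, with the separant as
  coefficient; by the Leibniz rule each further one preserves this shape.\<close>

lemma funpow_deriv_leader:
  fixes h :: "'a::comm_ring_1 dpol"
  assumes d: "derivation \<delta>" and h: "order_le i r h"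
  shows "\<exists>T. order_le i (r + k) T \<and> (dpol_deriv \<delta> ^^ Suc k) h = mpartial (i, r) h * mvar (i, Suc (r + k)) + T"
proof (induction k)
  case 0
  let ?M = "insert (i, r) (mvars h)"
  have "mvars (Poly_Mapping.map \<delta> h) \<subseteq> mvars h"
  proof
    fix v assume "v \<in> mvars (Poly_Mapping.map \<delta> h)"
    then obtain m where m: "coef (Poly_Mapping.map \<delta> h) m \<noteq> 0" "coef m v \<noteq> 0" by (auto simp: mvars_iff)
    then have "coef h m \<noteq> 0" using derivation_0[OF d] by (auto simp: coef_map)
    then show "v \<in> mvars h" using m(2) by (auto simp: mvars_iff)
  qed
  then have m: "order_le i r (Poly_Mapping.map \<delta> h)" "order_le i r (mpartial v h)" for v
    using order_le_mvars[OF _ h] mvars_mpartial[of v h] by auto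
  have "dpol_deriv \<delta> h = Poly_Mapping.map \<delta> h + (\<Sum>(j, s)\<in>?M. mpartial (j, s) h * mvar (j, Suc s))"
    by (rule dpol_deriv_superset) auto
  also have "(\<Sum>(j, s)\<in>?M. mpartial (j, s) h * mvar (j, Suc s)) =
    mpartial (i, r) h * mvar (i, Suc r) + (\<Sum>(j, s)\<in>?M - {(i, r)}. mpartial (j, s) h * mvar (j, Suc s))"
    by (subst sum.remove[of _ "(i, r)"]) auto
  finally have eq: "dpol_deriv \<delta> h = mpartial (i, r) h * mvar (i, Suc r) +
    (Poly_Mapping.map \<delta> h + (\<Sum>(j, s)\<in>?M - {(i, r)}. mpartial (j, s) h * mvar (j, Suc s)))" by (simp add: algebra_simps)
  have "order_le i r (Poly_Mapping.map \<delta> h + (\<Sum>(j, s)\<in>?M - {(i, r)}. mpartial (j, s) h * mvar (j, Suc s)))"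
  proof (intro order_le_closed(1,6) m)
    fix v assume v: "v \<in> ?M - {(i, r)}"
    obtain j s where js: "v = (j, s)" by (cases v)
    have "order_le i r (mvar (j, Suc s))"
      using v h js by (fastforce simp: order_le_def)
    then show "order_le i r (case v of (j, s) \<Rightarrow> mpartial (j, s) h * mvar (j, Suc s))"
      using m(2)[of "(j, s)"] js by (auto intro: order_le_closed)
  qed
  then show ?case using eq by auto
next
  case (Suc k)
  let ?S = "mpartial (i, r) h"
  obtain T where T: "order_le i (r + k) T" "(dpol_deriv \<delta> ^^ Suc k) h = ?S * mvar (i, Suc (r + k)) + T"
    using Suc by blast
  let ?T = "dpol_deriv \<delta> ?S * mvar (i, Suc (r + k)) + dpol_deriv \<delta> T"
  have "(dpol_deriv \<delta> ^^ Suc (Suc k)) h = dpol_deriv \<delta> (?S * mvar (i, Suc (r + k)) + T)"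
    using T(2) by simp
  also have "\<dots> = ?S * mvar (i, Suc (r + Suc k)) + ?T"
    by (simp add: derivation_simps[OF derivation_dpol_deriv[OF d]] d algebra_simps)
  finally have eq: "(dpol_deriv \<delta> ^^ Suc (Suc k)) h = ?S * mvar (i, Suc (r + Suc k)) + ?T" .
  have "order_le i r ?S" using order_le_mvars[OF mvars_mpartial h] .
  then have "order_le i (Suc r) (dpol_deriv \<delta> ?S)" by (rule order_le_deriv[OF d])
  then have "order_le i (r + Suc k) (dpol_deriv \<delta> ?S)" by (rule order_le_mono) simp
  moreover have "order_le i (r + Suc k) (mvar (i, Suc (r + k)) :: 'a dpol)" by (auto simp: order_le_def)
  moreover have "order_le i (r + Suc k) (dpol_deriv \<delta> T)" using order_le_deriv[OF d T(1)] by simp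
  ultimately have "order_le i (r + Suc k) ?T" by (intro order_le_closed)
  then show ?case using eq by blast
qed

text \<open>
  Modulo \<open>h\<close> and its derivatives, \<open>S y\<^sub>i\<^sup>(\<^sup>s\<^sup>)\<close> with \<open>s > r\<close> is congruent to a polynomial in lower derivatives of
  \<open>y\<^sub>i\<close>, so that these can be eliminated at the price of a power of the separant \<open>S\<close>.
\<close>

lemma partial_reduction:
  fixes h :: "'a::idom dpol"
  assumes d: "derivation \<delta>" and A: "dclosed \<delta> i A" and h: "h \<in> A" "order_le i r h"
  shows "f \<in> A \<Longrightarrow> order_le i (r + N) f \<Longrightarrow>
    \<exists>k. \<exists>g\<in>A. order_le i r g \<and> (\<forall>J. dideal \<delta> A J \<and> h \<in> J \<longrightarrow> mpartial (i, r) h ^ k * f - g \<in> J)"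
proof (induction N arbitrary: f)
  case 0
  then show ?case by (intro exI[of _ 0] bexI[of _ f]) (auto simp: dideal_def)
next
  case (Suc N)
  let ?S = "mpartial (i, r) h" and ?z = "(i, Suc (r + N))"
  have AR: "subring_set A" using A by (simp add: dclosed_def)
  note AD = subring_setD[OF AR]
  have hk: "(dpol_deriv \<delta> ^^ k) h \<in> A" for k by (induction k) (use A h in \<open>auto simp: dclosed_def\<close>)
  have SA: "?S \<in> A" by (rule mpartial_in_dclosed[OF A h(1)])
  have zA: "mvar ?z \<in> A" using A by (simp add: dclosed_def)
  obtain T where T: "order_le i (r + N) T" "(dpol_deriv \<delta> ^^ Suc N) h = ?S * mvar ?z + T"
    using funpow_deriv_leader[OF d h(2), of N] by blast
  have TA: "T \<in> A" using AD(4)[OF hk[of "Suc N"] AD(5)[OF SA zA]] T(2) by simp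
  have "order_le i r ?S" by (rule order_le_mvars[OF mvars_mpartial h(2)])
  then have So: "order_le i (r + N) ?S" by (rule order_le_mono) simp
  let ?D = "degree (up ?z f)" and ?c = "coeff (up ?z f)"
  have cA: "?c j \<in> A" for j using A Suc.prems(1) by (auto simp: dclosed_def polys_over_def)
  have co: "order_le i (r + N) (?c j)" for j
  proof -
    have "s \<le> r + N" if "(i, s) \<in> mvars (?c j)" for s
    proof -
      have "(i, s) \<in> mvars f" "s \<noteq> Suc (r + N)" using that mvars_coeff_up[of ?z f j] by auto
      then have "s \<le> r + Suc N" using Suc.prems(2) by (simp add: order_le_def)
      then show ?thesis using \<open>s \<noteq> Suc (r + N)\<close> by simp
    qed
    then show ?thesis by (simp add: order_le_def)
  qed
  \<comment> \<open>This is \<open>?S ^ ?D * f\<close> with every \<open>?S * mvar ?z\<close>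
    replaced by \<open>- T\<close>, to which it is congruent.\<close>
  define g1 where "g1 = (\<Sum>j\<le>?D. ?c j * ?S ^ (?D - j) * (- T) ^ j)"
  have g1: "g1 \<in> A" "order_le i (r + N) g1"
    unfolding g1_def by (intro subring_set_sum[OF AR] AD cA SA TA order_le_closed co So T(1))+
  obtain k g where g: "g \<in> A" "order_le i r g" "\<And>J. dideal \<delta> A J \<Longrightarrow> h \<in> J \<Longrightarrow> ?S ^ k * g1 - g \<in> J"
    using Suc.IH[OF g1] by blast
  have "?S ^ (k + ?D) * f - g \<in> J" if J: "dideal \<delta> A J" "h \<in> J" for J
  proof -
    have J0: "0 \<in> J" "\<And>a b. a \<in> J \<Longrightarrow> b \<in> J \<Longrightarrow> a + b \<in> J" "\<And>a b. a \<in> A \<Longrightarrow> b \<in> J \<Longrightarrow> a * b \<in> J"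
      "\<And>a. a \<in> J \<Longrightarrow> dpol_deriv \<delta> a \<in> J" using J(1) by (auto simp: dideal_def)
    have Jsum: "sum F B \<in> J" if "\<And>x. x \<in> B \<Longrightarrow> F x \<in> J" for F and B :: "nat set"
      using that by (induction B rule: infinite_finite_induct) (auto intro: J0)
    have "(dpol_deriv \<delta> ^^ j) h \<in> J" for j by (induction j) (auto intro: J0 J(2))
    then have zT: "?S * mvar ?z + T \<in> J" using T(2) by metis
    have pw: "(?S * mvar ?z) ^ j - (- T) ^ j \<in> J" for j
    proof (induction j)
      case (Suc j)
      have "(?S * mvar ?z) ^ Suc j - (- T) ^ Suc j =
         (?S * mvar ?z) * ((?S * mvar ?z) ^ j - (- T) ^ j) + (- T) ^ j * (?S * mvar ?z + T)"
        by (simp add: algebra_simps)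
      also have "\<dots> \<in> J" by (intro J0 AD Suc.IH zT SA zA TA)
      finally show ?case .
    qed (simp add: J0)
    have "f = (\<Sum>j\<le>?D. ?c j * mvar ?z ^ j)" using poly_up[of ?z f] by (simp add: poly_altdef)
    then have "?S ^ ?D * f = ?S ^ ?D * (\<Sum>j\<le>?D. ?c j * mvar ?z ^ j)" by (rule arg_cong)
    also have "\<dots> = (\<Sum>j\<le>?D. ?c j * ?S ^ (?D - j) * (?S * mvar ?z) ^ j)"
      unfolding sum_distrib_left
    proof (intro sum.cong refl)
      fix j assume "j \<in> {..?D}"
      then have "?S ^ ?D = ?S ^ (?D - j) * ?S ^ j" by (simp flip: power_add)
      then show "?S ^ ?D * (?c j * mvar ?z ^ j) = ?c j * ?S ^ (?D - j) * (?S * mvar ?z) ^ j"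
        by (simp add: power_mult_distrib algebra_simps)
    qed
    finally have "?S ^ ?D * f - g1 = (\<Sum>j\<le>?D. (?c j * ?S ^ (?D - j)) * ((?S * mvar ?z) ^ j - (- T) ^ j))"
      by (simp add: g1_def algebra_simps flip: sum_subtractf)
    also have "\<dots> \<in> J" by (intro Jsum J0 AD cA SA pw)
    finally have "?S ^ ?D * f - g1 \<in> J" .
    then have "?S ^ k * (?S ^ ?D * f - g1) + (?S ^ k * g1 - g) \<in> J" by (intro J0 g J AD SA)
    then show ?thesis by (simp add: power_add algebra_simps)
  qed
  then show ?case using g(1,2) by blast
qed

lemma order_le_exists: "\<exists>N. order_le i (r + N) f"
proof -
  have "s \<le> r + Max (insert 0 (snd ` mvars f))" if "(i, s) \<in> mvars f" for s
    using that by (intro trans_le_add2 Max_ge) (auto intro!: rev_image_eqI)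
  then show ?thesis unfolding order_le_def by blast
qed

subsection \<open>Nonvanishing of differential polynomials\<close>

locale universal =
  fixes \<delta> :: "'u::field_char_0 \<Rightarrow> 'u"
  assumes universal: "universal_domain \<delta>"
begin

lemma d: "derivation \<delta>"
  using universal by (simp add: universal_domain_def)

lemma sat: "saturated \<delta>"
  using universal by (simp add: universal_domain_def)

lemma inf: "infinite (UNIV :: 'u set)"
  by (rule infinite_UNIV_char_0)

text \<open>For \<open>r = 0\<close> the set of indeterminates allowed for \<open>g\<close> is
  empty, in accordance with the convention for constants in
  \<open>differentially_closed\<close>.\<close>

lemma blum:
  assumes f: "f \<in> MP UNIV ({0} \<times> UNIV)" "(0, r) \<in> mvars f" "order_le 0 r f"
    and g: "g \<in> MP UNIV ({0} \<times> {..<r})" "g \<noteq> 0"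
  shows "\<exists>x. dval \<delta> f (\<lambda>_. x) = 0 \<and> dval \<delta> g (\<lambda>_. x) \<noteq> 0"
proof -
  have "mvars f \<subseteq> {0} \<times> UNIV" using f(1) by (simp add: MP_def)
  then have "dpol_order f = r"
    unfolding dpol_order_def using f(3) imageI[OF f(2), of snd] by (intro Max_eqI) (auto simp: order_le_def)
  moreover have "f \<in> dpols UNIV 0" "g \<in> dpols UNIV 0"
    using f(1) g(1) by (auto simp: dpols_eq_MP MP_def)
  moreover have "\<forall>v\<in>mvars g. snd v < r" using g(1) by (auto simp: MP_def)
  ultimately show ?thesis
    using universal f(2) g(2) unfolding universal_domain_def differentially_closed_def by (metis empty_iff)
qed

lemma nonvanishing1:
  assumes g: "g \<in> MP UNIV ({0} \<times> UNIV)" "g \<noteq> 0"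
  shows "\<exists>x. dval \<delta> g (\<lambda>_. x) \<noteq> 0"
proof -
  obtain N where N: "order_le 0 (0 + N) g" using order_le_exists by blast
  have "g \<in> MP UNIV ({0} \<times> {..<Suc N})" using g(1) N by (force simp: MP_def order_le_def)
  \<comment> \<open>The derivative of order \<open>Suc N\<close> serves as the equation in Blum's
    axiom: its order exceeds that of \<open>g\<close>.\<close>
  then show ?thesis
    using blum[of "mvar (0, Suc N)" "Suc N" g] g(2) MP_mvar[OF subring_set_UNIV, of "(0, Suc N)" "{0} \<times> UNIV"]
    by (auto simp: order_le_def)
qed

lemma nonvanishing_single:
  assumes g: "g \<in> MP UNIV ({n} \<times> UNIV)" "g \<noteq> 0"
  shows "\<exists>x. dval \<delta> g (\<lambda>_. x) \<noteq> 0"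
proof -
  let ?g = "dsubst \<delta> (\<lambda>_. mvar (0, 0)) g"
  have "dsubst \<delta> (\<lambda>_. mvar (n, 0)) ?g = g"
    by (rule ring_homo_eqI[OF subring_set_UNIV g(1) ring_homo_comp[OF ring_homo_dsubst ring_homo_dsubst] ring_homo_id(2)])
      (auto simp: dsubst_mvar dpol_deriv_funpow_mvar[OF d])
  then have "?g \<noteq> 0" using g(2) by (auto simp: dsubst_hom)
  moreover have "?g \<in> MP UNIV ({0} \<times> UNIV)"
    by (rule dsubst_MP[OF d subring_set_UNIV _ g(1)]) auto
  ultimately obtain x where "dval \<delta> ?g (\<lambda>_. x) \<noteq> 0" using nonvanishing1 by blast
  then show ?thesis by (auto simp: dval_dsubst[OF d])
qed

text \<open>A nonzero coefficient with respect to the last indeterminate and its derivatives is made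
  nonzero by induction; what remains is a nonzero polynomial in that single unknown.\<close>

lemma nonvanishing:
  "f \<in> MP UNIV ({..<n} \<times> UNIV) \<Longrightarrow> f \<noteq> 0 \<Longrightarrow> \<exists>a. dval \<delta> f a \<noteq> 0"
proof (induction n arbitrary: f)
  case 0
  then obtain c where "f = mconst c" using mvars_empty_iff[of f] by (auto simp: MP_def)
  then show ?case using 0 by auto
next
  case (Suc n)
  let ?X = "{n} \<times> UNIV :: (nat \<times> nat) set"
  have "split_poly ?X f \<noteq> 0" using meval_split_poly[of ?X f] Suc.prems(2) by auto
  then obtain m where m: "coef (split_poly ?X f) m \<noteq> 0" by (metis lookup_zero poly_mapping_eqI)
  have "coef (split_poly ?X f) m \<in> MP UNIV ({..<n} \<times> UNIV)"
    using coef_split_poly_in[OF subring_set_UNIV Suc.prems(1), of ?X m]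
      MP_mono[of UNIV UNIV "{..<Suc n} \<times> UNIV - ?X" "{..<n} \<times> UNIV"] by fastforce
  then obtain a where a: "dval \<delta> (coef (split_poly ?X f) m) a \<noteq> 0" using Suc.IH m by blast
  define g where "g = peval ?X (\<lambda>(i, r). (\<delta> ^^ r) (a i)) f"
  have "coef g m \<noteq> 0" using a by (simp add: g_def coef_peval dpol_eval_def)
  then have "g \<noteq> 0" by auto
  moreover have "g \<in> MP UNIV ?X"
    using peval_MP[OF Suc.prems(1), of ?X] MP_mono[of UNIV UNIV "({..<Suc n} \<times> UNIV) \<inter> ?X" ?X]
    unfolding g_def by blast
  ultimately obtain x where "dval \<delta> g (\<lambda>_. x) \<noteq> 0" using nonvanishing_single by blast
  then have "meval id (\<lambda>v. if v \<in> ?X then (\<lambda>(i, r). (\<delta> ^^ r) x) v else (\<lambda>(i, r). (\<delta> ^^ r) (a i)) v) f \<noteq> 0"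
    by (simp add: g_def dpol_eval_def meval_peval)
  also have "(\<lambda>v. if v \<in> ?X then (\<lambda>(i, r). (\<delta> ^^ r) x) v else (\<lambda>(i, r). (\<delta> ^^ r) (a i)) v) =
    (\<lambda>(i, r). (\<delta> ^^ r) ((a(n := x)) i))" by (auto simp: fun_eq_iff)
  finally show ?case unfolding dpol_eval_def by blast
qed

text \<open>Lets identities of differential polynomials, such as homogeneity, be proved by computing
  values.\<close>

lemma dpol_eq_if_dval_eq:
  assumes "\<And>a. dval \<delta> f a = dval \<delta> g a"
  shows "f = g"
proof (rule ccontr)
  assume "f \<noteq> g"
  let ?n = "Suc (Max (insert 0 (fst ` mvars (f - g))))"
  have "fst v < ?n" if "v \<in> mvars (f - g)" for v using that by (auto simp: less_Suc_eq_le)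
  then have "f - g \<in> MP UNIV ({..<?n} \<times> UNIV)" by (force simp: MP_def mcoeffs_in_def)
  then show False using nonvanishing[of "f - g" ?n] assms \<open>f \<noteq> g\<close> by (auto simp: dval_hom)
qed

text \<open>\<open>ys\<close> is differentially independent over \<open>K\<close> and
  \<open>xs\<close>. Finitely many polynomials that are not identically zero in the unknowns have a
  nonzero product, so \<open>nonvanishing\<close> supplies a point where none of them
  vanishes.\<close>

lemma generic_tuple:
  assumes K: "subring_set K" "small K"
  obtains ys where "length ys = m"
    "\<And>f zs. f \<in> MP K ({..<m + length xs} \<times> UNIV) \<Longrightarrow> dval \<delta> f (tup (ys @ xs)) = 0 \<Longrightarrow> length zs = m \<Longrightarrow>
      dval \<delta> f (tup (zs @ xs)) = 0"
proof -
  define Nz where "Nz = {f \<in> MP K ({..<m + length xs} \<times> UNIV). \<exists>zs. length zs = m \<and> dval \<delta> f (tup (zs @ xs)) \<noteq> 0}"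
  have "\<exists>ys. length ys = m \<and> (\<forall>f\<in>{}. dval \<delta> f (tup (ys @ xs)) = 0) \<and> (\<forall>f\<in>Nz. dval \<delta> f (tup (ys @ xs)) \<noteq> 0)"
  proof (rule realise_polynomials[OF sat inf K])
    fix P0 N0 :: "'u dpol set" assume *: "finite P0" "P0 \<subseteq> {}" "finite N0" "N0 \<subseteq> Nz"
    define \<theta> where "\<theta> i = (if i \<in> {..<m} then mvar (i, 0) else mconst (tup xs (i - m)) :: 'u dpol)" for i
    have val: "dval \<delta> (dsubst \<delta> \<theta> f) (tup zs) = dval \<delta> f (tup (zs @ xs))" if "length zs = m" for f zs
    proof -
      have "(\<lambda>i. dval \<delta> (\<theta> i) (tup zs)) = tup (zs @ xs)"
        using that by (auto simp: \<theta>_def fun_eq_iff nth_append nth_default_def)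
      then show ?thesis by (simp add: dval_dsubst[OF d])
    qed
    have nz: "dsubst \<delta> \<theta> f \<noteq> 0" if f: "f \<in> N0" for f
    proof -
      obtain zs where "length zs = m" "dval \<delta> f (tup (zs @ xs)) \<noteq> 0" using f *(4) unfolding Nz_def by blast
      then show ?thesis using val[of zs f] by (auto simp: dval_hom)
    qed
    let ?g = "\<Prod>f\<in>N0. dsubst \<delta> \<theta> f"
    have in_MP: "dsubst \<delta> \<theta> f \<in> MP UNIV ({..<m} \<times> UNIV)" for f
      by (rule dsubst_MP[OF d subring_set_UNIV, of f UNIV]) (auto simp: \<theta>_def)
    have "?g \<noteq> 0" using nz *(3) by (simp add: prod_zero_iff)
    moreover have "?g \<in> MP UNIV ({..<m} \<times> UNIV)" by (intro subring_set_prod subring_MP in_MP) simp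
    ultimately obtain a where a: "dval \<delta> ?g a \<noteq> 0" using nonvanishing by blast
    define ys where "ys = map a [0..<m]"
    have "dval \<delta> ?g (tup ys) = dval \<delta> ?g a"
      by (rule dval_cong) (use \<open>?g \<in> MP UNIV _\<close> in \<open>auto simp: ys_def MP_def nth_default_def\<close>)
    then have "dval \<delta> ?g (tup ys) \<noteq> 0" using a by simp
    then have "dval \<delta> (dsubst \<delta> \<theta> f) (tup ys) \<noteq> 0" if "f \<in> N0" for f
      using that *(3) by (auto simp: ring_homo_prod[OF ring_homo_dpol_eval[OF ring_homo_id(1)]])
    then show "\<exists>ys. length ys = m \<and> (\<forall>f\<in>P0. dval \<delta> f (tup (ys @ xs)) = 0) \<and> (\<forall>f\<in>N0. dval \<delta> f (tup (ys @ xs)) \<noteq> 0)"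
      using val[of ys] *(2) by (intro exI[of _ ys]) (auto simp: ys_def)
  qed (auto simp: Nz_def)
  then show ?thesis using that unfolding Nz_def by blast
qed

end

section \<open>Specialisations over a differential subfield\<close>

lemma subring_image: "ring_homo h \<Longrightarrow> subring_set A \<Longrightarrow> subring_set (h ` A)"
proof -
  assume h: "ring_homo h" and A: "subring_set A"
  note hD = ring_homoD[OF h] and AD = subring_setD[OF A]
  have "0 \<in> h ` A" "1 \<in> h ` A" using AD(1,2) hD(1,4) by (metis imageI)+
  moreover have "h x + h y \<in> h ` A" "h x - h y \<in> h ` A" "h x * h y \<in> h ` A" if "x \<in> A" "y \<in> A" for x y
    using AD(3-5)[OF that] by (auto simp flip: hD)
  ultimately show ?thesis by (auto simp: subring_set_def)
qed

lemma subring_Int: "subring_set A \<Longrightarrow> subring_set B \<Longrightarrow> subring_set (A \<inter> B)"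
  by (simp add: subring_set_def)

context universal
begin

text \<open>Equality of quantifier-free types over \<open>K\<close>. Through
  \<open>extend_type\<close> it has the back-and-forth property and so does the work of equality of
  types.\<close>

definition eqtp :: "'u set \<Rightarrow> 'u list \<Rightarrow> 'u list \<Rightarrow> bool" where
  "eqtp K xs xs' \<longleftrightarrow> length xs = length xs' \<and>
     (\<forall>f\<in>MP K ({..<length xs} \<times> UNIV). dval \<delta> f (tup xs) = 0 \<longleftrightarrow> dval \<delta> f (tup xs') = 0)"

lemma eqtp_sym: "eqtp K xs xs' \<Longrightarrow> eqtp K xs' xs"
  by (auto simp: eqtp_def)

text \<open>The index 0 is the unknown and the index \<open>Suc j\<close> stands for the entry
  \<open>j\<close> of \<open>b\<close>, in accordance with the tuple \<open>x # b\<close>.\<close>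

definition pv :: "'u list \<Rightarrow> 'u dpol \<Rightarrow> 'u dpol" where
  "pv b = dsubst \<delta> (\<lambda>i. if i \<in> {0} then mvar (i, 0) else mconst (tup b (i - 1)))"

lemma ring_homo_pv: "ring_homo (pv b)"
  unfolding pv_def by (rule ring_homo_dsubst)

lemmas pv_hom = ring_homoD[OF ring_homo_pv]

lemma tup_Cons: "tup (x # b) i = (if i = 0 then x else tup b (i - 1))"
  by (cases i) (auto simp: nth_default_def)

lemma dval_pv: "dval \<delta> (pv b f) (\<lambda>_. x) = dval \<delta> f (tup (x # b))"
proof -
  have "(\<lambda>i. dval \<delta> (if i \<in> {0} then mvar (i, 0) else mconst (tup b (i - 1))) (\<lambda>_. x)) = tup (x # b)"
    by (auto simp: tup_Cons fun_eq_iff)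
  then show ?thesis by (simp add: pv_def dval_dsubst[OF d])
qed

lemma pv_MP: "pv b f \<in> MP UNIV ({0} \<times> UNIV)"
  unfolding pv_def by (rule dsubst_MP[OF d subring_set_UNIV, of f UNIV]) auto

lemma mvars_pv: "mvars (pv b f) \<subseteq> {0} \<times> UNIV"
  using pv_MP[of b f] by (simp add: MP_def)

context
  fixes K :: "'u set"
  assumes K: "diff_subfield \<delta> K" and small: "small K"
begin

lemma KR: "subring_set K"
  by (rule diff_subfield_subring[OF K])

lemma K\<delta>: "c \<in> K \<Longrightarrow> \<delta> c \<in> K"
  using K by (simp add: diff_subfield_def)

text \<open>A coefficient of \<open>pv b f\<close> is the value at \<open>b\<close> of a
  differential polynomial over \<open>K\<close> that depends on \<open>f\<close> and the monomial
  only, so the type of \<open>b\<close> decides whether it vanishes.\<close>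

lemma coef_pv_eq_0_iff:
  assumes e: "eqtp K b b'" and f: "f \<in> MP K ({..<Suc (length b)} \<times> UNIV)"
  shows "coef (pv b f) m = 0 \<longleftrightarrow> coef (pv b' f) m = 0"
proof -
  let ?X = "{0} \<times> UNIV :: (nat \<times> nat) set"
  define c where "c = coef (split_poly ?X f) m"
  have W: "{..<Suc (length b)} \<times> UNIV - ?X \<subseteq> {1..length b} \<times> UNIV" by auto
  have c: "c \<in> MP K ({1..length b} \<times> UNIV)"
    using coef_split_poly_in[OF KR f, of ?X m] MP_mono[OF order_refl W] unfolding c_def by blast
  define c' where "c' = dsubst \<delta> (\<lambda>i. mvar (i - 1, 0)) c"
  have c': "c' \<in> MP K ({..<length b} \<times> UNIV)"
    unfolding c'_def by (rule dsubst_MP[OF d KR K\<delta> c]) (auto intro!: MP_mvar KR)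
  have "coef (pv b f) m = dval \<delta> c' (tup b)" for b
  proof -
    have "pv b f = peval ?X (\<lambda>(i, r). (\<delta> ^^ r) (tup b (i - 1))) f"
      unfolding pv_def by (rule dsubst_eq_peval[OF d])
    then have "coef (pv b f) m = dval \<delta> c (\<lambda>i. tup b (i - 1))"
      by (simp only: coef_peval c_def dpol_eval_def)
    then show ?thesis by (simp add: c'_def dval_dsubst[OF d])
  qed
  then show ?thesis using e c' unfolding eqtp_def by simp
qed

lemma pv_eq_0_iff:
  assumes "eqtp K b b'" "f \<in> MP K ({..<Suc (length b)} \<times> UNIV)"
  shows "pv b f = 0 \<longleftrightarrow> pv b' f = 0"
proof -
  have "p = 0 \<longleftrightarrow> (\<forall>m. coef p m = 0)" for p :: "'u dpol"
    by (metis lookup_zero poly_mapping_eqI)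
  then show ?thesis using coef_pv_eq_0_iff[OF assms] by blast
qed

lemma mvars_pv_eq:
  assumes "eqtp K b b'" "f \<in> MP K ({..<Suc (length b)} \<times> UNIV)"
  shows "mvars (pv b f) = mvars (pv b' f)"
  using coef_pv_eq_0_iff[OF assms] by (auto simp: mvars_iff)

lemma dclosed_pv: "dclosed \<delta> 0 (pv b ` MP K (I \<times> UNIV))" if "0 \<in> I"
proof -
  let ?A = "MP K (I \<times> UNIV)"
  let ?D = "pv b ` ?A"
  have AR: "subring_set ?A" by (rule subring_MP[OF KR])
  have DR: "subring_set ?D" by (rule subring_image[OF ring_homo_pv AR])
  have z: "pv b (mvar (0, s)) = mvar (0, s)" for s
    by (simp add: pv_def dsubst_mvar dpol_deriv_funpow_mvar[OF d])
  have vD: "mvar (0, s) \<in> ?D" for s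
  proof (rule image_eqI)
    show "mvar (0, s) = pv b (mvar (0, s))" by (simp add: z)
    show "mvar (0, s) \<in> ?A" using that by (auto intro!: MP_mvar KR)
  qed
  have der: "dpol_deriv \<delta> (pv b f) \<in> ?D" if f: "f \<in> ?A" for f
  proof (rule image_eqI)
    show "dpol_deriv \<delta> (pv b f) = pv b (dpol_deriv \<delta> f)" by (simp add: pv_def dsubst_deriv[OF d])
    show "dpol_deriv \<delta> f \<in> ?A" by (rule dpol_deriv_MP[OF d KR K\<delta> _ f]) auto
  qed
  have P: "p \<in> ?D \<Longrightarrow> [:p:] \<in> polys_over ?D" for p
    by (intro polys_over_pCons polys_over_0 subring_setD(1)[OF DR])
  have "up (0, s) (pv b f) \<in> polys_over ?D" if f: "f \<in> ?A" for f s
    using KR f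
  proof (induction rule: MP_induct)
    case (const c)
    have "mconst c \<in> ?A" using const by (auto intro: MP_mconst KR)
    then have "pv b (mconst c) \<in> ?D" by (rule imageI)
    then show ?case using P by (simp add: pv_def)
  next
    case (var v)
    obtain j t where v: "v = (j, t)" by (cases v)
    have "pv b (mvar v) \<in> ?D" using var by (auto intro!: imageI MP_mvar KR)
    moreover have "[:0, 1:] \<in> polys_over ?D"
      by (intro polys_over_pCons polys_over_0 subring_setD[OF DR])
    ultimately show ?case
      using P by (cases "j = 0") (auto simp: v z up_mvar pv_def dsubst_mvar dpol_deriv_funpow_mvar[OF d] dpol_deriv_funpow_mconst[OF d])
  qed (auto simp: pv_hom up_hom intro: subring_setD[OF subring_polys_over[OF DR]])
  then show ?thesis using DR vD der by (auto simp: dclosed_def)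
qed

text \<open>
  The differential polynomials over \<open>K\<langle>b\<rangle>\<close> vanishing at \<open>c\<close> are, up to a factor not vanishing at \<open>c\<close>,
  controlled by one of minimal rank, \<open>h\<close>; this survives the passage from \<open>b\<close> to \<open>b'\<close>.
\<close>

lemma minimal_polynomial:
  fixes b b' :: "'u list" and c :: 'u
  defines "A \<equiv> MP K ({..<Suc (length b)} \<times> UNIV)"
  assumes e: "eqtp K b b'" and f0: "f0 \<in> A" "dval \<delta> f0 (tup (c # b)) = 0" "pv b f0 \<noteq> 0"
  obtains h r q where "h \<in> A" "(0, r) \<in> mvars (pv b h)" "order_le 0 r (pv b h)"
    "dval \<delta> h (tup (c # b)) = 0" "dval \<delta> (mpartial (0, r) (pv b h)) (\<lambda>_. c) \<noteq> 0"
    "q \<in> A" "dval \<delta> q (tup (c # b)) \<noteq> 0"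
    "\<forall>f\<in>A. \<forall>x. dval \<delta> f (tup (c # b)) = 0 \<longrightarrow> dval \<delta> h (tup (x # b')) = 0 \<longrightarrow>
      dval \<delta> q (tup (x # b')) \<noteq> 0 \<longrightarrow> dval \<delta> f (tup (x # b')) = 0"
    "\<forall>g\<in>A. dval \<delta> g (tup (c # b)) \<noteq> 0 \<longrightarrow> (\<exists>C\<in>A. pv b C \<noteq> 0 \<and> mvars (pv b C) \<subseteq> {0} \<times> {..<r} \<and>
      (\<forall>x. dval \<delta> h (tup (x # b')) = 0 \<longrightarrow> dval \<delta> C (tup (x # b')) \<noteq> 0 \<longrightarrow> dval \<delta> g (tup (x # b')) \<noteq> 0))"
proof -
  have AR: "subring_set A" unfolding A_def by (rule subring_MP[OF KR])
  note AD = subring_setD[OF AR]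
  define D where "D = pv b ` A"
  have D: "dclosed \<delta> 0 D" unfolding D_def A_def by (rule dclosed_pv) simp
  have DR: "subring_set D" and Dz: "mvar (0, s) \<in> D" for s using D by (auto simp: dclosed_def)
  note DD = subring_setD[OF DR]
  have Dmv: "mvars p \<subseteq> {0} \<times> UNIV" if "p \<in> D" for p using that mvars_pv by (auto simp: D_def)
  define ev where "ev p = dval \<delta> p (\<lambda>_. c)" for p
  have ev: "ring_homo ev" unfolding ev_def by (rule ring_homo_dpol_eval[OF ring_homo_id(1)])
  note evD = ring_homoD[OF ev]
  have ev_pv: "ev (pv b f) = dval \<delta> f (tup (c # b))" for f by (simp add: ev_def dval_pv)
  \<comment> \<open>The ideal of \<open>x\<close> over \<open>b'\<close>, transported to polynomials
    over \<open>b\<close>. This is well defined because \<open>pv b f = 0\<close> implies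
    \<open>pv b' f = 0\<close>.\<close>
  define J where "J x = {pv b f | f. f \<in> A \<and> dval \<delta> f (tup (x # b')) = 0}" for x
  have J_iff: "pv b f \<in> J x \<longleftrightarrow> dval \<delta> f (tup (x # b')) = 0" if f: "f \<in> A" for f x
  proof
    assume "pv b f \<in> J x"
    then obtain f' where f': "pv b f = pv b f'" "f' \<in> A" "dval \<delta> f' (tup (x # b')) = 0" unfolding J_def by blast
    have "pv b (f - f') = 0" using f'(1) by (simp add: pv_hom)
    then have "pv b' (f - f') = 0" using pv_eq_0_iff[OF e, of "f - f'"] AD(4)[OF f f'(2)] unfolding A_def by blast
    then have "dval \<delta> (f - f') (tup (x # b')) = 0" using dval_pv[of b' "f - f'" x] by (simp add: dval_hom)
    then show "dval \<delta> f (tup (x # b')) = 0" using f'(3) by (simp add: dval_hom)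
  qed (use f in \<open>auto simp: J_def\<close>)
  have derA: "dpol_deriv \<delta> f \<in> A" if "f \<in> A" for f
    unfolding A_def by (rule dpol_deriv_MP[OF d KR K\<delta> _ that[unfolded A_def]]) auto
  have dJ: "dideal \<delta> D (J x)" for x
    unfolding dideal_def
  proof (intro conjI ballI)
    have "pv b 0 \<in> J x" using J_iff[OF AD(1)] by (simp add: dval_hom)
    then show "0 \<in> J x" by (simp add: pv_hom)
  next
    fix p p' assume "p \<in> J x" "p' \<in> J x"
    then obtain f f' where f: "p = pv b f" "f \<in> A" "dval \<delta> f (tup (x # b')) = 0"
      "p' = pv b f'" "f' \<in> A" "dval \<delta> f' (tup (x # b')) = 0" unfolding J_def by blast
    have "pv b (f + f') \<in> J x" using J_iff[OF AD(3)[OF f(2,5)]] f by (simp add: dval_hom)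
    then show "p + p' \<in> J x" using f by (simp add: pv_hom)
  next
    fix a p assume "a \<in> D" "p \<in> J x"
    then obtain g f where f: "p = pv b f" "f \<in> A" "dval \<delta> f (tup (x # b')) = 0" "a = pv b g" "g \<in> A"
      unfolding J_def D_def by blast
    have "pv b (g * f) \<in> J x" using J_iff[OF AD(5)[OF f(5,2)]] f by (simp add: dval_hom)
    then show "a * p \<in> J x" using f by (simp add: pv_hom)
  next
    fix p assume "p \<in> J x"
    then obtain f where f: "p = pv b f" "f \<in> A" "dval \<delta> f (tup (x # b')) = 0" unfolding J_def by blast
    have "pv b (dpol_deriv \<delta> f) \<in> J x"
      using J_iff[OF derA[OF f(2)]] f(3) by (simp add: dval_deriv[OF d] derivation_0[OF d])
    then show "dpol_deriv \<delta> p \<in> J x" by (simp add: f(1) pv_def dsubst_deriv[OF d])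
  qed
  define P where "P = {p \<in> D. ev p = 0}"
  have dP: "dideal \<delta> D P"
    using DD D by (auto simp: dideal_def P_def evD dclosed_def) (simp add: ev_def dval_deriv[OF d] derivation_0[OF d])
  \<comment> \<open>Minimal rank: first the least order \<open>r\<close> of a relation for
    \<open>c\<close>, then in \<open>hh\<close> the least degree in the derivative of order
    \<open>r\<close>.\<close>
  define Q where "Q r \<longleftrightarrow> (\<exists>p\<in>D. p \<noteq> 0 \<and> ev p = 0 \<and> order_le 0 r p)" for r
  define r where "r = (LEAST r. Q r)"
  define z where "z = (0::nat, r)"
  obtain r0 where "order_le 0 (0 + r0) (pv b f0)" using order_le_exists by blast
  then have "Q r0" unfolding Q_def D_def using f0 ev_pv by auto
  then have Qr: "Q r" unfolding r_def by (rule LeastI)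
  have min1: "p = 0" if p: "p \<in> D" "ev p = 0" "mvars p \<subseteq> {0} \<times> {..<r}" for p
  proof (rule ccontr)
    assume n: "p \<noteq> 0"
    show False
    proof (cases r)
      case 0
      then obtain k where "p = mconst k" using p(3) mvars_empty_iff[of p] by auto
      then show False using p(2) n by (simp add: ev_def)
    next
      case (Suc r')
      have "order_le 0 r' p" using p(3) Suc by (auto simp: order_le_def)
      then have "Q r'" using p n unfolding Q_def by blast
      then show False using not_less_Least[of r' Q] Suc unfolding r_def by simp
    qed
  qed
  define Ph where "Ph p \<longleftrightarrow> p \<in> D \<and> p \<noteq> 0 \<and> ev p = 0 \<and> order_le 0 r p" for p
  obtain p0 where "Ph p0" using Qr unfolding Q_def Ph_def by blast
  then obtain hh where hh: "Ph hh" and hmin: "\<And>p. Ph p \<Longrightarrow> mdeg z hh \<le> mdeg z p"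
    using ex_has_least_nat[of Ph p0 "mdeg z"] by blast
  have hD: "hh \<in> D" "hh \<noteq> 0" "ev hh = 0" "order_le 0 r hh" using hh by (auto simp: Ph_def)
  have min2: "p = 0" if "p \<in> D" "ev p = 0" "order_le 0 r p" "mdeg z p < mdeg z hh" for p
    using hmin[of p] that unfolding Ph_def by fastforce
  have sub_r: "mvars p \<subseteq> {0} \<times> {..<r}" if p: "p \<in> D" "order_le 0 r p" "z \<notin> mvars p" for p
  proof
    fix v assume v: "v \<in> mvars p"
    then obtain s where s: "v = (0, s)" using Dmv[OF p(1)] by auto
    then have "s \<le> r" "s \<noteq> r" using p(2,3) v by (auto simp: order_le_def z_def)
    then show "v \<in> {0} \<times> {..<r}" using s by simp
  qed
  have zh: "z \<in> mvars hh" using min1[OF hD(1,3)] sub_r[OF hD(1,4)] hD(2) by blast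
  \<comment> \<open>Nonzero elements of \<open>D0\<close> have order below \<open>r\<close> and
    hence do not vanish at \<open>c\<close>; \<open>D0\<close> is the ring of coefficients for
    division by \<open>hh\<close>.\<close>
  define D0 where "D0 = D \<inter> MP UNIV ({0} \<times> {..<r})"
  have D0R: "subring_set D0" unfolding D0_def by (intro subring_Int DR subring_MP) simp
  have D0min: "p = 0" if "p \<in> D0" "ev p = 0" for p
    using min1[of p] that by (auto simp: D0_def MP_def)
  have upD0: "up z p \<in> polys_over D0" if p: "p \<in> D" "order_le 0 r p" for p
    unfolding polys_over_def
  proof (intro CollectI allI)
    fix k
    have c: "coeff (up z p) k \<in> D" using D p(1) unfolding z_def by (auto simp: dclosed_def polys_over_def)
    have "order_le 0 r (coeff (up z p) k)" "z \<notin> mvars (coeff (up z p) k)"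
      using mvars_coeff_up[of z p k] order_le_mvars[OF _ p(2), of "coeff (up z p) k"] by auto
    then show "coeff (up z p) k \<in> D0" using c sub_r[OF c] by (auto simp: D0_def MP_def mcoeffs_in_def)
  qed
  define em where "em p = poly p (mvar z)" for p :: "'u dpol poly"
  have em: "ring_homo em" unfolding em_def by (rule ring_homo_poly)
  note emD = ring_homoD[OF em]
  have em_up: "em (up z p) = p" for p by (simp add: em_def poly_up)
  have em_smult: "em (smult a p) = a * em p" for a p by (simp add: em_def)
  have em_in: "em p \<in> D" "order_le 0 r (em p)" "up z (em p) = p" if p: "p \<in> polys_over D0" for p
  proof -
    have "p \<in> polys_over D" "p \<in> polys_over (MP UNIV ({0} \<times> {..<r}))" using p by (auto simp: polys_over_def D0_def)
    moreover from this(2) have "em p \<in> MP UNIV (insert z ({0} \<times> {..<r}))"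
      unfolding em_def by (rule poly_mvar_in[OF subring_set_UNIV])
    ultimately show "em p \<in> D" "order_le 0 r (em p)"
      using poly_in[OF DR _ Dz] unfolding em_def z_def by (auto simp: MP_def order_le_def)
    have "p \<in> polys_over (MP UNIV (- {z}))" using p by (auto simp: polys_over_def D0_def MP_def z_def)
    then show "up z (em p) = p" unfolding em_def by (rule up_poly)
  qed
  define S where "S = mpartial z hh"
  define H where "H = lead_coeff (up z hh)"
  have SD: "S \<in> D" unfolding S_def z_def by (rule mpartial_in_dclosed[OF D hD(1)])
  have S: "ev S \<noteq> 0"
    using min2[OF SD _ order_le_mvars[OF _ hD(4)]] mpartial_nonzero[OF zh] mvars_mpartial[of z hh] unfolding S_def by auto
  have HD0: "H \<in> D0" unfolding H_def using upD0[OF hD(1,4)] by (simp add: polys_over_def)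
  then have HD: "H \<in> D" by (simp add: D0_def)
  have H: "ev H \<noteq> 0" using D0min[OF HD0] hD(2) by (auto simp: H_def)
  \<comment> \<open>Ritt reduction: the separant \<open>S\<close> removes derivatives above order
    \<open>r\<close>, and pseudo-division with the initial \<open>H\<close> lowers the degree below
    that of \<open>hh\<close>.\<close>
  have red: "\<exists>k l. \<exists>g\<in>D. order_le 0 r g \<and> (g = 0 \<or> mdeg z g < mdeg z hh) \<and>
    (\<forall>J. dideal \<delta> D J \<and> hh \<in> J \<longrightarrow> H ^ l * (S ^ k * f) - g \<in> J)" if f: "f \<in> D" for f
  proof -
    obtain N where "order_le 0 (r + N) f" using order_le_exists by blast
    then obtain k g1 where g1: "g1 \<in> D" "order_le 0 r g1" "\<And>J. dideal \<delta> D J \<Longrightarrow> hh \<in> J \<Longrightarrow> S ^ k * f - g1 \<in> J"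
      using partial_reduction[OF d D hD(1,4) f] unfolding S_def z_def by blast
    have "up z hh \<noteq> 0" using hD(2) by simp
    then obtain l s g where g: "s \<in> polys_over D0" "g \<in> polys_over D0" "smult (H ^ l) (up z g1) = s * up z hh + g"
      "g = 0 \<or> degree g < degree (up z hh)"
      using pseudo_division[OF D0R upD0[OF hD(1,4)] _ upD0[OF g1(1,2)]] unfolding H_def by blast
    have eq: "H ^ l * g1 = em s * hh + em g" using arg_cong[OF g(3), of em] by (simp add: emD em_smult em_up)
    have "H ^ l * (S ^ k * f) - em g \<in> J" if J: "dideal \<delta> D J" "hh \<in> J" for J
    proof -
      have "H ^ l * (S ^ k * f) - em g = H ^ l * (S ^ k * f - g1) + em s * hh"
        using eq by (simp add: algebra_simps)
      also have "\<dots> \<in> J"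
        using J g1(3)[OF J] em_in(1)[OF g(1)] DD(7)[OF HD, of l] unfolding dideal_def by blast
      finally show ?thesis .
    qed
    moreover have "em g = 0 \<or> mdeg z (em g) < mdeg z hh"
      using g(4) em_in(3)[OF g(2)] by (auto simp: mdeg_def emD)
    ultimately show ?thesis using em_in[OF g(2)] by blast
  qed
  obtain h s0 h0 where lift: "h \<in> A" "pv b h = hh" "s0 \<in> A" "pv b s0 = S" "h0 \<in> A" "pv b h0 = H"
    using hD(1) SD HD unfolding D_def by blast
  show ?thesis
  proof (rule that[of h r "h0 * s0"])
    show "h \<in> A" by (rule lift(1))
    show "(0, r) \<in> mvars (pv b h)" "order_le 0 r (pv b h)" using zh hD(4) by (simp_all add: lift(2) z_def)
    show "dval \<delta> h (tup (c # b)) = 0" using hD(3) ev_pv[of h] by (simp add: lift(2))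
    show "dval \<delta> (mpartial (0, r) (pv b h)) (\<lambda>_. c) \<noteq> 0" using S by (simp add: lift(2) S_def ev_def z_def)
    show "h0 * s0 \<in> A" by (intro AD lift)
    have "ev (pv b (h0 * s0)) \<noteq> 0" using S H by (simp add: pv_hom lift evD)
    then show "dval \<delta> (h0 * s0) (tup (c # b)) \<noteq> 0" by (simp add: ev_pv)
  next
    show "\<forall>f\<in>A. \<forall>x. dval \<delta> f (tup (c # b)) = 0 \<longrightarrow> dval \<delta> h (tup (x # b')) = 0 \<longrightarrow>
      dval \<delta> (h0 * s0) (tup (x # b')) \<noteq> 0 \<longrightarrow> dval \<delta> f (tup (x # b')) = 0"
    proof (intro ballI allI impI)
    fix f x assume f: "f \<in> A" "dval \<delta> f (tup (c # b)) = 0" and x: "dval \<delta> h (tup (x # b')) = 0"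
      "dval \<delta> (h0 * s0) (tup (x # b')) \<noteq> 0"
    obtain k l g where g: "g \<in> D" "order_le 0 r g" "g = 0 \<or> mdeg z g < mdeg z hh"
      "\<And>J. dideal \<delta> D J \<Longrightarrow> hh \<in> J \<Longrightarrow> H ^ l * (S ^ k * pv b f) - g \<in> J"
      using red[of "pv b f"] f(1) unfolding D_def by blast
    have "H ^ l * (S ^ k * pv b f) - g \<in> P" using g(4)[OF dP] hD by (simp add: P_def)
    then have "ev g = 0" using f(2) by (simp add: P_def evD ev_pv)
    then have g0: "g = 0" using min2[OF g(1) _ g(2)] g(3) by blast
    have "hh \<in> J x" using J_iff[OF lift(1)] x(1) lift(2) by blast
    then have "pv b (h0 ^ l * (s0 ^ k * f)) \<in> J x" using g(4)[OF dJ] g0 by (simp add: pv_hom lift)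
    moreover have "h0 ^ l * (s0 ^ k * f) \<in> A" by (intro AD lift f)
    ultimately have "dval \<delta> (h0 ^ l * (s0 ^ k * f)) (tup (x # b')) = 0" using J_iff by blast
    then show "dval \<delta> f (tup (x # b')) = 0" using x(2) by (auto simp: dval_hom)
    qed
  next
    show "\<forall>g\<in>A. dval \<delta> g (tup (c # b)) \<noteq> 0 \<longrightarrow> (\<exists>C\<in>A. pv b C \<noteq> 0 \<and> mvars (pv b C) \<subseteq> {0} \<times> {..<r} \<and>
      (\<forall>x. dval \<delta> h (tup (x # b')) = 0 \<longrightarrow> dval \<delta> C (tup (x # b')) \<noteq> 0 \<longrightarrow> dval \<delta> g (tup (x # b')) \<noteq> 0))"
    proof (intro ballI impI)
    fix g assume gA: "g \<in> A" "dval \<delta> g (tup (c # b)) \<noteq> 0"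
    obtain k l g2 where g: "g2 \<in> D" "order_le 0 r g2"
      "\<And>J. dideal \<delta> D J \<Longrightarrow> hh \<in> J \<Longrightarrow> H ^ l * (S ^ k * pv b g) - g2 \<in> J"
      using red[of "pv b g"] gA(1) unfolding D_def by blast
    have "H ^ l * (S ^ k * pv b g) - g2 \<in> P" using g(3)[OF dP] hD by (simp add: P_def)
    then have g2: "ev g2 \<noteq> 0" using gA(2) S H by (auto simp: P_def evD ev_pv)
    \<comment> \<open>A combination of \<open>g2\<close> and \<open>hh\<close> free of the
      derivative of order \<open>r\<close> is wanted, since Blum's axiom admits only an inequation
      of lower order.\<close>
    obtain m u w s t k' l' where m: "m \<noteq> 0" "m = u * up z g2 + w * up z hh" "m \<in> polys_over D0" "u \<in> polys_over D0"
      "w \<in> polys_over D0" "s \<in> polys_over D0" "t \<in> polys_over D0" "smult (lead_coeff m ^ k') (up z g2) = s * m"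
      "smult (lead_coeff m ^ l') (up z hh) = t * m"
      by (rule poly_bezout[OF D0R upD0[OF g(1,2)] upD0[OF hD(1,4)]]) (use hD(2) in auto)
    define a where "a = lead_coeff m"
    have a: "a \<in> D0" "a \<noteq> 0" using m(1,3) by (auto simp: a_def polys_over_def)
    have eva: "ev a \<noteq> 0" using D0min[OF a(1)] a(2) by blast
    have 1: "a ^ k' * g2 = em s * em m" using arg_cong[OF m(8), of em] by (simp add: emD em_smult em_up a_def)
    have 2: "a ^ l' * hh = em t * em m" using arg_cong[OF m(9), of em] by (simp add: emD em_smult em_up a_def)
    have evm: "ev (em m) \<noteq> 0" using arg_cong[OF 1, of ev] eva g2 by (auto simp: evD)
    then have evt: "ev (em t) = 0" using arg_cong[OF 2, of ev] hD(3) by (auto simp: evD)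
    have tn: "t \<noteq> 0" using m(9) hD(2) a(2) by (auto simp: a_def)
    \<comment> \<open>Otherwise the cofactor \<open>t\<close> in \<open>m(9)\<close> would have
      smaller degree than \<open>hh\<close> and vanish at \<open>c\<close>, against
      minimality.\<close>
    have "degree m = 0"
    proof (rule ccontr)
      assume "degree m \<noteq> 0"
      moreover have "degree (up z hh) = degree t + degree m"
        using arg_cong[OF m(9), of degree] a(2) tn m(1) by (simp add: a_def degree_mult_eq)
      ultimately have "mdeg z (em t) < mdeg z hh" using em_in(3)[OF m(7)] by (simp add: mdeg_def)
      then have "em t = 0" using min2 em_in(1,2)[OF m(7)] evt by blast
      then have "t = 0" using em_in(3)[OF m(7)] by (simp add: up_hom)
      then show False using tn by blast
    qed
    then obtain C0 where C0: "m = [:C0:]" by (auto elim: degree_eq_zeroE)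
    have C0D: "C0 \<in> D0" "C0 \<noteq> 0" using m(1,3) C0 by (auto simp: polys_over_def dest: spec[of _ 0])
    have C0eq: "C0 = em u * g2 + em w * hh" using arg_cong[OF m(2), of em] by (simp add: emD em_up C0) (simp add: em_def)
    have pre: "\<exists>f. f \<in> A \<and> pv b f = p" if "p \<in> D" for p using that unfolding D_def by blast
    have "C0 \<in> D" using C0D(1) by (simp add: D0_def)
    from pre[OF this] pre[OF em_in(1)[OF m(4)]] pre[OF em_in(1)[OF m(5)]] pre[OF g(1)]
    obtain C u' w' g2' where l: "C \<in> A" "pv b C = C0" "u' \<in> A" "pv b u' = em u" "w' \<in> A" "pv b w' = em w" "g2' \<in> A" "pv b g2' = g2"
      by (elim exE conjE)
    show "\<exists>C\<in>A. pv b C \<noteq> 0 \<and> mvars (pv b C) \<subseteq> {0} \<times> {..<r} \<and>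
      (\<forall>x. dval \<delta> h (tup (x # b')) = 0 \<longrightarrow> dval \<delta> C (tup (x # b')) \<noteq> 0 \<longrightarrow> dval \<delta> g (tup (x # b')) \<noteq> 0)"
    proof (intro bexI[of _ C] conjI allI impI notI)
      show "C \<in> A" by (rule l(1))
      show "mvars (pv b C) \<subseteq> {0} \<times> {..<r}" using C0D(1) by (simp add: l(2) D0_def MP_def)
      show False if "pv b C = 0" using that C0D(2) l(2) by simp
      fix x assume x: "dval \<delta> h (tup (x # b')) = 0" "dval \<delta> C (tup (x # b')) \<noteq> 0" "dval \<delta> g (tup (x # b')) = 0"
      have hJ: "hh \<in> J x" using J_iff[OF lift(1)] x(1) lift(2) by blast
      have "pv b (h0 ^ l * (s0 ^ k * g) - g2') \<in> J x" using g(3)[OF dJ hJ] by (simp add: pv_hom lift l)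
      moreover have "h0 ^ l * (s0 ^ k * g) - g2' \<in> A" by (intro AD lift l gA)
      ultimately have "dval \<delta> (h0 ^ l * (s0 ^ k * g) - g2') (tup (x # b')) = 0" using J_iff by blast
      then have z2: "dval \<delta> g2' (tup (x # b')) = 0" using x(3) by (simp add: dval_hom)
      have "pv b (C - (u' * g2' + w' * h)) = 0" using C0eq by (simp add: pv_hom l lift)
      then have "pv b (C - (u' * g2' + w' * h)) \<in> J x" using dJ[of x] by (simp add: dideal_def)
      moreover have "C - (u' * g2' + w' * h) \<in> A" by (intro AD lift l)
      ultimately have "dval \<delta> (C - (u' * g2' + w' * h)) (tup (x # b')) = 0" using J_iff by blast
      then show False using z2 x(1,2) by (simp add: dval_hom)
    qed
    qed
  qed
qed

text \<open>If \<open>c\<close> satisfies no nontrivial relation over \<open>b\<close>, a point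
  where \<open>pv b' g\<close> does not vanish is enough. Otherwise a solution over
  \<open>b'\<close> of the minimal relation \<open>h\<close> at which \<open>C\<close> is nonzero
  satisfies the given finite part of the type, and Blum's axiom provides it because \<open>C\<close>
  has lower order.\<close>

theorem extend_type:
  assumes e: "eqtp K b b'"
  shows "\<exists>c'. eqtp K (c # b) (c' # b')"
proof -
  let ?A = "MP K ({..<Suc (length b)} \<times> UNIV)"
  have len: "length b' = length b" using e by (simp add: eqtp_def)
  have AR: "subring_set ?A" by (rule subring_MP[OF KR])
  let ?P = "{f \<in> ?A. dval \<delta> f (tup (c # b)) = 0}" and ?N = "{f \<in> ?A. dval \<delta> f (tup (c # b)) \<noteq> 0}"
  have "\<exists>ys. length ys = 1 \<and> (\<forall>f\<in>?P. dval \<delta> f (tup (ys @ b')) = 0) \<and> (\<forall>f\<in>?N. dval \<delta> f (tup (ys @ b')) \<noteq> 0)"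
  proof (rule realise_polynomials[OF sat inf KR small])
    fix P0 N0 assume *: "finite P0" "P0 \<subseteq> ?P" "finite N0" "N0 \<subseteq> ?N"
    define g where "g = \<Prod>N0"
    have gA: "g \<in> ?A" unfolding g_def using *(4) by (intro subring_set_prod[OF AR]) auto
    have gv: "dval \<delta> g a = (\<Prod>f\<in>N0. dval \<delta> f a)" for a
      unfolding g_def by (rule ring_homo_prod[OF ring_homo_dpol_eval[OF ring_homo_id(1)]])
    have g: "dval \<delta> g (tup (c # b)) \<noteq> 0" unfolding gv using *(3,4) by (auto simp: prod_zero_iff)
    have gN: "\<forall>f\<in>N0. dval \<delta> f a \<noteq> 0" if "dval \<delta> g a \<noteq> 0" for a
      using that *(3) unfolding gv by (auto simp: prod_zero_iff)
    have "\<exists>x. (\<forall>f\<in>P0. dval \<delta> f (tup (x # b')) = 0) \<and> dval \<delta> g (tup (x # b')) \<noteq> 0"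
    proof (cases "\<forall>f\<in>?A. dval \<delta> f (tup (c # b)) = 0 \<longrightarrow> pv b f = 0")
      case True
      have "pv b g \<noteq> 0" using g dval_pv[of b g c] by (auto simp: dval_hom)
      then have "pv b' g \<noteq> 0" using pv_eq_0_iff[OF e gA] by blast
      then obtain x where "dval \<delta> (pv b' g) (\<lambda>_. x) \<noteq> 0" using nonvanishing1[OF pv_MP] by blast
      moreover have "dval \<delta> f (tup (x # b')) = 0" if "f \<in> P0" for f
      proof -
        have "pv b' f = 0" using True pv_eq_0_iff[OF e, of f] that *(2) by blast
        then show ?thesis using dval_pv[of b' f x] by (simp add: dval_hom)
      qed
      ultimately show ?thesis by (auto simp: dval_pv)
    next
      case False
      then obtain f0 where f0: "f0 \<in> ?A" "dval \<delta> f0 (tup (c # b)) = 0" "pv b f0 \<noteq> 0" by blast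
      obtain h r q where h: "h \<in> ?A" "(0, r) \<in> mvars (pv b h)" "order_le 0 r (pv b h)"
          "dval \<delta> h (tup (c # b)) = 0" "dval \<delta> (mpartial (0, r) (pv b h)) (\<lambda>_. c) \<noteq> 0"
        and q: "q \<in> ?A" "dval \<delta> q (tup (c # b)) \<noteq> 0"
        "\<forall>f\<in>?A. \<forall>x. dval \<delta> f (tup (c # b)) = 0 \<longrightarrow> dval \<delta> h (tup (x # b')) = 0 \<longrightarrow>
          dval \<delta> q (tup (x # b')) \<noteq> 0 \<longrightarrow> dval \<delta> f (tup (x # b')) = 0"
        and C: "\<forall>g\<in>?A. dval \<delta> g (tup (c # b)) \<noteq> 0 \<longrightarrow> (\<exists>C\<in>?A. pv b C \<noteq> 0 \<and> mvars (pv b C) \<subseteq> {0} \<times> {..<r} \<and>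
          (\<forall>x. dval \<delta> h (tup (x # b')) = 0 \<longrightarrow> dval \<delta> C (tup (x # b')) \<noteq> 0 \<longrightarrow> dval \<delta> g (tup (x # b')) \<noteq> 0))"
        by (rule minimal_polynomial[OF e f0], rule that)
      have "g * q \<in> ?A" "dval \<delta> (g * q) (tup (c # b)) \<noteq> 0"
        using gA q g by (auto simp: dval_hom intro: subring_setD[OF AR])
      then obtain C where C: "C \<in> ?A" "pv b C \<noteq> 0" "mvars (pv b C) \<subseteq> {0} \<times> {..<r}"
        "\<And>x. dval \<delta> h (tup (x # b')) = 0 \<Longrightarrow> dval \<delta> C (tup (x # b')) \<noteq> 0 \<Longrightarrow> dval \<delta> (g * q) (tup (x # b')) \<noteq> 0"
        using C by blast
      have mv: "mvars (pv b' h) = mvars (pv b h)" "mvars (pv b' C) = mvars (pv b C)" "pv b' C \<noteq> 0"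
        using mvars_pv_eq[OF e] pv_eq_0_iff[OF e] h(1) C(1,2) by auto
      have "\<exists>x. dval \<delta> (pv b' h) (\<lambda>_. x) = 0 \<and> dval \<delta> (pv b' C) (\<lambda>_. x) \<noteq> 0"
      proof (rule blum[OF pv_MP, of r])
        show "(0, r) \<in> mvars (pv b' h)" "order_le 0 r (pv b' h)" using h(2,3) mv(1) by (auto simp: order_le_def)
        show "pv b' C \<in> MP UNIV ({0} \<times> {..<r})" "pv b' C \<noteq> 0" using C(3) mv by (auto simp: MP_def mcoeffs_in_def)
      qed
      then obtain x where x: "dval \<delta> h (tup (x # b')) = 0" "dval \<delta> C (tup (x # b')) \<noteq> 0" by (auto simp: dval_pv)
      then have gq: "dval \<delta> g (tup (x # b')) \<noteq> 0" "dval \<delta> q (tup (x # b')) \<noteq> 0" using C(4)[OF x] by (auto simp: dval_hom)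
      moreover have "dval \<delta> f (tup (x # b')) = 0" if "f \<in> P0" for f
        using q(3) x(1) gq(2) subsetD[OF *(2) that] by blast
      ultimately show ?thesis by blast
    qed
    then obtain x where "\<forall>f\<in>P0. dval \<delta> f (tup (x # b')) = 0" "dval \<delta> g (tup (x # b')) \<noteq> 0" by blast
    then show "\<exists>ys. length ys = 1 \<and> (\<forall>f\<in>P0. dval \<delta> f (tup (ys @ b')) = 0) \<and> (\<forall>f\<in>N0. dval \<delta> f (tup (ys @ b')) \<noteq> 0)"
      using gN by (intro exI[of _ "[x]"]) auto
  qed (auto simp: len)
  then obtain ys where ys: "length ys = 1" "\<forall>f\<in>?P. dval \<delta> f (tup (ys @ b')) = 0" "\<forall>f\<in>?N. dval \<delta> f (tup (ys @ b')) \<noteq> 0" by blast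
  obtain c' where c': "ys = [c']" using ys(1) by (auto simp: length_Suc_conv)
  then show ?thesis using ys(2,3) len by (intro exI[of _ c']) (auto simp: eqtp_def)
qed

corollary extend_types:
  assumes "eqtp K b b'"
  shows "\<exists>ys'. length ys' = length ys \<and> eqtp K (ys @ b) (ys' @ b')"
proof (induction ys)
  case (Cons y ys)
  then obtain ys' where ys': "length ys' = length ys" "eqtp K (ys @ b) (ys' @ b')" by blast
  obtain y' where "eqtp K (y # ys @ b) (y' # ys' @ b')" using extend_type[OF ys'(2)] by blast
  then show ?case using ys'(1) by (intro exI[of _ "y' # ys'"]) auto
qed (use assms in auto)

end

section \<open>Conjugates of an element outside \<open>K\<close>\<close>

lemma exists_root:
  fixes q :: "'u poly"
  assumes "degree q > 0"
  shows "\<exists>x. poly q x = 0"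
proof -
  define f where "f = (\<Sum>i\<le>degree q. mconst (coeff q i) * mvar (0, 0) ^ i :: 'u dpol)"
  have val: "dval \<delta> f (\<lambda>_. a) = poly q a" for a
    by (simp add: f_def ring_homo_sum[OF ring_homo_dpol_eval[OF ring_homo_id(1)]] dval_hom poly_altdef)
  note M = subring_setD[OF subring_MP[OF subring_set_UNIV]]
  have f: "f \<in> MP UNIV {(0, 0)}" unfolding f_def
    by (intro subring_set_sum subring_MP M MP_mconst MP_mvar) auto
  have "mvars f \<noteq> {}"
  proof
    assume "mvars f = {}"
    then obtain c where "f = mconst c" using mvars_empty_iff by blast
    then have "poly q a = poly [:c:] a" for a using val[of a] by simp
    then have "q = [:c:]" using poly_eq_poly_eq_iff[of q "[:c:]"] by blast
    then show False using assms by simp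
  qed
  then have "(0, 0) \<in> mvars f" "order_le 0 0 f" "f \<in> MP UNIV ({0} \<times> UNIV)"
    using f by (auto simp: MP_def order_le_def)
  \<comment> \<open>Blum's axiom in order 0 with the inequation of 1, which expresses that the field
    is algebraically closed.\<close>
  moreover have "(1 :: 'u dpol) \<in> MP UNIV ({0} \<times> {..<0})" by (rule M)
  ultimately have "\<exists>x. dval \<delta> f (\<lambda>_. x) = 0 \<and> dval \<delta> 1 (\<lambda>_. x) \<noteq> 0" by (intro blum) auto
  then show ?thesis by (auto simp: val)
qed

lemma order_0_poly:
  assumes K: "subring_set K" and h: "h \<in> MP K {(0, 0)}"
  shows "\<exists>p\<in>polys_over K. \<forall>x. poly p x = dval \<delta> h (\<lambda>_. x) \<and> poly (pderiv p) x = dval \<delta> (mpartial (0, 0) h) (\<lambda>_. x)"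
  using K h
proof (induction rule: MP_induct)
  case (const c)
  then show ?case using subring_setD(1)[OF K]
    by (intro bexI[of _ "[:c:]"]) (auto simp: dpol_eval_def intro!: polys_over_pCons polys_over_0)
next
  case (var v)
  then have "poly [:0, 1:] x = dval \<delta> (mvar v) (\<lambda>_. x)" "poly (pderiv [:0, 1:]) x = dval \<delta> (mpartial (0, 0) (mvar v)) (\<lambda>_. x)" for x
    by (simp_all add: mpartial_mvar pderiv_pCons dval_hom)
  moreover have "[:0, 1:] \<in> polys_over K" by (intro polys_over_pCons polys_over_0 subring_setD[OF K])
  ultimately show ?case by blast
next
  case (add f g)
  then obtain p q where "p \<in> polys_over K" "q \<in> polys_over K"
    "\<forall>x. poly p x = dval \<delta> f (\<lambda>_. x) \<and> poly (pderiv p) x = dval \<delta> (mpartial (0, 0) f) (\<lambda>_. x)"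
    "\<forall>x. poly q x = dval \<delta> g (\<lambda>_. x) \<and> poly (pderiv q) x = dval \<delta> (mpartial (0, 0) g) (\<lambda>_. x)" by blast
  then have "poly (p + q) x = dval \<delta> (f + g) (\<lambda>_. x)" "p + q \<in> polys_over K"
    "poly (pderiv (p + q)) x = dval \<delta> (mpartial (0, 0) (f + g)) (\<lambda>_. x)" for x
    by (simp_all add: dval_hom pderiv_add mpartial_add subring_setD[OF subring_polys_over[OF K]])
  then show ?case by blast
next
  case (mult f g)
  then obtain p q where "p \<in> polys_over K" "q \<in> polys_over K"
    "\<forall>x. poly p x = dval \<delta> f (\<lambda>_. x) \<and> poly (pderiv p) x = dval \<delta> (mpartial (0, 0) f) (\<lambda>_. x)"
    "\<forall>x. poly q x = dval \<delta> g (\<lambda>_. x) \<and> poly (pderiv q) x = dval \<delta> (mpartial (0, 0) g) (\<lambda>_. x)" by blast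
  then have "poly (p * q) x = dval \<delta> (f * g) (\<lambda>_. x)" "p * q \<in> polys_over K"
    "poly (pderiv (p * q)) x = dval \<delta> (mpartial (0, 0) (f * g)) (\<lambda>_. x)" for x
    by (simp_all add: dval_hom pderiv_mult derivation_mult[OF derivation_mpartial] subring_setD[OF subring_polys_over[OF K]] algebra_simps)
  then show ?case by blast
qed

text \<open>Three cases. If \<open>e\<close> satisfies no relation over \<open>K\<close>, or one of
  positive minimal order, the factor \<open>?y\<close> in the inequation excludes \<open>e\<close>.
  In order 0, \<open>e\<close> is a simple root of a polynomial over \<open>K\<close> that, as
  \<open>e\<close> is not in \<open>K\<close>, has another root.\<close>

theorem move_element:
  assumes K: "diff_subfield \<delta> K" "small K" and e: "e \<notin> K"
  shows "\<exists>e'. e' \<noteq> e \<and> eqtp K [e] [e']"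
proof -
  note R = KR[OF K]
  have F: "subfield_set K" using K(1) by (simp add: diff_subfield_def)
  let ?A = "MP K ({..<Suc (length ([] :: 'u list))} \<times> UNIV) :: 'u dpol set"
  have AR: "subring_set ?A" by (rule subring_MP[OF R])
  have e0: "eqtp K [] []" by (simp add: eqtp_def)
  \<comment> \<open>The unknown has index 0 and the parameter \<open>e\<close> index 1, so
    \<open>\<epsilon>\<close> being nonzero states that the new element differs from
    \<open>e\<close>.\<close>
  define \<epsilon> where "\<epsilon> = (mvar (0, 0) - mvar (1, 0) :: 'u dpol)"
  let ?P = "{f \<in> ?A. dval \<delta> f (tup [e]) = 0}" and ?N = "{f \<in> ?A. dval \<delta> f (tup [e]) \<noteq> 0}"
  have two: "dval \<delta> f (tup [x, e]) = dval \<delta> f (tup [x])" if "f \<in> ?A" for f x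
    by (rule dval_cong) (use that in \<open>auto simp: MP_def nth_default_def less_Suc_eq\<close>)
  have \<epsilon>: "dval \<delta> \<epsilon> (tup [x, e]) = x - e" for x by (simp add: \<epsilon>_def dval_hom nth_default_def)
  have "\<exists>ys. length ys = 1 \<and> (\<forall>f\<in>?P. dval \<delta> f (tup (ys @ [e])) = 0) \<and> (\<forall>f\<in>insert \<epsilon> ?N. dval \<delta> f (tup (ys @ [e])) \<noteq> 0)"
  proof (rule realise_polynomials[OF sat inf R K(2)])
    have sub: "?A \<subseteq> MP K ({..<1 + length [e]} \<times> UNIV)" by (rule MP_mono) auto
    then show "?P \<subseteq> MP K ({..<1 + length [e]} \<times> UNIV)" by blast
    have "\<epsilon> \<in> MP K ({..<1 + length [e]} \<times> UNIV)"
      unfolding \<epsilon>_def by (intro subring_setD[OF subring_MP[OF R]] MP_mvar R) auto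
    then show "insert \<epsilon> ?N \<subseteq> MP K ({..<1 + length [e]} \<times> UNIV)" using sub by blast
    fix P0 N0 assume *: "finite P0" "P0 \<subseteq> ?P" "finite N0" "N0 \<subseteq> insert \<epsilon> ?N"
    define g where "g = \<Prod>(N0 - {\<epsilon>})"
    have gA: "g \<in> ?A" unfolding g_def using *(4) by (intro subring_set_prod[OF AR]) auto
    have gv: "dval \<delta> g a = (\<Prod>f\<in>N0 - {\<epsilon>}. dval \<delta> f a)" for a
      unfolding g_def by (rule ring_homo_prod[OF ring_homo_dpol_eval[OF ring_homo_id(1)]])
    have g: "dval \<delta> g (tup [e]) \<noteq> 0" unfolding gv using *(3,4) by (auto simp: prod_zero_iff)
    have gN: "\<forall>f\<in>N0 - {\<epsilon>}. dval \<delta> f a \<noteq> 0" if "dval \<delta> g a \<noteq> 0" for a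
      using that *(3) unfolding gv by (auto simp: prod_zero_iff)
    let ?y = "mvar (0, 0) - mconst e :: 'u dpol"
    have y: "dval \<delta> ?y (\<lambda>_. x) = x - e" for x by (simp add: dval_hom)
    have yn: "?y \<noteq> 0"
    proof
      assume "?y = 0"
      then show False using y[of "e + 1"] by (simp add: dval_hom)
    qed
    have yM: "?y \<in> MP UNIV ({0} \<times> W)" if "0 \<in> W" for W
      using that by (intro subring_setD[OF subring_MP[OF subring_set_UNIV]] MP_mvar MP_mconst) auto
    have "\<exists>x. x \<noteq> e \<and> (\<forall>f\<in>P0. dval \<delta> f (tup [x]) = 0) \<and> dval \<delta> g (tup [x]) \<noteq> 0"
    proof (cases "\<forall>f\<in>?A. dval \<delta> f (tup [e]) = 0 \<longrightarrow> pv [] f = 0")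
      case True
      have "pv [] g \<noteq> 0" using g dval_pv[of "[]" g e] by (auto simp: dval_hom)
      then have "pv [] g * ?y \<noteq> 0" using yn by simp
      moreover have "pv [] g * ?y \<in> MP UNIV ({0} \<times> UNIV)"
        by (intro subring_setD(5)[OF subring_MP[OF subring_set_UNIV]] pv_MP yM) simp
      ultimately obtain x where "dval \<delta> (pv [] g * ?y) (\<lambda>_. x) \<noteq> 0" using nonvanishing1 by blast
      then have x: "x \<noteq> e" "dval \<delta> g (tup [x]) \<noteq> 0" by (auto simp: dval_hom dval_pv)
      moreover have "dval \<delta> f (tup [x]) = 0" if "f \<in> P0" for f
      proof -
        have "pv [] f = 0" using True that *(2) by blast
        then show ?thesis using dval_pv[of "[]" f x] by (simp add: dval_hom)
      qed
      ultimately show ?thesis by blast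
    next
      case False
      then obtain f0 where f0: "f0 \<in> ?A" "dval \<delta> f0 (tup [e]) = 0" "pv [] f0 \<noteq> 0" by blast
      obtain h r q where h: "h \<in> ?A" "(0, r) \<in> mvars (pv [] h)" "order_le 0 r (pv [] h)"
          "dval \<delta> h (tup [e]) = 0" "dval \<delta> (mpartial (0, r) (pv [] h)) (\<lambda>_. e) \<noteq> 0"
        and q: "q \<in> ?A" "dval \<delta> q (tup [e]) \<noteq> 0"
        "\<forall>f\<in>?A. \<forall>x. dval \<delta> f (tup [e]) = 0 \<longrightarrow> dval \<delta> h (tup [x]) = 0 \<longrightarrow>
          dval \<delta> q (tup [x]) \<noteq> 0 \<longrightarrow> dval \<delta> f (tup [x]) = 0"
        and C: "\<forall>g\<in>?A. dval \<delta> g (tup [e]) \<noteq> 0 \<longrightarrow> (\<exists>C\<in>?A. pv [] C \<noteq> 0 \<and> mvars (pv [] C) \<subseteq> {0} \<times> {..<r} \<and>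
          (\<forall>x. dval \<delta> h (tup [x]) = 0 \<longrightarrow> dval \<delta> C (tup [x]) \<noteq> 0 \<longrightarrow> dval \<delta> g (tup [x]) \<noteq> 0))"
        by (rule minimal_polynomial[OF K e0 f0], rule that)
      have "g * q \<in> ?A" by (rule subring_setD(5)[OF AR gA q(1)])
      moreover have "dval \<delta> (g * q) (tup [e]) \<noteq> 0" using q(2) g by (simp add: dval_hom)
      ultimately obtain C where C: "C \<in> ?A" "pv [] C \<noteq> 0" "mvars (pv [] C) \<subseteq> {0} \<times> {..<r}"
        "\<And>x. dval \<delta> h (tup [x]) = 0 \<Longrightarrow> dval \<delta> C (tup [x]) \<noteq> 0 \<Longrightarrow> dval \<delta> (g * q) (tup [x]) \<noteq> 0"
        using C by blast
      have "\<exists>x. x \<noteq> e \<and> dval \<delta> h (tup [x]) = 0 \<and> dval \<delta> C (tup [x]) \<noteq> 0"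
      proof (cases "r = 0")
        case False
        have "\<exists>x. dval \<delta> (pv [] h) (\<lambda>_. x) = 0 \<and> dval \<delta> (pv [] C * ?y) (\<lambda>_. x) \<noteq> 0"
        proof (rule blum[OF pv_MP h(2,3)])
          have "pv [] C \<in> MP UNIV ({0} \<times> {..<r})" using C(3) by (auto simp: MP_def mcoeffs_in_def)
          then show "pv [] C * ?y \<in> MP UNIV ({0} \<times> {..<r})"
            using False by (intro subring_setD(5)[OF subring_MP[OF subring_set_UNIV]] yM) auto
          show "pv [] C * ?y \<noteq> 0" using C(2) yn by simp
        qed
        then show ?thesis by (auto simp: dval_hom dval_pv)
      next
        case r0: True
        obtain k where k: "pv [] C = mconst k" using C(3) r0 mvars_empty_iff[of "pv [] C"] by auto
        then have "k \<noteq> 0" using C(2) by auto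
        then have Cx: "dval \<delta> C (tup [x]) \<noteq> 0" for x using dval_pv[of "[]" C x] k by simp
        have pvh: "pv [] h = h"
        proof (rule ring_homo_eqI[OF R h(1) ring_homo_pv ring_homo_id(2)])
          show "pv [] (mvar v) = mvar v" if "v \<in> {..<Suc (length ([] :: 'u list))} \<times> UNIV" for v
            using that by (cases v) (auto simp: pv_def dsubst_mvar dpol_deriv_funpow_mvar[OF d])
        qed (simp add: pv_def)
        have "h \<in> MP K {(0, 0)}" using h(1,3) r0 pvh by (force simp: MP_def order_le_def)
        then obtain p where p: "p \<in> polys_over K" "\<And>x. poly p x = dval \<delta> h (\<lambda>_. x)"
          "\<And>x. poly (pderiv p) x = dval \<delta> (mpartial (0, 0) h) (\<lambda>_. x)" using order_0_poly[OF R] by blast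
        have hx: "dval \<delta> h (tup [x]) = poly p x" for x using dval_pv[of "[]" h x] pvh p(2) by simp
        have "poly p e = 0" using h(4) hx by simp
        then obtain p1 where p1: "p = [:- e, 1:] * p1" by (auto simp: poly_eq_0_iff_dvd)
        have "poly (pderiv p) e = poly p1 e" by (simp add: p1 pderiv_pCons pderiv_diff pderiv_smult)
        then have p1e: "poly p1 e \<noteq> 0" using h(5) r0 pvh p(3) by simp
        have "degree p1 > 0"
        proof (rule ccontr)
          assume "\<not> degree p1 > 0"
          then obtain k where k: "p1 = [:k:]" by (auto elim: degree_eq_zeroE)
          have c: "coeff p i \<in> K" for i using p(1) by (simp add: polys_over_def)
          \<comment> \<open>The coefficients of a linear \<open>p\<close> would be
            \<open>- (e * k)\<close> and \<open>k\<close>, which would put \<open>e\<close> into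
            \<open>K\<close>.\<close>
          have "e * k \<in> K" "k \<in> K" "k \<noteq> 0"
            using c[of 0] c[of 1] p1e subfieldD(7)[OF F, of "- (e * k)"] by (auto simp: p1 k mult.commute)
          then have "e * k / k \<in> K" by (intro subfieldD(8)[OF F])
          then show False using e \<open>k \<noteq> 0\<close> by simp
        qed
        then obtain x where "poly p1 x = 0" using exists_root by blast
        moreover from this have "x \<noteq> e" using p1e by auto
        ultimately show ?thesis using Cx hx by (intro exI[of _ x]) (auto simp: p1)
      qed
      then obtain x where x: "x \<noteq> e" "dval \<delta> h (tup [x]) = 0" "dval \<delta> C (tup [x]) \<noteq> 0" by blast
      then have gq: "dval \<delta> g (tup [x]) \<noteq> 0" "dval \<delta> q (tup [x]) \<noteq> 0" using C(4)[OF x(2,3)] by (auto simp: dval_hom)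
      moreover have "dval \<delta> f (tup [x]) = 0" if "f \<in> P0" for f
        using q(3) x(2) gq(2) subsetD[OF *(2) that] by blast
      ultimately show ?thesis using x(1) by blast
    qed
    then obtain x where x: "x \<noteq> e" "\<forall>f\<in>P0. dval \<delta> f (tup [x]) = 0" "dval \<delta> g (tup [x]) \<noteq> 0" by blast
    have "\<forall>f\<in>P0. dval \<delta> f (tup [x, e]) = 0" using x(2) two *(2) by auto
    moreover have "\<forall>f\<in>N0. dval \<delta> f (tup [x, e]) \<noteq> 0"
    proof
      fix f assume f: "f \<in> N0"
      show "dval \<delta> f (tup [x, e]) \<noteq> 0"
      proof (cases "f = \<epsilon>")
        case False
        then have "f \<in> ?A" using subsetD[OF *(4) f] by simp
        then show ?thesis using two[of f x] gN[OF x(3)] f False by simp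
      qed (use \<epsilon>[of x] x(1) in simp)
    qed
    ultimately show "\<exists>ys. length ys = 1 \<and> (\<forall>f\<in>P0. dval \<delta> f (tup (ys @ [e])) = 0) \<and> (\<forall>f\<in>N0. dval \<delta> f (tup (ys @ [e])) \<noteq> 0)"
      by (intro exI[of _ "[x]"]) auto
  qed
  then obtain ys where ys: "length ys = 1" "\<forall>f\<in>?P. dval \<delta> f (tup (ys @ [e])) = 0"
    "\<forall>f\<in>insert \<epsilon> ?N. dval \<delta> f (tup (ys @ [e])) \<noteq> 0" by blast
  obtain e' where e': "ys = [e']" using ys(1) by (auto simp: length_Suc_conv)
  have "e' \<noteq> e" using ys(3) \<epsilon>[of e'] e' by auto
  moreover have "eqtp K [e] [e']" using ys(2,3) two[of _ e'] e' by (auto simp: eqtp_def)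
  ultimately show ?thesis by blast
qed

end

section \<open>Linear dependence over a complete variety\<close>

lemma MP_UNIV_I: "f \<in> MP K W \<Longrightarrow> f \<in> MP UNIV W"
  by (simp add: MP_def mcoeffs_in_def)

context universal
begin

text \<open>Multiplied by \<open>x\<close> to avoid the exponent \<open>k - 1\<close>.\<close>

lemma derivation_power: "x * \<delta> (x ^ k) = of_nat k * x ^ k * \<delta> x"
proof (induction k)
  case (Suc k)
  have "x * \<delta> (x ^ Suc k) = x * \<delta> x * x ^ k + x * (x * \<delta> (x ^ k))"
    by (simp add: derivation_simps[OF d] algebra_simps)
  then show ?case unfolding Suc.IH by (simp add: algebra_simps)
qed (simp add: derivation_1[OF d])

lemma dval_sum: "dval \<delta> (sum f A) a = (\<Sum>x\<in>A. dval \<delta> (f x) a)"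
  by (rule ring_homo_sum[OF ring_homo_dpol_eval[OF ring_homo_id(1)]])

subsection \<open>Homogeneous differential polynomials\<close>

lemma d_homogeneousI:
  assumes "\<And>a t. dval \<delta> f (\<lambda>i. if i \<in> I then t * a i else a i) = t ^ e * dval \<delta> f a"
  shows "d_homogeneous \<delta> j I e f"
  unfolding d_homogeneous_def
proof (rule dpol_eq_if_dval_eq)
  fix a
  have "dval \<delta> (dsubst \<delta> (\<lambda>i. if i \<in> I then mvar (j, 0) * mvar (i, 0) else mvar (i, 0)) f) a =
    dval \<delta> f (\<lambda>i. if i \<in> I then a j * a i else a i)"
    unfolding dval_dsubst[OF d] by (intro arg_cong[of _ _ "dval \<delta> f"]) (auto simp: dval_hom fun_eq_iff)
  also have "\<dots> = a j ^ e * dval \<delta> f a" by (rule assms)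
  also have "\<dots> = dval \<delta> (mvar (j, 0) ^ e * f) a" by (simp add: dval_hom)
  finally show "dval \<delta> (dpol_eval mconst (dpol_deriv \<delta>) f (\<lambda>i. if i \<in> I then mvar (j, 0) * mvar (i, 0) else mvar (i, 0))) a =
    dval \<delta> (mvar (j, 0) ^ e * f) a" by (simp add: dsubst_def)
qed

lemma d_homogeneousD:
  assumes h: "d_homogeneous \<delta> j I e f" and f: "f \<in> MP UNIV (W \<times> UNIV)" "j \<notin> W"
  shows "dval \<delta> f (\<lambda>i. if i \<in> I then t * a i else a i) = t ^ e * dval \<delta> f a"
proof -
  let ?a = "a(j := t)"
  have cong: "dval \<delta> f b = dval \<delta> f b'" if "\<And>i. i \<in> W \<Longrightarrow> b i = b' i" for b b'
    by (rule dval_cong) (use f that in \<open>auto simp: MP_def\<close>)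
  have "dval \<delta> f (\<lambda>i. if i \<in> I then t * a i else a i) =
    dval \<delta> f (\<lambda>i. dval \<delta> (if i \<in> I then mvar (j, 0) * mvar (i, 0) else mvar (i, 0)) ?a)"
    using f(2) by (intro cong) (auto simp: dval_hom)
  also have "\<dots> = dval \<delta> (dsubst \<delta> (\<lambda>i. if i \<in> I then mvar (j, 0) * mvar (i, 0) else mvar (i, 0)) f) ?a"
    by (rule dval_dsubst[OF d, symmetric])
  also have "\<dots> = dval \<delta> (mvar (j, 0) ^ e * f) ?a"
    using h unfolding d_homogeneous_def dsubst_def by simp
  also have "\<dots> = t ^ e * dval \<delta> f ?a" by (simp add: dval_hom)
  also have "dval \<delta> f ?a = dval \<delta> f a" using f(2) by (intro cong) auto
  finally show ?thesis .
qed

definition homs :: "'u set \<Rightarrow> nat \<Rightarrow> 'u dpol set" where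
  "homs K n = {f \<in> dpols K n. \<exists>e. d_homogeneous \<delta> (Suc n) {..n} e f}"

text \<open>The ideal over \<open>K\<close> of the hyperplane orthogonal to \<open>v\<close>. By
  \<open>generic_vanish_iff\<close> it is the ideal of a generic vector of that hyperplane, and it
  turns out to be the general component sought.\<close>

definition hyper_ideal :: "'u set \<Rightarrow> nat \<Rightarrow> (nat \<Rightarrow> 'u) \<Rightarrow> 'u dpol set" where
  "hyper_ideal K n v = {f \<in> dpols K n. \<forall>b. (\<Sum>i\<le>n. v i * b i) = 0 \<longrightarrow> dval \<delta> f b = 0}"

lemma dval_dpols_cong: "f \<in> dpols K n \<Longrightarrow> (\<And>i. i \<le> n \<Longrightarrow> a i = b i) \<Longrightarrow> dval \<delta> f a = dval \<delta> f b"
  by (rule dval_cong) (auto simp: dpols_def)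

lemma homs_scale:
  assumes "f \<in> homs K n"
  shows "\<exists>e. \<forall>t a. dval \<delta> f (\<lambda>i. t * a i) = t ^ e * dval \<delta> f a"
proof -
  obtain e where e: "d_homogeneous \<delta> (Suc n) {..n} e f" and f: "f \<in> dpols K n" using assms by (auto simp: homs_def)
  have "dval \<delta> f (\<lambda>i. t * a i) = t ^ e * dval \<delta> f a" for t a
  proof -
    have "dval \<delta> f (\<lambda>i. t * a i) = dval \<delta> f (\<lambda>i. if i \<in> {..n} then t * a i else a i)"
      by (rule dval_dpols_cong[OF f]) auto
    also have "\<dots> = t ^ e * dval \<delta> f a"
      by (rule d_homogeneousD[OF e, of "{..n}"]) (use f MP_UNIV_I in \<open>auto simp: dpols_eq_MP\<close>)
    finally show ?thesis .
  qed
  then show ?thesis by blast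
qed

lemma homsI:
  assumes f: "f \<in> dpols K n" and "\<And>a t. dval \<delta> f (\<lambda>i. t * a i) = t ^ e * dval \<delta> f a"
  shows "f \<in> homs K n"
proof -
  have "dval \<delta> f (\<lambda>i. if i \<in> {..n} then t * a i else a i) = t ^ e * dval \<delta> f a" for a t
  proof -
    have "dval \<delta> f (\<lambda>i. if i \<in> {..n} then t * a i else a i) = dval \<delta> f (\<lambda>i. t * a i)"
      by (rule dval_dpols_cong[OF f]) auto
    then show ?thesis by (simp only: assms(2))
  qed
  then have "d_homogeneous \<delta> (Suc n) {..n} e f" by (rule d_homogeneousI)
  then show ?thesis using f by (auto simp: homs_def)
qed

lemma homs_zero_scale: "f \<in> homs K n \<Longrightarrow> dval \<delta> f a = 0 \<Longrightarrow> dval \<delta> f (\<lambda>i. c * a i) = 0"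
  using homs_scale[of f K n] by auto

lemma homs_mult:
  assumes K: "subring_set K" and f: "f \<in> homs K n" and g: "g \<in> homs K n"
  shows "f * g \<in> homs K n"
proof -
  obtain e where e: "\<And>t a. dval \<delta> f (\<lambda>i. t * a i) = t ^ e * dval \<delta> f a" using homs_scale[OF f] by blast
  obtain e' where e': "\<And>t a. dval \<delta> g (\<lambda>i. t * a i) = t ^ e' * dval \<delta> g a" using homs_scale[OF g] by blast
  show ?thesis
  proof (rule homsI[of _ _ _ "e + e'"])
    show "f * g \<in> dpols K n"
      using f g unfolding homs_def dpols_eq_MP by (auto intro: subring_setD(5)[OF subring_MP[OF K]])
    show "dval \<delta> (f * g) (\<lambda>i. t * a i) = t ^ (e + e') * dval \<delta> (f * g) a" for a t
      by (simp add: dval_hom e e' power_add algebra_simps)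
  qed
qed

lemma homs_1: "subring_set K \<Longrightarrow> 1 \<in> homs K n"
  by (rule homsI[of _ _ _ 0]) (auto simp: dval_hom dpols_eq_MP intro: subring_setD(2)[OF subring_MP])

lemma homs_mvar: "subring_set K \<Longrightarrow> j \<le> n \<Longrightarrow> mvar (j, 0) \<in> homs K n"
  by (rule homsI[of _ _ _ 1]) (auto simp: dval_hom dpols_eq_MP intro!: MP_mvar)

lemma d_closed_iff: "d_closed \<delta> K n V \<longleftrightarrow> (\<exists>F\<subseteq>homs K n. V = proj_zeros \<delta> n F)"
  by (simp add: d_closed_def homs_def)

lemma in_proj_point [simp]: "a \<in> proj_point a"
  unfolding proj_point_def by (auto intro!: exI[of _ 1])

lemma proj_space_nonempty: "p \<in> proj_space n \<Longrightarrow> \<exists>a. a \<in> p"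
  unfolding proj_space_def using in_proj_point by blast

lemma proj_spaceE:
  assumes "p \<in> proj_space n" "a \<in> p"
  shows "p = proj_point a" "a \<in> affine_space (Suc n)" "\<exists>j\<le>n. a j \<noteq> 0"
proof -
  obtain b where b: "p = proj_point b" "b \<in> affine_space (Suc n)" "b \<noteq> (\<lambda>_. 0)" using assms(1) by (auto simp: proj_space_def)
  obtain c where c: "c \<noteq> 0" "a = (\<lambda>i. c * b i)" using assms(2) b(1) by (auto simp: proj_point_def)
  have "proj_point a \<subseteq> proj_point b"
  proof
    fix x assume "x \<in> proj_point a"
    then obtain k where "k \<noteq> 0" "x = (\<lambda>i. k * a i)" by (auto simp: proj_point_def)
    then have "k * c \<noteq> 0" "x = (\<lambda>i. (k * c) * b i)" using c by (auto simp: mult.assoc)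
    then show "x \<in> proj_point b" unfolding proj_point_def by blast
  qed
  moreover have "proj_point b \<subseteq> proj_point a"
  proof
    fix x assume "x \<in> proj_point b"
    then obtain k where "k \<noteq> 0" "x = (\<lambda>i. k * b i)" by (auto simp: proj_point_def)
    then have "k / c \<noteq> 0" "x = (\<lambda>i. (k / c) * a i)" using c by auto
    then show "x \<in> proj_point a" unfolding proj_point_def by blast
  qed
  ultimately show "p = proj_point a" using b by auto
  show aff: "a \<in> affine_space (Suc n)" using b(2) c by (auto simp: affine_space_def)
  obtain j where "b j \<noteq> 0" using b(3) by auto
  then have "a j \<noteq> 0" using c by simp
  moreover have "j \<le> n"
  proof (rule ccontr)
    assume "\<not> j \<le> n"
    then have "a j = 0" using aff by (simp add: affine_space_def)
    then show False using \<open>a j \<noteq> 0\<close> by blast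
  qed
  ultimately show "\<exists>j\<le>n. a j \<noteq> 0" by blast
qed

lemma proj_point_in_space: "a \<in> affine_space (Suc n) \<Longrightarrow> a j \<noteq> 0 \<Longrightarrow> proj_point a \<in> proj_space n"
  unfolding proj_space_def by (intro imageI) auto

lemma proj_zeros_iff:
  assumes F: "F \<subseteq> homs K n" and a: "proj_point a \<in> proj_space n"
  shows "proj_point a \<in> proj_zeros \<delta> n F \<longleftrightarrow> (\<forall>f\<in>F. dval \<delta> f a = 0)"
proof
  assume "proj_point a \<in> proj_zeros \<delta> n F"
  then show "\<forall>f\<in>F. dval \<delta> f a = 0" using in_proj_point[of a] unfolding proj_zeros_def by blast
next
  assume z: "\<forall>f\<in>F. dval \<delta> f a = 0"
  have "dval \<delta> f b = 0" if "f \<in> F" "b \<in> proj_point a" for f b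
    using that z F homs_zero_scale[of f K n a] by (auto simp: proj_point_def)
  then show "proj_point a \<in> proj_zeros \<delta> n F" using a unfolding proj_zeros_def by blast
qed

subsection \<open>Generic points\<close>

lemma tup_map_affine: "a \<in> affine_space m \<Longrightarrow> tup (map a [0..<m]) = a"
  by (auto simp: affine_space_def nth_default_def fun_eq_iff)

lemma tup_affine: "tup ys \<in> affine_space (length ys)"
  by (auto simp: affine_space_def nth_default_def)

context
  fixes K :: "'u set" and n :: nat and V :: "(nat \<Rightarrow> 'u) set set"
  assumes K: "diff_subfield \<delta> K" and small: "small K" and V: "d_closed \<delta> K n V"
begin

lemma KR': "subring_set K"
  by (rule diff_subfield_subring[OF K])

lemma V_space: "V \<subseteq> proj_space n"
  using V by (auto simp: d_closed_def proj_zeros_def)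

text \<open>The type demands that the equations of \<open>V\<close> hold and that every form not
  identically zero on \<open>V\<close> is nonzero. Irreducibility makes the set of these forms
  closed under products, so each finite part is satisfied by a point of \<open>V\<close>.\<close>

lemma generic_point_exists:
  assumes irr: "d_irreducible \<delta> K n V"
  shows "\<exists>\<alpha>. generic_point \<delta> K n V \<alpha>"
proof -
  obtain F where F: "F \<subseteq> homs K n" "V = proj_zeros \<delta> n F" using V by (auto simp: d_closed_iff)
  have sub: "homs K n \<subseteq> MP K ({..<Suc n + length ([] :: 'u list)} \<times> UNIV)"
    by (auto simp: homs_def dpols_eq_MP lessThan_Suc_atMost)
  define nv where "nv g \<longleftrightarrow> g \<in> homs K n \<and> (\<exists>p\<in>V. \<exists>a\<in>p. dval \<delta> g a \<noteq> 0)" for g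
  have nv_mult: "nv (g * g')" if g: "nv g" "nv g'" for g g'
  proof (rule ccontr)
    assume n: "\<not> nv (g * g')"
    have gh: "g \<in> homs K n" "g' \<in> homs K n" using g by (auto simp: nv_def)
    have z: "dval \<delta> (g * g') a = 0" if "p \<in> V" "a \<in> p" for p a
      using n that homs_mult[OF KR' gh] unfolding nv_def by blast
    define Z where "Z g = proj_zeros \<delta> n (insert g F)" for g
    have cl: "d_closed \<delta> K n (Z g)" if "g \<in> homs K n" for g unfolding d_closed_iff Z_def using that F(1) by (intro exI[of _ "insert g F"]) auto
    have ss: "Z h \<subset> V" if h: "nv h" for h
    proof -
      obtain p a where pa: "p \<in> V" "a \<in> p" "dval \<delta> h a \<noteq> 0" using h by (auto simp: nv_def)
      have "p \<notin> Z h" using pa(2,3) unfolding Z_def proj_zeros_def by blast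
      moreover have "Z h \<subseteq> V" unfolding Z_def F(2) proj_zeros_def by blast
      ultimately show ?thesis using pa(1) by blast
    qed
    have "V \<subseteq> Z g \<union> Z g'"
    proof
      fix p assume p: "p \<in> V"
      obtain a where a: "a \<in> p" "p = proj_point a"
        using p V_space by (auto simp: proj_space_def)
      have pa: "proj_point a \<in> proj_space n" using a p V_space by auto
      have Fa: "\<forall>f\<in>F. dval \<delta> f a = 0" using p a unfolding F(2) proj_zeros_def by blast
      have "dval \<delta> g a = 0 \<or> dval \<delta> g' a = 0" using z[OF p a(1)] by (simp add: dval_hom)
      then show "p \<in> Z g \<union> Z g'"
        using proj_zeros_iff[of "insert g F" K n a] proj_zeros_iff[of "insert g' F" K n a] F(1) gh pa Fa a(2)
        by (auto simp: Z_def)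
    qed
    then have "V = Z g \<union> Z g'" using ss[OF g(1)] ss[OF g(2)] by blast
    then show False using irr cl[OF gh(1)] cl[OF gh(2)] ss[OF g(1)] ss[OF g(2)] unfolding d_irreducible_def by blast
  qed
  obtain p0 where p0: "p0 \<in> V" using irr by (auto simp: d_irreducible_def)
  then obtain a0 where a0: "a0 \<in> p0" using V_space proj_space_nonempty by blast
  have nv1: "nv 1" using p0 a0 homs_1[OF KR'] by (auto simp: nv_def dval_hom)
  have "\<exists>ys. length ys = Suc n \<and> (\<forall>f\<in>F. dval \<delta> f (tup (ys @ [])) = 0) \<and> (\<forall>f\<in>{g. nv g}. dval \<delta> f (tup (ys @ [])) \<noteq> 0)"
  proof (rule realise_polynomials[OF sat inf KR' small])
    show "F \<subseteq> MP K ({..<Suc n + length ([] :: 'u list)} \<times> UNIV)" by (rule subset_trans[OF F(1) sub])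
    have "{g. nv g} \<subseteq> homs K n" by (auto simp: nv_def)
    then show "{g. nv g} \<subseteq> MP K ({..<Suc n + length ([] :: 'u list)} \<times> UNIV)" using sub by (rule subset_trans)
    fix P0 N0 assume *: "finite P0" "P0 \<subseteq> F" "finite N0" "N0 \<subseteq> {g. nv g}"
    have "nv (\<Prod>N0)" using *(3,4) by (induction N0 rule: finite_induct) (auto intro: nv1 nv_mult)
    then obtain p a where a: "p \<in> V" "a \<in> p" "dval \<delta> (\<Prod>N0) a \<noteq> 0" by (auto simp: nv_def)
    have "dval \<delta> (\<Prod>N0) a = (\<Prod>f\<in>N0. dval \<delta> f a)"
      by (rule ring_homo_prod[OF ring_homo_dpol_eval[OF ring_homo_id(1)]])
    then have "\<forall>f\<in>N0. dval \<delta> f a \<noteq> 0" using a(3) *(3) by (auto simp: prod_zero_iff)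
    moreover have "\<forall>f\<in>P0. dval \<delta> f a = 0" using a(1,2) *(2) unfolding F(2) proj_zeros_def by blast
    moreover have "tup (map a [0..<Suc n]) = a"
      using proj_spaceE(2)[OF _ a(2)] a(1) V_space tup_map_affine by blast
    ultimately show "\<exists>ys. length ys = Suc n \<and> (\<forall>f\<in>P0. dval \<delta> f (tup (ys @ [])) = 0) \<and> (\<forall>f\<in>N0. dval \<delta> f (tup (ys @ [])) \<noteq> 0)"
      by (intro exI[of _ "map a [0..<Suc n]"]) simp
  qed
  then obtain ys where ys: "length ys = Suc n" "\<forall>f\<in>F. dval \<delta> f (tup ys) = 0" "\<And>g. nv g \<Longrightarrow> dval \<delta> g (tup ys) \<noteq> 0" by auto
  let ?v = "tup ys"
  obtain j where j: "j \<le> n" "a0 j \<noteq> 0" using proj_spaceE(3)[OF _ a0] p0 V_space by blast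
  have "nv (mvar (j, 0))" using j p0 a0 homs_mvar[OF KR' j(1)] by (auto simp: nv_def)
  then have "?v j \<noteq> 0" using ys(3) by fastforce
  then have vS: "proj_point ?v \<in> proj_space n" using tup_affine[of ys] ys(1) proj_point_in_space by metis
  then have vV: "proj_point ?v \<in> V" using proj_zeros_iff[OF F(1) vS] ys(2) F(2) by blast
  have "proj_point ?v \<notin> W" if W: "d_closed \<delta> K n W" "W \<subset> V" for W
  proof
    assume vW: "proj_point ?v \<in> W"
    obtain G where G: "G \<subseteq> homs K n" "W = proj_zeros \<delta> n G" using W(1) by (auto simp: d_closed_iff)
    obtain p where p: "p \<in> V" "p \<notin> W" using W(2) by blast
    then obtain g a where "g \<in> G" "a \<in> p" "dval \<delta> g a \<noteq> 0" using V_space unfolding G(2) proj_zeros_def by blast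
    then have "nv g" "g \<in> G" using p(1) G(1) by (auto simp: nv_def)
    then show False using ys(3) vW proj_zeros_iff[OF G(1) vS] G(2) by blast
  qed
  then show ?thesis using vV unfolding generic_point_def by blast
qed

section \<open>Specialising the generic point to other points of \<open>V\<close>\<close>

context
  fixes \<alpha> v
  assumes \<alpha>: "generic_point \<delta> K n V \<alpha>" and v: "v \<in> \<alpha>"
begin

lemma \<alpha>V: "\<alpha> \<in> V"
  using \<alpha> by (simp add: generic_point_def)

lemma generic_vanishes:
  assumes g: "g \<in> homs K n" "dval \<delta> g v = 0" and w: "p \<in> V" "w \<in> p"
  shows "dval \<delta> g w = 0"
proof -
  obtain F where F: "F \<subseteq> homs K n" "V = proj_zeros \<delta> n F" using V by (auto simp: d_closed_iff)
  define W where "W = proj_zeros \<delta> n (insert g F)"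
  have W: "d_closed \<delta> K n W" unfolding d_closed_iff W_def using F(1) g(1) by (intro exI[of _ "insert g F"]) auto
  have WV: "W \<subseteq> V" unfolding W_def F(2) proj_zeros_def by blast
  have s: "\<alpha> = proj_point v" "proj_point v \<in> proj_space n" using proj_spaceE(1)[OF _ v] \<alpha>V V_space by auto
  have "\<forall>f\<in>F. dval \<delta> f v = 0" using \<alpha>V v unfolding F(2) proj_zeros_def by blast
  then have "\<alpha> \<in> W" unfolding W_def s(1) using proj_zeros_iff[OF _ s(2), of "insert g F" K] F(1) g by auto
  then have "W = V" using \<alpha> W WV unfolding generic_point_def by blast
  then show ?thesis using w unfolding W_def proj_zeros_def by blast
qed

lemma homogenise_dehomogenised:
  assumes j: "j \<le> n" and P: "P \<in> dpols K n"
  shows "\<exists>M. \<exists>Q\<in>dpols K n. \<forall>x. x j \<noteq> 0 \<longrightarrow> dval \<delta> Q x = x j ^ M * dval \<delta> P (\<lambda>i. x i / x j)"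
  using KR' P unfolding dpols_eq_MP
proof (induction rule: MP_induct)
  case (const c)
  then show ?case by (intro exI[of _ 0] bexI[of _ "mconst c"]) (auto intro: MP_mconst KR')
next
  let ?A = "MP K ({..n} \<times> UNIV)"
  note M = subring_setD[OF subring_MP[OF KR', of "{..n} \<times> UNIV"]]
  have jA: "mvar (j, s) \<in> ?A" for s using j by (auto intro!: MP_mvar KR')
  {
    case (var u)
    obtain i r where u: "u = (i, r)" by (cases u)
    have i: "i \<le> n" using var u by simp
    have "\<exists>M. \<exists>Q\<in>?A. \<forall>x. x j \<noteq> 0 \<longrightarrow> dval \<delta> Q x = x j ^ M * (\<delta> ^^ r) (x i / x j)"
    proof (induction r)
      case 0
      then show ?case using i by (intro exI[of _ 1] bexI[of _ "mvar (i, 0)"]) (auto intro!: MP_mvar KR')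
    next
      case (Suc r)
      then obtain m Q where Q: "Q \<in> ?A" "\<And>x. x j \<noteq> 0 \<Longrightarrow> dval \<delta> Q x = x j ^ m * (\<delta> ^^ r) (x i / x j)" by blast
      \<comment> \<open>The quotient rule, with \<open>x\<close> for \<open>x j\<close> and
        \<open>y\<close> for the derivative of the quotient reached so far: \<open>x ^ Suc m *
        \<delta> y = x * \<delta> (x ^ m * y) - of_nat m * \<delta> x * (x ^ m * y)\<close>.\<close>
      let ?Q = "mvar (j, 0) * dpol_deriv \<delta> Q - of_nat m * mvar (j, 1) * Q"
      have dQ: "dpol_deriv \<delta> Q \<in> ?A"
        by (rule dpol_deriv_MP[OF d KR' _ _ Q(1)]) (use K in \<open>auto simp: diff_subfield_def\<close>)
      have "?Q \<in> ?A" by (intro M(4,5,8) jA Q(1) dQ)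
      moreover have "dval \<delta> ?Q x = x j ^ Suc m * (\<delta> ^^ Suc r) (x i / x j)" if x: "x j \<noteq> 0" for x
      proof -
        let ?y = "(\<delta> ^^ r) (x i / x j)"
        have "dval \<delta> ?Q x = x j * \<delta> (x j ^ m * ?y) - of_nat m * \<delta> (x j) * (x j ^ m * ?y)"
          using Q(2)[of x, OF x] by (simp add: dval_hom dval_deriv[OF d] ring_homo_of_nat[OF ring_homo_dpol_eval[OF ring_homo_id(1)]])
        also have "\<dots> = (x j * \<delta> (x j ^ m)) * ?y + x j ^ Suc m * \<delta> ?y - of_nat m * \<delta> (x j) * (x j ^ m * ?y)"
          by (simp add: derivation_mult[OF d] algebra_simps)
        also have "\<dots> = x j ^ Suc m * \<delta> ?y" unfolding derivation_power by (simp add: algebra_simps)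
        finally show ?thesis by simp
      qed
      ultimately show ?case by blast
    qed
    then show ?case unfolding u dpol_eval_mvar[OF ring_homo_id(1)] .
  next
    case (add f g)
    then obtain m m' Q Q' where Q: "Q \<in> ?A" "\<And>x. x j \<noteq> 0 \<Longrightarrow> dval \<delta> Q x = x j ^ m * dval \<delta> f (\<lambda>i. x i / x j)"
      "Q' \<in> ?A" "\<And>x. x j \<noteq> 0 \<Longrightarrow> dval \<delta> Q' x = x j ^ m' * dval \<delta> g (\<lambda>i. x i / x j)" by metis
    let ?Q = "mvar (j, 0) ^ m' * Q + mvar (j, 0) ^ m * Q'"
    have "?Q \<in> ?A" by (intro M jA Q)
    moreover have "dval \<delta> ?Q x = x j ^ (m + m') * dval \<delta> (f + g) (\<lambda>i. x i / x j)" if x: "x j \<noteq> 0" for x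
      using Q(2)[of x, OF x] Q(4)[of x, OF x] by (simp add: dval_hom power_add algebra_simps)
    ultimately show ?case by blast
  next
    case (mult f g)
    then obtain m m' Q Q' where Q: "Q \<in> ?A" "\<And>x. x j \<noteq> 0 \<Longrightarrow> dval \<delta> Q x = x j ^ m * dval \<delta> f (\<lambda>i. x i / x j)"
      "Q' \<in> ?A" "\<And>x. x j \<noteq> 0 \<Longrightarrow> dval \<delta> Q' x = x j ^ m' * dval \<delta> g (\<lambda>i. x i / x j)" by metis
    have "Q * Q' \<in> ?A" by (intro M Q)
    moreover have "dval \<delta> (Q * Q') x = x j ^ (m + m') * dval \<delta> (f * g) (\<lambda>i. x i / x j)" if x: "x j \<noteq> 0" for x
      using Q(2)[of x, OF x] Q(4)[of x, OF x] by (simp add: dval_hom power_add algebra_simps)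
    ultimately show ?case by blast
  }
qed

text \<open>The scaling law for \<open>Q\<close> is clear where \<open>x j\<close> and the factor
  are nonzero. After multiplication by both indeterminates it holds everywhere, and cancelling them
  in the integral domain gives homogeneity.\<close>

lemma homogenise:
  assumes j: "j \<le> n" and P: "P \<in> dpols K n"
  shows "\<exists>M. \<exists>Q\<in>homs K n. \<forall>x. x j \<noteq> 0 \<longrightarrow> dval \<delta> Q x = x j ^ M * dval \<delta> P (\<lambda>i. x i / x j)"
proof -
  obtain M Q where Q: "Q \<in> dpols K n" "\<And>x. x j \<noteq> 0 \<Longrightarrow> dval \<delta> Q x = x j ^ M * dval \<delta> P (\<lambda>i. x i / x j)"
    using homogenise_dehomogenised[OF assms] by blast
  define \<theta> where "\<theta> i = (if i \<in> {..n} then mvar (Suc n, 0) * mvar (i, 0) else mvar (i, 0) :: 'u dpol)" for i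
  have "(dsubst \<delta> \<theta> Q - mvar (Suc n, 0) ^ M * Q) * (mvar (Suc n, 0) * mvar (j, 0)) = 0"
  proof (rule dpol_eq_if_dval_eq)
    fix a :: "nat \<Rightarrow> 'u"
    let ?t = "a (Suc n)"
    have "dval \<delta> (dsubst \<delta> \<theta> Q) a = dval \<delta> Q (\<lambda>i. ?t * a i)"
      unfolding dval_dsubst[OF d] by (rule dval_dpols_cong[OF Q(1)]) (simp add: \<theta>_def dval_hom)
    moreover have "dval \<delta> Q (\<lambda>i. ?t * a i) = ?t ^ M * dval \<delta> Q a" if "?t \<noteq> 0" "a j \<noteq> 0"
      using Q(2)[of "\<lambda>i. ?t * a i"] Q(2)[of a] that by (simp add: power_mult_distrib)
    ultimately show "dval \<delta> ((dsubst \<delta> \<theta> Q - mvar (Suc n, 0) ^ M * Q) * (mvar (Suc n, 0) * mvar (j, 0))) a = dval \<delta> 0 a"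
      by (cases "?t = 0 \<or> a j = 0") (auto simp: dval_hom)
  qed
  moreover have "mvar u \<noteq> (0 :: 'u dpol)" for u using mvars_mvar[of u, where 'a = 'u] by force
  ultimately have "dsubst \<delta> \<theta> Q = mvar (Suc n, 0) ^ M * Q" by auto
  then have "d_homogeneous \<delta> (Suc n) {..n} M Q" unfolding d_homogeneous_def dsubst_def \<theta>_def by simp
  then show ?thesis using Q unfolding homs_def by blast
qed

lemma generic_specialises:
  assumes P: "P \<in> dpols K n" and w: "p \<in> V" "w \<in> p" "j \<le> n" "w j \<noteq> 0"
    and z: "dval \<delta> P (\<lambda>i. v i / v j) = 0"
  shows "v j \<noteq> 0" "dval \<delta> P (\<lambda>i. w i / w j) = 0"
proof -
  show vj: "v j \<noteq> 0"
    using generic_vanishes[OF homs_mvar[OF KR' w(3)] _ w(1,2)] w(4) by auto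
  obtain M Q where Q: "Q \<in> homs K n" "\<And>x. x j \<noteq> 0 \<Longrightarrow> dval \<delta> Q x = x j ^ M * dval \<delta> P (\<lambda>i. x i / x j)"
    using homogenise[OF w(3) P] by blast
  have "dval \<delta> Q v = 0" using Q(2)[of v, OF vj] z by simp
  then have "dval \<delta> Q w = 0" using generic_vanishes[OF Q(1) _ w(1,2)] by blast
  then show "dval \<delta> P (\<lambda>i. w i / w j) = 0" using Q(2)[of w, OF w(4)] w(4) by simp
qed

text \<open>
  The indeterminates \<open>y\<^sub>l\<close> and \<open>y\<^sub>n\<^sub>+\<^sub>1\<^sub>+\<^sub>l\<close> stand for the coordinates of a point of \<open>V\<close>, normalised by \<open>y\<^sub>j = 1\<close>,
  and of a vector orthogonal to it, whose coordinate with index \<open>j\<close> is eliminated.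
\<close>

lemma hyper_ideal_vanishes:
  assumes f: "f \<in> hyper_ideal K n v" and w: "p \<in> V" "w \<in> p" and b: "(\<Sum>i\<le>n. w i * b i) = 0"
  shows "dval \<delta> f b = 0"
proof -
  have fK: "f \<in> dpols K n" and fv: "\<And>b. (\<Sum>i\<le>n. v i * b i) = 0 \<Longrightarrow> dval \<delta> f b = 0" using f by (auto simp: hyper_ideal_def)
  obtain j where j: "j \<le> n" "w j \<noteq> 0" using proj_spaceE(3)[OF _ w(2)] w(1) V_space by blast
  have vj: "v j \<noteq> 0"
    using generic_specialises(1)[OF _ w j, of 0] by (simp add: dpols_eq_MP dval_hom subring_setD[OF subring_MP[OF KR']])
  define \<theta> where "\<theta> i = (if i = j then - (\<Sum>l\<in>{..n} - {j}. mvar (l, 0) * mvar (Suc n + l, 0)) else mvar (Suc n + i, 0) :: 'u dpol)" for i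
  define G where "G = dsubst \<delta> \<theta> f"
  let ?J = "{Suc n..Suc n + n}"
  let ?X = "?J \<times> UNIV :: (nat \<times> nat) set"
  let ?W = "({..n} \<union> ?J) \<times> UNIV :: (nat \<times> nat) set"
  note M = subring_MP[OF KR', of ?W]
  have \<theta>: "\<theta> i \<in> MP K ?W" if "i \<in> {..n}" for i
  proof (cases "i = j")
    case True
    have "(\<Sum>l\<in>{..n} - {j}. mvar (l, 0) * mvar (Suc n + l, 0)) \<in> MP K ?W"
      by (intro subring_set_sum[OF M] subring_setD(5)[OF M] MP_mvar KR') auto
    then show ?thesis using True subring_setD(6)[OF M] by (simp add: \<theta>_def)
  next
    case False
    then show ?thesis using that by (auto simp: \<theta>_def intro!: MP_mvar KR')
  qed
  have GK: "G \<in> MP K ?W" unfolding G_def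
    by (rule dsubst_MP[OF d KR' _ fK[unfolded dpols_eq_MP] \<theta>]) (use K in \<open>auto simp: diff_subfield_def\<close>)
  have Gval: "dval \<delta> G c = dval \<delta> f (\<lambda>i. if i = j then - (\<Sum>l\<in>{..n} - {j}. c l * c (Suc n + l)) else c (Suc n + i))" for c
    unfolding G_def dval_dsubst[OF d]
    by (intro arg_cong[of _ _ "dval \<delta> f"]) (auto simp: \<theta>_def dval_hom dval_sum fun_eq_iff)
  have ort: "(\<Sum>i\<le>n. u i * (if i = j then - (\<Sum>l\<in>{..n} - {j}. u l / u j * c l) else c i)) = 0" if u: "u j \<noteq> 0" for u c :: "nat \<Rightarrow> 'u"
  proof -
    have "(\<Sum>i\<le>n. u i * (if i = j then - (\<Sum>l\<in>{..n} - {j}. u l / u j * c l) else c i)) =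
      u j * - (\<Sum>l\<in>{..n} - {j}. u l / u j * c l) + (\<Sum>i\<in>{..n} - {j}. u i * (if i = j then - (\<Sum>l\<in>{..n} - {j}. u l / u j * c l) else c i))"
      using j(1) by (subst sum.remove[of _ j]) auto
    also have "(\<Sum>i\<in>{..n} - {j}. u i * (if i = j then - (\<Sum>l\<in>{..n} - {j}. u l / u j * c l) else c i)) = (\<Sum>i\<in>{..n} - {j}. u i * c i)"
      by (intro sum.cong) auto
    also have "u j * - (\<Sum>l\<in>{..n} - {j}. u l / u j * c l) = - (\<Sum>i\<in>{..n} - {j}. u i * c i)"
      using u by (simp add: sum_distrib_left)
    finally show ?thesis by simp
  qed
  \<comment> \<open>\<open>G\<close> expresses \<open>f\<close> on the hyperplane through the point
    and the free coordinates of the vector; \<open>pe u\<close> inserts the point \<open>u\<close>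
    and keeps the free coordinates as indeterminates.\<close>
  define pe where "pe u = peval ?X (\<lambda>(i, r). (\<delta> ^^ r) (u i / u j)) G" for u :: "nat \<Rightarrow> 'u"
  have pe_val: "dval \<delta> (pe u) c = dval \<delta> G (\<lambda>i. if i \<in> ?J then c i else u i / u j)" for u c
    unfolding pe_def dpol_eval_def meval_peval by (rule meval_cong) (auto simp: case_prod_beta)
  have pe_coef: "coef (pe u) m = dval \<delta> (coef (split_poly ?X G) m) (\<lambda>i. u i / u j)" for u m
    unfolding pe_def coef_peval dpol_eval_def by simp
  have cK: "coef (split_poly ?X G) m \<in> dpols K n" for m
    using coef_split_poly_in[OF KR' GK, of ?X m] MP_mono[OF order_refl, of "?W - ?X" "{..n} \<times> UNIV" K]
    unfolding dpols_eq_MP by auto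
  have "pe v = 0"
  proof (rule dpol_eq_if_dval_eq)
    fix c
    have "dval \<delta> (pe v) c = dval \<delta> f (\<lambda>i. if i = j then - (\<Sum>l\<in>{..n} - {j}. v l / v j * c (Suc n + l)) else c (Suc n + i))"
      unfolding pe_val Gval by (rule dval_dpols_cong[OF fK]) auto
    also have "\<dots> = 0" by (rule fv[OF ort[where u = v, OF vj]])
    finally show "dval \<delta> (pe v) c = dval \<delta> 0 c" by (simp add: dval_hom)
  qed
  \<comment> \<open>The coefficients are differential polynomials over \<open>K\<close> in the point
    alone, so their vanishing passes from the generic point to \<open>w\<close>.\<close>
  then have "dval \<delta> (coef (split_poly ?X G) m) (\<lambda>i. v i / v j) = 0" for m
    using pe_coef[of v m] by simp
  then have "dval \<delta> (coef (split_poly ?X G) m) (\<lambda>i. w i / w j) = 0" for m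
    using generic_specialises(2)[OF cK w j] by blast
  then have "coef (pe w) m = 0" for m using pe_coef[of w m] by simp
  then have "pe w = 0" by (metis lookup_zero poly_mapping_eqI)
  then have 0: "dval \<delta> (pe w) (\<lambda>i. b (i - Suc n)) = 0" by (simp add: dval_hom)
  have bj: "b j = - (\<Sum>l\<in>{..n} - {j}. w l / w j * b l)"
  proof -
    have "(\<Sum>i\<le>n. w i * b i) = w j * b j + (\<Sum>l\<in>{..n} - {j}. w l * b l)" using j(1) by (subst sum.remove[of _ j]) auto
    then have "w j * b j = - (\<Sum>l\<in>{..n} - {j}. w l * b l)" using b by (simp add: eq_neg_iff_add_eq_0)
    also have "\<dots> = w j * - (\<Sum>l\<in>{..n} - {j}. w l / w j * b l)" using j(2) by (simp add: sum_distrib_left)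
    finally show ?thesis by (rule mult_left_cancel[THEN iffD1, OF j(2)])
  qed
  have "dval \<delta> (pe w) (\<lambda>i. b (i - Suc n)) = dval \<delta> f b"
    unfolding pe_val Gval by (rule dval_dpols_cong[OF fK]) (auto simp: bj)
  then show ?thesis using 0 by simp
qed

end

subsection \<open>Descent to the field of definition\<close>

definition ld_points :: "(nat \<Rightarrow> 'u) set" where
  "ld_points = {b \<in> affine_space (Suc n). lin_dependent_over n V b}"

definition ld_ideal :: "'u dpol set" where
  "ld_ideal = {f \<in> dpols UNIV n. \<forall>b\<in>ld_points. dval \<delta> f b = 0}"

lemma of_coefs_eq: "distinct ms \<Longrightarrow> coef (\<Sum>k<length ms. Poly_Mapping.single (ms ! k) (c k)) (ms ! i) = c i" if "i < length ms" for c :: "nat \<Rightarrow> 'u"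
proof -
  assume ms: "distinct ms"
  have "(\<Sum>k<length ms. coef (Poly_Mapping.single (ms ! k) (c k)) (ms ! i)) = (\<Sum>k<length ms. if k = i then c k else 0)"
    using ms that by (intro sum.cong) (auto simp: lookup_single when_def nth_eq_iff_index_eq)
  then show ?thesis using that by (simp add: lookup_sum)
qed

text \<open>For a dependent vector \<open>b'\<close> and a point \<open>w'\<close> of
  \<open>V\<close> witnessing this, the correspondence between \<open>\<mu>'\<close> and
  \<open>\<mu>\<close> extends to \<open>w'\<close> and \<open>b'\<close>. Membership in
  \<open>V\<close> and orthogonality are equations over \<open>K\<close>, so the counterparts are
  again a witness and a dependent vector, at which the polynomial with coefficients
  \<open>\<mu>\<close> vanishes; this transfers back.\<close>

lemma ld_ideal_invariant:
  fixes ms :: "((nat \<times> nat) \<Rightarrow>\<^sub>0 nat) list"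
  assumes e: "eqtp K \<mu> \<mu>'" and len: "length \<mu> = length ms" and ms: "\<And>m. m \<in> set ms \<Longrightarrow> supp m \<subseteq> {..n} \<times> UNIV"
    and f: "(\<Sum>k<length ms. Poly_Mapping.single (ms ! k) (\<mu> ! k)) \<in> ld_ideal"
  shows "(\<Sum>k<length ms. Poly_Mapping.single (ms ! k) (\<mu>' ! k)) \<in> ld_ideal"
proof -
  let ?N = "Suc n" and ?s = "length ms"
  have len': "length \<mu>' = ?s" using e len by (simp add: eqtp_def)
  have mon: "Poly_Mapping.single m (1 :: 'u) \<in> dpols K n" if "m \<in> set ms" for m
    using ms[OF that] subring_setD(1,2)[OF KR'] by (auto simp: dpols_def mcoeffs_in_def mvars_def)
  have val: "dval \<delta> (\<Sum>k<?s. Poly_Mapping.single (ms ! k) (\<nu> ! k)) b = (\<Sum>k<?s. \<nu> ! k * dval \<delta> (Poly_Mapping.single (ms ! k) 1) b)" for \<nu> b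
    unfolding dval_sum by (intro sum.cong refl) (simp add: dpol_eval_def meval_single)
  have "dval \<delta> (\<Sum>k<?s. Poly_Mapping.single (ms ! k) (\<mu>' ! k)) b' = 0" if b': "b' \<in> ld_points" for b'
  proof -
    obtain p w' where w': "p \<in> V" "w' \<in> p" "(\<Sum>i\<le>n. w' i * b' i) = 0" and baff: "b' \<in> affine_space ?N"
      using b' by (auto simp: ld_points_def lin_dependent_over_def)
    have waff: "w' \<in> affine_space ?N" using proj_spaceE(2)[OF _ w'(2)] w'(1) V_space by blast
    define ws' where "ws' = map w' [0..<?N]"
    define bs' where "bs' = map b' [0..<?N]"
    have l': "length ws' = ?N" "length bs' = ?N" by (simp_all add: ws'_def bs'_def)
    obtain ys where ys: "length ys = length (ws' @ bs')" "eqtp K ((ws' @ bs') @ \<mu>') (ys @ \<mu>)"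
      using extend_types[OF K small eqtp_sym[OF e], of "ws' @ bs'"] by blast
    define ws where "ws = take ?N ys"
    define bs where "bs = drop ?N ys"
    have l: "length ws = ?N" "length bs = ?N" "ys = ws @ bs" using ys(1) l' by (auto simp: ws_def bs_def)
    define x' where "x' = tup (ws' @ bs' @ \<mu>')"
    define x where "x = tup (ws @ bs @ \<mu>)"
    have eq: "dval \<delta> g x' = 0 \<longleftrightarrow> dval \<delta> g x = 0" if "g \<in> MP K ({..<?N + ?N + ?s} \<times> UNIV)" for g
      using ys(2) that l l' len' unfolding eqtp_def x'_def x_def by (simp add: add.assoc)
    have x: "x' i = w' i" "x i = tup ws i" "x' (Suc (n + i)) = b' i" "x (Suc (n + i)) = tup bs i" if "i \<le> n" for i
      using that l l' by (auto simp: x_def x'_def nth_append nth_default_def ws'_def bs'_def simp del: upt_Suc)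
    have x\<mu>: "x' (Suc (Suc (n + n + k))) = \<mu>' ! k" "x (Suc (Suc (n + n + k))) = \<mu> ! k" if "k < ?s" for k
      using that l l' len len' by (auto simp: x_def x'_def nth_append nth_default_def)
    obtain F where F: "F \<subseteq> homs K n" "V = proj_zeros \<delta> n F" using V by (auto simp: d_closed_iff)
    have sub: "dpols K n \<subseteq> MP K ({..<?N + ?N + ?s} \<times> UNIV)" unfolding dpols_eq_MP by (rule MP_mono) auto
    have "dval \<delta> f (tup ws) = 0" if f: "f \<in> F" for f
    proof -
      have fK: "f \<in> dpols K n" using f F(1) by (auto simp: homs_def)
      have "dval \<delta> f w' = 0" using w'(1,2) f unfolding F(2) proj_zeros_def by blast
      then have "dval \<delta> f x' = 0" using dval_dpols_cong[OF fK, of x' w'] x by simp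
      then have "dval \<delta> f x = 0" using eq fK sub by blast
      then show ?thesis using dval_dpols_cong[OF fK, of x "tup ws"] x by simp
    qed
    moreover obtain j where j: "j \<le> n" "w' j \<noteq> 0" using proj_spaceE(3)[OF _ w'(2)] w'(1) V_space by blast
    have "tup ws j \<noteq> 0"
      using eq[of "mvar (j, 0)"] x[OF j(1)] j MP_mvar[OF KR', of "(j, 0)" "{..<?N + ?N + ?s} \<times> UNIV"] by auto
    then have ps: "proj_point (tup ws) \<in> proj_space n" using tup_affine[of ws] l(1) proj_point_in_space by metis
    ultimately have pV: "proj_point (tup ws) \<in> V" using proj_zeros_iff[OF F(1) ps] F(2) by blast
    let ?M = "MP K ({..<?N + ?N + ?s} \<times> UNIV)"
    note MR = subring_MP[OF KR', of "{..<?N + ?N + ?s} \<times> UNIV"]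
    have "(\<Sum>i\<le>n. mvar (i, 0) * mvar (?N + i, 0)) \<in> ?M"
      by (intro subring_set_sum[OF MR] subring_setD(5)[OF MR] MP_mvar KR') auto
    from eq[OF this] have "(\<Sum>i\<le>n. tup ws i * tup bs i) = 0"
      using w'(3) by (simp add: dval_sum dval_hom x)
    then have "lin_dependent_over n V (tup bs)"
      unfolding lin_dependent_over_def using pV in_proj_point[of "tup ws"] by blast
    then have "tup bs \<in> ld_points" using tup_affine[of bs] l(2) by (simp add: ld_points_def)
    then have fz: "(\<Sum>k<?s. \<mu> ! k * dval \<delta> (Poly_Mapping.single (ms ! k) 1) (tup bs)) = 0"
      using f unfolding ld_ideal_def by (simp add: val)
    define sh where "sh f = dsubst \<delta> (\<lambda>i. mvar (?N + i, 0)) f" for f :: "'u dpol"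
    have sh_in: "sh f \<in> ?M" if "f \<in> dpols K n" for f
      unfolding sh_def by (rule dsubst_MP[OF d KR' _ that[unfolded dpols_eq_MP]])
        (use K in \<open>auto simp: diff_subfield_def intro!: MP_mvar KR'\<close>)
    have sh_val: "dval \<delta> (sh f) x = dval \<delta> f (tup bs)" "dval \<delta> (sh f) x' = dval \<delta> f b'" if "f \<in> dpols K n" for f
      unfolding sh_def dval_dsubst[OF d] by (rule dval_dpols_cong[OF that]; simp add: x)+
    \<comment> \<open>The polynomial with its coefficients as further unknowns, which makes it one
      over \<open>K\<close>.\<close>
    define \<Phi> where "\<Phi> = (\<Sum>k<?s. mvar (?N + ?N + k, 0) * sh (Poly_Mapping.single (ms ! k) 1))"
    have "\<Phi> \<in> ?M" unfolding \<Phi>_def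
      by (intro subring_set_sum[OF MR] subring_setD(5)[OF MR] MP_mvar KR' sh_in mon) auto
    moreover have "dval \<delta> \<Phi> x = (\<Sum>k<?s. \<mu> ! k * dval \<delta> (Poly_Mapping.single (ms ! k) 1) (tup bs))"
      unfolding \<Phi>_def dval_sum by (intro sum.cong refl) (simp add: dval_hom x\<mu> sh_val mon)
    moreover have "dval \<delta> \<Phi> x' = (\<Sum>k<?s. \<mu>' ! k * dval \<delta> (Poly_Mapping.single (ms ! k) 1) b')"
      unfolding \<Phi>_def dval_sum by (intro sum.cong refl) (simp add: dval_hom x\<mu> sh_val mon)
    ultimately show ?thesis using eq[of \<Phi>] fz by (simp add: val)
  qed
  moreover have "(\<Sum>k<?s. Poly_Mapping.single (ms ! k) (\<mu>' ! k)) \<in> dpols UNIV n"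
    unfolding dpols_eq_MP
  proof (rule subring_set_sum[OF subring_MP[OF subring_set_UNIV]])
    fix k assume "k \<in> {..<?s}"
    then show "Poly_Mapping.single (ms ! k) (\<mu>' ! k) \<in> MP UNIV ({..n} \<times> UNIV)"
      using ms[of "ms ! k"] by (auto simp: MP_def mcoeffs_in_def mvars_def split: if_splits)
  qed
  ultimately show ?thesis by (simp add: ld_ideal_def)
qed

lemma ld_ideal_closed:
  "f \<in> ld_ideal \<Longrightarrow> g \<in> ld_ideal \<Longrightarrow> f - g \<in> ld_ideal" "f \<in> ld_ideal \<Longrightarrow> mconst c * f \<in> ld_ideal"
  unfolding ld_ideal_def dpols_eq_MP
  by (auto simp: dval_hom intro!: subring_setD[OF subring_MP[OF subring_set_UNIV]] MP_mconst)

lemma coef_mconst_mult: "coef (mconst c * f) m = c * coef f m" for f :: "('v, 'u) mpol"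
proof (induction f rule: poly_mapping_add_induct)
  case (single k a)
  then show ?case by (simp add: mconst_def mult_single lookup_single when_def)
qed (simp_all add: lookup_add algebra_simps)

text \<open>An element of minimal support, normalised to have a coefficient 1, is fixed by all specialisations over \<open>K\<close>.\<close>

lemma minimal_support_in_K:
  assumes g: "g \<in> ld_ideal" "g \<noteq> 0" and m0: "coef g m0 = 1"
    and min: "\<And>h. h \<in> ld_ideal \<Longrightarrow> h \<noteq> 0 \<Longrightarrow> supp h \<subseteq> supp g \<Longrightarrow> card (supp g) \<le> card (supp h)"
  shows "g \<in> dpols K n"
proof (rule ccontr)
  assume n: "g \<notin> dpols K n"
  have gU: "g \<in> dpols UNIV n" using g(1) by (simp add: ld_ideal_def)
  then obtain m1 where m1: "m1 \<in> supp g" "coef g m1 \<notin> K" using n by (auto simp: dpols_def mcoeffs_in_def)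
  obtain ms where ms: "set ms = supp g" "distinct ms" using finite_distinct_list[of "supp g"] by auto
  define \<mu> where "\<mu> = map (coef g) ms"
  obtain e' where e': "e' \<noteq> coef g m1" "eqtp K [coef g m1] [e']" using move_element[OF K small m1(2)] by blast
  \<comment> \<open>Conjugation over \<open>K\<close> is extended from one coefficient to all of
    them; the copy of this coefficient at the end ties the conjugate list to
    \<open>e'\<close>.\<close>
  obtain \<mu>' where \<mu>': "length \<mu>' = length \<mu>" "eqtp K (\<mu> @ [coef g m1]) (\<mu>' @ [e'])"
    using extend_types[OF K small e'(2), of \<mu>] by blast
  have len: "length \<mu> = length ms" "length \<mu>' = length ms" using \<mu>'(1) by (simp_all add: \<mu>_def)
  let ?M = "MP K ({..<Suc (length ms)} \<times> UNIV) :: 'u dpol set"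
  note MR = subring_MP[OF KR', of "{..<Suc (length ms)} \<times> (UNIV :: nat set)"]
  have eq: "dval \<delta> f (tup (\<mu> @ [coef g m1])) = 0 \<longleftrightarrow> dval \<delta> f (tup (\<mu>' @ [e'])) = 0" if "f \<in> ?M" for f
    using \<mu>'(2) that len by (simp add: eqtp_def)
  have "eqtp K \<mu> \<mu>'"
    unfolding eqtp_def
  proof (intro conjI ballI)
    fix f :: "'u dpol" assume f: "f \<in> MP K ({..<length \<mu>} \<times> UNIV)"
    have "dval \<delta> f (tup (\<nu> @ [c])) = dval \<delta> f (tup \<nu>)" if "length \<nu> = length \<mu>" for \<nu> c
      by (rule dval_cong) (use f that in \<open>auto simp: MP_def nth_append nth_default_def\<close>)
    moreover have "{..<length \<mu>} \<times> UNIV \<subseteq> {..<Suc (length ms)} \<times> (UNIV :: nat set)" using len by auto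
    then have "f \<in> ?M" using f MP_mono[OF order_refl] by blast
    ultimately show "dval \<delta> f (tup \<mu>) = 0 \<longleftrightarrow> dval \<delta> f (tup \<mu>') = 0"
      using eq[of f] \<mu>'(1) by simp
  qed (simp add: \<mu>'(1))
  define g' where "g' = (\<Sum>k<length ms. Poly_Mapping.single (ms ! k) (\<mu>' ! k))"
  have "g = (\<Sum>m\<in>set ms. Poly_Mapping.single m (coef g m))" using poly_mapping_sum_single[of g] ms(1) by simp
  also have "\<dots> = (\<Sum>k<length ms. Poly_Mapping.single (ms ! k) (coef g (ms ! k)))"
    using sum.reindex_bij_betw[OF bij_betw_nth[OF ms(2) refl refl], of "\<lambda>m. Poly_Mapping.single m (coef g m)"] by simp
  also have "\<dots> = (\<Sum>k<length ms. Poly_Mapping.single (ms ! k) (\<mu> ! k))"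
    by (intro sum.cong refl) (simp add: \<mu>_def)
  finally have g_eq: "g = (\<Sum>k<length ms. Poly_Mapping.single (ms ! k) (\<mu> ! k))" .
  have "g' \<in> ld_ideal" unfolding g'_def
  proof (rule ld_ideal_invariant[OF \<open>eqtp K \<mu> \<mu>'\<close> len(1)])
    show "supp m \<subseteq> {..n} \<times> UNIV" if "m \<in> set ms" for m
      using that ms(1) gU by (auto simp: dpols_def mvars_def)
  qed (use g(1) g_eq in simp)
  then have dl: "g - g' \<in> ld_ideal" using ld_ideal_closed(1) g(1) by blast
  have g'c: "coef g' (ms ! k) = \<mu>' ! k" if "k < length ms" for k
    unfolding g'_def by (rule of_coefs_eq[OF that ms(2)])
  have tl: "tup (\<mu> @ [coef g m1]) k = coef g (ms ! k)" "tup (\<mu>' @ [e']) k = \<mu>' ! k" if "k < length ms" for k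
    using that len by (simp_all add: nth_append nth_default_def \<mu>_def)
  have tl2: "tup (\<mu> @ [coef g m1]) (length ms) = coef g m1" "tup (\<mu>' @ [e']) (length ms) = e'"
    using len by (simp_all add: nth_append nth_default_def)
  obtain k1 where k1: "k1 < length ms" "ms ! k1 = m1" using m1(1) ms(1) by (metis in_set_conv_nth)
  have m0s: "m0 \<in> supp g" using m0 by (auto simp: in_keys_iff)
  then obtain k0 where k0: "k0 < length ms" "ms ! k0 = m0" using ms(1) by (metis in_set_conv_nth)
  have "mvar (k1, 0) - mvar (length ms, 0) \<in> ?M" using k1 by (intro subring_setD(4)[OF MR] MP_mvar KR') auto
  from eq[OF this] have "\<mu>' ! k1 = e'" using tl[OF k1(1)] tl2 k1(2) by (simp add: dval_hom)
  then have "coef g' m1 = e'" using g'c[OF k1(1)] k1(2) by simp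
  then have "coef (g - g') m1 \<noteq> 0" using e'(1) by (simp add: lookup_minus)
  then have nz: "g - g' \<noteq> 0" by auto
  have "mvar (k0, 0) - 1 \<in> ?M" using k0 by (intro subring_setD(2,4)[OF MR] MP_mvar KR') auto
  from eq[OF this] have "\<mu>' ! k0 = 1" using tl[OF k0(1)] k0(2) m0 by (simp add: dval_hom)
  then have "coef g' m0 = 1" using g'c[OF k0(1)] k0(2) by simp
  then have m0n: "m0 \<notin> supp (g - g')" using m0 by (simp add: in_keys_iff lookup_minus)
  have g's: "supp g' \<subseteq> supp g"
  proof
    fix m assume "m \<in> supp g'"
    then have "(\<Sum>k<length ms. coef (Poly_Mapping.single (ms ! k) (\<mu>' ! k)) m) \<noteq> 0"
      by (simp add: g'_def in_keys_iff lookup_sum)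
    then obtain k where "k < length ms" "coef (Poly_Mapping.single (ms ! k) (\<mu>' ! k)) m \<noteq> 0"
      by (meson lessThan_iff sum.neutral)
    then show "m \<in> supp g" using ms(1) nth_mem[of k ms] by (auto simp: lookup_single when_def split: if_splits)
  qed
  have "supp (g - g') \<subseteq> supp g"
  proof
    fix m assume "m \<in> supp (g - g')"
    then have "m \<in> supp g \<or> m \<in> supp g'" by (auto simp: in_keys_iff lookup_minus)
    then show "m \<in> supp g" using g's by blast
  qed
  moreover have "card (supp (g - g')) < card (supp g)"
    using calculation m0s m0n by (intro psubset_card_mono) auto
  ultimately show False using min[OF dl nz] by simp
qed

text \<open>Induction on the size of the support: an element of minimal support inside that of
  \<open>f\<close>, suitably normalised, has coefficients in \<open>K\<close>, and subtracting a
  multiple of it removes a monomial of \<open>f\<close>.\<close>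

lemma ld_ideal_descends:
  assumes c: "\<And>g. g \<in> ld_ideal \<Longrightarrow> g \<in> dpols K n \<Longrightarrow> dval \<delta> g c = 0"
  shows "f \<in> ld_ideal \<Longrightarrow> dval \<delta> f c = 0"
proof (induction "card (supp f)" arbitrary: f rule: less_induct)
  case less
  show ?case
  proof (cases "f = 0")
    case True
    then show ?thesis by (simp add: dval_hom)
  next
    case False
    define T where "T h \<longleftrightarrow> h \<in> ld_ideal \<and> h \<noteq> 0 \<and> supp h \<subseteq> supp f" for h
    have "T f" using less.prems False by (simp add: T_def)
    then obtain g0 where g0: "T g0" "\<And>h. T h \<Longrightarrow> card (supp g0) \<le> card (supp h)"
      using ex_has_least_nat[of T f "\<lambda>h. card (supp h)"] by blast
    obtain m0 where m0: "coef g0 m0 \<noteq> 0" using g0(1) unfolding T_def by (metis lookup_zero poly_mapping_eqI)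
    define g where "g = mconst (inverse (coef g0 m0)) * g0"
    have cg: "coef g m = inverse (coef g0 m0) * coef g0 m" for m by (simp add: g_def coef_mconst_mult)
    have sg: "supp g = supp g0" using m0 by (auto simp: in_keys_iff cg)
    have gl: "g \<in> ld_ideal" using g0(1) ld_ideal_closed(2) by (simp add: T_def g_def)
    have g1: "coef g m0 = 1" using m0 by (simp add: cg)
    then have gn: "g \<noteq> 0" by auto
    have "card (supp g) \<le> card (supp h)" if "h \<in> ld_ideal" "h \<noteq> 0" "supp h \<subseteq> supp g" for h
      using g0 that unfolding T_def sg by blast
    then have "g \<in> dpols K n" using minimal_support_in_K[OF gl gn g1] by blast
    then have gc: "dval \<delta> g c = 0" using c gl by blast
    define f1 where "f1 = f - mconst (coef f m0) * g"
    have "f1 \<in> ld_ideal" unfolding f1_def using less.prems gl by (intro ld_ideal_closed)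
    moreover have "m0 \<in> supp f" using m0 g0(1) by (auto simp: T_def in_keys_iff)
    moreover have "coef f1 m0 = 0" using g1 by (simp add: f1_def lookup_minus coef_mconst_mult)
    then have "m0 \<notin> supp f1" by (simp add: in_keys_iff)
    moreover have "supp f1 \<subseteq> supp f"
    proof
      fix m assume "m \<in> supp f1"
      then have "m \<in> supp f \<or> m \<in> supp g" by (auto simp: f1_def in_keys_iff lookup_minus coef_mconst_mult)
      then show "m \<in> supp f" using g0(1) sg by (auto simp: T_def)
    qed
    ultimately have f1: "f1 \<in> ld_ideal" "supp f1 \<subset> supp f" by blast+
    then have "card (supp f1) < card (supp f)" by (intro psubset_card_mono) auto
    then have "dval \<delta> f1 c = 0" using less.hyps f1(1) by blast
    then show ?thesis using gc by (simp add: f1_def dval_hom)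
  qed
qed

text \<open>Project the incidence variety of points and vectors with vanishing scalar product. Only
  nonzero vectors define points of projective space, which is why the zero vector is left
  out.\<close>

lemma complete_imp_ld_closed:
  assumes comp: "d_complete \<delta> n V"
  shows "\<exists>F0\<subseteq>homs UNIV n. \<forall>b\<in>affine_space (Suc n). \<forall>j. b j \<noteq> 0 \<longrightarrow>
    (lin_dependent_over n V b \<longleftrightarrow> (\<forall>f\<in>F0. dval \<delta> f b = 0))"
proof -
  let ?N = "Suc n"
  define f where "f = (\<Sum>i\<le>n. mvar (i, 0) * mvar (?N + i, 0) :: 'u dpol)"
  have fval: "dval \<delta> f a = (\<Sum>i\<le>n. a i * a (?N + i))" for a by (simp add: f_def dval_sum dval_hom)
  have fM: "f \<in> dpols UNIV (?N + n)" unfolding f_def dpols_eq_MP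
    by (intro subring_set_sum subring_setD(5) subring_MP MP_mvar subring_set_UNIV) auto
  define Z where "Z = {(p, q) \<in> proj_space n \<times> proj_space n. \<forall>f\<in>{f}. \<forall>a\<in>p. \<forall>b\<in>q. dval \<delta> f (join n a b) = 0}"
  have h1: "d_homogeneous \<delta> (Suc (?N + n)) {..n} 1 f"
    by (rule d_homogeneousI) (simp add: fval sum_distrib_left mult.assoc)
  have h2: "d_homogeneous \<delta> (Suc (?N + n)) {?N..?N + n} 1 f"
  proof (rule d_homogeneousI)
    fix a and t :: 'u
    show "dval \<delta> f (\<lambda>i. if i \<in> {?N..?N + n} then t * a i else a i) = t ^ 1 * dval \<delta> f a"
      unfolding fval sum_distrib_left by (intro sum.cong refl) (auto simp: algebra_simps)
  qed
  have Z: "d_closed_prod \<delta> n n Z"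
    unfolding d_closed_prod_def
  proof (intro exI[of _ "{f}"] conjI)
    show "{f} \<subseteq> {f \<in> dpols UNIV (?N + n). (\<exists>e. d_homogeneous \<delta> (Suc (?N + n)) {..n} e f) \<and>
      (\<exists>e. d_homogeneous \<delta> (Suc (?N + n)) {?N..?N + n} e f)}" using fM h1 h2 by auto
  qed (simp add: Z_def)
  \<comment> \<open>Projective space has no equations and the empty set the equation 1 = 0; together
    they show that projective space is quasiprojective.\<close>
  have "proj_space n = proj_zeros \<delta> n {}" "{} = proj_zeros \<delta> n {1 :: 'u dpol}"
    by (auto simp: proj_zeros_def proj_space_def dval_hom intro!: bexI[of _ "_"] in_proj_point)
  then have "d_closed \<delta> UNIV n (proj_space n)" "d_closed \<delta> UNIV n {}"
    using homs_1[OF subring_set_UNIV, of n] unfolding d_closed_iff by (metis empty_subsetI, metis empty_subsetI insert_subset)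
  then have "quasiprojective \<delta> n (proj_space n)" unfolding quasiprojective_def by blast
  then obtain C where C: "d_closed \<delta> UNIV n C" "snd ` (Z \<inter> V \<times> proj_space n) = C \<inter> proj_space n"
    using comp Z unfolding d_complete_def by blast
  obtain F0 where F0: "F0 \<subseteq> homs UNIV n" "C = proj_zeros \<delta> n F0" using C(1) by (auto simp: d_closed_iff)
  have "lin_dependent_over n V b \<longleftrightarrow> (\<forall>f\<in>F0. dval \<delta> f b = 0)" if b: "b \<in> affine_space ?N" "b j \<noteq> 0" for b j
  proof -
    have bs: "proj_point b \<in> proj_space n" by (rule proj_point_in_space[OF b])
    have jv: "dval \<delta> f (join n a c) = (\<Sum>i\<le>n. a i * c i)" for a c by (simp add: fval join_def)
    have "(p, proj_point b) \<in> Z \<longleftrightarrow> (\<exists>w\<in>p. (\<Sum>i\<le>n. w i * b i) = 0)" if p: "p \<in> V" for p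
    proof
      assume "(p, proj_point b) \<in> Z"
      moreover obtain w where "w \<in> p" using proj_space_nonempty p V_space by blast
      ultimately show "\<exists>w\<in>p. (\<Sum>i\<le>n. w i * b i) = 0" using in_proj_point[of b] by (auto simp: Z_def jv)
    next
      assume "\<exists>w\<in>p. (\<Sum>i\<le>n. w i * b i) = 0"
      then obtain w where w: "w \<in> p" "(\<Sum>i\<le>n. w i * b i) = 0" by blast
      have pw: "p = proj_point w" using proj_spaceE(1)[OF _ w(1)] p V_space by blast
      have "(\<Sum>i\<le>n. x * w i * (y * b i)) = x * y * (\<Sum>i\<le>n. w i * b i)" for x y
        by (simp add: sum_distrib_left algebra_simps)
      then show "(p, proj_point b) \<in> Z" using p V_space bs w(2) by (auto simp: Z_def jv pw proj_point_def)
    qed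
    then have "lin_dependent_over n V b \<longleftrightarrow> proj_point b \<in> snd ` (Z \<inter> V \<times> proj_space n)"
      using bs by (force simp: lin_dependent_over_def)
    also have "\<dots> \<longleftrightarrow> (\<forall>f\<in>F0. dval \<delta> f b = 0)"
      unfolding C(2) F0(2) using bs proj_zeros_iff[OF F0(1) bs] by blast
    finally show ?thesis .
  qed
  then show ?thesis using F0(1) by blast
qed

text \<open>The hyperplane orthogonal to \<open>v\<close> consists of dependent vectors, so the
  elements of \<open>ld_ideal\<close> over \<open>K\<close> lie in \<open>hyper_ideal K n v\<close>.
  With \<open>ld_ideal_descends\<close> a common zero of the latter therefore satisfies the
  equations \<open>F0\<close> of dependence.\<close>

theorem lin_dependent_iff:
  assumes \<alpha>: "generic_point \<delta> K n V \<alpha>" "v \<in> \<alpha>" and comp: "d_complete \<delta> n V" and n: "n \<ge> 1"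
    and c: "c \<in> affine_space (Suc n)"
  shows "lin_dependent_over n V c \<longleftrightarrow> (\<forall>f\<in>hyper_ideal K n v. dval \<delta> f c = 0)"
proof
  assume "lin_dependent_over n V c"
  then show "\<forall>f\<in>hyper_ideal K n v. dval \<delta> f c = 0"
    using hyper_ideal_vanishes[OF \<alpha>] by (auto simp: lin_dependent_over_def)
next
  assume z: "\<forall>f\<in>hyper_ideal K n v. dval \<delta> f c = 0"
  have \<alpha>V: "\<alpha> \<in> V" using \<alpha>(1) by (simp add: generic_point_def)
  have ld: "b \<in> ld_points" if "b \<in> affine_space (Suc n)" "(\<Sum>i\<le>n. v i * b i) = 0" for b
    using that \<alpha>V \<alpha>(2) by (auto simp: ld_points_def lin_dependent_over_def)
  show "lin_dependent_over n V c"
  proof (cases "\<exists>j. c j \<noteq> 0")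
    case False
    then show ?thesis using \<alpha>V \<alpha>(2) by (auto simp: lin_dependent_over_def)
  next
    case True
    then obtain j where j: "c j \<noteq> 0" by blast
    obtain F0 where F0: "F0 \<subseteq> homs UNIV n"
      "\<And>b j. b \<in> affine_space (Suc n) \<Longrightarrow> b j \<noteq> 0 \<Longrightarrow> lin_dependent_over n V b \<longleftrightarrow> (\<forall>f\<in>F0. dval \<delta> f b = 0)"
      using complete_imp_ld_closed[OF comp] by meson
    \<comment> \<open>A nonzero vector orthogonal to \<open>v\<close>, which exists as
      \<open>n \<ge> 1\<close>. The forms in \<open>F0\<close> vanish at it and hence, by scaling
      with 0, at the zero vector.\<close>
    define b0 :: "nat \<Rightarrow> 'u" where "b0 = (if v 0 = 0 then (\<lambda>_. 0)(0 := 1) else (\<lambda>_. 0)(0 := v 1, 1 := - v 0))"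
    have b0: "b0 \<in> affine_space (Suc n)" "\<exists>j. b0 j \<noteq> 0" "(\<Sum>i\<le>n. v i * b0 i) = 0"
    proof -
      show "b0 \<in> affine_space (Suc n)" using n by (auto simp: affine_space_def b0_def)
      show "\<exists>j. b0 j \<noteq> 0" by (cases "v 0 = 0") (auto simp: b0_def intro: exI[of _ 0] exI[of _ 1])
      have "(\<Sum>i\<le>n. v i * b0 i) = (\<Sum>i\<in>{0, 1}. v i * b0 i)"
        using n by (intro sum.mono_neutral_right) (auto simp: b0_def)
      also have "\<dots> = 0" by (simp add: b0_def)
      finally show "(\<Sum>i\<le>n. v i * b0 i) = 0" .
    qed
    have "dval \<delta> f c = 0" if f: "f \<in> F0" for f
    proof (rule ld_ideal_descends)
      have fh: "f \<in> homs UNIV n" using f F0(1) by blast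
      obtain j0 where j0: "b0 j0 \<noteq> 0" using b0(2) by blast
      have "dval \<delta> f b0 = 0" using F0(2)[OF b0(1) j0] ld[OF b0(1,3)] f by (auto simp: ld_points_def)
      then have f0: "dval \<delta> f (\<lambda>_. 0) = 0" using homs_zero_scale[OF fh, of b0 0] by simp
      have "dval \<delta> f b = 0" if b: "b \<in> ld_points" for b
      proof (cases "\<exists>j. b j \<noteq> 0")
        case True
        then show ?thesis using F0(2)[of b] b f by (auto simp: ld_points_def)
      next
        case False
        then have "b = (\<lambda>_. 0)" by auto
        then show ?thesis using f0 by simp
      qed
      then show "f \<in> ld_ideal" using fh by (auto simp: ld_ideal_def homs_def)
      fix g assume g: "g \<in> ld_ideal" "g \<in> dpols K n"
      have "dval \<delta> g b = 0" if "(\<Sum>i\<le>n. v i * b i) = 0" for b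
      proof -
        let ?b = "\<lambda>i. if i \<le> n then b i else 0"
        have "?b \<in> ld_points" using that by (intro ld) (auto simp: affine_space_def)
        then have "dval \<delta> g ?b = 0" using g(1) by (auto simp: ld_ideal_def)
        then show ?thesis using dval_dpols_cong[OF g(2), of b ?b] by simp
      qed
      then have "g \<in> hyper_ideal K n v" using g(2) \<alpha> by (simp add: hyper_ideal_def)
      then show "dval \<delta> g c = 0" using z by blast
    qed
    then show ?thesis using F0(2)[OF c j] by blast
  qed
qed

end

end

section \<open>Kolchin polynomials\<close>

lemma (in matroid_closure) indep_union:
  assumes "finite D" "indep B" "\<And>x. x \<in> D \<Longrightarrow> x \<notin> cl (B \<union> (D - {x}))"
  shows "indep (B \<union> D)" "B \<inter> D = {}"
proof -
  have "indep (B \<union> D)"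
    using assms(1,3)
  proof (induction D rule: finite_induct)
    case (insert x D)
    have "y \<notin> cl (B \<union> (D - {y}))" if "y \<in> D" for y
      using insert.prems[of y] that mono[of "B \<union> (D - {y})" "B \<union> (insert x D - {y})"] by auto
    then have i: "indep (B \<union> D)" by (rule insert.IH)
    have "B \<union> (insert x D - {x}) = B \<union> D" using insert.hyps(2) by auto
    then have x: "x \<notin> cl (B \<union> D)" using insert.prems[of x] by simp
    then have "x \<notin> B \<union> D" using ext[of "B \<union> D"] by auto
    then show ?case using indep_insert_iff[of x "B \<union> D"] i x by simp
  qed (simp add: assms(2))
  then show "indep (B \<union> D)" .
  show "B \<inter> D = {}" using assms(3) ext[of "B \<union> _"] by blast
qed

lemma acl_finitary:
  assumes K: "subfield_set K" and x: "x \<in> acl K S"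
  obtains S0 where "finite S0" "S0 \<subseteq> S" "x \<in> acl K S0"
proof (cases "x \<in> S")
  case True
  then show ?thesis using that[of "{x}"] acl_superset(2)[of "{x}" K] by auto
next
  case False
  have "x \<in> acl K ((\<lambda>v. v) ` S)" using x by simp
  then obtain f k where f: "f \<in> MP K (insert x S)" "meval id (\<lambda>v. v) f = 0" "meval id (\<lambda>v. v) (coeff (up x f) k) \<noteq> 0"
    using relation_if_acl[OF K False, of "\<lambda>v. v"] by blast
  have "f \<in> MP K (insert x (mvars f - {x}))" using f(1) by (auto simp: MP_def)
  then have "x \<in> acl K ((\<lambda>v. v) ` (mvars f - {x}))" by (rule acl_if_relation[OF K _ f(2,3)])
  then show ?thesis using that[of "mvars f - {x}"] f(1) by (auto simp: MP_def)
qed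

lemma nat_decseq_eventually_constant:
  fixes e :: "nat \<Rightarrow> nat"
  assumes "\<And>t. e (Suc t) \<le> e t"
  shows "\<exists>N c. \<forall>t\<ge>N. e t = c"
proof -
  obtain N where N: "\<And>t. e N \<le> e t" using ex_has_least_nat[of "\<lambda>_. True" 0 e] by blast
  have "e t \<le> e N" if "t \<ge> N" for t
    by (rule lift_Suc_antimono_le[of e N t]) (use assms that in auto)
  then show ?thesis using N by (metis le_antisym)
qed

context universal
begin

definition jets :: "nat \<Rightarrow> (nat \<Rightarrow> 'u) \<Rightarrow> nat \<Rightarrow> 'u set" where
  "jets n b t = {(\<delta> ^^ r) (b i) | i r. i \<le> n \<and> r \<le> t}"

lemma finite_jets: "finite (jets n b t)"
proof -
  have "jets n b t = (\<lambda>(i, r). (\<delta> ^^ r) (b i)) ` ({..n} \<times> {..t})" by (auto simp: jets_def)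
  then show ?thesis by simp
qed

lemma jets_mono: "t \<le> t' \<Longrightarrow> jets n b t \<subseteq> jets n b t'"
  unfolding jets_def by (blast intro: le_trans)

lemma deriv_jets: "\<delta> ` jets n b t \<subseteq> jets n b (Suc t)"
proof
  fix x assume "x \<in> \<delta> ` jets n b t"
  then obtain i r where "x = \<delta> ((\<delta> ^^ r) (b i))" "i \<le> n" "r \<le> t" by (auto simp: jets_def)
  then have "x = (\<delta> ^^ Suc r) (b i)" "i \<le> n" "Suc r \<le> Suc t" by auto
  then show "x \<in> jets n b (Suc t)" unfolding jets_def by blast
qed

lemma jets_Suc: "jets n b (Suc t) = jets n b t \<union> (\<lambda>i. (\<delta> ^^ Suc t) (b i)) ` {..n}"
proof
  show "jets n b (Suc t) \<subseteq> jets n b t \<union> (\<lambda>i. (\<delta> ^^ Suc t) (b i)) ` {..n}"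
  proof
    fix x assume "x \<in> jets n b (Suc t)"
    then obtain i r where x: "x = (\<delta> ^^ r) (b i)" "i \<le> n" "r \<le> Suc t" by (auto simp: jets_def)
    then show "x \<in> jets n b t \<union> (\<lambda>i. (\<delta> ^^ Suc t) (b i)) ` {..n}"
      by (cases "r = Suc t") (auto simp: jets_def le_Suc_eq)
  qed
  show "jets n b t \<union> (\<lambda>i. (\<delta> ^^ Suc t) (b i)) ` {..n} \<subseteq> jets n b (Suc t)"
    using jets_mono[of t "Suc t" n b] by (auto simp: jets_def simp del: funpow.simps)
qed

context
  fixes K :: "'u set"
  assumes K: "diff_subfield \<delta> K"
begin

lemma KF: "subfield_set K"
  using K by (simp add: diff_subfield_def)

interpretation acl: matroid_closure "acl K"
  by (rule matroid_acl[OF KF])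

text \<open>
  If the \<open>(t+1)\<close>-st derivatives are algebraic over the lower ones and a set \<open>D\<close> of them, then the \<open>(t+2)\<close>-nd
  derivatives are algebraic over the lower ones and \<open>\<delta> ` D\<close>.
\<close>

lemma jets_increment:
  fixes n b
  defines "f \<equiv> \<lambda>t. trdeg K (field_gen K (jets n b t))"
  shows "\<exists>k. f (Suc t) = f t + k \<and> f (Suc (Suc t)) \<le> f (Suc t) + k"
proof -
  let ?T = "jets n b"
  obtain B where B: "B \<subseteq> ?T t" "acl.indep B" "?T t \<subseteq> acl K B" using acl.basis_exists[OF finite_jets] .
  have fB: "finite B" using B(1) finite_jets finite_subset by blast
  interpret con: matroid_closure "\<lambda>S. acl K (B \<union> S)" by (rule acl.matroid_contract)
  let ?D = "(\<lambda>i. (\<delta> ^^ Suc t) (b i)) ` {..n}"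
  obtain D where D: "D \<subseteq> ?D" "con.indep D" "?D \<subseteq> acl K (B \<union> D)" using con.basis_exists[of ?D] by blast
  have fD: "finite D" using D(1) finite_subset by blast
  have BD: "acl.indep (B \<union> D)" "B \<inter> D = {}"
    using acl.indep_union[OF fD B(2)] D(2) by (auto simp: con.indep_def)
  have T1: "?T (Suc t) \<subseteq> acl K (B \<union> D)"
    unfolding jets_Suc using B(3) D(3) acl.mono[of B "B \<union> D"] by blast
  have f0: "f t = card B" unfolding f_def by (rule trdeg_field_gen[OF KF finite_jets B])
  have f1: "f (Suc t) = card (B \<union> D)" unfolding f_def
    by (rule trdeg_field_gen[OF KF finite_jets _ BD(1) T1]) (use B(1) D(1) in \<open>auto simp: jets_Suc\<close>)
  obtain B2 where B2: "B2 \<subseteq> ?T (Suc (Suc t))" "acl.indep B2" "?T (Suc (Suc t)) \<subseteq> acl K B2"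
    using acl.basis_exists[OF finite_jets] .
  have f2: "f (Suc (Suc t)) = card B2" unfolding f_def by (rule trdeg_field_gen[OF KF finite_jets B2])
  let ?G = "(B \<union> D) \<union> \<delta> ` D"
  have T1G: "?T (Suc t) \<subseteq> acl K ?G" using T1 acl.mono[of "B \<union> D" ?G] by blast
  have "(\<delta> ^^ Suc (Suc t)) (b i) \<in> acl K ?G" if "i \<le> n" for i
  proof -
    have "(\<delta> ^^ Suc t) (b i) \<in> acl K (B \<union> D)" using D(3) that by blast
    then have "\<delta> ((\<delta> ^^ Suc t) (b i)) \<in> acl K ((B \<union> D) \<union> \<delta> ` (B \<union> D))" by (rule acl_deriv[OF d K])
    moreover have "\<delta> ` B \<subseteq> ?T (Suc t)" using B(1) deriv_jets by blast
    then have "(B \<union> D) \<union> \<delta> ` (B \<union> D) \<subseteq> acl K ?G" using T1G acl.ext[of ?G] by blast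
    then have "acl K ((B \<union> D) \<union> \<delta> ` (B \<union> D)) \<subseteq> acl K ?G" by (rule acl.cl_least)
    ultimately have "\<delta> ((\<delta> ^^ Suc t) (b i)) \<in> acl K ?G" by blast
    then show ?thesis by simp
  qed
  then have "?T (Suc (Suc t)) \<subseteq> acl K ?G" unfolding jets_Suc[of n b "Suc t"] using T1G by blast
  then have "card B2 \<le> card ?G" using acl.steinitz(2)[OF _ B2(2), of ?G] B2(1) fB fD by auto
  also have "\<dots> \<le> card (B \<union> D) + card (\<delta> ` D)" by (rule card_Un_le)
  also have "\<dots> \<le> card (B \<union> D) + card D" using card_image_le[OF fD] by simp
  finally show ?thesis using f0 f1 f2 card_Un_disjoint[OF fB fD BD(2)] by (intro exI[of _ "card D"]) simp
qed

text \<open>\<open>kolchin_poly\<close> is a definite description, so it needs existence and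
  uniqueness. The increments of the transcendence degree never increase and so become constant,
  which makes the degree eventually linear in \<open>t\<close>.\<close>

theorem kolchin_poly_exists:
  "\<exists>!\<omega>. \<forall>\<^sub>F t in sequentially. poly \<omega> (of_nat t :: rat) = of_nat (trdeg K (field_gen K (jets n b t)))"
proof -
  define f where "f t = trdeg K (field_gen K (jets n b t))" for t
  obtain e where e: "\<And>t. f (Suc t) = f t + e t \<and> f (Suc (Suc t)) \<le> f (Suc t) + e t"
    using jets_increment[of n b] unfolding f_def by metis
  have "e (Suc t) \<le> e t" for t using e[of t] e[of "Suc t"] by linarith
  then obtain N c where c: "\<And>t. t \<ge> N \<Longrightarrow> e t = c" using nat_decseq_eventually_constant by metis
  have lin: "f (N + k) = f N + k * c" for k
    by (induction k) (use e c in auto)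
  define \<omega> where "\<omega> = [:of_nat (f N) - of_nat N * of_nat c, of_nat c :: rat:]"
  have "poly \<omega> (of_nat t) = of_nat (f t)" if t: "t \<ge> N" for t
  proof -
    obtain k where "t = N + k" using le_Suc_ex[OF t] by blast
    then show ?thesis using lin[of k] by (simp add: \<omega>_def algebra_simps)
  qed
  then have ev: "\<forall>\<^sub>F t in sequentially. poly \<omega> (of_nat t) = of_nat (f t)" unfolding eventually_sequentially by blast
  show ?thesis
  proof (rule ex1I[of _ \<omega>])
    show "\<forall>\<^sub>F t in sequentially. poly \<omega> (of_nat t) = of_nat (trdeg K (field_gen K (jets n b t)))"
      using ev by (simp add: f_def)
    fix \<omega>' :: "rat poly" assume "\<forall>\<^sub>F t in sequentially. poly \<omega>' (of_nat t) = of_nat (trdeg K (field_gen K (jets n b t)))"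
    then have "\<forall>\<^sub>F t in sequentially. poly (\<omega>' - \<omega>) (of_nat t) = 0"
      using ev by eventually_elim (simp add: f_def)
    then obtain M where M: "\<And>t. t \<ge> M \<Longrightarrow> poly (\<omega>' - \<omega>) (of_nat t) = 0" unfolding eventually_sequentially by blast
    have "of_nat ` {M..} \<subseteq> {x. poly (\<omega>' - \<omega>) x = 0}" using M by auto
    moreover have "infinite (of_nat ` {M..} :: rat set)"
      using finite_imageD[of "of_nat :: nat \<Rightarrow> rat" "{M..}"] infinite_Ici by (auto simp: inj_on_def)
    ultimately have "infinite {x. poly (\<omega>' - \<omega>) x = 0}" using finite_subset by blast
    then show "\<omega>' = \<omega>" using poly_roots_finite[of "\<omega>' - \<omega>"] by auto
  qed
qed

text \<open>Constancy makes the transcendence degree stop growing at \<open>t0\<close>, so a basis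
  of the derivatives up to order \<open>t0\<close> is one for all orders.\<close>

lemma kolchin_poly_constant:
  assumes "kolchin_poly \<delta> K n b = [:of_nat d:]"
  obtains B t0 where "finite B" "card B = d" "acl.indep B" "B \<subseteq> jets n b t0" "\<And>t. jets n b t \<subseteq> acl K B"
proof -
  have "\<forall>\<^sub>F t in sequentially. poly (kolchin_poly \<delta> K n b) (of_nat t) = of_nat (trdeg K (field_gen K (jets n b t)))"
    using theI'[OF kolchin_poly_exists[of n b]] unfolding kolchin_poly_def jets_def .
  then obtain t0 where t0: "\<And>t. t \<ge> t0 \<Longrightarrow> trdeg K (field_gen K (jets n b t)) = d"
    unfolding eventually_sequentially assms by auto
  obtain B where B: "B \<subseteq> jets n b t0" "acl.indep B" "jets n b t0 \<subseteq> acl K B" using acl.basis_exists[OF finite_jets] .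
  have fB: "finite B" using B(1) finite_jets finite_subset by blast
  have cB: "card B = d" using trdeg_field_gen[OF KF finite_jets B] t0[of t0] by simp
  have "jets n b t \<subseteq> acl K B" for t
  proof (rule ccontr)
    assume "\<not> jets n b t \<subseteq> acl K B"
    then obtain x where x: "x \<in> jets n b t" "x \<notin> acl K B" by blast
    let ?t = "max t t0"
    obtain B2 where B2: "B2 \<subseteq> jets n b ?t" "acl.indep B2" "jets n b ?t \<subseteq> acl K B2" using acl.basis_exists[OF finite_jets] .
    have fB2: "finite B2" using B2(1) finite_jets finite_subset by blast
    have cB2: "card B2 = d" using trdeg_field_gen[OF KF finite_jets B2] t0[of ?t] by simp
    have xB: "x \<notin> B" using x(2) acl.ext[of B] by blast
    have "acl.indep (insert x B)" using acl.indep_insert_iff[OF xB] B(2) x(2) by blast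
    moreover have "insert x B \<subseteq> acl K B2"
      using x(1) B(1) B2(3) jets_mono[of t ?t n b] jets_mono[of t0 ?t n b] by auto
    ultimately have "card (insert x B) \<le> card B2" using acl.steinitz(2)[OF fB2] by blast
    then show False using cB cB2 fB xB by simp
  qed
  then show ?thesis using that[OF fB cB B(2,1)] by blast
qed

section \<open>The order of the generic dependence relation\<close>

lemma coeff_up_peval:
  assumes w: "w \<in> X"
  shows "coeff (up w (peval X \<xi> f)) k = peval X \<xi> (coeff (up w f) k)"
proof -
  define p where "p = (\<Sum>k\<le>degree (up w f). monom (peval X \<xi> (coeff (up w f) k)) k)"
  have c: "coeff p k = peval X \<xi> (coeff (up w f) k)" for k
    by (cases "k \<le> degree (up w f)") (auto simp: p_def coeff_sum coeff_eq_0 ring_homoD[OF ring_homo_peval])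
  have "peval X \<xi> f = peval X \<xi> (\<Sum>k\<le>degree (up w f). coeff (up w f) k * mvar w ^ k)"
    using poly_up[of w f] by (simp add: poly_altdef)
  also have "\<dots> = (\<Sum>k\<le>degree (up w f). peval X \<xi> (coeff (up w f) k) * peval X \<xi> (mvar w) ^ k)"
    by (simp add: ring_homo_sum[OF ring_homo_peval] ring_homoD[OF ring_homo_peval])
  also have "peval X \<xi> (mvar w) = mvar w" using w by (simp add: peval_def)
  also have "(\<Sum>k\<le>degree (up w f). peval X \<xi> (coeff (up w f) k) * mvar w ^ k) = poly p (mvar w)"
    by (simp add: p_def poly_sum poly_monom)
  finally have e: "peval X \<xi> f = poly p (mvar w)" .
  have "peval X \<xi> (coeff (up w f) k) \<in> MP UNIV (- {w})" for k
  proof -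
    have "coeff (up w f) k \<in> MP UNIV (- {w})" using mvars_coeff_up[of w f k] by (auto simp: MP_def mcoeffs_in_def)
    from peval_MP[OF this, of X \<xi>] show ?thesis using MP_mono[of UNIV UNIV "- {w} \<inter> X" "- {w}"] by blast
  qed
  then have "p \<in> polys_over (MP UNIV (- {w}))" by (simp add: polys_over_def c)
  then show ?thesis unfolding e by (simp add: up_poly c)
qed

lemma chain_rule:
  fixes \<Xi> :: "'v \<Rightarrow> ('v, 'a::comm_ring_1) mpol"
  assumes fin: "finite W"
  shows "P \<in> MP UNIV W \<Longrightarrow>
    mpartial w (meval mconst \<Xi> P) = (\<Sum>u\<in>W. meval mconst \<Xi> (mpartial u P) * mpartial w (\<Xi> u))"
proof -
  note h = ring_homoD[OF ring_homo_meval[OF ring_homo_mconst]]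
  note p = derivation_simps[OF derivation_mpartial]
  assume "P \<in> MP UNIV W"
  with subring_set_UNIV show ?thesis
  proof (induction rule: MP_induct)
    case (var v)
    have "(\<Sum>u\<in>W. meval mconst \<Xi> (mpartial u (mvar v)) * mpartial w (\<Xi> u)) = (\<Sum>u\<in>W. if u = v then mpartial w (\<Xi> u) else 0)"
      by (intro sum.cong refl) (auto simp: mpartial_mvar h)
    also have "\<dots> = mpartial w (\<Xi> v)" using var fin by simp
    finally show ?case by simp
  next
    case (add f g)
    then show ?case by (simp add: h p sum.distrib algebra_simps)
  next
    case (mult f g)
    then show ?case by (simp add: h p sum.distrib sum_distrib_left sum_distrib_right algebra_simps)
  qed (simp add: h p)
qed

lemma funpow_deriv_linear:
  "\<exists>E. E \<in> MP UNIV (UNIV \<times> {..<r}) \<and> (dpol_deriv \<delta> ^^ r) (mconst c * mvar (l, 0)) = mconst c * mvar (l, r) + E"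
proof (induction r)
  case 0
  then show ?case using subring_setD(1)[OF subring_MP[OF subring_set_UNIV]] by (intro exI[of _ 0]) auto
next
  case (Suc r)
  then obtain E where E: "E \<in> MP UNIV (UNIV \<times> {..<r})" "(dpol_deriv \<delta> ^^ r) (mconst c * mvar (l, 0)) = mconst c * mvar (l, r) + E" by blast
  let ?E = "mconst (\<delta> c) * mvar (l, r) + dpol_deriv \<delta> E"
  have "dpol_deriv \<delta> E \<in> MP UNIV (UNIV \<times> {..<Suc r})"
    by (rule dpol_deriv_MP[OF d subring_set_UNIV _ _ E(1)]) auto
  then have "?E \<in> MP UNIV (UNIV \<times> {..<Suc r})"
    by (intro subring_setD(3,5)[OF subring_MP[OF subring_set_UNIV]] MP_mconst MP_mvar subring_set_UNIV) auto
  moreover have "(dpol_deriv \<delta> ^^ Suc r) (mconst c * mvar (l, 0)) = mconst c * mvar (l, Suc r) + ?E"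
    using E(2) by (simp add: derivation_simps[OF derivation_dpol_deriv[OF d]] d algebra_simps)
  ultimately show ?case by blast
qed

section \<open>A generic vector orthogonal to \<open>v\<close>\<close>

context
  fixes n i :: nat and v :: "nat \<Rightarrow> 'u" and B :: "'u set" and t0 :: nat and ys :: "'u list"
  assumes small: "small K" and i: "i \<le> n" and vi: "v i = 1"
    and B: "finite B" "acl.indep B" "B \<subseteq> jets n v t0" "\<And>t. jets n v t \<subseteq> acl K B"
    and ys: "length ys = Suc n"
    and gen: "\<And>f zs. f \<in> MP K ({..<Suc n + length (map v [0..<Suc n])} \<times> UNIV) \<Longrightarrow> dval \<delta> f (tup (ys @ map v [0..<Suc n])) = 0 \<Longrightarrow>
      length zs = Suc n \<Longrightarrow> dval \<delta> f (tup (zs @ map v [0..<Suc n])) = 0"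
begin

definition vs :: "'u list" where "vs = map v [0..<Suc n]"

text \<open>As \<open>v i = 1\<close>, orthogonality to \<open>v\<close> determines the coordinate
  with index \<open>i\<close> by the others, which are free entries of \<open>ys\<close>.\<close>

definition gp :: "nat \<Rightarrow> 'u" where
  "gp l = (if l = i then - (\<Sum>k\<in>{..n} - {i}. v k * ys ! k) else if l \<le> n then ys ! l else 0)"

definition gx :: "nat \<times> nat \<Rightarrow> 'u" where
  "gx = (\<lambda>(l, s). (\<delta> ^^ s) (gp l))"

definition WA :: "(nat \<times> nat) set" where
  "WA = ({..n} - {i}) \<times> UNIV"

lemma gp_affine: "gp \<in> affine_space (Suc n)"
  using i by (auto simp: affine_space_def gp_def)

lemma gp_orthogonal: "(\<Sum>l\<le>n. v l * gp l) = 0"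
proof -
  have "(\<Sum>l\<le>n. v l * gp l) = v i * gp i + (\<Sum>l\<in>{..n} - {i}. v l * gp l)"
    using i by (subst sum.remove[of _ i]) auto
  also have "(\<Sum>l\<in>{..n} - {i}. v l * gp l) = (\<Sum>l\<in>{..n} - {i}. v l * ys ! l)"
    by (intro sum.cong refl) (auto simp: gp_def)
  finally show ?thesis using vi by (simp add: gp_def)
qed

lemma dval_gp: "dval \<delta> f gp = meval id gx f"
  by (simp add: dpol_eval_def gx_def)

text \<open>The hyperplane is parametrised by its coordinates other than \<open>i\<close>, so
  \<open>f\<close> becomes a relation of \<open>ys\<close> over \<open>v\<close>, and by genericity
  it holds for all values of these coordinates.\<close>

lemma generic_vanish_iff:
  assumes f: "f \<in> dpols K n"
  shows "dval \<delta> f gp = 0 \<longleftrightarrow> f \<in> hyper_ideal K n v"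
proof
  assume "f \<in> hyper_ideal K n v"
  then show "dval \<delta> f gp = 0" using gp_orthogonal by (simp add: hyper_ideal_def)
next
  assume z: "dval \<delta> f gp = 0"
  note R = diff_subfield_subring[OF K]
  define \<theta> where "\<theta> l = (if l = i then - (\<Sum>k\<in>{..n} - {i}. mvar (Suc n + k, 0) * mvar (k, 0)) else mvar (l, 0) :: 'u dpol)" for l
  let ?M = "MP K ({..<Suc n + length vs} \<times> (UNIV :: nat set))"
  note MR = subring_MP[OF R, of "{..<Suc n + length vs} \<times> (UNIV :: nat set)"]
  have "(\<Sum>k\<in>{..n} - {i}. mvar (Suc n + k, 0) * mvar (k, 0)) \<in> ?M"
    by (intro subring_set_sum[OF MR] subring_setD(5)[OF MR] MP_mvar R) (auto simp: vs_def)
  then have \<theta>: "\<theta> l \<in> ?M" if "l \<in> {..n}" for l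
    using that subring_setD(6)[OF MR] by (auto simp: \<theta>_def vs_def intro!: MP_mvar R)
  have g: "dsubst \<delta> \<theta> f \<in> ?M"
    by (rule dsubst_MP[OF d R _ f[unfolded dpols_eq_MP] \<theta>]) (use K in \<open>auto simp: diff_subfield_def\<close>)
  have val: "dval \<delta> (dsubst \<delta> \<theta> f) (tup (zs @ vs)) = dval \<delta> f (\<lambda>l. if l = i then - (\<Sum>k\<in>{..n} - {i}. v k * zs ! k) else zs ! l)"
    if zs: "length zs = Suc n" for zs
    unfolding dval_dsubst[OF d]
  proof (rule dval_dpols_cong[OF f])
    fix l assume l: "l \<le> n"
    have t: "tup (zs @ vs) k = zs ! k" "tup (zs @ vs) (Suc (n + k)) = v k" if "k \<le> n" for k
      using that zs by (auto simp: nth_default_def nth_append vs_def simp del: upt_Suc)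
    have "dval \<delta> (\<theta> i) (tup (zs @ vs)) = - (\<Sum>k\<in>{..n} - {i}. v k * zs ! k)"
      by (simp add: \<theta>_def dval_hom dval_sum t)
    then show "dval \<delta> (\<theta> l) (tup (zs @ vs)) = (if l = i then - (\<Sum>k\<in>{..n} - {i}. v k * zs ! k) else zs ! l)"
      using l t[of l] by (cases "l = i") (auto simp: \<theta>_def)
  qed
  have "dval \<delta> f gp = dval \<delta> (dsubst \<delta> \<theta> f) (tup (ys @ vs))"
    unfolding val[OF ys] by (rule dval_dpols_cong[OF f]) (auto simp: gp_def)
  then have z0: "dval \<delta> (dsubst \<delta> \<theta> f) (tup (ys @ vs)) = 0" using z by simp
  have "dval \<delta> f b = 0" if b: "(\<Sum>l\<le>n. v l * b l) = 0" for b
  proof -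
    let ?zs = "map b [0..<Suc n]"
    have "dval \<delta> (dsubst \<delta> \<theta> f) (tup (?zs @ vs)) = 0"
      using gen[OF g[unfolded vs_def] z0[unfolded vs_def], of ?zs] unfolding vs_def by simp
    then have "dval \<delta> f (\<lambda>l. if l = i then - (\<Sum>k\<in>{..n} - {i}. v k * ?zs ! k) else ?zs ! l) = 0"
      using val[of ?zs] by simp
    moreover have "- (\<Sum>k\<in>{..n} - {i}. v k * ?zs ! k) = b i"
    proof -
      have "(\<Sum>k\<in>{..n} - {i}. v k * ?zs ! k) = (\<Sum>k\<in>{..n} - {i}. v k * b k)"
        by (intro sum.cong refl) (auto simp del: upt_Suc)
      moreover have "(\<Sum>l\<le>n. v l * b l) = b i + (\<Sum>k\<in>{..n} - {i}. v k * b k)"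
        using i vi by (subst sum.remove[of _ i]) auto
      ultimately show ?thesis using b by (simp add: add_eq_0_iff del: upt_Suc)
    qed
    ultimately show ?thesis
      using dval_dpols_cong[OF f, of "\<lambda>l. if l = i then - (\<Sum>k\<in>{..n} - {i}. v k * ?zs ! k) else ?zs ! l" b]
      by (simp del: upt_Suc)
  qed
  then show "f \<in> hyper_ideal K n v" using f by (simp add: hyper_ideal_def)
qed

text \<open>The elements of \<open>B\<close> are derivatives of coordinates of \<open>v\<close>. A
  relation over them would hold for all values of the free coordinates, so it vanishes identically
  after inserting \<open>v\<close>, including the coefficient assumed nonzero.\<close>

lemma gx_WA_independent_over_B:
  assumes w: "w \<in> WA"
  shows "gx w \<notin> acl K (B \<union> gx ` (WA - {w}))"
proof
  assume a: "gx w \<in> acl K (B \<union> gx ` (WA - {w}))"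
  define \<zeta> where "\<zeta> = (\<lambda>(l, s). (\<delta> ^^ s) (tup (ys @ vs) l))"
  have t: "tup (ys @ vs) k = ys ! k" "tup (ys @ vs) (Suc (n + k)) = v k" if "k \<le> n" for k
    using that ys by (auto simp: nth_default_def nth_append vs_def simp del: upt_Suc)
  have g: "gx u = \<zeta> u" if u: "u \<in> WA" for u
  proof -
    obtain l s where "u = (l, s)" "l \<le> n" "l \<noteq> i" using u by (auto simp: WA_def)
    then show ?thesis using t(1)[of l] by (simp add: gx_def \<zeta>_def gp_def)
  qed
  let ?W = "(WA - {w}) \<union> {Suc n..Suc n + n} \<times> UNIV"
  have "B \<subseteq> \<zeta> ` ({Suc n..Suc n + n} \<times> UNIV)"
  proof
    fix x assume "x \<in> B"
    then obtain l s where "x = (\<delta> ^^ s) (v l)" "l \<le> n" using B(3) by (auto simp: jets_def)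
    then have "x = \<zeta> (Suc n + l, s)" "(Suc n + l, s) \<in> {Suc n..Suc n + n} \<times> UNIV" using t by (auto simp: \<zeta>_def)
    then show "x \<in> \<zeta> ` ({Suc n..Suc n + n} \<times> UNIV)" by (rule image_eqI)
  qed
  moreover have "gx ` (WA - {w}) = \<zeta> ` (WA - {w})" by (rule image_cong) (simp_all add: g)
  ultimately have "B \<union> gx ` (WA - {w}) \<subseteq> \<zeta> ` ?W" by (simp only: image_Un) blast
  then have "gx w \<in> acl K (\<zeta> ` ?W)" by (rule subsetD[OF acl.mono a])
  then have "\<zeta> w \<in> acl K (\<zeta> ` ?W)" unfolding g[OF w] .
  moreover have wW: "w \<notin> ?W" using w by (auto simp: WA_def)
  ultimately have "\<exists>f\<in>MP K (insert w ?W). meval id \<zeta> f = 0 \<and> (\<exists>k. meval id \<zeta> (coeff (up w f) k) \<noteq> 0)"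
    by (intro relation_if_acl[OF KF wW])
  then obtain f k where f: "f \<in> MP K (insert w ?W)" "meval id \<zeta> f = 0" "meval id \<zeta> (coeff (up w f) k) \<noteq> 0"
    by blast
  have dv: "dval \<delta> p (tup (ys @ vs)) = meval id \<zeta> p" for p by (simp add: dpol_eval_def \<zeta>_def)
  have "f \<in> MP K ({..<Suc n + length vs} \<times> UNIV)"
    by (rule subsetD[OF MP_mono f(1)]) (use w in \<open>auto simp: WA_def vs_def\<close>)
  then have all0: "dval \<delta> f (tup (zs @ vs)) = 0" if "length zs = Suc n" for zs
    using gen[of f zs] that f(2) dv[of f] unfolding vs_def by simp
  let ?X = "{..n} \<times> UNIV :: (nat \<times> nat) set"
  have pv: "dval \<delta> (peval ?X \<zeta> p) c = dval \<delta> p (tup (map c [0..<Suc n] @ vs))"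
    if p: "p \<in> MP K (insert w ?W)" for p c
    unfolding dpol_eval_def meval_peval
  proof (rule meval_cong)
    fix u assume u: "u \<in> mvars p"
    obtain l s where ls: "u = (l, s)" by (cases u)
    have "l \<le> Suc n + n" using u p w ls by (auto simp: MP_def WA_def)
    then show "(if u \<in> ?X then case u of (l, s) \<Rightarrow> (\<delta> ^^ s) (c l) else \<zeta> u) =
      (case u of (l, s) \<Rightarrow> (\<delta> ^^ s) (tup (map c [0..<Suc n] @ vs) l))"
      using ys by (auto simp: ls \<zeta>_def nth_default_def nth_append simp del: upt_Suc)
  qed
  have "peval ?X \<zeta> f = 0"
  proof (rule dpol_eq_if_dval_eq)
    show "dval \<delta> (peval ?X \<zeta> f) c = dval \<delta> 0 c" for c
      using pv[OF f(1), of c] all0[of "map c [0..<Suc n]"] by (simp add: dval_hom)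
  qed
  moreover have "w \<in> ?X" using w by (auto simp: WA_def)
  ultimately have "peval ?X \<zeta> (coeff (up w f) k) = 0"
    using coeff_up_peval[of w ?X \<zeta> f k] by (simp add: up_hom)
  then have "meval id \<zeta> (peval ?X \<zeta> (coeff (up w f) k)) = 0" by simp
  then show False using f(3) by (simp add: meval_peval)
qed

text \<open>Independence of the free derivatives over \<open>B\<close> is symmetric: adding finitely
  many of them to \<open>B\<close> keeps it independent.\<close>

lemma acl_B_independent_over_A:
  assumes x: "x \<in> B"
  shows "x \<notin> acl K (gx ` WA \<union> (B - {x}))"
proof
  assume "x \<in> acl K (gx ` WA \<union> (B - {x}))"
  then obtain S0 where S0: "finite S0" "S0 \<subseteq> gx ` WA \<union> (B - {x})" "x \<in> acl K S0"
    by (rule acl_finitary[OF KF])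
  define D where "D = S0 - B"
  have D: "finite D" "D \<subseteq> gx ` WA" using S0 by (auto simp: D_def)
  have n: "y \<notin> acl K (B \<union> (D - {y}))" if y: "y \<in> D" for y
  proof -
    obtain w where w: "w \<in> WA" "y = gx w" using y D(2) by blast
    have "B \<union> (D - {y}) \<subseteq> B \<union> gx ` (WA - {w})" using D(2) w(2) by auto
    then show ?thesis using gx_WA_independent_over_B[OF w(1)] acl.mono w(2) by blast
  qed
  from acl.indep_union[OF D(1) B(2) n] have "acl.indep (B \<union> D)" "B \<inter> D = {}" by auto
  then have "x \<notin> acl K (B \<union> D - {x})" using x by (auto simp: acl.indep_def)
  moreover have "S0 \<subseteq> B \<union> D - {x}" using S0(2) \<open>B \<inter> D = {}\<close> x
    by (auto simp: D_def) (use gx_WA_independent_over_B acl.ext in blast)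
  ultimately show False using S0(3) acl.mono by blast
qed

lemma fam_indep_WA: "fam_indep K WA gx"
  unfolding fam_indep_iff[OF KF]
proof
  show "inj_on gx WA"
  proof (rule inj_onI, rule ccontr)
    fix u w assume uw: "u \<in> WA" "w \<in> WA" "gx u = gx w" "u \<noteq> w"
    then have "gx u \<in> gx ` (WA - {u})" by auto
    then show False using gx_WA_independent_over_B[OF uw(1)] acl.ext[of "B \<union> gx ` (WA - {u})"] by blast
  qed
  show "acl.indep (gx ` WA)" unfolding acl.indep_def
  proof (rule ballI)
    fix x assume "x \<in> gx ` WA"
    then obtain w where w: "w \<in> WA" "x = gx w" by blast
    have "gx ` WA - {x} \<subseteq> B \<union> gx ` (WA - {w})" using w(2) by auto
    then show "x \<notin> acl K (gx ` WA - {x})" using gx_WA_independent_over_B[OF w(1)] acl.mono w(2) by blast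
  qed
qed

text \<open>The Leibniz rule on \<open>gp i\<close> produces derivatives of \<open>v\<close> and
  derivatives of order at most \<open>r\<close> of the free coordinates. The bound on the order is
  used for the dependence in \<open>order_eq_card\<close>.\<close>

lemma gx_i_in_acl: "gx (i, r) \<in> acl K (gx ` (({..n} - {i}) \<times> {..r}) \<union> B)"
proof -
  define S where "S r = gx ` (({..n} - {i}) \<times> {..r}) \<union> (\<Union>t. jets n v t)" for r
  have sup: "K \<subseteq> field_gen K (S r)" "S r \<subseteq> field_gen K (S r)" for r using field_gen_superset[of K "S r"] by auto
  have "gx (i, r) \<in> field_gen K (S r)"
  proof (induction r)
    case 0
    note F = subfield_subring[OF subfield_field_gen, of K "S 0"]
    have "v k \<in> field_gen K (S 0)" "ys ! k \<in> field_gen K (S 0)" if "k \<in> {..n} - {i}" for k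
    proof -
      have "v k = (\<delta> ^^ 0) (v k)" by simp
      then have "v k \<in> jets n v 0" using that unfolding jets_def by blast
      then have "v k \<in> S 0" unfolding S_def by blast
      then show "v k \<in> field_gen K (S 0)" using sup(2)[of 0] by blast
      have "ys ! k = gx (k, 0)" using that by (simp add: gx_def gp_def)
      then show "ys ! k \<in> field_gen K (S 0)" using sup(2)[of 0] that by (auto simp: S_def)
    qed
    then have "- (\<Sum>k\<in>{..n} - {i}. v k * ys ! k) \<in> field_gen K (S 0)"
      by (intro subring_setD(5,6)[OF F] subring_set_sum[OF F])
    then show ?case by (simp add: gx_def gp_def)
  next
    case (Suc r)
    let ?L = "field_gen K (S (Suc r))"
    have "S r \<subseteq> S (Suc r)" unfolding S_def by auto
    moreover have "\<delta> ` S r \<subseteq> S (Suc r)"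
    proof
      fix y assume "y \<in> \<delta> ` S r"
      then consider (a) l s where "l \<in> {..n} - {i}" "s \<le> r" "y = \<delta> (gx (l, s))" | (j) t where "y \<in> \<delta> ` jets n v t"
        unfolding S_def by blast
      then show "y \<in> S (Suc r)"
      proof cases
        case a
        then have "y = gx (l, Suc s)" by (simp add: gx_def)
        then show ?thesis using a unfolding S_def by auto
      next
        case j
        then show ?thesis using deriv_jets[of n v t] unfolding S_def by blast
      qed
    qed
    ultimately have "field_gen K (S r) \<subseteq> {y \<in> ?L. \<delta> y \<in> ?L}"
      using sup[of "Suc r"] K by (intro field_gen_least[OF subfield_deriv_preimage[OF d subfield_field_gen]]) (auto simp: diff_subfield_def)
    then have "\<delta> (gx (i, r)) \<in> ?L" using Suc by blast
    then show ?case by (simp add: gx_def)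
  qed
  then have "gx (i, r) \<in> acl K (S r)" using field_gen_subset_acl by blast
  moreover have "S r \<subseteq> acl K (gx ` (({..n} - {i}) \<times> {..r}) \<union> B)"
    unfolding S_def using B(4) acl.mono[of B "gx ` (({..n} - {i}) \<times> {..r}) \<union> B"]
      acl.ext[of "gx ` (({..n} - {i}) \<times> {..r}) \<union> B"] by blast
  ultimately show ?thesis using acl.cl_least by blast
qed

lemma gx_i_in_acl_WA: "gx (i, r) \<in> acl K (gx ` WA \<union> B)"
proof -
  have "gx ` (({..n} - {i}) \<times> {..r}) \<union> B \<subseteq> gx ` WA \<union> B" unfolding WA_def by blast
  then show ?thesis using gx_i_in_acl[of r] acl.mono by blast
qed

definition X :: "nat \<Rightarrow> 'u set" where
  "X s = (\<lambda>r. gx (i, r)) ` {..<s}"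

text \<open>Differentiating the relation along the hyperplane expresses the coordinates \<open>v\<^sub>j\<close> as quotients of partial derivatives.\<close>

lemma v_rational:
  assumes P: "P \<in> dpols K n" "order_le i s P" "dval \<delta> P gp = 0" and S: "dval \<delta> (mpartial (i, s) P) gp \<noteq> 0" and j: "j \<le> n"
  shows "v j \<in> field_gen K (gx ` ({..n} \<times> UNIV))"
proof (cases "j = i")
  case True
  then show ?thesis using vi subfieldD(2)[OF subfield_field_gen] by simp
next
  case ji: False
  define \<theta> where "\<theta> l = (if l = i then - (\<Sum>k\<in>{..n} - {i}. mconst (v k) * mvar (k, 0)) else mvar (l, 0) :: 'u dpol)" for l
  define \<Xi> where "\<Xi> = (\<lambda>(l, r). (dpol_deriv \<delta> ^^ r) (\<theta> l))"
  have ps: "dsubst \<delta> \<theta> p = meval mconst \<Xi> p" for p by (simp add: dsubst_def dpol_eval_def \<Xi>_def)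
  have \<theta>v: "(\<lambda>l. dval \<delta> (\<theta> l) c) = (\<lambda>l. if l = i then - (\<Sum>k\<in>{..n} - {i}. v k * c k) else c l)" for c
    by (auto simp: \<theta>_def dval_hom dval_sum fun_eq_iff)
  have "dsubst \<delta> \<theta> P = 0"
  proof (rule dpol_eq_if_dval_eq)
    fix c
    let ?b = "\<lambda>l. if l = i then - (\<Sum>k\<in>{..n} - {i}. v k * c k) else c l"
    have "(\<Sum>l\<le>n. v l * ?b l) = v i * ?b i + (\<Sum>l\<in>{..n} - {i}. v l * ?b l)"
      using i by (subst sum.remove[of _ i]) auto
    also have "(\<Sum>l\<in>{..n} - {i}. v l * ?b l) = (\<Sum>l\<in>{..n} - {i}. v l * c l)" by (intro sum.cong refl) auto
    finally have "(\<Sum>l\<le>n. v l * ?b l) = 0" using vi by simp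
    moreover have "P \<in> hyper_ideal K n v" using generic_vanish_iff[OF P(1)] P(3) by simp
    then have "\<forall>b. (\<Sum>l\<le>n. v l * b l) = 0 \<longrightarrow> dval \<delta> P b = 0" unfolding hyper_ideal_def by blast
    ultimately have "dval \<delta> P ?b = 0" by metis
    then show "dval \<delta> (dsubst \<delta> \<theta> P) c = dval \<delta> 0 c" unfolding dval_dsubst[OF d] \<theta>v by (simp add: dval_hom)
  qed
  \<comment> \<open>The composite of \<open>P\<close> with the parametrisation of the hyperplane is
    identically zero. In its partial derivative with respect to \<open>(j, s)\<close> the chain rule
    leaves two terms: that of \<open>(j, s)\<close> with factor 1 and that of \<open>(i, s)\<close>
    with factor \<open>- v j\<close>.\<close>
  then have 0: "mpartial (j, s) (meval mconst \<Xi> P) = 0" using ps[of P] by (simp add: derivation_0[OF derivation_mpartial])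
  let ?W = "insert (i, s) (insert (j, s) (mvars P))"
  have PW: "P \<in> MP UNIV ?W" by (auto simp: MP_def mcoeffs_in_def)
  have small_order: "mpartial (j, s) E = 0" if "E \<in> MP UNIV (UNIV \<times> {..<r})" "r \<le> s" for E :: "'u dpol" and r
    using that by (intro mpartial_not_mvars) (auto simp: MP_def)
  have \<Xi>i: "mpartial (j, s) (\<Xi> (i, r)) = (if r = s then - mconst (v j) else 0)" if "r \<le> s" for r
  proof -
    have lin: "(dpol_deriv \<delta> ^^ r) (- (\<Sum>k\<in>A. g k)) = - (\<Sum>k\<in>A. (dpol_deriv \<delta> ^^ r) (g k))" for g and A :: "nat set" and r
      by (induction r) (auto simp: derivation_simps[OF derivation_dpol_deriv[OF d]])
    have "mpartial (j, s) ((dpol_deriv \<delta> ^^ r) (mconst (v k) * mvar (k, 0))) = (if r = s \<and> k = j then mconst (v j) else 0)" for k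
    proof -
      obtain E where E: "E \<in> MP UNIV (UNIV \<times> {..<r})" "(dpol_deriv \<delta> ^^ r) (mconst (v k) * mvar (k, 0)) = mconst (v k) * mvar (k, r) + E"
        using funpow_deriv_linear by blast
      then show ?thesis using small_order[OF E(1) that]
        by (simp add: derivation_simps[OF derivation_mpartial] mpartial_mvar)
    qed
    then have "mpartial (j, s) (\<Xi> (i, r)) = - (\<Sum>k\<in>{..n} - {i}. if r = s \<and> k = j then mconst (v j) else 0)"
      by (simp add: \<Xi>_def \<theta>_def lin derivation_simps[OF derivation_mpartial])
    also have "(\<Sum>k\<in>{..n} - {i}. if r = s \<and> k = j then mconst (v j) else 0) = (if r = s then mconst (v j) else 0 :: 'u dpol)"
      using j ji by simp
    finally show ?thesis by simp
  qed
  have \<Xi>l: "mpartial (j, s) (\<Xi> (l, r)) = (if (l, r) = (j, s) then 1 else 0)" if "l \<noteq> i" for l r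
    using that by (simp add: \<Xi>_def \<theta>_def dpol_deriv_funpow_mvar[OF d] mpartial_mvar)
  have "(\<Sum>u\<in>?W. meval mconst \<Xi> (mpartial u P) * mpartial (j, s) (\<Xi> u)) =
    (\<Sum>u\<in>?W. if u = (i, s) then - mconst (v j) * meval mconst \<Xi> (mpartial (i, s) P)
      else if u = (j, s) then meval mconst \<Xi> (mpartial (j, s) P) else 0)"
  proof (intro sum.cong refl)
    fix u assume u: "u \<in> ?W"
    obtain l r where lr: "u = (l, r)" by (cases u)
    show "meval mconst \<Xi> (mpartial u P) * mpartial (j, s) (\<Xi> u) =
      (if u = (i, s) then - mconst (v j) * meval mconst \<Xi> (mpartial (i, s) P)
      else if u = (j, s) then meval mconst \<Xi> (mpartial (j, s) P) else 0)"
    proof (cases "l = i")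
      case True
      then have "r \<le> s" using u lr P(2) by (auto simp: order_le_def)
      then show ?thesis using \<Xi>i[of r] True lr ji by auto
    next
      case False
      then show ?thesis using \<Xi>l[of l r] lr by auto
    qed
  qed
  also have "\<dots> = - mconst (v j) * meval mconst \<Xi> (mpartial (i, s) P) + meval mconst \<Xi> (mpartial (j, s) P)"
    using ji by (subst sum.remove[of _ "(i, s)"], simp, simp, subst sum.remove[of _ "(j, s)"]) (auto intro!: sum.neutral)
  finally have "meval mconst \<Xi> (mpartial (j, s) P) = mconst (v j) * meval mconst \<Xi> (mpartial (i, s) P)"
    using chain_rule[OF _ PW, of "(j, s)" \<Xi>] 0 by simp
  then have "dval \<delta> (dsubst \<delta> \<theta> (mpartial (j, s) P)) gp = v j * dval \<delta> (dsubst \<delta> \<theta> (mpartial (i, s) P)) gp"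
    by (simp add: ps dval_hom)
  moreover have "dval \<delta> (dsubst \<delta> \<theta> p) gp = dval \<delta> p gp" for p
  proof -
    have "(\<Sum>k\<in>{..n} - {i}. v k * gp k) = (\<Sum>k\<in>{..n} - {i}. v k * ys ! k)" by (intro sum.cong refl) (auto simp: gp_def)
    then have "(\<lambda>l. dval \<delta> (\<theta> l) gp) = gp" unfolding \<theta>v by (auto simp: fun_eq_iff) (auto simp: gp_def)
    then show ?thesis by (simp add: dval_dsubst[OF d])
  qed
  ultimately have eq: "v j = meval id gx (mpartial (j, s) P) / meval id gx (mpartial (i, s) P)"
    using S by (simp add: dval_gp)
  note R = diff_subfield_subring[OF K]
  have L: "K \<subseteq> field_gen K (gx ` ({..n} \<times> UNIV))" "gx ` ({..n} \<times> UNIV) \<subseteq> field_gen K (gx ` ({..n} \<times> UNIV))"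
    using field_gen_superset[of K "gx ` ({..n} \<times> UNIV)"] by auto
  have "meval id gx (mpartial w P) \<in> field_gen K (gx ` ({..n} \<times> UNIV))" for w
    using mpartial_MP[OF R P(1)[unfolded dpols_eq_MP], of w]
    by (rule meval_in[OF R _ ring_homo_id(1) subfield_subring[OF subfield_field_gen]]) (use L in auto)
  then show ?thesis unfolding eq by (intro subfieldD(8)[OF subfield_field_gen])
qed

lemma fam_indep_extend:
  assumes "\<And>r. r < s \<Longrightarrow> gx (i, r) \<notin> acl K (gx ` WA \<union> X r)"
  shows "fam_indep K (WA \<union> {i} \<times> {..<s}) gx"
  using assms
proof (induction s)
  case 0
  then show ?case using fam_indep_WA by simp
next
  case (Suc s)
  have e: "WA \<union> {i} \<times> {..<Suc s} = insert (i, s) (WA \<union> {i} \<times> {..<s})" by auto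
  have im: "gx ` (WA \<union> {i} \<times> {..<s}) = gx ` WA \<union> X s" by (auto simp: X_def)
  have "(i, s) \<notin> WA \<union> {i} \<times> {..<s}" by (auto simp: WA_def)
  then show ?case unfolding e using fam_indep_insert[OF KF, of "(i, s)" "WA \<union> {i} \<times> {..<s}" gx] Suc unfolding im by auto
qed

text \<open>Let \<open>s\<close> be the least order in which a derivative of \<open>gp i\<close>
  depends on its lower ones and \<open>WA\<close>. The first \<open>Suc (card B)\<close> derivatives
  lie in the closure of \<open>B\<close> over \<open>WA\<close>, so \<open>s\<close> is at most
  \<open>card B\<close>. Conversely \<open>v_rational\<close> puts \<open>B\<close> into the closure
  of \<open>s\<close> derivatives over \<open>WA\<close>, and \<open>B\<close> is independent over
  \<open>WA\<close>.\<close>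

lemma order_eq_card:
  shows "fam_indep K (WA \<union> {i} \<times> {..<card B}) gx" (is ?indep)
    and "gx (i, card B) \<in> acl K (gx ` (({..n} - {i}) \<times> {..card B} \<union> {i} \<times> {..<card B}))" (is ?dep)
proof -
  interpret con: matroid_closure "\<lambda>S. acl K (gx ` WA \<union> S)" by (rule acl.matroid_contract)
  define x where "x r = gx (i, r)" for r
  have X: "X s = x ` {..<s}" for s by (simp add: X_def x_def)
  have "\<exists>s\<le>card B. x s \<in> acl K (gx ` WA \<union> X s)"
  proof (rule ccontr)
    assume "\<not> (\<exists>s\<le>card B. x s \<in> acl K (gx ` WA \<union> X s))"
    then have *: "x r \<notin> acl K (gx ` WA \<union> x ` {..<r})" if "r < Suc (card B)" for r using that by (auto simp: X)
    from con.indep_sequence[OF *] have "con.indep (x ` {..<Suc (card B)})" "inj_on x {..<Suc (card B)}" by auto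
    moreover have "x ` {..<Suc (card B)} \<subseteq> acl K (gx ` WA \<union> B)" using gx_i_in_acl_WA by (auto simp: x_def)
    ultimately have "card (x ` {..<Suc (card B)}) \<le> card B" using con.steinitz(2)[OF B(1)] by blast
    then show False using card_image[OF \<open>inj_on x {..<Suc (card B)}\<close>] by simp
  qed
  then obtain s0 where s0: "s0 \<le> card B" "x s0 \<in> acl K (gx ` WA \<union> X s0)" by blast
  define s where "s = (LEAST s. x s \<in> acl K (gx ` WA \<union> X s))"
  have s: "x s \<in> acl K (gx ` WA \<union> X s)" unfolding s_def by (rule LeastI[of _ s0]) (rule s0(2))
  have s_le: "s \<le> card B" using Least_le[of "\<lambda>s. x s \<in> acl K (gx ` WA \<union> X s)" s0] s0 unfolding s_def by simp
  have less: "x r \<notin> acl K (gx ` WA \<union> X r)" if "r < s" for r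
    using not_less_Least[of r "\<lambda>s. x s \<in> acl K (gx ` WA \<union> X s)"] that unfolding s_def by blast
  let ?W = "WA \<union> {i} \<times> {..<s}"
  have ind: "fam_indep K ?W gx" by (rule fam_indep_extend) (use less in \<open>simp add: x_def\<close>)
  have im: "gx ` ?W = gx ` WA \<union> X s" by (auto simp: X_def)
  have zW: "(i, s) \<notin> ?W" by (auto simp: WA_def)
  let ?z = "(i, s)"
  have Wz: "insert ?z ?W - {?z} = ?W" using zW by auto
  have sub: "insert ?z ?W \<subseteq> {..n} \<times> UNIV" using i by (auto simp: WA_def)
  obtain f where f: "f \<in> MP K (insert ?z ?W)" "meval id gx f = 0" "f \<noteq> 0"
  proof -
    have "gx ?z \<in> acl K (gx ` ?W)" using s unfolding im x_def .
    then obtain f k where f: "f \<in> MP K (insert ?z ?W)" "meval id gx f = 0" "meval id gx (coeff (up ?z f) k) \<noteq> 0"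
      using relation_if_acl[OF KF zW, of gx] by blast
    then have "f \<noteq> 0" by (auto simp: up_hom)
    then show ?thesis using that f by blast
  qed
  \<comment> \<open>Least degree in \<open>?z\<close> ensures that the separant does not vanish at
    the generic vector, as \<open>v_rational\<close> requires.\<close>
  define Q where "Q f \<longleftrightarrow> f \<in> MP K (insert ?z ?W) \<and> meval id gx f = 0 \<and> f \<noteq> 0" for f
  obtain P where P: "Q P" "\<And>f. Q f \<Longrightarrow> mdeg ?z P \<le> mdeg ?z f"
    using ex_has_least_nat[of Q f "mdeg ?z"] f unfolding Q_def by blast
  have PM: "P \<in> MP K (insert ?z ?W)" using P(1) by (simp add: Q_def)
  have zP: "?z \<in> mvars P"
  proof (rule ccontr)
    assume "?z \<notin> mvars P"
    then have "P \<in> MP K ?W" using PM by (auto simp: MP_def)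
    then show False using ind P(1) unfolding fam_indep_def Q_def by blast
  qed
  have "mpartial ?z P \<in> MP K (insert ?z ?W)" by (rule mpartial_MP[OF diff_subfield_subring[OF K] PM])
  then have SP: "meval id gx (mpartial ?z P) \<noteq> 0"
    using P(2)[of "mpartial ?z P"] mpartial_nonzero[OF zP] unfolding Q_def by auto
  have PK: "P \<in> dpols K n" unfolding dpols_eq_MP using PM MP_mono[OF order_refl sub] by blast
  have Po: "order_le i s P" using PM by (auto simp: MP_def order_le_def WA_def)
  let ?L = "field_gen K (gx ` ({..n} \<times> UNIV))"
  have vL: "v j \<in> ?L" if "j \<le> n" for j
    by (rule v_rational[OF PK Po _ _ that]) (use P(1) SP in \<open>auto simp: dval_gp Q_def\<close>)
  have "\<delta> ` gx ` ({..n} \<times> UNIV) \<subseteq> gx ` ({..n} \<times> UNIV)"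
  proof safe
    fix l r :: nat assume "l \<le> n"
    have "\<delta> (gx (l, r)) = gx (l, Suc r)" by (simp add: gx_def)
    then show "\<delta> (gx (l, r)) \<in> gx ` ({..n} \<times> UNIV)" using \<open>l \<le> n\<close> by auto
  qed
  then have dL: "\<delta> y \<in> ?L" if "y \<in> ?L" for y using field_gen_deriv_closed[OF d K] that by blast
  have "(\<delta> ^^ t) (v j) \<in> ?L" if "j \<le> n" for t j by (induction t) (use vL[OF that] dL in auto)
  then have BL: "B \<subseteq> ?L" using B(3) by (auto simp: jets_def)
  \<comment> \<open>One dependence in order \<open>s\<close> makes the closure stable under
    \<open>\<delta>\<close>, so it contains all further derivatives.\<close>
  have step: "x r \<in> acl K (gx ` WA \<union> X s)" for r
  proof (induction r)
    case 0
    show ?case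
    proof (cases "s = 0")
      case False
      then have "x 0 \<in> gx ` WA \<union> X s" by (auto simp: X)
      then show ?thesis by (rule subsetD[OF acl.ext])
    next
      case True
      then show ?thesis using s by simp
    qed
  next
    case (Suc r)
    let ?S = "gx ` WA \<union> X s"
    have "\<delta> (x r) \<in> acl K (?S \<union> \<delta> ` ?S)" by (rule acl_deriv[OF d K Suc])
    moreover have "\<delta> ` ?S \<subseteq> acl K ?S"
    proof
      fix y assume "y \<in> \<delta> ` ?S"
      then consider (a) u where "u \<in> WA" "y = \<delta> (gx u)" | (b) r' where "r' < s" "y = \<delta> (x r')" unfolding X by blast
      then show "y \<in> acl K ?S"
      proof cases
        case a
        obtain l t where u: "u = (l, t)" by (cases u)
        then have "y = gx (l, Suc t)" "(l, Suc t) \<in> WA" using a by (auto simp: gx_def WA_def)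
        then have "y \<in> ?S" by blast
        then show ?thesis by (rule subsetD[OF acl.ext])
      next
        case b
        then have "y = x (Suc r')" by (simp add: x_def gx_def)
        show ?thesis
        proof (cases "Suc r' = s")
          case True
          then show ?thesis using s \<open>y = x (Suc r')\<close> by simp
        next
          case False
          then have "y \<in> X s" using b(1) \<open>y = x (Suc r')\<close> unfolding X by auto
          then show ?thesis using acl.ext[of ?S] by blast
        qed
      qed
    qed
    then have "?S \<union> \<delta> ` ?S \<subseteq> acl K ?S" using acl.ext[of ?S] by blast
    ultimately have "\<delta> (x r) \<in> acl K ?S" using acl.cl_least by blast
    then show ?case by (simp add: x_def gx_def)
  qed
  have "gx ` ({..n} \<times> UNIV) \<subseteq> acl K (gx ` WA \<union> X s)"
  proof safe
    fix l r :: nat assume "l \<le> n"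
    show "gx (l, r) \<in> acl K (gx ` WA \<union> X s)"
    proof (cases "l = i")
      case True
      then show ?thesis using step[of r] by (simp add: x_def)
    next
      case False
      then have "(l, r) \<in> WA" using \<open>l \<le> n\<close> by (simp add: WA_def)
      then show ?thesis using acl.ext[of "gx ` WA \<union> X s"] by blast
    qed
  qed
  then have "?L \<subseteq> acl K (gx ` WA \<union> X s)"
    by (intro field_gen_least[OF subfield_acl acl_superset(1)])
  then have "B \<subseteq> acl K (gx ` WA \<union> X s)" using BL by blast
  moreover have "con.indep B" unfolding con.indep_def using acl_B_independent_over_A by blast
  moreover have "finite (X s)" by (simp add: X)
  ultimately have "card B \<le> card (X s)" using con.steinitz(2) by blast
  also have "\<dots> \<le> s" unfolding X using card_image_le[of "{..<s}" x] by simp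
  finally have sB: "s = card B" using s_le by simp
  then show ?indep using ind by simp
  show ?dep
  proof (rule ccontr)
    let ?A = "gx ` (({..n} - {i}) \<times> {..card B})"
    assume nd: "\<not> ?dep"
    \<comment> \<open>The upper count again, with orders bounded by \<open>card B\<close>, so that
      the equation will have order at most \<open>card B\<close> in every coordinate.\<close>
    interpret con2: matroid_closure "\<lambda>S. acl K (?A \<union> S)" by (rule acl.matroid_contract)
    have *: "x r \<notin> acl K (?A \<union> x ` {..<r})" if "r < Suc (card B)" for r
    proof (cases "r = card B")
      case True
      have "gx ` (({..n} - {i}) \<times> {..card B} \<union> {i} \<times> {..<card B}) = ?A \<union> x ` {..<card B}" by (auto simp: x_def)
      then show ?thesis using nd True by (simp add: x_def)
    next
      case False
      then have "r < s" using that sB by simp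
      moreover have "?A \<union> x ` {..<r} \<subseteq> gx ` WA \<union> X r" by (auto simp: X WA_def)
      ultimately show ?thesis using less[of r] acl.mono by blast
    qed
    from con2.indep_sequence[OF *] have "con2.indep (x ` {..<Suc (card B)})" "inj_on x {..<Suc (card B)}" by auto
    moreover have "x ` {..<Suc (card B)} \<subseteq> acl K (?A \<union> B)"
    proof
      fix y assume "y \<in> x ` {..<Suc (card B)}"
      then obtain r where r: "r \<le> card B" "y = gx (i, r)" by (auto simp: x_def less_Suc_eq_le)
      have "gx ` (({..n} - {i}) \<times> {..r}) \<union> B \<subseteq> ?A \<union> B" using r(1) by auto
      then show "y \<in> acl K (?A \<union> B)" using gx_i_in_acl[of r] r(2) acl.mono by blast
    qed
    ultimately have "card (x ` {..<Suc (card B)}) \<le> card B" using con2.steinitz(2)[OF B(1)] by blast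
    then show False using card_image[OF \<open>inj_on x {..<Suc (card B)}\<close>] by simp
  qed
qed

lemma generic_orthogonal_vector:
  "\<exists>c\<in>affine_space (Suc n). (\<Sum>l\<le>n. v l * c l) = 0 \<and>
    (\<forall>f\<in>dpols K n. dval \<delta> f c = 0 \<longleftrightarrow> f \<in> hyper_ideal K n v) \<and>
    fam_indep K (({..n} - {i}) \<times> UNIV \<union> {i} \<times> {..<card B}) (\<lambda>(l, s). (\<delta> ^^ s) (c l)) \<and>
    (\<delta> ^^ card B) (c i) \<in> acl K ((\<lambda>(l, s). (\<delta> ^^ s) (c l)) ` (({..n} - {i}) \<times> {..card B} \<union> {i} \<times> {..<card B}))"
proof (intro bexI[of _ gp] conjI)
  show "fam_indep K (({..n} - {i}) \<times> UNIV \<union> {i} \<times> {..<card B}) (\<lambda>(l, s). (\<delta> ^^ s) (gp l))"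
    using order_eq_card(1) unfolding gx_def WA_def .
  have "(\<delta> ^^ card B) (gp i) = gx (i, card B)" by (simp add: gx_def)
  then show "(\<delta> ^^ card B) (gp i) \<in> acl K ((\<lambda>(l, s). (\<delta> ^^ s) (gp l)) ` (({..n} - {i}) \<times> {..card B} \<union> {i} \<times> {..<card B}))"
    using order_eq_card(2) unfolding gx_def by simp
qed (use gp_affine gp_orthogonal generic_vanish_iff in auto)

end

end

end

section \<open>The dependence equation and its general component\<close>

lemma irreducible_factor_vanishes:
  fixes f :: "('v::linorder, 'u::field) mpol"
  assumes K: "subfield_set K"
  shows "f \<in> MP K W \<Longrightarrow> f \<noteq> 0 \<Longrightarrow> meval id \<xi> f = 0 \<Longrightarrow> \<exists>p\<in>MP K W. mirr K p \<and> meval id \<xi> p = 0"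
proof (induction "tdeg f" arbitrary: f rule: less_induct)
  case less
  note h = ring_homoD[OF ring_homo_meval[OF ring_homo_id(1), of \<xi>]]
  have "mvars f \<noteq> {}"
  proof
    assume "mvars f = {}"
    then obtain a where "f = mconst a" using mvars_empty_iff[of f] by blast
    then show False using less.prems by auto
  qed
  from exists_irreducible_factor[OF K less.prems(1) this less.prems(2)]
  obtain p q where pq: "p \<in> MP K W" "q \<in> MP K W" "mirr K p" "f = p * q" by blast
  have "p \<noteq> 0" "q \<noteq> 0" using pq(4) less.prems(2) by auto
  show ?case
  proof (cases "meval id \<xi> p = 0")
    case False
    then have q0: "meval id \<xi> q = 0" using less.prems(3) pq(4) by (simp add: h)
    have "mvars p \<noteq> {}" using pq(3) by (simp add: mirr_def)
    then have "tdeg q < tdeg f"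
      using tdeg_pos[OF K, of p] unfolding pq(4) tdeg_mult[OF K \<open>p \<noteq> 0\<close> \<open>q \<noteq> 0\<close>] by simp
    then show ?thesis using less.hyps pq(2) \<open>q \<noteq> 0\<close> q0 by blast
  qed (use pq in blast)
qed

section \<open>Leaders with respect to a ranking\<close>

lemma linear_order_finite_greatest:
  assumes r: "linear_order_on A r"
  shows "finite B \<Longrightarrow> B \<noteq> {} \<Longrightarrow> B \<subseteq> A \<Longrightarrow> \<exists>!m. m \<in> B \<and> (\<forall>x\<in>B. (x, m) \<in> r)"
proof (induction B rule: finite_ne_induct)
  have refl: "(x, x) \<in> r" if "x \<in> A" for x
    using r that by (auto simp: linear_order_on_def partial_order_on_def preorder_on_def refl_on_def)
  have anti: "x = y" if "(x, y) \<in> r" "(y, x) \<in> r" for x y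
    using r that by (auto simp: linear_order_on_def partial_order_on_def dest: antisymD)
  have tr: "(x, z) \<in> r" if "(x, y) \<in> r" "(y, z) \<in> r" for x y z
    using r that by (auto simp: linear_order_on_def partial_order_on_def preorder_on_def dest: transD)
  have tot: "(x, y) \<in> r \<or> (y, x) \<in> r" if "x \<in> A" "y \<in> A" for x y
    using r that refl by (cases "x = y") (auto simp: linear_order_on_def total_on_def)
  {
    case (singleton x)
    then show ?case using refl by auto
  next
    case (insert x B)
    then have "\<exists>m\<in>B. \<forall>y\<in>B. (y, m) \<in> r" by auto
    then obtain m where m: "m \<in> B" "\<And>y. y \<in> B \<Longrightarrow> (y, m) \<in> r" by blast
    have "\<exists>m'\<in>insert x B. \<forall>y\<in>insert x B. (y, m') \<in> r"
    proof (cases "(x, m) \<in> r")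
      case True
      then show ?thesis using m by auto
    next
      case False
      then have mx: "(m, x) \<in> r" using tot[of x m] m(1) insert.prems by auto
      have "(y, x) \<in> r" if "y \<in> B" for y by (rule tr[OF m(2)[OF that] mx])
      moreover have "(x, x) \<in> r" using refl insert.prems by simp
      ultimately show ?thesis by simp
    qed
    then obtain m' where "m' \<in> insert x B" "\<forall>y\<in>insert x B. (y, m') \<in> r" by (rule bexE)
    then show ?case by (intro ex1I[of _ m']) (simp, meson anti)
  }
qed

lemma ranking_mono:
  assumes \<rho>: "ranking n \<rho>" and i: "i \<le> n" and rs: "r \<le> s"
  shows "((i, r), (i, s)) \<in> \<rho>"
  using rs
proof (induction rule: dec_induct)
  case base
  show ?case using \<rho> i by (auto simp: ranking_def linear_order_on_def partial_order_on_def preorder_on_def refl_on_def)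
next
  case (step m)
  have "trans \<rho>" using \<rho> by (auto simp: ranking_def linear_order_on_def partial_order_on_def preorder_on_def)
  moreover have "((i, m), (i, Suc m)) \<in> \<rho>" using \<rho> i by (simp add: ranking_def)
  ultimately show ?case using step.IH by (meson transD)
qed

text \<open>A ranking compares derivatives of one indeterminate by their order, so the leader is the
  highest derivative of its own indeterminate in \<open>R\<close>, although other indeterminates may
  occur with higher order.\<close>

lemma leader_properties:
  fixes R :: "'u::field dpol"
  assumes \<rho>: "ranking n \<rho>" and R: "R \<in> dpols K n" "mvars R \<noteq> {}" and l: "leader \<rho> R = (j, r)"
  shows "(j, r) \<in> mvars R" "j \<le> n" "order_le j r R"
proof -
  have lin: "linear_order_on ({..n} \<times> UNIV) \<rho>" using \<rho> by (simp add: ranking_def)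
  have sub: "mvars R \<subseteq> {..n} \<times> UNIV" using R(1) by (simp add: dpols_def)
  from theI'[OF linear_order_finite_greatest[OF lin _ R(2) sub]]
  have *: "(j, r) \<in> mvars R" "\<And>v. v \<in> mvars R \<Longrightarrow> (v, (j, r)) \<in> \<rho>" using l unfolding leader_def by auto
  then show "(j, r) \<in> mvars R" "j \<le> n" using sub by auto
  show "order_le j r R" unfolding order_le_def
  proof (intro allI impI)
    fix s assume "(j, s) \<in> mvars R"
    then have 1: "((j, s), (j, r)) \<in> \<rho>" using * by blast
    show "s \<le> r"
    proof (rule ccontr)
      assume n: "\<not> s \<le> r"
      then have "((j, r), (j, s)) \<in> \<rho>" using ranking_mono[OF \<rho> \<open>j \<le> n\<close>, of r s] by simp
      moreover have "antisym \<rho>" using lin by (simp add: linear_order_on_def partial_order_on_def)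
      ultimately show False using antisymD[OF _ 1] n by auto
    qed
  qed
qed

lemma dclosed_dpols:
  assumes d: "derivation \<delta>" and K: "diff_subfield \<delta> K" and j: "j \<le> n"
  shows "dclosed \<delta> j (dpols K n)"
proof -
  note R = diff_subfield_subring[OF K]
  have "coeff (up (j, s) f) k \<in> MP K ({..n} \<times> UNIV)" if "f \<in> MP K ({..n} \<times> UNIV)" for f s k
    using coeff_up_in[OF R that, of "(j, s)" k] MP_mono[of K K "{..n} \<times> UNIV - {(j, s)}" "{..n} \<times> UNIV"] by blast
  moreover have "dpol_deriv \<delta> f \<in> MP K ({..n} \<times> UNIV)" if "f \<in> MP K ({..n} \<times> UNIV)" for f
    using dpol_deriv_funpow_MP[OF d R _ that, of 1] K by (auto simp: diff_subfield_def)
  moreover have "mvar (j, s) \<in> MP K ({..n} \<times> UNIV)" for s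
    by (rule MP_mvar[OF R]) (use j in auto)
  ultimately show ?thesis
    unfolding dclosed_def dpols_eq_MP polys_over_def using subring_MP[OF R] by auto
qed

section \<open>Differential ideals over \<open>K\<close>\<close>

context
  fixes \<delta> :: "'u::field_char_0 \<Rightarrow> 'u" and K :: "'u set" and n :: nat
  assumes d: "derivation \<delta>" and K: "diff_subfield \<delta> K"
begin

lemma differential_ideal_dpols: "differential_ideal \<delta> K n (dpols K n)"
proof -
  note M = subring_setD[OF subring_MP[OF diff_subfield_subring[OF K], of "{..n} \<times> UNIV"]]
  have "dclosed \<delta> 0 (dpols K n)" by (rule dclosed_dpols[OF d K]) simp
  then show ?thesis unfolding differential_ideal_def dclosed_def
    using M(1,3,5) by (auto simp: dpols_eq_MP)
qed

lemma differential_ideal_gen: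
  assumes F: "F \<subseteq> dpols K n"
  shows "differential_ideal \<delta> K n (differential_ideal_gen \<delta> K n F)" "F \<subseteq> differential_ideal_gen \<delta> K n F"
proof -
  show "F \<subseteq> differential_ideal_gen \<delta> K n F" unfolding differential_ideal_gen_def by blast
  have "differential_ideal_gen \<delta> K n F \<subseteq> dpols K n"
    unfolding differential_ideal_gen_def using differential_ideal_dpols F by blast
  then show "differential_ideal \<delta> K n (differential_ideal_gen \<delta> K n F)"
    unfolding differential_ideal_def differential_ideal_gen_def by auto
qed

lemma differential_ideal_gen_least:
  "differential_ideal \<delta> K n I \<Longrightarrow> F \<subseteq> I \<Longrightarrow> differential_ideal_gen \<delta> K n F \<subseteq> I"
  unfolding differential_ideal_gen_def by blast

lemma in_general_component:
  assumes R: "R \<in> dpols K n"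
  shows "R \<in> general_component \<delta> K n \<rho> R"
proof -
  have I: "differential_ideal \<delta> K n (differential_ideal_gen \<delta> K n {R})" "R \<in> differential_ideal_gen \<delta> K n {R}"
    using differential_ideal_gen[of "{R}"] R by auto
  have S: "separant \<rho> R \<in> dpols K n"
    using mpartial_MP[OF diff_subfield_subring[OF K], of R] R unfolding separant_def dpols_eq_MP by blast
  have SR: "separant \<rho> R * R \<in> differential_ideal_gen \<delta> K n {R}" using I S unfolding differential_ideal_def by blast
  then have "separant \<rho> R * R \<in> dpols K n" using I(1) unfolding differential_ideal_def by blast
  then have "separant \<rho> R * R \<in> radical K n (differential_ideal_gen \<delta> K n {R})"
    using SR unfolding radical_def by (auto intro: exI[of _ 1])
  then show ?thesis using R by (simp add: general_component_def)
qed

lemma differential_ideal_vanishing: "differential_ideal \<delta> K n {f \<in> dpols K n. dval \<delta> f c = 0}"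
proof -
  have "\<delta> 0 = 0" by (rule derivation_0[OF d])
  then show ?thesis
    using differential_ideal_dpols unfolding differential_ideal_def by (auto simp: dval_hom dval_deriv[OF d])
qed

section \<open>The irreducible relation satisfied by \<open>c\<close>\<close>

context
  fixes i D :: nat and c :: "nat \<Rightarrow> 'u" and \<xi> :: "nat \<times> nat \<Rightarrow> 'u"
  assumes i: "i \<le> n" and \<xi>: "\<xi> = (\<lambda>(l, s). (\<delta> ^^ s) (c l))"
    and indep: "fam_indep K (({..n} - {i}) \<times> UNIV \<union> {i} \<times> {..<D}) \<xi>"
    and dep: "\<xi> (i, D) \<in> acl K (\<xi> ` (({..n} - {i}) \<times> {..D} \<union> {i} \<times> {..<D}))"
begin

lemma dval_\<xi>: "dval \<delta> f c = meval id \<xi> f"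
  by (simp add: dpol_eval_def \<xi>)

lemma KF': "subfield_set K"
  using K by (simp add: diff_subfield_def)

interpretation acl: matroid_closure "acl K"
  by (rule matroid_acl[OF KF'])

lemma grid_eq: "{..n} \<times> {..D} = insert (i, D) (({..n} - {i}) \<times> {..D} \<union> {i} \<times> {..<D})"
  using i by auto

lemma indep_grid: "fam_indep K (({..n} - {i}) \<times> {..D} \<union> {i} \<times> {..<D}) \<xi>"
  by (rule fam_indep_subset[OF indep]) auto

lemma equation_exists: "\<exists>R\<in>MP K ({..n} \<times> {..D}). mirr K R \<and> meval id \<xi> R = 0"
proof -
  let ?W = "({..n} - {i}) \<times> {..D} \<union> {i} \<times> {..<D}"
  have "(i, D) \<notin> ?W" by auto
  from relation_if_acl[OF KF' this, of \<xi>] dep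
  obtain f k where f: "f \<in> MP K ({..n} \<times> {..D})" "meval id \<xi> f = 0" "meval id \<xi> (coeff (up (i, D) f) k) \<noteq> 0"
    unfolding grid_eq by blast
  then have "f \<noteq> 0" by (auto simp: up_hom)
  then show ?thesis using irreducible_factor_vanishes[OF KF' f(1) _ f(2)] by blast
qed

context
  fixes R :: "'u dpol"
  assumes R: "R \<in> MP K ({..n} \<times> {..D})" "mirr K R" "meval id \<xi> R = 0"
begin

lemma R_dpols: "R \<in> dpols K n"
  using R(1) MP_mono[of K K "{..n} \<times> {..D}" "{..n} \<times> UNIV"] by (auto simp: dpols_eq_MP)

lemma R_mvars: "mvars R \<noteq> {}"
  using R(2) by (simp add: mirr_def)

lemma R_nonzero: "R \<noteq> 0"
  using R_mvars mvars_mconst[of "0 :: 'u"] by fastforce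

lemma top_in_mvars: "(i, D) \<in> mvars R"
proof (rule ccontr)
  assume "(i, D) \<notin> mvars R"
  then have "R \<in> MP K (({..n} - {i}) \<times> {..D} \<union> {i} \<times> {..<D})" using R(1) unfolding grid_eq by (auto simp: MP_def)
  then show False using indep_grid R(3) R_nonzero unfolding fam_indep_def by blast
qed

lemma order_equation: "dpol_order R = D"
  unfolding dpol_order_def
proof (rule Max_eqI)
  show "y \<le> D" if "y \<in> snd ` mvars R" for y using that R(1) by (auto simp: MP_def)
  show "D \<in> snd ` mvars R" using top_in_mvars by force
qed simp

text \<open>Division with respect to the derivative \<open>(i, D)\<close>: the remaining derivatives
  up to order \<open>D\<close> are independent at \<open>\<xi>\<close>.\<close>

lemma equation_divides:
  assumes P: "P \<in> MP K ({..n} \<times> {..D})" "meval id \<xi> P = 0"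
  shows "\<exists>q\<in>MP K ({..n} \<times> {..D}). P = q * R"
proof (rule irreducible_divides_if_vanishes[OF KF' R(1,2) top_in_mvars P(1) R(3) P(2)])
  fix m assume m: "m \<in> MP K ({..n} \<times> {..D} - {(i, D)})" "meval id \<xi> m = 0"
  have "{..n} \<times> {..D} - {(i, D)} = ({..n} - {i}) \<times> {..D} \<union> {i} \<times> {..<D}" unfolding grid_eq by auto
  then show "m = 0" using m indep_grid unfolding fam_indep_def by metis
qed

lemma equation_unique:
  assumes R': "dpol_irreducible K n R'" "dpol_order R' = D" "dval \<delta> R' c = 0"
  shows "\<exists>a\<in>K. a \<noteq> 0 \<and> R' = mconst a * R"
proof -
  have R'K: "R' \<in> MP K ({..n} \<times> UNIV)" "mirr K R'" using R'(1) dpol_irreducible_iff[OF KF', of n R'] by (auto simp: dpols_eq_MP)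
  have "r \<le> D" if "(l, r) \<in> mvars R'" for l r
    unfolding R'(2)[symmetric] dpol_order_def using that by (intro Max_ge) (auto intro: rev_image_eqI)
  then have "R' \<in> MP K ({..n} \<times> {..D})" using R'K(1) by (auto simp: MP_def)
  then obtain q where q: "q \<in> MP K ({..n} \<times> {..D})" "R' = q * R" using equation_divides R'(3) by (auto simp: dval_\<xi>)
  have "q \<in> MP K UNIV" "R \<in> MP K UNIV"
    using q(1) R(1) MP_mono[of K K "{..n} \<times> {..D}" UNIV] by auto
  then have "mvars q = {}" using R'K(2) q(2) R_mvars unfolding mirr_def by blast
  then obtain a where a: "q = mconst a" using mvars_empty_iff[of q] by blast
  have "coef q 0 \<in> K" using q(1) by (simp add: MP_iff[OF diff_subfield_subring[OF K]])
  then have "a \<in> K" by (simp add: a mconst_def)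
  moreover have "a \<noteq> 0"
  proof
    assume "a = 0"
    then have "mvars R' = {}" using q(2) a mvars_mconst[of "0 :: 'u"] by auto
    then show False using R'K(2) by (simp add: mirr_def)
  qed
  ultimately show ?thesis using q(2) a by blast
qed

section \<open>Reduction with respect to the leader of \<open>R\<close>\<close>

context
  fixes \<rho> j r
  assumes \<rho>: "ranking n \<rho>" and l: "leader \<rho> R = (j, r)"
begin

lemmas lead = leader_properties[OF \<rho> R_dpols R_mvars l]

lemma r_le: "r \<le> D"
  using lead(1) R(1) by (auto simp: MP_def)

text \<open>Otherwise \<open>R\<close> would divide its separant, which is nonzero and has smaller
  degree in the leader.\<close>

lemma separant_nonzero: "meval id \<xi> (mpartial (j, r) R) \<noteq> 0"
proof
  assume z: "meval id \<xi> (mpartial (j, r) R) = 0"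
  have "mpartial (j, r) R \<in> MP K ({..n} \<times> {..D})" by (rule mpartial_MP[OF diff_subfield_subring[OF K] R(1)])
  from equation_divides[OF this z] obtain q where q: "mpartial (j, r) R = q * R" by blast
  note nz = mpartial_nonzero[OF lead(1)]
  have "q \<noteq> 0" using q nz(1) by auto
  then have "mdeg (j, r) (mpartial (j, r) R) = mdeg (j, r) q + mdeg (j, r) R" unfolding q by (rule mdeg_mult) (rule R_nonzero)
  then show False using nz(2) by simp
qed

text \<open>The separant is built from the coefficients of \<open>R\<close> in the leader, so its
  nonvanishing rules out that all of these vanish at \<open>\<xi>\<close>.\<close>

lemma leader_step:
  assumes W: "mvars R - {(j, r)} \<subseteq> W" "(j, r) \<notin> W"
  shows "\<xi> (j, r) \<in> acl K (\<xi> ` W)"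
proof -
  have RW: "R \<in> MP K (insert (j, r) W)" using R(1) W by (auto simp: MP_def)
  have "\<exists>k. meval id \<xi> (coeff (up (j, r) R) k) \<noteq> 0"
  proof (rule ccontr)
    assume "\<not> ?thesis"
    then have "meval id \<xi> (coeff (up (j, r) R) k) = 0" for k by blast
    then have "meval id \<xi> (coeff (up (j, r) (mpartial (j, r) R)) k) = 0" for k
      unfolding up_mpartial coeff_pderiv ring_homo_mult[OF ring_homo_meval[OF ring_homo_id(1)]] by simp
    then have "meval id \<xi> (mpartial (j, r) R) = 0"
      by (subst meval_up[OF ring_homo_id(1), of _ _ "(j, r)"]) simp
    then show False using separant_nonzero by blast
  qed
  then show ?thesis using acl_if_relation[OF KF' RW R(3)] by blast
qed

text \<open>The equation differentiated \<open>Suc k\<close> times is linear in the new derivative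
  with the separant as coefficient, so it can be solved for it. The other indeterminates then occur
  up to order \<open>D + Suc k\<close>, whence the bound on \<open>M\<close>.\<close>

lemma derived_leader_step:
  assumes M: "D + Suc k \<le> M"
    and L: "subfield_set L" "K \<subseteq> L" "\<And>l s. l \<le> n \<Longrightarrow> l \<noteq> j \<Longrightarrow> s \<le> M \<Longrightarrow> \<xi> (l, s) \<in> L"
      "\<And>s. s \<le> r + k \<Longrightarrow> \<xi> (j, s) \<in> L"
  shows "\<xi> (j, Suc (r + k)) \<in> L"
proof -
  note KR = diff_subfield_subring[OF K]
  let ?S = "mpartial (j, r) R" and ?E = "(dpol_deriv \<delta> ^^ Suc k) R"
  note MR = subring_MP[OF KR, of "{..n} \<times> {..D + Suc k}"]
  obtain T where T: "order_le j (r + k) T" "?E = ?S * mvar (j, Suc (r + k)) + T"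
    using funpow_deriv_leader[OF d lead(3)] by blast
  have E: "(dpol_deriv \<delta> ^^ m) R \<in> MP K ({..n} \<times> {..D + m})" for m
  proof (induction m)
    case (Suc m)
    have "dpol_deriv \<delta> ((dpol_deriv \<delta> ^^ m) R) \<in> MP K ({..n} \<times> {..D + Suc m})"
      by (rule dpol_deriv_MP[OF d KR _ _ Suc]) (use K in \<open>auto simp: diff_subfield_def\<close>)
    then show ?case by simp
  qed (use R(1) in simp)
  have S0: "?S \<in> MP K ({..n} \<times> {..D})" by (rule mpartial_MP[OF KR R(1)])
  then have S: "?S \<in> MP K ({..n} \<times> {..D + Suc k})" by (rule rev_subsetD[OF _ MP_mono]) auto
  have "mvar (j, Suc (r + k)) \<in> MP K ({..n} \<times> {..D + Suc k})" using lead(2) r_le by (intro MP_mvar[OF KR]) auto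
  then have "?E - ?S * mvar (j, Suc (r + k)) \<in> MP K ({..n} \<times> {..D + Suc k})"
    by (intro subring_setD(4,5)[OF MR] E S)
  then have TK: "T \<in> MP K ({..n} \<times> {..D + Suc k})" using T(2) by simp
  have in_L: "meval id \<xi> p \<in> L" if p: "p \<in> MP K ({..n} \<times> {..D + Suc k})" "order_le j (r + k) p" for p
  proof (rule meval_in[OF KR _ ring_homo_id(1) subfield_subring[OF L(1)]])
    show "p \<in> MP K (mvars p)" using p(1) by (simp add: MP_def)
    fix w assume w: "w \<in> mvars p"
    obtain l s where ls: "w = (l, s)" by (cases w)
    show "\<xi> w \<in> L"
    proof (cases "l = j")
      case True
      then show ?thesis using L(4)[of s] p(2) w ls by (simp add: order_le_def)
    next
      case False
      moreover have "l \<le> n" "s \<le> M" using p(1) w ls M by (auto simp: MP_def)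
      ultimately show ?thesis using L(3) ls by simp
    qed
  qed (use L(2) in auto)
  have "order_le j r ?S" by (rule order_le_mvars[OF mvars_mpartial lead(3)])
  then have "order_le j (r + k) ?S" by (rule order_le_mono) simp
  then have SL: "meval id \<xi> ?S \<in> L" by (rule in_L[OF S])
  have "(\<delta> ^^ m) 0 = 0" for m by (induction m) (simp_all add: derivation_0[OF d])
  then have "meval id \<xi> ?E = 0" using dval_funpow_deriv[OF d, of "Suc k" R c] R(3) unfolding dval_\<xi> by metis
  then have "meval id \<xi> ?S * \<xi> (j, Suc (r + k)) + meval id \<xi> T = 0"
    unfolding T(2) by (simp add: ring_homoD[OF ring_homo_meval[OF ring_homo_id(1)]])
  then have "\<xi> (j, Suc (r + k)) = - meval id \<xi> T / meval id \<xi> ?S"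
    using separant_nonzero by (simp add: field_simps eq_neg_iff_add_eq_0)
  then show ?thesis
    using subfieldD(8)[OF L(1) subring_setD(6)[OF subfield_subring[OF L(1)] in_L[OF TK T(1)]] SL] by simp
qed

text \<open>
  For \<open>M \<ge> D\<close>, the \<open>n (M + 1) + D\<close> independent elements with orders up to \<open>M\<close> given by \<open>indep\<close> are
  algebraic over the \<open>n (M + 1) + r\<close> elements not involving the leader or its derivatives, together with the
  \<open>D - r\<close> highest derivatives of \<open>y\<^sub>j\<close>; counting shows that the \<open>n (M + 1) + r\<close> elements are independent.
\<close>

lemma indep_below_leader: "fam_indep K (({..n} - {j}) \<times> UNIV \<union> {j} \<times> {..<r}) \<xi>"
proof -
  have main: "fam_indep K (({..n} - {j}) \<times> {..M} \<union> {j} \<times> {..<r}) \<xi>" if M: "D \<le> M" for M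
  proof -
    define T where "T = ({..n} - {j}) \<times> {..M} \<union> {j} \<times> {..<r}"
    define Z where "Z = ({..n} - {i}) \<times> {..M} \<union> {i} \<times> {..<D}"
    have "card T = card (({..n} - {j}) \<times> {..M}) + card ({j} \<times> {..<r})" unfolding T_def
      by (rule card_Un_disjoint) auto
    then have cT: "finite T" "card T = n * Suc M + r"
      using lead(2) by (auto simp: card_cartesian_product T_def)
    have "card Z = card (({..n} - {i}) \<times> {..M}) + card ({i} \<times> {..<D})" unfolding Z_def
      by (rule card_Un_disjoint) auto
    then have cZ: "finite Z" "card Z = n * Suc M + D"
      using i by (auto simp: card_cartesian_product Z_def)
    obtain B where B: "B \<subseteq> \<xi> ` T" "acl.indep B" "\<xi> ` T \<subseteq> acl K B"
      using acl.basis_exists[of "\<xi> ` T"] cT(1) by blast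
    have fB: "finite B" using B(1) cT(1) finite_subset by blast
    have TB: "\<xi> u \<in> acl K B" if "u \<in> T" for u using B(3) that by blast
    have low: "\<xi> (j, s) \<in> acl K B" if "s \<le> r + (M - D)" for s
      using that
    proof (induction s rule: less_induct)
      case (less s)
      consider (a) "s < r" | (b) "s = r" | (e) k where "s = Suc (r + k)"
        by (metis less_imp_Suc_add linorder_neqE_nat)
      then show ?case
      proof cases
        case a
        then show ?thesis by (intro TB) (simp add: T_def)
      next
        case b
        have "mvars R - {(j, r)} \<subseteq> T"
        proof
          fix u assume u: "u \<in> mvars R - {(j, r)}"
          obtain l t where "u = (l, t)" by (cases u)
          moreover have "l \<le> n" "t \<le> D" using u R(1) \<open>u = (l, t)\<close> by (auto simp: MP_def)
          moreover have "t < r" if "l = j" using lead(3) u \<open>u = (l, t)\<close> that by (auto simp: order_le_def le_less)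
          ultimately show "u \<in> T" using M by (auto simp: T_def)
        qed
        moreover have "(j, r) \<notin> T" by (auto simp: T_def)
        ultimately have "\<xi> (j, r) \<in> acl K (\<xi> ` T)" by (rule leader_step)
        then show ?thesis using acl.cl_least[OF B(3)] b by blast
      next
        case e
        show ?thesis unfolding e
        proof (rule derived_leader_step[OF _ subfield_acl acl_superset(1)])
          show "D + Suc k \<le> M" using less.prems e M by simp
          show "\<xi> (l, s) \<in> acl K B" if "l \<le> n" "l \<noteq> j" "s \<le> M" for l s
            using that by (intro TB) (simp add: T_def)
          show "\<xi> (j, s') \<in> acl K B" if "s' \<le> r + k" for s'
            using that less.prems e by (intro less.IH) auto
        qed
      qed
    qed
    \<comment> \<open>The derivatives up to order \<open>M\<close> not covered by
      \<open>low\<close>, since keeping all orders within \<open>M\<close> allows only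
      \<open>M - D\<close> differentiations of \<open>R\<close>.\<close>
    let ?H = "(\<lambda>s. \<xi> (j, s)) ` {r + (M - D)<..M}"
    have "\<xi> u \<in> acl K (B \<union> ?H)" if u: "u \<in> Z" for u
    proof -
      obtain l s where ls: "u = (l, s)" by (cases u)
      have le: "l \<le> n" "s \<le> M" using u ls M i by (auto simp: Z_def)
      consider "l \<noteq> j" | "l = j" "s \<le> r + (M - D)" | "l = j" "s > r + (M - D)" by fastforce
      then show ?thesis
      proof cases
        case 1
        then have "u \<in> T" using le ls by (simp add: T_def)
        then have "\<xi> u \<in> acl K B" by (rule TB)
        then show ?thesis by (rule rev_subsetD) (rule acl.mono, simp)
      next
        case 2
        then have "\<xi> u \<in> acl K B" using low ls by simp
        then show ?thesis by (rule rev_subsetD) (rule acl.mono, simp)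
      next
        case 3
        then have "\<xi> u \<in> B \<union> ?H" using le ls by auto
        then show ?thesis by (rule subsetD[OF acl.ext])
      qed
    qed
    then have ZB: "\<xi> ` Z \<subseteq> acl K (B \<union> ?H)" by blast
    have "fam_indep K Z \<xi>" by (rule fam_indep_subset[OF indep]) (auto simp: Z_def)
    then have Z: "inj_on \<xi> Z" "acl.indep (\<xi> ` Z)" using fam_indep_iff[OF KF'] by blast+
    have "n * Suc M + D = card (\<xi> ` Z)" using card_image[OF Z(1)] cZ(2) by simp
    also have "\<dots> \<le> card (B \<union> ?H)" using acl.steinitz(2)[OF _ Z(2) ZB] fB by simp
    also have "\<dots> \<le> card B + card ?H" by (rule card_Un_le)
    also have "card ?H \<le> card {r + (M - D)<..M}" by (rule card_image_le) simp
    also have "card {r + (M - D)<..M} = D - r" using M r_le by simp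
    finally have "card T \<le> card B" using r_le cT(2) by simp
    moreover have "card B \<le> card (\<xi> ` T)" "card (\<xi> ` T) \<le> card T"
      using B(1) cT(1) by (auto intro: card_mono card_image_le)
    ultimately have "card B = card (\<xi> ` T)" "card (\<xi> ` T) = card T" by auto
    then have "B = \<xi> ` T" "inj_on \<xi> T"
      using card_subset_eq[OF _ B(1)] eq_card_imp_inj_on[OF cT(1)] cT(1) by auto
    then show ?thesis using B(2) fam_indep_iff[OF KF'] unfolding T_def by blast
  qed
  show ?thesis unfolding fam_indep_def
  proof (intro ballI impI)
    fix p assume p: "p \<in> MP K (({..n} - {j}) \<times> UNIV \<union> {j} \<times> {..<r})" "meval id \<xi> p = 0"
    define M where "M = max D (Max (insert 0 (snd ` mvars p)))"
    have "s \<le> M" if "(l, s) \<in> mvars p" for l s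
      unfolding M_def using that by (intro max.coboundedI2 Max_ge) (auto intro: rev_image_eqI)
    then have "p \<in> MP K (({..n} - {j}) \<times> {..M} \<union> {j} \<times> {..<r})" using p(1) by (auto simp: MP_def)
    then show "p = 0" using main[of M] p(2) unfolding fam_indep_def M_def by auto
  qed
qed

text \<open>One inclusion holds since \<open>R\<close> vanishes at \<open>c\<close> and its separant
  does not. For the other, reduce \<open>f\<close> to some \<open>g\<close> of order at most
  \<open>r\<close> in the indeterminate of the leader; as \<open>g\<close> vanishes at
  \<open>c\<close>, it is a multiple of \<open>R\<close> by
  \<open>indep_below_leader\<close>.\<close>

lemma general_component_eq: "general_component \<delta> K n \<rho> R = {f \<in> dpols K n. dval \<delta> f c = 0}"
proof -
  let ?I = "differential_ideal_gen \<delta> K n {R}" and ?S = "mpartial (j, r) R" and ?J = "{f \<in> dpols K n. dval \<delta> f c = 0}"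
  note KR = diff_subfield_subring[OF K]
  note A = subring_setD[OF subring_MP[OF KR, of "{..n} \<times> UNIV"]]
  have I: "differential_ideal \<delta> K n ?I" "R \<in> ?I" using differential_ideal_gen[of "{R}"] R_dpols by auto
  have RJ: "R \<in> ?J" using R_dpols R(3) by (simp add: dval_\<xi>)
  have I_add: "f + g \<in> ?I" if "f \<in> ?I" "g \<in> ?I" for f g using I(1) that by (simp add: differential_ideal_def)
  have I_mult: "h * f \<in> ?I" if "h \<in> dpols K n" "f \<in> ?I" for h f using I(1) that by (simp add: differential_ideal_def)
  have IJ: "?I \<subseteq> ?J" by (rule differential_ideal_gen_least[OF differential_ideal_vanishing]) (use RJ in simp)
  have S: "?S \<in> dpols K n" using R_dpols unfolding dpols_eq_MP by (rule mpartial_MP[OF KR])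
  have Sc: "dval \<delta> ?S c \<noteq> 0" using separant_nonzero by (simp add: dval_\<xi>)
  have di: "dideal \<delta> (dpols K n) J" if "differential_ideal \<delta> K n J" for J
    using that unfolding differential_ideal_def dideal_def by blast
  have "dval \<delta> f c = 0" if f: "f \<in> dpols K n" "?S * f \<in> radical K n ?I" for f
  proof -
    obtain k where "(?S * f) ^ k \<in> ?I" using f(2) by (auto simp: radical_def)
    then have "dval \<delta> ((?S * f) ^ k) c = 0" using IJ by blast
    then show ?thesis using Sc by (auto simp: dval_hom)
  qed
  moreover have "?S * f \<in> radical K n ?I" if f: "f \<in> dpols K n" "dval \<delta> f c = 0" for f
  proof -
    obtain N where N: "order_le j (r + N) f" using order_le_exists by blast
    from partial_reduction[OF d dclosed_dpols[OF d K lead(2)] R_dpols lead(3) f(1) N]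
    obtain k g where g: "g \<in> dpols K n" "order_le j r g"
      "\<And>J. dideal \<delta> (dpols K n) J \<Longrightarrow> R \<in> J \<Longrightarrow> ?S ^ k * f - g \<in> J" by blast
    have "?S ^ k * f - g \<in> ?J" by (rule g(3)[OF di[OF differential_ideal_vanishing] RJ])
    then have g0: "meval id \<xi> g = 0" using f(2) by (simp add: dval_hom flip: dval_\<xi>)
    let ?W = "insert (j, r) (({..n} - {j}) \<times> UNIV \<union> {j} \<times> {..<r})"
    have in_W: "p \<in> MP K ?W" if "p \<in> dpols K n" "order_le j r p" for p
    proof -
      have "u \<in> ?W" if u: "u \<in> mvars p" for u
      proof -
        obtain l s where ls: "u = (l, s)" by (cases u)
        have "l \<le> n" using u \<open>p \<in> dpols K n\<close> ls by (auto simp: dpols_def)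
        moreover have "s \<le> r" if "l = j" using \<open>order_le j r p\<close> u ls that by (simp add: order_le_def)
        ultimately show ?thesis using ls by (auto simp: le_less)
      qed
      then show ?thesis using that(1) by (auto simp: MP_def dpols_def)
    qed
    have "\<exists>q\<in>MP K ?W. g = q * R"
    proof (rule irreducible_divides_if_vanishes[OF KF' in_W[OF R_dpols lead(3)] R(2) lead(1) in_W[OF g(1,2)] R(3) g0])
      fix m assume m: "m \<in> MP K (?W - {(j, r)})" "meval id \<xi> m = 0"
      have "?W - {(j, r)} = ({..n} - {j}) \<times> UNIV \<union> {j} \<times> {..<r}" by auto
      then show "m = 0" using m indep_below_leader unfolding fam_indep_def by metis
    qed
    then obtain q where q: "q \<in> MP K ?W" "g = q * R" by blast
    have "q \<in> dpols K n" unfolding dpols_eq_MP by (rule subsetD[OF MP_mono q(1)]) (use lead(2) in auto)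
    then have "g \<in> ?I" unfolding q(2) by (rule I_mult[OF _ I(2)])
    moreover have "?S ^ k * f - g \<in> ?I" by (rule g(3)[OF di[OF I(1)] I(2)])
    ultimately have "(?S ^ k * f - g) + g \<in> ?I" by (intro I_add)
    then have "?S ^ k * f \<in> ?I" by simp
    \<comment> \<open>The missing factors that turn \<open>?S ^ k * f\<close> into the power
      \<open>(?S * f) ^ Suc k\<close>.\<close>
    moreover have "?S * f ^ k \<in> dpols K n" using S f(1) unfolding dpols_eq_MP by (intro A(5,7))
    ultimately have "(?S * f ^ k) * (?S ^ k * f) \<in> ?I" by (rule I_mult[rotated])
    moreover have "(?S * f ^ k) * (?S ^ k * f) = (?S * f) ^ Suc k" by (simp add: power_mult_distrib algebra_simps)
    ultimately have "(?S * f) ^ Suc k \<in> ?I" by simp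
    moreover have "?S * f \<in> dpols K n" using S f(1) unfolding dpols_eq_MP by (rule A(5))
    ultimately show ?thesis unfolding radical_def by blast
  qed
  ultimately show ?thesis unfolding general_component_def separant_def l by blast
qed

end

end

end

end

section \<open>Existence and uniqueness of the dependence equation\<close>

theorem corollary4p8:
  fixes \<delta> :: "'u::field_char_0 \<Rightarrow> 'u"
    and K :: "'u set"
    and n d :: nat
    and V :: "(nat \<Rightarrow> 'u) set set"
    and \<rho> :: "((nat \<times> nat) \<times> (nat \<times> nat)) set"
  assumes "universal_domain \<delta>"
    and "diff_subfield \<delta> K" and "small K"
    and "n \<ge> 1" and "V \<subset> proj_space n"
    and "d_complete \<delta> n V"
    and "d_closed \<delta> K n V" and "d_irreducible \<delta> K n V"
    and "kolchin_poly_variety \<delta> K n V = [:of_nat d:]"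
    and "ranking n \<rho>"
  shows "\<exists>R. is_dependence_equation \<delta> K n \<rho> V d R \<and>
           (\<forall>R'. is_dependence_equation \<delta> K n \<rho> V d R' \<longrightarrow>
                 (\<exists>c \<in> K. c \<noteq> 0 \<and> R' = mconst c * R))"
proof -
  interpret U: universal \<delta> by unfold_locales (rule assms(1))
  note K = assms(2) and small = assms(3) and V = assms(7) and \<rho> = assms(10)
  note KR = diff_subfield_subring[OF K]
  have KF: "subfield_set K" using K by (simp add: diff_subfield_def)
  define \<alpha> where "\<alpha> = (SOME \<alpha>. generic_point \<delta> K n V \<alpha>)"
  have \<alpha>: "generic_point \<delta> K n V \<alpha>"
    unfolding \<alpha>_def by (rule someI_ex[OF U.generic_point_exists[OF K small V assms(8)]])
  have \<alpha>V: "\<alpha> \<in> V" using \<alpha> by (simp add: generic_point_def)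
  then have \<alpha>S: "\<alpha> \<in> proj_space n" using assms(5) by blast
  define a where "a = (SOME a. a \<in> \<alpha>)"
  have a: "a \<in> \<alpha>" unfolding a_def by (rule someI_ex[OF U.proj_space_nonempty[OF \<alpha>S]])
  define i where "i = (SOME i. i \<le> n \<and> a i \<noteq> 0)"
  have "\<exists>i. i \<le> n \<and> a i \<noteq> 0" using U.proj_spaceE(3)[OF \<alpha>S a] by blast
  then have i: "i \<le> n \<and> a i \<noteq> 0" unfolding i_def by (rule someI_ex)
  define v where "v = (\<lambda>j. a j / a i)"
  \<comment> \<open>\<open>v\<close> is both the affine tuple that enters the Kolchin polynomial and
    a tuple of homogeneous coordinates of \<open>\<alpha>\<close>.\<close>
  have "v = (\<lambda>j. (1 / a i) * a j)" "1 / a i \<noteq> 0" using i by (auto simp: v_def)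
  then have v: "v \<in> \<alpha>" unfolding U.proj_spaceE(1)[OF \<alpha>S a] proj_point_def by blast
  have vi: "v i = 1" using i by (simp add: v_def)
  have kp: "kolchin_poly \<delta> K n v = [:of_nat d:]"
    using assms(9) unfolding kolchin_poly_variety_def kolchin_poly_point_def Let_def
    unfolding \<alpha>_def[symmetric] a_def[symmetric] i_def[symmetric] v_def .
  obtain B t0 where B: "finite B" "card B = d" "aindep K B" "B \<subseteq> U.jets n v t0" "\<forall>t. U.jets n v t \<subseteq> acl K B"
    by (rule U.kolchin_poly_constant[OF K kp], rule that) blast+
  obtain ys where ys: "length ys = Suc n"
    "\<And>f zs. f \<in> MP K ({..<Suc n + length (map v [0..<Suc n])} \<times> UNIV) \<Longrightarrow> dval \<delta> f (tup (ys @ map v [0..<Suc n])) = 0 \<Longrightarrow>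
      length zs = Suc n \<Longrightarrow> dval \<delta> f (tup (zs @ map v [0..<Suc n])) = 0"
    by (rule U.generic_tuple[OF KR small, of "Suc n" "map v [0..<Suc n]"]) blast
  obtain c where c: "c \<in> affine_space (Suc n)" "(\<Sum>l\<le>n. v l * c l) = 0"
    "\<forall>f\<in>dpols K n. dval \<delta> f c = 0 \<longleftrightarrow> f \<in> U.hyper_ideal K n v"
    "fam_indep K (({..n} - {i}) \<times> UNIV \<union> {i} \<times> {..<d}) (\<lambda>(l, s). (\<delta> ^^ s) (c l))"
    "(\<delta> ^^ d) (c i) \<in> acl K ((\<lambda>(l, s). (\<delta> ^^ s) (c l)) ` (({..n} - {i}) \<times> {..d} \<union> {i} \<times> {..<d}))"
    using U.generic_orthogonal_vector[OF K small conjunct1[OF i] vi B(1,3,4) B(5)[rule_format] ys] unfolding B(2) by blast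
  let ?\<xi> = "\<lambda>(l, s). (\<delta> ^^ s) (c l)"
  have dep: "?\<xi> (i, d) \<in> acl K (?\<xi> ` (({..n} - {i}) \<times> {..d} \<union> {i} \<times> {..<d}))" using c(5) by simp
  note generic = U.d K conjunct1[OF i] refl c(4) dep
  obtain R where R: "R \<in> MP K ({..n} \<times> {..d})" "mirr K R" "meval id ?\<xi> R = 0"
    using equation_exists[OF generic] by blast
  obtain j r where l: "leader \<rho> R = (j, r)" by (cases "leader \<rho> R")
  have RK: "R \<in> dpols K n" by (rule R_dpols[OF generic R])
  have gen: "general_component \<delta> K n \<rho> R = U.hyper_ideal K n v"
  proof -
    have "general_component \<delta> K n \<rho> R = {f \<in> dpols K n. dval \<delta> f c = 0}"
      by (rule general_component_eq[OF generic R \<rho> l])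
    also have "\<dots> = U.hyper_ideal K n v" using c(3) by (auto simp: U.hyper_ideal_def)
    finally show ?thesis .
  qed
  have "is_dependence_equation \<delta> K n \<rho> V d R"
    unfolding is_dependence_equation_def general_solution_def gen
    using U.lin_dependent_iff[OF K small V \<alpha> v assms(6,4)] RK R(2) dpol_irreducible_iff[OF KF]
      order_equation[OF generic R] by auto
  moreover have "\<exists>e\<in>K. e \<noteq> 0 \<and> R' = mconst e * R" if R': "is_dependence_equation \<delta> K n \<rho> V d R'" for R'
  proof -
    have irr: "dpol_irreducible K n R'" "dpol_order R' = d" using R' by (auto simp: is_dependence_equation_def)
    \<comment> \<open>\<open>c\<close> is itself a dependent vector, so it lies in the general
      solution of any competing \<open>R'\<close>, and \<open>R'\<close> belongs to its own general
      component.\<close>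
    have "lin_dependent_over n V c" using \<alpha>V v c(2) by (auto simp: lin_dependent_over_def)
    then have "c \<in> general_solution \<delta> K n \<rho> R'" using R' c(1) by (auto simp: is_dependence_equation_def)
    moreover have "R' \<in> general_component \<delta> K n \<rho> R'"
      using irr(1) by (intro in_general_component[OF U.d K]) (simp add: dpol_irreducible_def)
    ultimately have "dval \<delta> R' c = 0" by (auto simp: general_solution_def)
    then show ?thesis by (rule equation_unique[OF generic R irr])
  qed
  ultimately show ?thesis by blast
qed

end
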